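(* Let $a$ be a fixed integer and let $\theta$ be a real constant with $0.6<\theta<0.625$. Then there exists $x_0=x_0(\theta)$ (which may also depend on the fixed integer $a$) such that for all real $x>x_0$ the greatest prime factor of the integer $$\prod_{\substack{n\le x\\ n\ \text{semi-prime}\\ n+a\neq 0}}(n+a)$$ exceeds $x^{\theta}$.
   Context: A semi-prime is a positive integer of the form $n=p_1p_2$ with $p_1\le p_2$ primes (the case $p_1=p_2$ is allowed). The greatest prime factor of a nonzero integer $m$ is the largest prime dividing $|m|$. *)

theory Defs
  imports Complex_Main "HOL-Computational_Algebra.Primes"
begin

definition semiprime :: "nat \<Rightarrow> bool" where
  "semiprime n \<longleftrightarrow> (\<exists>p q. prime p \<and> prime q \<and> p \<le> q \<and> n = p * q)"

text \<open>
  On type \<^typ>\<open>int\<close>, \<^const>\<open>prime_factors\<close> yields positive primes only, so the sign of the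
  argument is irrelevant. The value is unspecified for \<open>0\<close>, \<open>1\<close> and \<open>-1\<close>, whose set of prime
  factors is empty.
\<close>
definition greatest_prime_factor :: "int \<Rightarrow> int" where
  "greatest_prime_factor m = Max (prime_factors m)"

definition shifted_semiprimes_prod :: "int \<Rightarrow> real \<Rightarrow> int" where
  "shifted_semiprimes_prod a x =
     (\<Prod>n | real n \<le> x \<and> semiprime n \<and> int n + a \<noteq> 0. int n + a)"

lemma finite_shifted_semiprimes:
  "finite {n. real n \<le> x \<and> semiprime n \<and> int n + a \<noteq> 0}"
proof (rule finite_subset)
  show "{n. real n \<le> x \<and> semiprime n \<and> int n + a \<noteq> 0} \<subseteq> {..nat \<lfloor>x\<rfloor>}"
    by (auto simp: le_nat_floor)
qed simp

lemma shifted_semiprimes_prod_nonzero: "shifted_semiprimes_prod a x \<noteq> 0"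
  using finite_shifted_semiprimes[of x a] by (auto simp: shifted_semiprimes_prod_def)

lemma greatest_prime_factor_eq_Max:
  assumes "m \<noteq> 0"
  shows "greatest_prime_factor m = Max {p. prime p \<and> p dvd \<bar>m\<bar>}"
  using assms by (simp add: greatest_prime_factor_def prime_factors_dvd)

end

theory Submission
  imports Defs "HOL-Number_Theory.Cong" "HOL-Analysis.Analysis" "HOL-Library.Real_Mod" "HOL-Real_Asymp.Real_Asymp"
begin

text \<open>
  This is Chebyshev's method. Let \<open>p\<^sub>1\<close> and \<open>p\<^sub>2\<close> run over primes of size about \<open>x powr \<delta>\<close> and
  \<open>x powr (1 - 3 * \<delta>)\<close>, and let \<open>N\<close> be the number of pairs. The logarithms of the numbers
  \<open>p\<^sub>1 * p\<^sub>2 + a\<close> add up to nearly \<open>N * ln x\<close>; on the other hand the sum equals that of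
  \<open>ln q * T (q ^ j)\<close> over prime powers, \<open>T d\<close> counting the pairs with \<open>d\<close> dividing
  \<open>p\<^sub>1 * p\<^sub>2 + a\<close>. Proper powers contribute little. For primes \<open>q\<close> below
  about \<open>x powr (1 / 2)\<close> the large sieve, applied to the bilinear congruence, gives about \<open>N / q\<close> for \<open>T q\<close> on average and
  hence a contribution of about \<open>N * ln x / 2\<close>. For larger \<open>q\<close> switch to the cofactor: \<open>p\<^sub>1 * p\<^sub>2 = q * m - a\<close> is
  again bilinear, now in \<open>q\<close> and \<open>m\<close>, so the large sieve supplies level of distribution \<open>x powr (1 / 2)\<close> and
  Selberg's sieve bounds \<open>T q\<close> by about \<open>4 * N / q\<close> on average. If no prime beyond \<open>x powr \<theta>\<close> occurred,
  then \<open>1 \<le> 1 / 2 + 4 * (\<theta> - 1 / 2)\<close> up to \<open>O(\<delta>)\<close>, which fails for \<open>\<theta> < 5 / 8\<close>.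
  For \<open>a = 0\<close> the semi-primes \<open>2 * p\<close> suffice.
\<close>

section \<open>Mertens' estimate\<close>

text \<open>The congruence \<open>q * m \<equiv> a\<close> modulo \<open>t\<close> ties
  \<open>m\<close> to the class of \<open>a / q\<close>, so the discrepancy, squared and summed over
  all classes of \<open>m\<close>, becomes the variance of the set of \<open>q\<close> over residue
  classes modulo \<open>t\<close>. In this form the multiplicative problem is open to the additive
  large sieve, on average over \<open>t\<close>. Both variables must then range over a box. That is
  why \<open>p\<^sub>1\<close>, \<open>p\<^sub>2\<close> and \<open>q\<close> are confined to short
  blocks: \<open>m\<close> then runs over an interval that depends on \<open>p\<^sub>1\<close>
  alone, and the relaxation costs a factor that tends to 1 with \<delta>. The modulus in Selberg's
  sieve is \<open>p\<^sub>1\<close> times the least common multiple of two sieve divisors, so level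
  of distribution \<open>x powr (1 / 2)\<close> permits sifting only up to about
  \<open>x powr (1 / 4)\<close>; the constant 4 is the inverse of this exponent. Mertens' estimate
  gives the blocks of \<open>q\<close> the weight \<open>ln q / q\<close>, which turns the sum over
  \<open>q\<close> into the length \<theta> - 1 / 2 of the range on the logarithmic scale.\<close>

lemma finite_primes_le: "finite {p::nat. prime p \<and> p \<le> n}"
  by (rule finite_subset[of _ "{..n}"]) auto

lemma prod_primes_dvd:
  assumes "finite S" "\<And>p. p \<in> S \<Longrightarrow> prime p"
  shows "\<Prod>S dvd (n::nat) \<longleftrightarrow> (\<forall>p\<in>S. p dvd n)"
  using assms
proof (induction S rule: finite_induct)
  case (insert p S)
  have "coprime p (\<Prod>S)"
    using insert.hyps insert.prems by (intro prod_coprime_right primes_coprime) auto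
  then have "p * \<Prod>S dvd n \<longleftrightarrow> p dvd n \<and> \<Prod>S dvd n"
    by (auto intro: divides_mult dvd_mult_left dvd_mult_right)
  then show ?case using insert by simp
qed auto

text \<open>The two equal middle coefficients together are at most the row sum
  \<open>2 ^ (2 * m + 1)\<close>.\<close>

lemma central_binomial_odd_le: "(2 * m + 1) choose m \<le> 4 ^ m"
proof -
  have "2 * ((2 * m + 1) choose m) = ((2 * m + 1) choose m) + ((2 * m + 1) choose (m + 1))"
    using binomial_symmetric[of m "2 * m + 1"] by simp
  also have "\<dots> = (\<Sum>k\<in>{m, m + 1}. (2 * m + 1) choose k)" by simp
  also have "\<dots> \<le> (\<Sum>k\<le>2 * m + 1. (2 * m + 1) choose k)" by (rule sum_mono2) auto
  also have "\<dots> = 2 ^ (2 * m + 1)" by (rule choose_row_sum)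
  also have "\<dots> = 2 * 4 ^ m" by (simp add: power_mult)
  finally show ?thesis by simp
qed

text \<open>Erdos's induction. For \<open>n = 2 * m + 1\<close> the primes up to
  \<open>m + 1\<close> are covered by the induction hypothesis. Those above divide the factorial of
  \<open>n\<close> but neither factorial in the denominator of \<open>n choose m\<close>, so their
  product divides this coefficient and is at most \<open>4 ^ m\<close>.\<close>

lemma primorial_le: "\<Prod>{p::nat. prime p \<and> p \<le> n} \<le> 4 ^ n"
proof (induction n rule: less_induct)
  case (less n)
  consider "n < 2" | "n = 2" | "n > 2" "even n" | "n > 2" "odd n" by linarith
  then show ?case
  proof cases
    case 1
    then have empty: "{p::nat. prime p \<and> p \<le> n} = {}" by (auto dest: prime_ge_2_nat)
    show ?thesis unfolding empty by simp
  next
    case 2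
    then have two: "{p::nat. prime p \<and> p \<le> n} = {2}" by (auto dest: prime_ge_2_nat)
    show ?thesis unfolding two using 2 by simp
  next
    case 3
    then have "\<not> prime n" using prime_odd_nat by blast
    then have "prime p \<and> p \<le> n \<longleftrightarrow> prime p \<and> p \<le> n - 1" for p
      using 3 by (cases "p = n") auto
    with less[of "n - 1"] 3 have "\<Prod>{p::nat. prime p \<and> p \<le> n} \<le> 4 ^ (n - 1)" by simp
    also have "\<dots> \<le> 4 ^ n" by (rule power_increasing) auto
    finally show ?thesis .
  next
    case 4
    then obtain m where m: "n = 2 * m + 1" by (auto elim: oddE)
    have "m \<ge> 1" using 4 m by simp
    let ?A = "{p::nat. prime p \<and> p \<le> m + 1}"
    let ?B = "{p::nat. prime p \<and> m + 1 < p \<and> p \<le> n}"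
    have fin: "finite ?A" "finite ?B" by (auto intro: finite_subset[of _ "{..n}"] finite_subset[of _ "{..m+1}"])
    have "{p::nat. prime p \<and> p \<le> n} = ?A \<union> ?B" using m by auto
    then have "\<Prod>{p::nat. prime p \<and> p \<le> n} = \<Prod>?A * \<Prod>?B"
      using fin by (simp add: prod.union_disjoint disjoint_iff)
    moreover have "\<Prod>?A \<le> 4 ^ (m + 1)" using less[of "m + 1"] m \<open>m \<ge> 1\<close> by simp
    moreover have "\<Prod>?B dvd (n choose m)"
    proof (subst prod_primes_dvd)
      show "\<forall>p\<in>?B. p dvd (n choose m)"
      proof
        fix p assume p: "p \<in> ?B"
        have eq: "fact m * fact (m + 1) * (n choose m) = (fact n :: nat)"
          using binomial_fact_lemma[of m n] m by simp
        have "p dvd fact n" using p by (simp add: prime_dvd_fact_iff)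
        then have "p dvd fact m * fact (m + 1) * (n choose m)" by (simp only: eq)
        moreover have "\<not> p dvd fact m" "\<not> p dvd (fact (m + 1) :: nat)"
          using p prime_dvd_fact_iff[of p m] prime_dvd_fact_iff[of p "m+1"] by auto
        ultimately show "p dvd (n choose m)" using p prime_dvd_mult_nat by blast
      qed
    qed (use fin in auto)
    then have "\<Prod>?B \<le> n choose m" using m by (intro dvd_imp_le) simp_all
    then have "\<Prod>?B \<le> 4 ^ m"
      using central_binomial_odd_le[of m] m by simp
    ultimately have "\<Prod>{p::nat. prime p \<and> p \<le> n} \<le> 4 ^ (m + 1) * 4 ^ m"
      using mult_le_mono by presburger
    also have "\<dots> = 4 ^ n" using m by (simp add: mult_2 power_add)
    finally show ?thesis .
  qed
qed

text \<open>Chebyshev's bound for the theta function. In Mertens' estimate it pays for the rounding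
  in \<open>n div p\<close>.\<close>

lemma sum_ln_primes_le: "(\<Sum>p | prime p \<and> p \<le> n. ln (real p)) \<le> real n * ln 4"
proof -
  have "(\<Sum>p | prime p \<and> p \<le> n. ln (real p)) = ln (\<Prod>p | prime p \<and> p \<le> n. real p)"
    using finite_primes_le[of n] by (intro ln_prod[symmetric]) (auto dest: prime_gt_0_nat)
  also have "(\<Prod>p | prime p \<and> p \<le> n. real p) = real (\<Prod>{p. prime p \<and> p \<le> n})" by simp
  also have "ln \<dots> \<le> ln (real (4 ^ n))"
  proof (subst ln_le_cancel_iff)
    have "\<Prod>{p::nat. prime p \<and> p \<le> n} > 0" by (rule prod_pos) (auto dest: prime_gt_0_nat)
    then show "0 < real (\<Prod>{p. prime p \<and> p \<le> n})" by (simp only: of_nat_0_less_iff)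
    show "real (\<Prod>{p. prime p \<and> p \<le> n}) \<le> real (4 ^ n)"
      using primorial_le[of n] by (simp only: of_nat_le_iff)
  qed simp
  also have "\<dots> = real n * ln 4" by (simp add: ln_realpow)
  finally show ?thesis .
qed

section \<open>Prime powers, Legendre's formula and Mertens' sum\<close>

lemma ln_prime_nonneg: "prime p \<Longrightarrow> 0 \<le> ln (real p)"
  using prime_gt_0_nat[of p] by (intro ln_ge_zero) linarith

text \<open>These pairs index the support of the von Mangoldt function up to \<open>B\<close>; the
  pair \<open>(q, j)\<close> carries the weight \<open>ln q\<close>.\<close>

definition prime_power_pairs :: "nat \<Rightarrow> (nat \<times> nat) set" where
  "prime_power_pairs B = {(q, j). prime q \<and> 1 \<le> j \<and> q ^ j \<le> B}"

lemma prime_power_pairs_bounds: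
  assumes "(q, j) \<in> prime_power_pairs B"
  shows "q \<le> B" "j \<le> B"
proof -
  have q: "prime q" "1 \<le> j" "q ^ j \<le> B" using assms by (auto simp: prime_power_pairs_def)
  have "q ^ 1 \<le> q ^ j" using q by (intro power_increasing) (auto simp: prime_gt_0_nat Suc_le_eq)
  then show "q \<le> B" using q by simp
  have "j < q ^ j" using prime_gt_1_nat[OF q(1)] power_gt_expt[of q j] by simp
  then show "j \<le> B" using q by simp
qed

lemma finite_prime_power_pairs: "finite (prime_power_pairs B)"
proof (rule finite_subset)
  show "prime_power_pairs B \<subseteq> {..B} \<times> {..B}" using prime_power_pairs_bounds by auto
qed simp

text \<open>The divisor sum of the von Mangoldt function is the logarithm. The bound
  \<open>B\<close> provides one index set for all \<open>m\<close>, so that summation over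
  \<open>m\<close> and over prime powers can be interchanged.\<close>

lemma ln_eq_sum_prime_powers:
  assumes "0 < m" "m \<le> B"
  shows "ln (real m) = (\<Sum>(q, j)\<in>prime_power_pairs B. if q ^ j dvd m then ln (real q) else 0)"
proof -
  have "ln (real m) = ln (real (\<Prod>p\<in>prime_factors m. p ^ multiplicity p m))"
    using assms by (simp add: prod_prime_factors)
  also have "\<dots> = (\<Sum>p\<in>prime_factors m. real (multiplicity p m) * ln (real p))"
    unfolding of_nat_prod of_nat_power
    by (subst ln_prod) (auto simp: ln_realpow prime_gt_0_nat in_prime_factors_iff)
  also have "\<dots> = (\<Sum>p\<in>prime_factors m. \<Sum>j\<in>{1..multiplicity p m}. ln (real p))" by simp
  also have "\<dots> = (\<Sum>(q, j)\<in>(SIGMA q:prime_factors m. {1..multiplicity q m}). ln (real q))"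
    by (subst sum.Sigma) auto
  also have "(SIGMA q:prime_factors m. {1..multiplicity q m}) = {(q, j) \<in> prime_power_pairs B. q ^ j dvd m}"
  proof -
    have "(q, j) \<in> (SIGMA q:prime_factors m. {1..multiplicity q m})
      \<longleftrightarrow> (q, j) \<in> prime_power_pairs B \<and> q ^ j dvd m" for q j
    proof (cases "prime q \<and> 1 \<le> j")
      case True
      then have "q ^ j dvd m \<longleftrightarrow> j \<le> multiplicity q m"
        using assms by (intro power_dvd_iff_le_multiplicity) auto
      moreover have "q dvd m" if "q ^ j dvd m"
        using that True dvd_trans[OF dvd_power[of j q]] by auto
      ultimately show ?thesis using True assms dvd_imp_le[of "q ^ j" m]
        by (auto simp: prime_power_pairs_def in_prime_factors_iff)
    qed (auto simp: prime_power_pairs_def in_prime_factors_iff)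
    then show ?thesis
      unfolding set_eq_iff split_paired_All mem_Collect_eq prod.case by blast
  qed
  also have "(\<Sum>(q, j)\<in>{(q, j) \<in> prime_power_pairs B. q ^ j dvd m}. ln (real q))
    = (\<Sum>(q, j)\<in>prime_power_pairs B. if q ^ j dvd m then ln (real q) else 0)"
    by (rule sum.mono_neutral_cong_left) (auto simp: finite_prime_power_pairs split: if_splits)
  finally show ?thesis .
qed

lemma card_multiples: "d > 0 \<Longrightarrow> card {m \<in> {1..n}. d dvd m} = n div (d::nat)"
proof -
  assume d: "d > 0"
  have "{m \<in> {1..n}. d dvd m} = (\<lambda>k. d * k) ` {1..n div d}"
    using d by (auto simp: dvd_def image_iff less_eq_div_iff_mult_less_eq mult.commute)
  then show ?thesis using d by (simp add: card_image inj_on_def)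
qed

text \<open>Legendre's formula: after interchanging the sums, each prime power counts its multiples
  up to \<open>n\<close>.\<close>

lemma ln_fact_eq:
  "ln (fact n) = (\<Sum>(q, j)\<in>prime_power_pairs n. ln (real q) * real (n div q ^ j))"
proof -
  have "ln (fact n) = (\<Sum>m\<in>{1..n}. ln (real m))"
    by (subst fact_prod, unfold of_nat_prod, subst ln_prod) auto
  also have "\<dots> = (\<Sum>m\<in>{1..n}. \<Sum>(q, j)\<in>prime_power_pairs n. if q ^ j dvd m then ln (real q) else 0)"
    by (rule sum.cong) (auto intro: ln_eq_sum_prime_powers)
  also have "\<dots> = (\<Sum>x\<in>prime_power_pairs n. \<Sum>m\<in>{1..n}. if fst x ^ snd x dvd m then ln (real (fst x)) else 0)"
    by (subst sum.swap) (simp add: case_prod_beta)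
  also have "\<dots> = (\<Sum>x\<in>prime_power_pairs n. ln (real (fst x)) * real (n div fst x ^ snd x))"
  proof (rule sum.cong)
    fix x assume "x \<in> prime_power_pairs n"
    then have "fst x ^ snd x > 0" by (auto simp: prime_power_pairs_def prime_gt_0_nat)
    then show "(\<Sum>m\<in>{1..n}. if fst x ^ snd x dvd m then ln (real (fst x)) else 0)
      = ln (real (fst x)) * real (n div fst x ^ snd x)"
      using card_multiples[of "fst x ^ snd x" n]
      by (subst sum.inter_filter[symmetric]) (simp_all add: mult.commute del: zero_less_power_eq)
  qed simp
  finally show ?thesis by (simp add: case_prod_beta)
qed

definition proper_prime_powers :: "(nat \<times> nat) set" where
  "proper_prime_powers = {(q, j). prime q \<and> 2 \<le> j}"

lemma sum_inverse_powers_le: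
  assumes "q \<ge> (2::real)"
  shows "(\<Sum>j\<in>{2..<n}. 1 / q ^ j) \<le> 2 / q ^ 2"
proof (cases "n \<ge> 2")
  case True
  \<comment> \<open>The induction carries the tail \<open>2 / q ^ n\<close>, which absorbs the next
    term because \<open>q \<ge> 2\<close>.\<close>
  then have "(\<Sum>j\<in>{2..<n}. 1 / q ^ j) \<le> 2 / q ^ 2 - 2 / q ^ n"
  proof (induction n rule: dec_induct)
    case (step n)
    have "q * (1 / q ^ Suc n) = 1 / q ^ n" using assms by simp
    moreover have "2 * (1 / q ^ Suc n) \<le> q * (1 / q ^ Suc n)" using assms by (intro mult_right_mono) auto
    ultimately have "2 / q ^ Suc n \<le> 1 / q ^ n" by simp
    then show ?case using step by simp
  qed simp
  then show ?thesis using assms by (smt (verit) divide_nonneg_nonneg zero_le_power)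
qed simp

text \<open>Boundedness over all finite subsets expresses convergence of the double series without
  ordering the pairs; \<open>small_tail\<close> takes it in this form.\<close>

lemma sum_proper_prime_powers_bounded:
  "\<exists>C. \<forall>F. finite F \<longrightarrow> F \<subseteq> proper_prime_powers \<longrightarrow> (\<Sum>(q, j)\<in>F. ln (real q) / real q ^ j) \<le> C"
proof -
  \<comment> \<open>The exponent combines \<open>ln q \<le> 2 * sqrt q\<close> with the bound
    \<open>2 / q ^ 2\<close> for the geometric tail.\<close>
  have sm: "summable (\<lambda>q::nat. 4 * real q powr (-3/2))"
    using summable_real_powr_iff[of "-3/2"] by (intro summable_mult) simp
  show ?thesis
  proof (intro exI allI impI)
    fix F assume F: "finite F" "F \<subseteq> proper_prime_powers"
    obtain n where n: "F \<subseteq> {2..<n} \<times> {2..<n}"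
    proof -
      have "finite (fst ` F \<union> snd ` F)" using F by simp
      then obtain n where n: "\<And>i. i \<in> fst ` F \<union> snd ` F \<Longrightarrow> i < n"
        unfolding finite_nat_set_iff_bounded by blast
      have "z \<in> {2..<n} \<times> {2..<n}" if z: "z \<in> F" for z
      proof -
        have "fst z < n" "snd z < n" using n z by auto
        moreover have "2 \<le> fst z" "2 \<le> snd z"
          using z F prime_ge_2_nat by (auto simp: proper_prime_powers_def)
        ultimately show ?thesis by (cases z) simp
      qed
      then show ?thesis using that by blast
    qed
    have "(\<Sum>(q, j)\<in>F. ln (real q) / real q ^ j) \<le> (\<Sum>(q, j)\<in>{2..<n} \<times> {2..<n}. ln (real q) / real q ^ j)"
      by (rule sum_mono2) (use n in auto)
    also have "\<dots> = (\<Sum>q\<in>{2..<n}. ln (real q) * (\<Sum>j\<in>{2..<n}. 1 / real q ^ j))"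
      by (subst sum.cartesian_product[symmetric]) (simp add: sum_distrib_left)
    also have "\<dots> \<le> (\<Sum>q\<in>{2..<n}. 4 * real q powr (-3/2))"
    proof (rule sum_mono)
      fix q assume q: "q \<in> {2..<n}"
      have "ln (real q) = 2 * ln (sqrt (real q))" using q by (simp add: ln_sqrt)
      also have "\<dots> \<le> 2 * sqrt (real q)" using q ln_bound[of "sqrt (real q)"] by simp
      finally have "ln (real q) \<le> 2 * real q powr (1/2)" by (simp add: powr_half_sqrt)
      then have "ln (real q) * (\<Sum>j\<in>{2..<n}. 1 / real q ^ j) \<le> 2 * real q powr (1/2) * (2 / real q ^ 2)"
        using q by (intro mult_mono sum_inverse_powers_le sum_nonneg) auto
      also have "\<dots> = 4 * real q powr (1/2 - 2)" using q by (subst powr_diff) simp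
      finally show "ln (real q) * (\<Sum>j\<in>{2..<n}. 1 / real q ^ j) \<le> 4 * real q powr (-3/2)" by simp
    qed
    also have "\<dots> \<le> (\<Sum>q. 4 * real q powr (-3/2))" by (rule sum_le_suminf[OF sm]) auto
    finally show "(\<Sum>(q, j)\<in>F. ln (real q) / real q ^ j) \<le> (\<Sum>q. 4 * real q powr (-3/2))" .
  qed
qed

text \<open>A finite set whose sum is within \<epsilon> of the supremum of all finite partial sums
  leaves at most \<epsilon> for any finite set disjoint from it.\<close>

lemma small_tail:
  fixes f :: "'a \<Rightarrow> real"
  assumes "\<And>F. finite F \<Longrightarrow> F \<subseteq> A \<Longrightarrow> sum f F \<le> C" and "\<epsilon> > 0"
  obtains F where "finite F" "F \<subseteq> A" "\<And>G. finite G \<Longrightarrow> G \<subseteq> A - F \<Longrightarrow> sum f G \<le> \<epsilon>"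
proof -
  let ?X = "sum f ` {F. finite F \<and> F \<subseteq> A}"
  have bdd: "bdd_above ?X" using assms(1) by (auto intro!: bdd_aboveI)
  have "?X \<noteq> {}" by auto
  have "\<exists>y\<in>?X. Sup ?X - \<epsilon> < y"
    by (rule less_cSupD[OF \<open>?X \<noteq> {}\<close>]) (use assms(2) in auto)
  then obtain F where F: "finite F" "F \<subseteq> A" "Sup ?X - \<epsilon> < sum f F" by auto
  show ?thesis
  proof (rule that[OF F(1,2)])
    fix G assume G: "finite G" "G \<subseteq> A - F"
    have "sum f (F \<union> G) \<le> Sup ?X" using F G bdd by (intro cSup_upper) auto
    moreover have "sum f (F \<union> G) = sum f F + sum f G" using F G by (intro sum.union_disjoint) auto
    ultimately show "sum f G \<le> \<epsilon>" using F by simp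
  qed
qed

lemma ln_fact_le: "ln (fact n) \<le> real n * ln (real n)"
proof (cases "n = 0")
  case False
  have "(fact n :: real) \<le> real n ^ n" using fact_le_power[of n, where ?'a=real] by simp
  then have "ln (fact n) \<le> ln (real n ^ n)" using False by (subst ln_le_cancel_iff) auto
  then show ?thesis using False by (simp add: ln_realpow)
qed simp

text \<open>One term of the exponential series at \<open>n\<close>, namely
  \<open>n ^ n / fact n\<close>, is at most the whole series \<open>exp n\<close>.\<close>

lemma ln_fact_ge: "ln (fact n) \<ge> real n * ln (real n) - real n"
proof (cases "n = 0")
  case False
  have "real n ^ n / fact n \<le> exp (real n)"
  proof -
    have "(\<Sum>k\<in>{n}. inverse (fact k) * real n ^ k) \<le> (\<Sum>k. inverse (fact k) * real n ^ k)"
      using summable_exp[of "real n"] by (intro sum_le_suminf) auto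
    then show ?thesis by (simp add: exp_def field_simps scaleR_conv_of_real)
  qed
  then have "ln (real n ^ n / fact n) \<le> ln (exp (real n))"
    using False by (subst ln_le_cancel_iff) auto
  then show ?thesis using False by (simp add: ln_div ln_realpow)
qed simp

text \<open>The logarithm of the factorial is \<open>n * ln n + O(n)\<close>. In Legendre's formula
  the removal of the floors costs \<open>O(n)\<close> by Chebyshev's bound, and so do the proper
  prime powers by convergence; division by \<open>n\<close> leaves a bounded error.\<close>

lemma mertens:
  "\<exists>C>0. \<forall>n\<ge>1. \<bar>(\<Sum>p | prime p \<and> p \<le> n. ln (real p) / real p) - ln (real n)\<bar> \<le> C"
proof -
  obtain C where C: "\<And>F. finite F \<Longrightarrow> F \<subseteq> proper_prime_powers \<Longrightarrow> (\<Sum>(q, j)\<in>F. ln (real q) / real q ^ j) \<le> C"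
    using sum_proper_prime_powers_bounded by blast
  have "C \<ge> 0" using C[of "{}"] by simp
  show ?thesis
  proof (intro exI conjI allI impI)
    show "C + ln 4 + 1 > 0" using \<open>C \<ge> 0\<close> by (simp add: add_nonneg_pos)
    fix n :: nat assume n: "n \<ge> 1"
    let ?M = "\<Sum>p | prime p \<and> p \<le> n. ln (real p) / real p"
    let ?P1 = "(\<lambda>p. (p, 1::nat)) ` {p. prime p \<and> p \<le> n}"
    let ?P2 = "prime_power_pairs n \<inter> proper_prime_powers"
    have split: "prime_power_pairs n = ?P1 \<union> ?P2"
      by (auto simp: prime_power_pairs_def proper_prime_powers_def image_iff le_Suc_eq numeral_2_eq_2 not_less_eq_eq)
    have disj: "?P1 \<inter> ?P2 = {}" by (auto simp: proper_prime_powers_def)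
    have eq: "ln (fact n) = (\<Sum>p | prime p \<and> p \<le> n. ln (real p) * real (n div p))
        + (\<Sum>(q, j)\<in>?P2. ln (real q) * real (n div q ^ j))"
    proof -
      have "ln (fact n) = (\<Sum>(q, j)\<in>?P1 \<union> ?P2. ln (real q) * real (n div q ^ j))"
        unfolding ln_fact_eq by (rule sum.cong[OF split]) simp
      also have "\<dots> = (\<Sum>(q, j)\<in>?P1. ln (real q) * real (n div q ^ j))
          + (\<Sum>(q, j)\<in>?P2. ln (real q) * real (n div q ^ j))"
        using finite_primes_le[of n] finite_prime_power_pairs[of n]
        by (intro sum.union_disjoint[OF _ _ disj]) auto
      finally show ?thesis by (simp add: sum.reindex inj_on_def)
    qed
    \<comment> \<open>Upper bound for the sum: each floor loses at most 1, and the proper powers are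
      dropped.\<close>
    have "real n * ?M - real n * ln 4 \<le> (\<Sum>p | prime p \<and> p \<le> n. ln (real p) * (real n / real p - 1))"
      using sum_ln_primes_le[of n] by (simp add: sum_subtractf sum_distrib_left algebra_simps)
    also have "\<dots> \<le> (\<Sum>p | prime p \<and> p \<le> n. ln (real p) * real (n div p))"
    proof (rule sum_mono, rule mult_left_mono)
      fix p show "real n / real p - 1 \<le> real (n div p)"
        using floor_divide_of_nat_eq[of n p, where ?'a=real] by linarith
    qed (simp add: ln_prime_nonneg)
    also have "\<dots> \<le> ln (fact n)"
    proof -
      have "0 \<le> (\<Sum>(q, j)\<in>?P2. ln (real q) * real (n div q ^ j))"
        by (rule sum_nonneg) (auto simp: proper_prime_powers_def ln_prime_nonneg)
      then show ?thesis unfolding eq by simp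
    qed
    also have "\<dots> \<le> real n * ln (real n)" by (rule ln_fact_le)
    finally have "real n * (?M - ln 4 - ln (real n)) \<le> 0" by (simp add: algebra_simps)
    then have up: "?M - ln 4 - ln (real n) \<le> 0" using n by (simp add: mult_le_0_iff)
    \<comment> \<open>Lower bound for the sum: floors are replaced by quotients, and the proper
      powers add at most \<open>n * C\<close>.\<close>
    have "real n * ln (real n) - real n \<le> ln (fact n)" by (rule ln_fact_ge)
    also have "\<dots> \<le> (\<Sum>p | prime p \<and> p \<le> n. ln (real p) * (real n / real p))
        + (\<Sum>(q, j)\<in>?P2. ln (real q) * (real n / real q ^ j))"
    proof -
      have div_le: "real (n div d) \<le> real n / real d" for d
        using floor_divide_of_nat_eq[of n d, where ?'a=real] by linarith
      have "(\<Sum>p | prime p \<and> p \<le> n. ln (real p) * real (n div p))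
          \<le> (\<Sum>p | prime p \<and> p \<le> n. ln (real p) * (real n / real p))"
        by (rule sum_mono, rule mult_left_mono[OF div_le]) (simp add: ln_prime_nonneg)
      moreover have "(\<Sum>(q, j)\<in>?P2. ln (real q) * real (n div q ^ j))
          \<le> (\<Sum>(q, j)\<in>?P2. ln (real q) * (real n / real q ^ j))"
      proof (rule sum_mono)
        fix x assume "x \<in> ?P2"
        then have "ln (real (fst x)) * real (n div fst x ^ snd x)
            \<le> ln (real (fst x)) * (real n / real (fst x ^ snd x))"
          by (intro mult_left_mono[OF div_le]) (auto simp: proper_prime_powers_def ln_prime_nonneg)
        then show "(case x of (q, j) \<Rightarrow> ln (real q) * real (n div q ^ j))
            \<le> (case x of (q, j) \<Rightarrow> ln (real q) * (real n / real q ^ j))"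
          by (simp add: case_prod_beta)
      qed
      ultimately show ?thesis unfolding eq by simp
    qed
    also have "\<dots> = real n * ?M + real n * (\<Sum>(q, j)\<in>?P2. ln (real q) / real q ^ j)"
      by (simp add: sum_distrib_left case_prod_beta mult_ac)
    also have "\<dots> \<le> real n * ?M + real n * C"
      using C[of ?P2] finite_prime_power_pairs[of n] by (intro add_left_mono mult_left_mono) auto
    finally have "real n * (ln (real n) - 1 - ?M - C) \<le> 0" by (simp add: algebra_simps)
    then have lo: "ln (real n) - 1 - ?M - C \<le> 0" using n by (simp add: mult_le_0_iff)
    show "\<bar>?M - ln (real n)\<bar> \<le> C + ln 4 + 1"
    proof -
      have "0 \<le> ln (4::real)" by simp
      then show ?thesis using up lo \<open>C \<ge> 0\<close> unfolding abs_le_iff by linarith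
    qed
  qed
qed

section \<open>The large sieve\<close>

lemma sum_mod_coprime_product:
  fixes f g :: "nat \<Rightarrow> 'a::comm_semiring_0"
  assumes "coprime m n" "m > 0" "n > 0"
  shows "(\<Sum>b<m * n. f (b mod m) * g (b mod n)) = (\<Sum>c<m. f c) * (\<Sum>d<n. g d)"
proof -
  let ?h = "\<lambda>b. (b mod m, b mod n)"
  have inj: "inj_on ?h {..<m * n}"
  proof (rule inj_onI)
    fix x y assume xy: "x \<in> {..<m * n}" "y \<in> {..<m * n}" "?h x = ?h y"
    then have "[x = y] (mod m * n)"
      using assms(1) by (intro coprime_cong_mult_nat) (auto simp: Cong.cong_def)
    then show "x = y" using xy by (auto simp: Cong.cong_def)
  qed
  have "?h ` {..<m * n} = {..<m} \<times> {..<n}"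
    by (rule card_subset_eq) (use assms inj in \<open>auto simp: card_image\<close>)
  then have "bij_betw ?h {..<m * n} ({..<m} \<times> {..<n})"
    using inj by (simp add: bij_betw_def)
  then have "(\<Sum>b<m * n. f (b mod m) * g (b mod n)) = (\<Sum>(c, d)\<in>{..<m} \<times> {..<n}. f c * g d)"
    by (rule sum.reindex_bij_betw_not_neutral[where S' = "{}" and T' = "{}" and h = ?h
        and g = "\<lambda>(c, d). f c * g d", simplified])
  then show ?thesis by (simp add: sum_product sum.cartesian_product)
qed

definition prime_set :: "nat set \<Rightarrow> bool" where
  "prime_set T \<longleftrightarrow> finite T \<and> (\<forall>p\<in>T. prime p)"

lemma prime_set_finite: "prime_set T \<Longrightarrow> finite T"
  by (simp add: prime_set_def)

lemma prime_set_prime: "prime_set T \<Longrightarrow> p \<in> T \<Longrightarrow> prime p"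
  by (simp add: prime_set_def)

lemma prime_set_subset: "prime_set T \<Longrightarrow> S \<subseteq> T \<Longrightarrow> prime_set S"
  by (auto simp: prime_set_def intro: finite_subset)

lemma prime_set_insert: "prime_set (insert p T) \<longleftrightarrow> prime p \<and> prime_set T"
  by (auto simp: prime_set_def)

lemma prime_set_Un: "prime_set (S \<union> T) \<longleftrightarrow> prime_set S \<and> prime_set T"
  by (auto simp: prime_set_def)

lemma prime_set_empty: "prime_set {}"
  by (simp add: prime_set_def)

lemma prod_prime_set_pos: "prime_set T \<Longrightarrow> \<Prod>T > 0"
  by (rule prod_pos) (auto simp: prime_set_def dest: prime_gt_0_nat)

lemma prod_prime_set_dvd_nat:
  "prime_set T \<Longrightarrow> \<Prod>T dvd n \<longleftrightarrow> (\<forall>p\<in>T. p dvd n)"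
  by (intro prod_primes_dvd) (auto simp: prime_set_def)

lemma prod_prime_set_dvd_int:
  "prime_set T \<Longrightarrow> int (\<Prod>T) dvd n \<longleftrightarrow> (\<forall>p\<in>T. int p dvd n)"
  using prod_prime_set_dvd_nat[of T "nat \<bar>n\<bar>"] by (simp only: dvd_nat_abs_iff)

lemma prime_factors_prod_prime_set: "prime_set T \<Longrightarrow> prime_factors (\<Prod>T) = T"
  by (subst prime_factors_prod) (auto simp: prime_set_def prime_factorization_prime)

lemma coprime_prod_prime_set:
  "prime_set T \<Longrightarrow> coprime n (\<Prod>T) \<longleftrightarrow> (\<forall>p\<in>T. \<not> p dvd n)"
proof
  assume T: "prime_set T" and "coprime n (\<Prod>T)"
  then show "\<forall>p\<in>T. \<not> p dvd n"
    by (meson coprime_common_divisor dvd_prodI not_prime_unit prime_set_finite prime_set_prime)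
next
  assume T: "prime_set T" and "\<forall>p\<in>T. \<not> p dvd n"
  then show "coprime n (\<Prod>T)"
    by (intro prod_coprime_right) (metis coprime_commute prime_imp_coprime prime_set_prime)
qed

text \<open>The residues of \<open>b\<close> modulo the primes of \<open>T\<close> are independent,
  so a complete sum over a product of local factors splits into local sums.\<close>

lemma sum_mod_prime_set:
  fixes F :: "nat \<Rightarrow> nat \<Rightarrow> 'a::comm_semiring_1"
  assumes "prime_set T"
  shows "(\<Sum>b<\<Prod>T. \<Prod>p\<in>T. F p (b mod p)) = (\<Prod>p\<in>T. \<Sum>c<p. F p c)"
proof -
  have "finite T" using assms by (simp add: prime_set_def)
  then show ?thesis using assms
  proof (induction T rule: finite_induct)
    case (insert p T)
    then have T: "prime_set T" and p: "prime p" by (auto simp: prime_set_def)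
    have "coprime p (\<Prod>T)" unfolding coprime_prod_prime_set[OF T]
      using insert.hyps p T by (auto simp: prime_set_def dest: primes_dvd_imp_eq)
    moreover have "(\<Prod>r\<in>T. F r (b mod r)) = (\<Prod>r\<in>T. F r (b mod \<Prod>T mod r))" for b
      using dvd_prodI[OF insert.hyps(1), of _ "\<lambda>x. x"]
      by (intro prod.cong refl) (simp add: mod_mod_cancel)
    ultimately have "(\<Sum>b<p * \<Prod>T. F p (b mod p) * (\<Prod>r\<in>T. F r (b mod r)))
        = (\<Sum>c<p. F p c) * (\<Sum>d<\<Prod>T. \<Prod>r\<in>T. F r (d mod r))"
      using sum_mod_coprime_product[of p "\<Prod>T" "F p" "\<lambda>d. \<Prod>r\<in>T. F r (d mod r)"]
        prime_gt_0_nat[OF p] prod_prime_set_pos[OF T] by simp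
    then show ?case using insert.IH[OF T] insert.hyps by simp
  qed simp
qed

text \<open>The solution set is described through \<open>b mod n\<close> so that it serves both
  complete residue systems and intervals.\<close>

lemma linear_congruence_unique_solution:
  fixes q n :: nat and a :: int
  assumes "coprime q n" "n > 0"
  shows "\<exists>c<n. \<forall>b. int n dvd int q * int b - a \<longleftrightarrow> b mod n = c"
proof -
  have "coprime (int q) (int n)" using assms by simp
  then obtain x where x: "[int q * x = 1] (mod int n)" using cong_solve_coprime_int by blast
  define c where "c = nat ((x * a) mod int n)"
  have c: "int c = (x * a) mod int n" using assms by (simp add: c_def)
  have "c < n" using c assms by (metis of_nat_0_less_iff of_nat_less_iff pos_mod_bound)
  moreover have "int n dvd int q * int b - a \<longleftrightarrow> b mod n = c" for b
  proof -
    have "int n dvd int q * int b - a \<longleftrightarrow> [int q * int b = a] (mod int n)"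
      by (simp add: cong_iff_dvd_diff)
    also have "\<dots> \<longleftrightarrow> [int b = x * a] (mod int n)"
    proof
      assume "[int q * int b = a] (mod int n)"
      then have "[x * (int q * int b) = x * a] (mod int n)" by (rule cong_scalar_left)
      moreover have "[int q * x * int b = 1 * int b] (mod int n)" using x by (rule cong_scalar_right)
      ultimately show "[int b = x * a] (mod int n)"
        by (metis cong_sym cong_trans mult.assoc mult.commute mult_1)
    next
      assume "[int b = x * a] (mod int n)"
      then have "[int q * int b = int q * (x * a)] (mod int n)" by (rule cong_scalar_left)
      moreover have "[int q * x * a = 1 * a] (mod int n)" using x by (rule cong_scalar_right)
      ultimately show "[int q * int b = a] (mod int n)"
        by (metis cong_trans mult.assoc mult_1)
    qed
    also have "\<dots> \<longleftrightarrow> int (b mod n) = int c" by (simp add: c Cong.cong_def zmod_int)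
    finally show ?thesis by simp
  qed
  ultimately show ?thesis by blast
qed

lemma of_bool_Ball_eq_prod:
  "finite A \<Longrightarrow> of_bool (\<forall>p\<in>A. P p) = (\<Prod>p\<in>A. of_bool (P p) :: 'a::comm_semiring_1)"
  by (induction A rule: finite_induct) (auto simp: of_bool_conj)

text \<open>A squarefree modulus is represented by the set of its prime factors. For \<open>T = {p}\<close> this is the
  variance of \<open>Q\<close> over the residue classes modulo \<open>p\<close>; in general it is the part of the variance modulo
  \<open>\<Prod>T\<close> that comes from characters of exact denominator \<open>\<Prod>T\<close>.\<close>

definition variance :: "nat set \<Rightarrow> nat set \<Rightarrow> real" where
  "variance Q T = (\<Sum>q\<in>Q. \<Sum>q'\<in>Q. \<Prod>p\<in>T. of_bool ([q = q'] (mod p)) - 1 / real p)"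

text \<open>This is the covariance of the indicators of the classes \<open>a / q\<close> and
  \<open>a / q'\<close>. Since \<open>p\<close> does not divide \<open>a\<close>, the classes
  coincide exactly when \<open>q\<close> and \<open>q'\<close> agree modulo \<open>p\<close>; here
  the multiplicative condition turns into an additive one.\<close>

lemma sum_centred_congruences:
  fixes p q q' :: nat and a :: int
  assumes "prime p" "\<not> p dvd q" "\<not> p dvd q'" "\<not> int p dvd a"
  shows "(\<Sum>c<p. (of_bool (int p dvd int q * int c - a) - 1 / real p) *
                  (of_bool (int p dvd int q' * int c - a) - 1 / real p))
         = of_bool ([q = q'] (mod p)) - 1 / real p"
proof -
  have p: "p > 0" using assms(1) by (rule prime_gt_0_nat)
  have "coprime q p" "coprime q' p" using assms by (simp_all add: prime_imp_coprime coprime_commute)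
  then obtain c c' where c: "c < p" "\<And>b. int p dvd int q * int b - a \<longleftrightarrow> b mod p = c"
    and c': "c' < p" "\<And>b. int p dvd int q' * int b - a \<longleftrightarrow> b mod p = c'"
    using linear_congruence_unique_solution[OF _ p] by metis
  have "c = c' \<longleftrightarrow> [q = q'] (mod p)"
  proof
    assume eq: "c = c'"
    have "int p dvd int q * int c - a" "int p dvd int q' * int c - a"
      using c c' eq by auto
    then have "int p dvd (int q * int c - a) - (int q' * int c - a)" by (rule dvd_diff)
    then have "int p dvd (int q - int q') * int c" by (simp add: algebra_simps)
    moreover have "\<not> int p dvd int c"
    proof
      assume "int p dvd int c"
      then have "int p dvd int q * int c" by (rule dvd_mult)
      from dvd_diff[OF this \<open>int p dvd int q * int c - a\<close>] have "int p dvd a" by simp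
      then show False using assms by simp
    qed
    ultimately have "int p dvd int q - int q'" using assms(1) by (simp add: prime_dvd_mult_iff)
    then show "[q = q'] (mod p)" by (simp add: cong_iff_dvd_diff flip: cong_int_iff)
  next
    assume "[q = q'] (mod p)"
    then have "[int q * int c = int q' * int c] (mod int p)"
      by (intro cong_scalar_right) (simp add: cong_int_iff)
    then have "int p dvd int q * int c - a \<longleftrightarrow> int p dvd int q' * int c - a"
      by (metis cong_iff_dvd_diff cong_sym cong_trans)
    then show "c = c'" using c c' by auto
  qed
  moreover have "(\<Sum>b<p. (of_bool (int p dvd int q * int b - a) - 1 / real p) *
                  (of_bool (int p dvd int q' * int b - a) - 1 / real p))
      = (\<Sum>b<p. of_bool (b = c) * of_bool (b = c') - 1 / real p * of_bool (b = c)
          - 1 / real p * of_bool (b = c') + 1 / real p ^ 2)"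
  proof (rule sum.cong[OF refl])
    fix b assume "b \<in> {..<p}"
    then have "int p dvd int q * int b - a \<longleftrightarrow> b = c" "int p dvd int q' * int b - a \<longleftrightarrow> b = c'"
      using c(2)[of b] c'(2)[of b] by simp_all
    then show "(of_bool (int p dvd int q * int b - a) - 1 / real p) *
                  (of_bool (int p dvd int q' * int b - a) - 1 / real p)
      = of_bool (b = c) * of_bool (b = c') - 1 / real p * of_bool (b = c)
          - 1 / real p * of_bool (b = c') + 1 / real p ^ 2"
      by (cases "b = c"; cases "b = c'") (simp_all add: algebra_simps power2_eq_square)
  qed
  moreover have "\<dots> = of_bool (c = c') - 1 / real p"
  proof -
    have delta: "(\<Sum>b<p. of_bool (b = d)) = (1::real)" if "d < p" for d
      using that by (simp add: of_bool_def)
    have "(\<Sum>b<p. of_bool (b = c) * of_bool (b = c')) = (\<Sum>b<p. of_bool (c = c') * of_bool (b = c) :: real)"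
      by (rule sum.cong) auto
    also have "\<dots> = of_bool (c = c')" using delta[OF c(1)] by (simp only: sum_distrib_left[symmetric] mult_1_right)
    finally have "(\<Sum>b<p. of_bool (b = c) * of_bool (b = c')) = (of_bool (c = c') :: real)" .
    then show ?thesis using delta
      using c(1) c'(1) p
      by (simp only: sum.distrib sum_subtractf sum_distrib_left[symmetric]) (simp add: power2_eq_square)
  qed
  ultimately show ?thesis by simp
qed

text \<open>The square opens into pairs \<open>q\<close>, \<open>q'\<close>, and for each pair the
  complete sum over \<open>b\<close> factors into the local covariances. The residue
  \<open>a\<close> has disappeared from the result.\<close>

lemma sum_square_eq_variance:
  fixes a :: int
  assumes T: "prime_set T" and a: "\<And>p. p \<in> T \<Longrightarrow> \<not> int p dvd a"
    and Q: "\<And>p q. p \<in> T \<Longrightarrow> q \<in> Q \<Longrightarrow> \<not> p dvd q"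
  shows "(\<Sum>b<\<Prod>T. (\<Sum>q\<in>Q. \<Prod>p\<in>T. of_bool (int p dvd int q * int b - a) - 1 / real p)\<^sup>2)
         = variance Q T"
proof -
  define G where "G q p c = of_bool (int p dvd int q * int c - a) - 1 / real p" for q p c :: nat
  have G_mod: "G q p (b mod p) = G q p b" for q p b
  proof -
    have "[int q * int (b mod p) = int q * int b] (mod int p)"
      by (intro cong_scalar_left) (simp add: Cong.cong_def zmod_int)
    then have "int p dvd int q * int (b mod p) - a \<longleftrightarrow> int p dvd int q * int b - a"
      by (metis cong_iff_dvd_diff cong_sym cong_trans)
    then show ?thesis by (simp add: G_def)
  qed
  have "(\<Sum>b<\<Prod>T. (\<Sum>q\<in>Q. \<Prod>p\<in>T. G q p b)\<^sup>2)
      = (\<Sum>b<\<Prod>T. \<Sum>q\<in>Q. \<Sum>q'\<in>Q. \<Prod>p\<in>T. G q p (b mod p) * G q' p (b mod p))"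
    by (simp add: power2_eq_square sum_product prod.distrib G_mod)
  also have "\<dots> = (\<Sum>q\<in>Q. \<Sum>q'\<in>Q. \<Sum>b<\<Prod>T. \<Prod>p\<in>T. G q p (b mod p) * G q' p (b mod p))"
    by (simp only: sum.swap[where A = "{..<\<Prod>T}"])
  also have "\<dots> = (\<Sum>q\<in>Q. \<Sum>q'\<in>Q. \<Prod>p\<in>T. \<Sum>c<p. G q p c * G q' p c)"
    by (simp add: sum_mod_prime_set[OF T, of "\<lambda>p c. G _ p c * G _ p c"])
  also have "\<dots> = variance Q T"
    unfolding variance_def G_def
    by (intro sum.cong prod.cong refl sum_centred_congruences)
       (use T a Q in \<open>auto simp: prime_set_def\<close>)
  finally show ?thesis by (simp add: G_def)
qed

section \<open>Additive characters and Ramanujan sums\<close>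

definition unit_char :: "real \<Rightarrow> complex" where
  "unit_char x = cis (2 * pi * x)"

lemma unit_char_add: "unit_char (x + y) = unit_char x * unit_char y"
  by (simp add: unit_char_def cis_mult distrib_left)

lemma unit_char_diff: "unit_char (x - y) = unit_char x * cnj (unit_char y)"
  by (simp add: unit_char_def cis_cnj cis_mult algebra_simps)

lemma unit_char_minus: "unit_char (- x) = cnj (unit_char x)"
  by (simp add: unit_char_def cis_cnj)

lemma norm_unit_char [simp]: "norm (unit_char x) = 1"
  by (simp add: unit_char_def)

lemma unit_char_of_int [simp]: "unit_char (of_int n) = 1"
  by (simp add: unit_char_def)

lemma unit_char_power: "unit_char x ^ n = unit_char (real n * x)"
  by (simp add: unit_char_def Complex.DeMoivre mult_ac)

lemma unit_char_eq_1_iff: "unit_char x = 1 \<longleftrightarrow> x \<in> \<int>"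
proof
  assume "unit_char x = 1"
  then obtain n where "2 * pi * x = of_int n * (2 * pi)" by (auto simp: unit_char_def cis_eq_1_iff)
  then have "x = of_int n" by simp
  then show "x \<in> \<int>" by simp
next
  assume "x \<in> \<int>"
  then show "unit_char x = 1" by (simp add: unit_char_def)
qed

text \<open>Orthogonality of the additive characters modulo \<open>t\<close>, read off from the
  geometric sum.\<close>

lemma sum_unit_char_multiples:
  assumes "t > 0"
  shows "(\<Sum>h<t. unit_char (real h * (of_int n / real t))) = of_nat t * of_bool (int t dvd n)"
proof -
  let ?z = "unit_char (of_int n / real t)"
  have eq: "(\<Sum>h<t. unit_char (real h * (of_int n / real t))) = (\<Sum>h<t. ?z ^ h)"
    by (simp add: unit_char_power)
  have "?z = 1 \<longleftrightarrow> int t dvd n"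
  proof -
    have "?z = 1 \<longleftrightarrow> (\<exists>k. of_int n / real t = of_int k)" by (auto simp: unit_char_eq_1_iff elim: Ints_cases)
    also have "\<dots> \<longleftrightarrow> (\<exists>k. of_int n = (of_int (int t * k) :: real))"
      using assms by (simp add: field_simps)
    also have "\<dots> \<longleftrightarrow> int t dvd n" by (simp only: of_int_eq_iff dvd_def)
    finally show ?thesis .
  qed
  moreover have "?z ^ t = 1"
    using assms by (simp add: unit_char_power)
  ultimately show ?thesis
    unfolding eq using geometric_sum[of ?z t] by (cases "?z = 1") auto
qed

text \<open>The left-hand side is Ramanujan's sum for a squarefree modulus. Moebius inversion over
  the subsets \<open>U\<close> of \<open>T\<close> removes the coprimality condition and leaves
  complete sums modulo \<open>\<Prod>(T - U)\<close>; the same terms arise from expanding the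
  product on the right.\<close>

lemma ramanujan_sum_eq:
  assumes T: "prime_set T"
  shows "(\<Sum>h\<in>{h. h < \<Prod>T \<and> coprime h (\<Prod>T)}. unit_char (real h * (of_int n / real (\<Prod>T))))
    = (\<Prod>p\<in>T. of_nat p * of_bool (int p dvd n) - 1)"
proof -
  have fin: "finite T" using T by (rule prime_set_finite)
  let ?t = "\<Prod>T"
  let ?e = "\<lambda>h. unit_char (real h * (of_int n / real ?t))"
  have coprime_eq: "(of_bool (coprime h ?t) :: complex) = (\<Sum>U\<in>Pow T. (-1) ^ card U * of_bool (\<Prod>U dvd h))" for h
  proof -
    have "(of_bool (coprime h ?t) :: complex) = (\<Prod>p\<in>T. - of_bool (p dvd h) + 1)"
      unfolding coprime_prod_prime_set[OF T] using fin by (induction T rule: finite_induct) auto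
    also have "\<dots> = (\<Sum>U\<in>Pow T. (\<Prod>p\<in>U. - of_bool (p dvd h)) * (\<Prod>p\<in>T - U. 1))"
      by (rule prod_add[OF fin])
    also have "\<dots> = (\<Sum>U\<in>Pow T. (-1) ^ card U * of_bool (\<Prod>U dvd h))"
    proof (rule sum.cong[OF refl])
      fix U assume U: "U \<in> Pow T"
      then have "prime_set U" using T prime_set_subset by auto
      have "finite U" using U fin finite_subset by auto
      then have "(\<Prod>p\<in>U. - of_bool (p dvd h)) = ((-1) ^ card U * of_bool (\<forall>p\<in>U. p dvd h) :: complex)"
        by (induction U rule: finite_induct) auto
      then show "(\<Prod>p\<in>U. - of_bool (p dvd h)) * (\<Prod>p\<in>T - U. 1) = ((-1) ^ card U * of_bool (\<Prod>U dvd h) :: complex)"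
        using prod_prime_set_dvd_nat[OF \<open>prime_set U\<close>] by simp
    qed
    finally show ?thesis .
  qed
  have inner: "(\<Sum>h<?t. of_bool (\<Prod>U dvd h) * ?e h) = (\<Prod>p\<in>T - U. of_nat p * of_bool (int p dvd n))"
    if U: "U \<subseteq> T" for U
  proof -
    let ?u = "\<Prod>U" and ?v = "\<Prod>(T - U)"
    have t: "?t = ?u * ?v" using prod.subset_diff[OF U fin, of "\<lambda>x. x"] by (simp add: mult.commute)
    have uv: "?u > 0" "?v > 0" using T U by (auto intro!: prod_prime_set_pos intro: prime_set_subset)
    have "(\<Sum>h<?t. of_bool (?u dvd h) * ?e h) = (\<Sum>h\<in>{h. h < ?t \<and> ?u dvd h}. ?e h)"
      by (rule sum.mono_neutral_cong_right) auto
    also have "\<dots> = (\<Sum>k<?v. ?e (?u * k))"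
    proof (rule sum.reindex_bij_betw[symmetric])
      show "bij_betw (\<lambda>k. ?u * k) {..<?v} {h. h < ?t \<and> ?u dvd h}"
        unfolding bij_betw_def t using uv by (auto simp: inj_on_def dvd_def image_iff)
    qed
    also have "\<dots> = (\<Sum>k<?v. unit_char (real k * (of_int n / real ?v)))"
      using uv by (intro sum.cong refl arg_cong[of _ _ unit_char]) (simp add: t field_simps del: of_nat_prod)
    also have "\<dots> = of_nat ?v * of_bool (int ?v dvd n)" by (rule sum_unit_char_multiples) (use uv in simp)
    also have "\<dots> = (\<Prod>p\<in>T - U. of_nat p * of_bool (int p dvd n))"
    proof -
      have "prime_set (T - U)" using T prime_set_subset by blast
      then have "of_bool (int ?v dvd n) = (of_bool (\<forall>p\<in>T-U. int p dvd n) :: complex)"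
        by (simp only: prod_prime_set_dvd_int)
      also have "\<dots> = (\<Prod>p\<in>T - U. of_bool (int p dvd n))"
        by (rule of_bool_Ball_eq_prod) (use fin in simp)
      finally show ?thesis by (simp add: prod.distrib)
    qed
    finally show ?thesis .
  qed
  have "(\<Sum>h\<in>{h. h < ?t \<and> coprime h ?t}. ?e h) = (\<Sum>h<?t. of_bool (coprime h ?t) * ?e h)"
    by (rule sum.mono_neutral_cong_left) auto
  also have "\<dots> = (\<Sum>h<?t. \<Sum>U\<in>Pow T. (-1) ^ card U * (of_bool (\<Prod>U dvd h) * ?e h))"
    by (simp only: coprime_eq sum_distrib_right mult.assoc)
  also have "\<dots> = (\<Sum>U\<in>Pow T. (-1) ^ card U * (\<Sum>h<?t. of_bool (\<Prod>U dvd h) * ?e h))"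
    by (subst sum.swap) (simp only: sum_distrib_left)
  also have "\<dots> = (\<Sum>U\<in>Pow T. (\<Prod>p\<in>U. -1) * (\<Prod>p\<in>T - U. of_nat p * of_bool (int p dvd n)))"
    by (rule sum.cong[OF refl]) (simp only: inner Pow_iff prod_constant)
  also have "\<dots> = (\<Prod>p\<in>T. -1 + of_nat p * of_bool (int p dvd n))"
    by (rule prod_add[OF fin, symmetric])
  finally show ?thesis by (simp add: add.commute)
qed

text \<open>Each local factor of the variance, multiplied by \<open>p\<close>, is the local factor
  of a Ramanujan sum in \<open>q - q'\<close>. Opening that sum into characters of exact denominator
  \<open>\<Prod>T\<close> separates \<open>q\<close> from \<open>q'\<close> and leaves squared
  absolute values.\<close>

lemma variance_eq_exponential_sums:
  assumes T: "prime_set T"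
  shows "real (\<Prod>T) * variance Q T =
    (\<Sum>h\<in>{h. h < \<Prod>T \<and> coprime h (\<Prod>T)}. (norm (\<Sum>q\<in>Q. unit_char (real q * (real h / real (\<Prod>T)))))\<^sup>2)"
proof -
  let ?t = "\<Prod>T" and ?H = "{h. h < \<Prod>T \<and> coprime h (\<Prod>T)}"
  have fin: "finite T" using T by (rule prime_set_finite)
  have "complex_of_real (\<Sum>h\<in>?H. (norm (\<Sum>q\<in>Q. unit_char (real q * (real h / real ?t))))\<^sup>2)
     = (\<Sum>h\<in>?H. \<Sum>q\<in>Q. \<Sum>q'\<in>Q. unit_char (real h * (of_int (int q - int q') / real ?t)))"
  proof -
    have "complex_of_real ((norm (\<Sum>q\<in>Q. unit_char (real q * (real h / real ?t))))\<^sup>2)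
        = (\<Sum>q\<in>Q. \<Sum>q'\<in>Q. unit_char (real h * (of_int (int q - int q') / real ?t)))" for h
    proof -
      have "unit_char (real q * (real h / real ?t)) * cnj (unit_char (real q' * (real h / real ?t)))
        = unit_char (real h * (of_int (int q - int q') / real ?t))" for q q'
        unfolding unit_char_diff[symmetric] by (rule arg_cong[of _ _ unit_char]) (simp add: diff_divide_distrib algebra_simps)
      then show ?thesis by (simp only: complex_norm_square sum_product cnj_sum)
    qed
    then show ?thesis by simp
  qed
  also have "\<dots> = (\<Sum>q\<in>Q. \<Sum>q'\<in>Q. \<Sum>h\<in>?H. unit_char (real h * (of_int (int q - int q') / real ?t)))"
    by (simp only: sum.swap[where A = ?H])
  also have "\<dots> = (\<Sum>q\<in>Q. \<Sum>q'\<in>Q. \<Prod>p\<in>T. of_nat p * of_bool (int p dvd int q - int q') - 1)"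
    by (simp only: ramanujan_sum_eq[OF T])
  also have "\<dots> = (\<Sum>q\<in>Q. \<Sum>q'\<in>Q. of_nat ?t * (\<Prod>p\<in>T. of_bool ([q = q'] (mod p)) - 1 / of_nat p))"
  proof (intro sum.cong refl)
    fix q q'
    have "(\<Prod>p\<in>T. of_nat p * of_bool (int p dvd int q - int q') - 1)
       = (\<Prod>p\<in>T. of_nat p * (of_bool ([q = q'] (mod p)) - 1 / of_nat p :: complex))"
    proof (rule prod.cong[OF refl])
      fix p assume "p \<in> T"
      then have "p > 0" using T by (auto simp: prime_set_def dest: prime_gt_0_nat)
      then show "of_nat p * of_bool (int p dvd int q - int q') - 1
         = of_nat p * (of_bool ([q = q'] (mod p)) - 1 / of_nat p :: complex)"
        by (simp add: cong_iff_dvd_diff right_diff_distrib flip: cong_int_iff)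
    qed
    then show "(\<Prod>p\<in>T. of_nat p * of_bool (int p dvd int q - int q') - 1)
       = of_nat ?t * (\<Prod>p\<in>T. of_bool ([q = q'] (mod p)) - 1 / of_nat p :: complex)"
      by (simp add: prod.distrib)
  qed
  also have "\<dots> = complex_of_real (real ?t * variance Q T)"
  proof -
    have "complex_of_real (of_bool P) = of_bool P" for P by (cases P) auto
    then show ?thesis by (simp add: variance_def sum_distrib_left)
  qed
  finally show ?thesis by (simp only: of_real_eq_iff)
qed

text \<open>The factors in the definition take both signs; positivity comes from the representation
  by squares.\<close>

lemma variance_nonneg: "prime_set T \<Longrightarrow> variance Q T \<ge> 0"
proof -
  assume T: "prime_set T"
  have "real (\<Prod>T) * variance Q T \<ge> 0"
    unfolding variance_eq_exponential_sums[OF T] by (intro sum_nonneg) auto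
  moreover have "real (\<Prod>T) > 0" using prod_prime_set_pos[OF T] by (simp only: of_nat_0_less_iff)
  ultimately show ?thesis by (simp add: zero_le_mult_iff del: of_nat_prod)
qed

section \<open>Geometric sums and the large sieve for spaced points\<close>

lemma sin_ge_third:
  assumes "0 \<le> x" "x \<le> 2"
  shows "x / 3 \<le> sin (x::real)"
proof -
  have "\<bar>sin x - (\<Sum>m<3. sin_coeff m * x ^ m)\<bar> \<le> inverse (fact 3) * \<bar>x\<bar> ^ 3"
    by (rule Maclaurin_sin_bound)
  then have "\<bar>sin x - x\<bar> \<le> x ^ 3 / 6"
    using assms by (simp add: numeral_3_eq_3 sin_coeff_def fact_numeral)
  moreover have "x ^ 3 / 6 \<le> 2 * x / 3"
  proof -
    have "x * x \<le> 2 * 2" using assms by (intro mult_mono) auto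
    then have "x * (x * x) \<le> x * 4" using assms by (intro mult_left_mono) auto
    then show ?thesis by (simp add: power3_eq_cube)
  qed
  ultimately show ?thesis by linarith
qed

text \<open>The norm equals \<open>2 * sin (pi * \<beta>)\<close>, and the left-hand side is the
  distance from \<beta> to the nearest integer.\<close>

lemma norm_one_minus_unit_char:
  assumes "0 \<le> \<beta>" "\<beta> \<le> 1"
  shows "min \<beta> (1 - \<beta>) \<le> norm (1 - unit_char \<beta>)"
proof -
  have "(norm (1 - unit_char \<beta>))\<^sup>2 = (2 * sin (pi * \<beta>))\<^sup>2"
  proof -
    have "(norm (1 - unit_char \<beta>))\<^sup>2 = (1 - cos (2 * (pi * \<beta>)))\<^sup>2 + (sin (2 * (pi * \<beta>)))\<^sup>2"
      by (simp add: cmod_power2 unit_char_def mult.assoc)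
    also have "\<dots> = 2 - 2 * cos (2 * (pi * \<beta>))"
      using sin_cos_squared_add[of "2 * (pi * \<beta>)"] by (simp add: power2_eq_square algebra_simps)
    also have "\<dots> = (2 * sin (pi * \<beta>))\<^sup>2" unfolding cos_double_sin by (simp add: power_mult_distrib)
    finally show ?thesis .
  qed
  moreover have sin_nonneg: "0 \<le> sin (pi * \<beta>)"
    using assms by (intro sin_ge_zero) (auto simp: mult_left_le)
  ultimately have norm_eq: "norm (1 - unit_char \<beta>) = 2 * sin (pi * \<beta>)"
    using power2_eq_iff_nonneg[of "norm (1 - unit_char \<beta>)" "2 * sin (pi * \<beta>)"] by simp
  have half: "\<gamma> \<le> 2 * sin (pi * \<gamma>)" if "0 \<le> \<gamma>" "\<gamma> \<le> 1 / 2" for \<gamma>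
  proof -
    \<comment> \<open>The crude bound \<open>pi < 4\<close> keeps the angle within the range of
      \<open>sin_ge_third\<close>; with \<open>pi \<ge> 2\<close> the factor 1 / 3 still leaves at
      least \<open>4 / 3 * \<gamma>\<close> for \<open>2 * sin (pi * \<gamma>)\<close>.\<close>
    have "pi * \<gamma> \<le> 4 * (1 / 2)" using that pi_less_4 by (intro mult_mono) auto
    then have "pi * \<gamma> / 3 \<le> sin (pi * \<gamma>)" using that by (intro sin_ge_third) auto
    moreover have "2 * \<gamma> \<le> pi * \<gamma>" using that pi_ge_two by (intro mult_right_mono) auto
    ultimately show ?thesis using that by linarith
  qed
  show ?thesis
  proof (cases "\<beta> \<le> 1 / 2")
    case True
    then show ?thesis using half[of \<beta>] assms norm_eq by simp
  next
    case False
    have "sin (pi * \<beta>) = sin (pi * (1 - \<beta>))"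
      by (simp add: algebra_simps sin_diff)
    then show ?thesis using half[of "1 - \<beta>"] False assms norm_eq by simp
  qed
qed

text \<open>A geometric sum is at most 2 divided by the distance to the nearest integer. Adding the
  contributions of both end points in place of the minimum lets each be summed separately over
  spaced points.\<close>

lemma norm_sum_unit_char_le:
  assumes "0 < \<beta>" "\<beta> < 1"
  shows "(norm (\<Sum>j<n. unit_char (real j * \<beta>)))\<^sup>2 \<le> 4 / \<beta>\<^sup>2 + 4 / (1 - \<beta>)\<^sup>2"
proof -
  let ?z = "unit_char \<beta>"
  let ?m = "min \<beta> (1 - \<beta>)"
  have m: "?m > 0" using assms by simp
  have lower: "?m \<le> norm (1 - ?z)" using assms by (intro norm_one_minus_unit_char) auto
  then have z: "?z \<noteq> 1" using m by auto
  have "(\<Sum>j<n. unit_char (real j * \<beta>)) = (\<Sum>j<n. ?z ^ j)" by (simp add: unit_char_power)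
  also have "\<dots> = (?z ^ n - 1) / (?z - 1)" using z by (rule geometric_sum)
  finally have "norm (\<Sum>j<n. unit_char (real j * \<beta>)) = norm (?z ^ n - 1) / norm (1 - ?z)"
    by (simp add: norm_divide norm_minus_commute)
  also have "\<dots> \<le> 2 / ?m"
  proof (rule frac_le)
    show "norm (?z ^ n - 1) \<le> 2" using norm_triangle_ineq4[of "?z ^ n" 1] by (simp add: norm_power)
  qed (use lower m in auto)
  finally have "(norm (\<Sum>j<n. unit_char (real j * \<beta>)))\<^sup>2 \<le> (2 / ?m)\<^sup>2"
    by (intro power_mono) auto
  also have "\<dots> \<le> 4 / \<beta>\<^sup>2 + 4 / (1 - \<beta>)\<^sup>2"
    by (auto simp: min_def power_divide)
  finally show ?thesis .
qed

lemma sum_inverse_squares_le: "(\<Sum>k\<in>{1..n}. 1 / real k ^ 2) \<le> 2"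
proof (cases "n = 0")
  case False
  then have "n > 0" by simp
  then have "(\<Sum>k\<in>{1..n}. 1 / real k ^ 2) \<le> 2 - 1 / real n"
  proof (induction n rule: nat_induct_non_zero)
    case (Suc n)
    have "1 / real (Suc n) ^ 2 \<le> 1 / real n - 1 / real (Suc n)"
    proof -
      have "1 / real n - 1 / real (Suc n) = 1 / (real n * real (Suc n))"
        using Suc.hyps by (simp add: field_simps)
      moreover have "1 / real (Suc n) ^ 2 \<le> 1 / (real n * real (Suc n))"
        unfolding power2_eq_square using Suc.hyps by (intro frac_le mult_right_mono) auto
      ultimately show ?thesis by simp
    qed
    then show ?case using Suc.IH by simp
  qed simp
  then show ?thesis by (smt (verit) divide_nonneg_nonneg of_nat_0_le_iff)
qed simp

text \<open>Cells of length \<Delta> contain at most one point each, and the cell at the origin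
  contains none; the sum is thus dominated by the series of inverse squares.\<close>

lemma sum_inverse_squares_spaced:
  fixes \<Delta> :: real
  assumes "finite G" "\<Delta> > 0" "\<And>\<gamma>. \<gamma> \<in> G \<Longrightarrow> \<Delta> \<le> \<gamma>"
    and spaced: "\<And>\<gamma> \<gamma>'. \<gamma> \<in> G \<Longrightarrow> \<gamma>' \<in> G \<Longrightarrow> \<gamma> \<noteq> \<gamma>' \<Longrightarrow> \<Delta> \<le> \<bar>\<gamma> - \<gamma>'\<bar>"
  shows "(\<Sum>\<gamma>\<in>G. 1 / \<gamma>\<^sup>2) \<le> 2 / \<Delta>\<^sup>2"
proof -
  define k where "k \<gamma> = nat \<lfloor>\<gamma> / \<Delta>\<rfloor>" for \<gamma>
  have k1: "1 \<le> k \<gamma>" and k2: "real (k \<gamma>) * \<Delta> \<le> \<gamma>" and k3: "\<gamma> < (real (k \<gamma>) + 1) * \<Delta>" if "\<gamma> \<in> G" for \<gamma>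
  proof -
    have "1 \<le> \<gamma> / \<Delta>" using that assms by (simp add: le_divide_eq)
    then have kf: "real (k \<gamma>) = of_int \<lfloor>\<gamma> / \<Delta>\<rfloor>" by (simp add: k_def)
    then show "1 \<le> k \<gamma>" using \<open>1 \<le> \<gamma> / \<Delta>\<close> by linarith
    have "real (k \<gamma>) \<le> \<gamma> / \<Delta>" "\<gamma> / \<Delta> < real (k \<gamma>) + 1" using kf by linarith+
    then show "real (k \<gamma>) * \<Delta> \<le> \<gamma>" "\<gamma> < (real (k \<gamma>) + 1) * \<Delta>"
      using assms(2) by (simp_all add: field_simps)
  qed
  have inj: "inj_on k G"
  proof (rule inj_onI, rule ccontr)
    fix x y assume "x \<in> G" "y \<in> G" "k x = k y" "x \<noteq> y"
    then show False using k2[of x] k3[of x] k2[of y] k3[of y] spaced[of x y] by (simp add: algebra_simps)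
  qed
  obtain n where n: "k ` G \<subseteq> {1..n}"
  proof -
    have "finite (k ` G)" using assms(1) by simp
    then obtain n where "\<And>i. i \<in> k ` G \<Longrightarrow> i \<le> n" unfolding finite_nat_set_iff_bounded_le by blast
    then show ?thesis using k1 that[of n] by fastforce
  qed
  have "(\<Sum>\<gamma>\<in>G. 1 / \<gamma>\<^sup>2) \<le> (\<Sum>\<gamma>\<in>G. 1 / (real (k \<gamma>) * \<Delta>)\<^sup>2)"
  proof (rule sum_mono)
    fix \<gamma> assume "\<gamma> \<in> G"
    then have "0 < real (k \<gamma>) * \<Delta>" "real (k \<gamma>) * \<Delta> \<le> \<gamma>"
      using k1[of \<gamma>] k2[of \<gamma>] assms(2) by auto
    then show "1 / \<gamma>\<^sup>2 \<le> 1 / (real (k \<gamma>) * \<Delta>)\<^sup>2"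
      by (intro frac_le power_mono zero_less_power) linarith+
  qed
  also have "\<dots> = (\<Sum>i\<in>k ` G. 1 / real i ^ 2) / \<Delta>\<^sup>2"
    by (simp add: sum.reindex[OF inj] power_mult_distrib sum_divide_distrib)
  also have "(\<Sum>i\<in>k ` G. 1 / real i ^ 2) \<le> (\<Sum>i\<in>{1..n}. 1 / real i ^ 2)"
    by (rule sum_mono2) (use n in auto)
  also have "\<dots> \<le> 2" by (rule sum_inverse_squares_le)
  finally show ?thesis using assms(2) by (simp add: divide_right_mono)
qed

text \<open>Spacing modulo 1 for chosen representatives: the second inequality excludes points that
  approach each other across an integer.\<close>

definition well_spaced :: "real \<Rightarrow> real set \<Rightarrow> bool" where
  "well_spaced \<Delta> P \<longleftrightarrow> finite P \<and>
     (\<forall>\<alpha>\<in>P. \<forall>\<beta>\<in>P. \<alpha> \<noteq> \<beta> \<longrightarrow> \<Delta> \<le> \<bar>\<alpha> - \<beta>\<bar> \<and> \<bar>\<alpha> - \<beta>\<bar> \<le> 1 - \<Delta>)"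

text \<open>The diagonal term is \<open>4 * L ^ 2\<close>. Off the diagonal the differences modulo 1
  are \<Delta>-spaced and keep distance \<Delta> from both 0 and 1, so each end point contributes at
  most \<open>8 / \<Delta> ^ 2 \<le> 8 * L ^ 2\<close>.\<close>

lemma sum_kernel_le:
  assumes P: "well_spaced \<Delta> P" and "\<Delta> > 0" "1 / \<Delta> \<le> real L" "\<alpha> \<in> P"
  shows "(\<Sum>\<beta>\<in>P. (norm (\<Sum>j<2 * L. unit_char (real j * (\<alpha> - \<beta>))))\<^sup>2) \<le> 20 * real L ^ 2"
proof -
  have fin: "finite P" using P by (simp add: well_spaced_def)
  define K where "K \<beta> = (norm (\<Sum>j<2 * L. unit_char (real j * (\<alpha> - \<beta>))))\<^sup>2" for \<beta>
  \<comment> \<open>The representative of \<open>\<alpha> - \<beta>\<close> modulo 1 in the unit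
    interval.\<close>
  define \<gamma> where "\<gamma> \<beta> = (if \<beta> < \<alpha> then \<alpha> - \<beta> else 1 + \<alpha> - \<beta>)" for \<beta>
  let ?P = "P - {\<alpha>}"
  have sp: "\<Delta> \<le> \<bar>x - y\<bar>" "\<bar>x - y\<bar> \<le> 1 - \<Delta>" if "x \<in> P" "y \<in> P" "x \<noteq> y" for x y
    using P that by (auto simp: well_spaced_def)
  have g1: "\<Delta> \<le> \<gamma> \<beta>" "\<gamma> \<beta> \<le> 1 - \<Delta>" if "\<beta> \<in> ?P" for \<beta>
    using sp[of \<alpha> \<beta>] that assms(4) by (auto simp: \<gamma>_def split: if_splits)
  have g2: "\<Delta> \<le> \<bar>\<gamma> \<beta> - \<gamma> \<beta>'\<bar>" if "\<beta> \<in> ?P" "\<beta>' \<in> ?P" "\<beta> \<noteq> \<beta>'" for \<beta> \<beta>'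
    using sp[of \<beta> \<beta>'] that by (auto simp: \<gamma>_def split: if_splits)
  then have inj: "inj_on \<gamma> ?P" using assms(2) by (intro inj_onI) fastforce
  have S1: "(\<Sum>\<beta>\<in>?P. 1 / (\<gamma> \<beta>)\<^sup>2) \<le> 2 / \<Delta>\<^sup>2"
  proof -
    have "(\<Sum>c\<in>\<gamma> ` ?P. 1 / c\<^sup>2) \<le> 2 / \<Delta>\<^sup>2"
      by (rule sum_inverse_squares_spaced) (use fin assms(2) g1 g2 in auto)
    then show ?thesis by (simp add: sum.reindex[OF inj])
  qed
  have S2: "(\<Sum>\<beta>\<in>?P. 1 / (1 - \<gamma> \<beta>)\<^sup>2) \<le> 2 / \<Delta>\<^sup>2"
  proof -
    have inj': "inj_on (\<lambda>\<beta>. 1 - \<gamma> \<beta>) ?P" using inj by (auto simp: inj_on_def)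
    have "(\<Sum>c\<in>(\<lambda>\<beta>. 1 - \<gamma> \<beta>) ` ?P. 1 / c\<^sup>2) \<le> 2 / \<Delta>\<^sup>2"
    proof (rule sum_inverse_squares_spaced)
      fix c c' assume "c \<in> (\<lambda>\<beta>. 1 - \<gamma> \<beta>) ` ?P" "c' \<in> (\<lambda>\<beta>. 1 - \<gamma> \<beta>) ` ?P" "c \<noteq> c'"
      then obtain \<beta> \<beta>' where "\<beta> \<in> ?P" "\<beta>' \<in> ?P" "c = 1 - \<gamma> \<beta>" "c' = 1 - \<gamma> \<beta>'" "\<beta> \<noteq> \<beta>'" by blast
      then show "\<Delta> \<le> \<bar>c - c'\<bar>" using g2[of \<beta> \<beta>'] by simp
    next
      fix c assume "c \<in> (\<lambda>\<beta>. 1 - \<gamma> \<beta>) ` ?P"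
      then obtain \<beta> where "\<beta> \<in> ?P" "c = 1 - \<gamma> \<beta>" by blast
      then show "\<Delta> \<le> c" using g1[of \<beta>] by simp
    qed (use fin assms(2) in auto)
    then show ?thesis by (simp add: sum.reindex[OF inj'])
  qed
  have K_le: "K \<beta> \<le> 4 * (1 / (\<gamma> \<beta>)\<^sup>2) + 4 * (1 / (1 - \<gamma> \<beta>)\<^sup>2)" if "\<beta> \<in> ?P" for \<beta>
  proof -
    have "unit_char (real j * (\<alpha> - \<beta>)) = unit_char (real j * \<gamma> \<beta>)" for j
    proof (cases "\<beta> < \<alpha>")
      case False
      have "unit_char (real j * \<gamma> \<beta>) = unit_char (of_int (int j) + real j * (\<alpha> - \<beta>))"
        using False by (simp add: \<gamma>_def algebra_simps)
      then show ?thesis by (simp only: unit_char_add unit_char_of_int mult_1)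
    qed (simp add: \<gamma>_def)
    then have "K \<beta> = (norm (\<Sum>j<2 * L. unit_char (real j * \<gamma> \<beta>)))\<^sup>2" by (simp add: K_def)
    also have "\<dots> \<le> 4 / (\<gamma> \<beta>)\<^sup>2 + 4 / (1 - \<gamma> \<beta>)\<^sup>2"
      using g1[OF that] assms(2) by (intro norm_sum_unit_char_le) auto
    finally show ?thesis by simp
  qed
  have "(\<Sum>\<beta>\<in>?P. K \<beta>) \<le> (\<Sum>\<beta>\<in>?P. 4 * (1 / (\<gamma> \<beta>)\<^sup>2) + 4 * (1 / (1 - \<gamma> \<beta>)\<^sup>2))"
    using K_le by (rule sum_mono)
  also have "\<dots> = 4 * (\<Sum>\<beta>\<in>?P. 1 / (\<gamma> \<beta>)\<^sup>2) + 4 * (\<Sum>\<beta>\<in>?P. 1 / (1 - \<gamma> \<beta>)\<^sup>2)"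
    by (simp only: sum.distrib sum_distrib_left)
  also have "\<dots> \<le> 16 * (1 / \<Delta>)\<^sup>2" using S1 S2 by (simp add: power_divide)
  also have "\<dots> \<le> 16 * (real L)\<^sup>2" using assms(2,3) by (intro mult_left_mono power_mono) auto
  finally have "(\<Sum>\<beta>\<in>?P. K \<beta>) \<le> 16 * (real L)\<^sup>2" .
  moreover have "K \<alpha> = 4 * (real L)\<^sup>2"
    using unit_char_of_int[of 0] by (simp add: K_def power_mult_distrib)
  ultimately have "(\<Sum>\<beta>\<in>P. K \<beta>) \<le> 20 * (real L)\<^sup>2"
    using assms(4) fin by (simp add: sum.remove[of P \<alpha>])
  then show ?thesis by (simp add: K_def)
qed

text \<open>Averaging over shifts replaces the Dirichlet kernel by the nonnegative kernel
  \<open>D\<close>, a square as in Fejer's. For a nonnegative symmetric kernel the quadratic form is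
  bounded by its largest row sum, which \<open>sum_kernel_le\<close> controls.\<close>

lemma large_sieve_dual:
  assumes P: "well_spaced \<Delta> P" and "\<Delta> > 0" "1 / \<Delta> \<le> real L"
  shows "(\<Sum>m<L. (norm (\<Sum>\<alpha>\<in>P. c \<alpha> * unit_char (real m * \<alpha>)))\<^sup>2) \<le> 20 * real L * (\<Sum>\<alpha>\<in>P. (norm (c \<alpha>))\<^sup>2)"
proof -
  have fin: "finite P" using P by (simp add: well_spaced_def)
  have L: "L > 0" using assms(2,3) by (cases L) (auto simp: field_simps)
  define S where "S r = (\<Sum>\<alpha>\<in>P. c \<alpha> * unit_char (r * \<alpha>))" for r
  define D where "D \<beta> = (norm (\<Sum>j<2 * L. unit_char (real j * \<beta>)))\<^sup>2" for \<beta>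
  have D_nonneg: "D \<beta> \<ge> 0" for \<beta> by (simp add: D_def)
  have D_minus: "D (\<beta> - \<alpha>) = D (\<alpha> - \<beta>)" for \<alpha> \<beta>
  proof -
    have "(\<Sum>j<2 * L. unit_char (real j * (\<beta> - \<alpha>))) = cnj (\<Sum>j<2 * L. unit_char (real j * (\<alpha> - \<beta>)))"
    proof -
      have "unit_char (real j * (\<beta> - \<alpha>)) = cnj (unit_char (real j * (\<alpha> - \<beta>)))" for j
        unfolding unit_char_minus[symmetric] by (rule arg_cong[of _ _ unit_char]) (simp add: algebra_simps)
      then show ?thesis by (simp only: cnj_sum)
    qed
    then show ?thesis by (simp only: D_def complex_mod_cnj)
  qed
  \<comment> \<open>Each \<open>m < L\<close> is written as \<open>j - k\<close> once for every
    shift \<open>k < L\<close>; the remaining pairs below \<open>2 * L\<close> only add nonnegative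
    terms.\<close>
  have "real L * (\<Sum>m<L. (norm (S (real m)))\<^sup>2) = (\<Sum>(m, k)\<in>{..<L} \<times> {..<L}. (norm (S (real m)))\<^sup>2)"
    by (subst sum.cartesian_product[symmetric]) (simp add: sum_distrib_left)
  also have "\<dots> = (\<Sum>(j, k)\<in>(\<lambda>(m, k). (m + k, k)) ` ({..<L} \<times> {..<L}). (norm (S (real j - real k)))\<^sup>2)"
    by (subst sum.reindex) (auto simp: inj_on_def intro!: sum.cong)
  also have "\<dots> \<le> (\<Sum>(j, k)\<in>{..<2 * L} \<times> {..<2 * L}. (norm (S (real j - real k)))\<^sup>2)"
    by (rule sum_mono2) auto
  also have "\<dots> = (\<Sum>j<2 * L. \<Sum>k<2 * L. (norm (S (real j - real k)))\<^sup>2)"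
    by (simp add: sum.cartesian_product)
  also have "\<dots> \<le> norm (\<Sum>j<2 * L. \<Sum>k<2 * L. complex_of_real ((norm (S (real j - real k)))\<^sup>2))"
    by (simp only: of_real_sum[symmetric] norm_of_real abs_ge_self)
  also have "(\<Sum>j<2 * L. \<Sum>k<2 * L. complex_of_real ((norm (S (real j - real k)))\<^sup>2))
      = (\<Sum>\<alpha>\<in>P. \<Sum>\<beta>\<in>P. c \<alpha> * cnj (c \<beta>) * of_real (D (\<alpha> - \<beta>)))"
  proof -
    have "complex_of_real ((norm (S (real j - real k)))\<^sup>2) = (\<Sum>\<alpha>\<in>P. \<Sum>\<beta>\<in>P. c \<alpha> * cnj (c \<beta>) *
        (unit_char (real j * (\<alpha> - \<beta>)) * cnj (unit_char (real k * (\<alpha> - \<beta>)))))" for j k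
    proof -
      have "c \<alpha> * unit_char ((real j - real k) * \<alpha>) * cnj (c \<beta> * unit_char ((real j - real k) * \<beta>))
        = c \<alpha> * cnj (c \<beta>) * (unit_char (real j * (\<alpha> - \<beta>)) * cnj (unit_char (real k * (\<alpha> - \<beta>))))" for \<alpha> \<beta>
      proof -
        have "unit_char ((real j - real k) * \<alpha>) * cnj (unit_char ((real j - real k) * \<beta>))
          = unit_char (real j * (\<alpha> - \<beta>)) * cnj (unit_char (real k * (\<alpha> - \<beta>)))"
          unfolding unit_char_diff[symmetric] by (rule arg_cong[of _ _ unit_char]) (simp add: algebra_simps)
        then show ?thesis by (simp add: mult_ac)
      qed
      then show ?thesis by (simp only: complex_norm_square S_def cnj_sum sum_product)
    qed
    then have "(\<Sum>j<2 * L. \<Sum>k<2 * L. complex_of_real ((norm (S (real j - real k)))\<^sup>2))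
      = (\<Sum>j<2 * L. \<Sum>k<2 * L. \<Sum>\<alpha>\<in>P. \<Sum>\<beta>\<in>P. c \<alpha> * cnj (c \<beta>) *
        (unit_char (real j * (\<alpha> - \<beta>)) * cnj (unit_char (real k * (\<alpha> - \<beta>)))))" by simp
    also have "\<dots> = (\<Sum>\<alpha>\<in>P. \<Sum>\<beta>\<in>P. \<Sum>j<2 * L. \<Sum>k<2 * L. c \<alpha> * cnj (c \<beta>) *
        (unit_char (real j * (\<alpha> - \<beta>)) * cnj (unit_char (real k * (\<alpha> - \<beta>)))))"
      by (simp only: sum.swap[where A = "{..<2 * L}" and B = P])
    also have "\<dots> = (\<Sum>\<alpha>\<in>P. \<Sum>\<beta>\<in>P. c \<alpha> * cnj (c \<beta>) * of_real (D (\<alpha> - \<beta>)))"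
    proof -
      have "complex_of_real (D \<beta>) = (\<Sum>j<2 * L. \<Sum>k<2 * L. unit_char (real j * \<beta>) * cnj (unit_char (real k * \<beta>)))" for \<beta>
        by (simp only: D_def complex_norm_square cnj_sum sum_product)
      then show ?thesis by (simp only: sum_distrib_left)
    qed
    finally show ?thesis .
  qed
  also have "norm \<dots> \<le> (\<Sum>\<alpha>\<in>P. \<Sum>\<beta>\<in>P. norm (c \<alpha>) * norm (c \<beta>) * D (\<alpha> - \<beta>))"
    by (intro order_trans[OF norm_sum] sum_mono) (simp add: norm_mult D_nonneg)
  \<comment> \<open>The inequality of the means separates the two coefficients; by the symmetry of
    \<open>D\<close> both halves have the same value.\<close>
  also have "\<dots> \<le> (\<Sum>\<alpha>\<in>P. \<Sum>\<beta>\<in>P. (norm (c \<alpha>))\<^sup>2 / 2 * D (\<alpha> - \<beta>) + (norm (c \<beta>))\<^sup>2 / 2 * D (\<alpha> - \<beta>))"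
  proof (intro sum_mono)
    fix \<alpha> \<beta>
    have "norm (c \<alpha>) * norm (c \<beta>) \<le> (norm (c \<alpha>))\<^sup>2 / 2 + (norm (c \<beta>))\<^sup>2 / 2"
      using sum_squares_bound[of "norm (c \<alpha>)" "norm (c \<beta>)"] by simp
    then have "norm (c \<alpha>) * norm (c \<beta>) * D (\<alpha> - \<beta>) \<le> ((norm (c \<alpha>))\<^sup>2 / 2 + (norm (c \<beta>))\<^sup>2 / 2) * D (\<alpha> - \<beta>)"
      by (intro mult_right_mono) (auto simp: D_def)
    then show "norm (c \<alpha>) * norm (c \<beta>) * D (\<alpha> - \<beta>) \<le> (norm (c \<alpha>))\<^sup>2 / 2 * D (\<alpha> - \<beta>) + (norm (c \<beta>))\<^sup>2 / 2 * D (\<alpha> - \<beta>)"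
      by (simp add: distrib_right)
  qed
  also have "\<dots> = (\<Sum>\<alpha>\<in>P. \<Sum>\<beta>\<in>P. (norm (c \<alpha>))\<^sup>2 / 2 * D (\<alpha> - \<beta>)) + (\<Sum>\<alpha>\<in>P. \<Sum>\<beta>\<in>P. (norm (c \<beta>))\<^sup>2 / 2 * D (\<alpha> - \<beta>))"
    by (simp only: sum.distrib)
  also have "(\<Sum>\<alpha>\<in>P. \<Sum>\<beta>\<in>P. (norm (c \<beta>))\<^sup>2 / 2 * D (\<alpha> - \<beta>)) = (\<Sum>\<alpha>\<in>P. \<Sum>\<beta>\<in>P. (norm (c \<alpha>))\<^sup>2 / 2 * D (\<alpha> - \<beta>))"
    by (subst sum.swap) (simp only: D_minus)
  also have "(\<Sum>\<alpha>\<in>P. \<Sum>\<beta>\<in>P. (norm (c \<alpha>))\<^sup>2 / 2 * D (\<alpha> - \<beta>)) + (\<Sum>\<alpha>\<in>P. \<Sum>\<beta>\<in>P. (norm (c \<alpha>))\<^sup>2 / 2 * D (\<alpha> - \<beta>))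
      = (\<Sum>\<alpha>\<in>P. (norm (c \<alpha>))\<^sup>2 * (\<Sum>\<beta>\<in>P. D (\<alpha> - \<beta>)))"
    unfolding sum.distrib[symmetric] sum_distrib_left by (intro sum.cong refl) simp
  also have "\<dots> \<le> (\<Sum>\<alpha>\<in>P. (norm (c \<alpha>))\<^sup>2 * (20 * real L ^ 2))"
    unfolding D_def using assms by (intro sum_mono mult_left_mono sum_kernel_le) auto
  also have "\<dots> = real L * (20 * real L * (\<Sum>\<alpha>\<in>P. (norm (c \<alpha>))\<^sup>2))"
    unfolding sum_distrib_right[symmetric] by (simp add: power2_eq_square)
  finally have "real L * (\<Sum>m<L. (norm (S (real m)))\<^sup>2) \<le> real L * (20 * real L * (\<Sum>\<alpha>\<in>P. (norm (c \<alpha>))\<^sup>2))" .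
  then show ?thesis using L by (simp add: S_def)
qed

text \<open>Duality: \<open>X\<close> is the inner product of the indicator of \<open>Q\<close> with
  the dual sum whose coefficients are the conjugates of \<open>S\<close>. By Cauchy-Schwarz and
  \<open>large_sieve_dual\<close> its square is at most a constant times \<open>X\<close> itself,
  and one factor \<open>X\<close> cancels.\<close>

lemma large_sieve:
  assumes P: "well_spaced \<Delta> P" and "\<Delta> > 0" "1 / \<Delta> \<le> real L" and Q: "Q \<subseteq> {N..<N + L}"
  shows "(\<Sum>\<alpha>\<in>P. (norm (\<Sum>q\<in>Q. unit_char (real q * \<alpha>)))\<^sup>2) \<le> 20 * real L * real (card Q)"
proof -
  define S where "S \<alpha> = (\<Sum>q\<in>Q. unit_char (real q * \<alpha>))" for \<alpha>
  define X where "X = (\<Sum>\<alpha>\<in>P. (norm (S \<alpha>))\<^sup>2)"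
  \<comment> \<open>The twist by \<open>N\<close> moves the window of \<open>Q\<close> to the origin
    without changing absolute values.\<close>
  define c where "c \<alpha> = cnj (S \<alpha>) * unit_char (real N * \<alpha>)" for \<alpha>
  define T where "T m = (\<Sum>\<alpha>\<in>P. c \<alpha> * unit_char (real m * \<alpha>))" for m :: nat
  have X0: "X \<ge> 0" by (simp add: X_def sum_nonneg)
  have finQ: "finite Q" using Q finite_subset by blast
  have "complex_of_real X = (\<Sum>\<alpha>\<in>P. cnj (S \<alpha>) * S \<alpha>)"
    unfolding X_def of_real_sum by (intro sum.cong refl) (simp only: complex_norm_square mult.commute)
  also have "\<dots> = (\<Sum>\<alpha>\<in>P. \<Sum>q\<in>Q. cnj (S \<alpha>) * unit_char (real q * \<alpha>))"
    by (simp add: S_def sum_distrib_left)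
  also have "\<dots> = (\<Sum>q\<in>Q. \<Sum>\<alpha>\<in>P. cnj (S \<alpha>) * unit_char (real q * \<alpha>))"
    by (rule sum.swap)
  also have "\<dots> = (\<Sum>q\<in>Q. T (q - N))"
  proof (rule sum.cong[OF refl])
    fix q assume "q \<in> Q"
    then have "q \<ge> N" using Q by auto
    have "unit_char (real q * \<alpha>) = unit_char (real N * \<alpha>) * unit_char (real (q - N) * \<alpha>)" for \<alpha>
      unfolding unit_char_add[symmetric] using \<open>q \<ge> N\<close> by (simp add: of_nat_diff algebra_simps)
    then show "(\<Sum>\<alpha>\<in>P. cnj (S \<alpha>) * unit_char (real q * \<alpha>)) = T (q - N)"
      by (simp add: T_def c_def mult.assoc)
  qed
  finally have "complex_of_real X = (\<Sum>q\<in>Q. T (q - N))" .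
  then have "X = norm (\<Sum>q\<in>Q. T (q - N))" using X0 by (metis abs_of_nonneg norm_of_real)
  also have "\<dots> \<le> (\<Sum>q\<in>Q. 1 * norm (T (q - N)))" by (simp add: norm_sum)
  finally have "X\<^sup>2 \<le> (\<Sum>q\<in>Q. 1 * norm (T (q - N)))\<^sup>2" using X0 by (intro power_mono) auto
  also have "\<dots> \<le> (\<Sum>q\<in>Q. 1\<^sup>2) * (\<Sum>q\<in>Q. (norm (T (q - N)))\<^sup>2)" by (rule Cauchy_Schwarz_ineq_sum)
  also have "\<dots> = real (card Q) * (\<Sum>q\<in>Q. (norm (T (q - N)))\<^sup>2)" by simp
  also have "\<dots> \<le> real (card Q) * (20 * real L * X)"
  proof (rule mult_left_mono)
    have inj: "inj_on (\<lambda>q. q - N) Q" using Q by (intro inj_onI) (metis atLeastLessThan_iff eq_diff_iff subsetD)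
    have "(\<Sum>q\<in>Q. (norm (T (q - N)))\<^sup>2) = (\<Sum>m\<in>(\<lambda>q. q - N) ` Q. (norm (T m))\<^sup>2)"
      by (simp add: sum.reindex[OF inj])
    also have "\<dots> \<le> (\<Sum>m<L. (norm (T m))\<^sup>2)"
      by (rule sum_mono2) (use Q in \<open>force+\<close>)
    also have "\<dots> \<le> 20 * real L * (\<Sum>\<alpha>\<in>P. (norm (c \<alpha>))\<^sup>2)"
      unfolding T_def using assms by (intro large_sieve_dual) auto
    also have "(\<Sum>\<alpha>\<in>P. (norm (c \<alpha>))\<^sup>2) = X" by (simp add: X_def c_def norm_mult)
    finally show "(\<Sum>q\<in>Q. (norm (T (q - N)))\<^sup>2) \<le> 20 * real L * X" .
  qed simp
  finally have "X * X \<le> (20 * real L * real (card Q)) * X"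
    by (simp add: power2_eq_square mult_ac)
  then have "X \<le> 20 * real L * real (card Q)" using X0 by (cases "X = 0") auto
  then show ?thesis by (simp add: X_def S_def)
qed

section \<open>Reduced fractions with squarefree denominators\<close>

definition prime_sets_upto :: "nat \<Rightarrow> nat set set" where
  "prime_sets_upto R = {T. prime_set T \<and> \<Prod>T \<le> R}"

lemma prime_sets_upto_subset: "T \<in> prime_sets_upto R \<Longrightarrow> T \<subseteq> {..R}"
proof
  fix p assume T: "T \<in> prime_sets_upto R" and p: "p \<in> T"
  then have "p dvd \<Prod>T" by (auto simp: prime_sets_upto_def prime_set_def intro: dvd_prodI[of _ _ "\<lambda>x. x"])
  then have "p \<le> \<Prod>T" using T prod_prime_set_pos by (intro dvd_imp_le) (auto simp: prime_sets_upto_def)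
  then show "p \<in> {..R}" using T by (auto simp: prime_sets_upto_def)
qed

lemma finite_prime_sets_upto: "finite (prime_sets_upto R)"
  by (rule finite_subset[of _ "Pow {..R}"]) (use prime_sets_upto_subset in blast)+

lemma inj_on_prod_prime_sets: "inj_on (\<lambda>T. \<Prod>T) {T. prime_set T}"
  by (rule inj_onI) (metis mem_Collect_eq prime_factors_prod_prime_set)

text \<open>Distinct reduced fractions differ by a nonzero integer over \<open>t * t'\<close>. For
  the second bound the same argument applies to 1 minus the distance, that is, to the distance
  across an integer.\<close>

lemma reduced_fractions_spaced:
  fixes h h' t t' R :: nat
  assumes "h < t" "h' < t'" "t \<le> R" "t' \<le> R" "coprime h t" "coprime h' t'" "(h, t) \<noteq> (h', t')"
  shows "1 / real R ^ 2 \<le> \<bar>real h / real t - real h' / real t'\<bar>"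
    "\<bar>real h / real t - real h' / real t'\<bar> \<le> 1 - 1 / real R ^ 2"
proof -
  have t: "t > 0" "t' > 0" "real R > 0" using assms by auto
  have tt: "real t * real t' \<le> real R ^ 2"
    unfolding power2_eq_square using assms by (intro mult_mono) auto
  have eq: "real h / real t - real h' / real t' = of_int (int h * int t' - int h' * int t) / (real t * real t')"
    using t by (simp add: field_simps)
  have bound: "1 / real R ^ 2 \<le> \<bar>of_int k\<bar> / (real t * real t')" if "k \<noteq> 0" for k :: int
    using that t tt by (intro frac_le) auto
  have ne: "int h * int t' - int h' * int t \<noteq> 0"
  proof
    assume "int h * int t' - int h' * int t = 0"
    then have eq: "h * t' = h' * t" by (metis eq_iff_diff_eq_0 of_nat_eq_iff of_nat_mult)
    have "t dvd t'" using eq assms(5) by (metis coprime_commute coprime_dvd_mult_right_iff dvd_triv_right)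
    moreover have "t' dvd t" using eq assms(6) by (metis coprime_commute coprime_dvd_mult_right_iff dvd_triv_right)
    ultimately have "t = t'" by (rule dvd_antisym)
    then show False using eq assms(7) t by simp
  qed
  then show "1 / real R ^ 2 \<le> \<bar>real h / real t - real h' / real t'\<bar>"
    unfolding eq using bound[OF ne] t by (simp add: abs_divide)
  have "\<bar>int h * int t' - int h' * int t\<bar> < int t * int t'"
  proof -
    have "int h * int t' < int t * int t'" "int h' * int t < int t' * int t"
      using assms t by (intro mult_strict_right_mono; simp)+
    moreover have "0 \<le> int h * int t'" "0 \<le> int h' * int t" by simp_all
    ultimately show ?thesis using mult.commute[of "int t" "int t'"] by linarith
  qed
  then have "int t * int t' - \<bar>int h * int t' - int h' * int t\<bar> \<noteq> 0" "int t * int t' - \<bar>int h * int t' - int h' * int t\<bar> \<ge> 0" by auto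
  from bound[OF this(1)] this(2)
  have "1 / real R ^ 2 \<le> of_int (int t * int t' - \<bar>int h * int t' - int h' * int t\<bar>) / (real t * real t')"
    by (simp only: abs_of_nonneg of_int_0_le_iff)
  also have "\<dots> = 1 - \<bar>real h / real t - real h' / real t'\<bar>"
  proof -
    have "\<bar>real h / real t - real h' / real t'\<bar> = of_int \<bar>int h * int t' - int h' * int t\<bar> / (real t * real t')"
      by (simp only: eq abs_divide of_int_abs) simp
    then show ?thesis using t by (simp add: diff_divide_distrib)
  qed
  finally show "\<bar>real h / real t - real h' / real t'\<bar> \<le> 1 - 1 / real R ^ 2" by simp
qed

text \<open>Taken over all \<open>T\<close> together, the exponential sums are evaluated at distinct
  reduced fractions with denominators at most \<open>R\<close>, which are spaced by
  \<open>1 / R ^ 2\<close>.\<close>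

lemma variance_large_sieve:
  assumes "\<T> \<subseteq> prime_sets_upto R" "R \<ge> 1" "Q \<subseteq> {N..<N + L}"
  shows "(\<Sum>T\<in>\<T>. real (\<Prod>T) * variance Q T) \<le> 20 * (real L + real R ^ 2) * real (card Q)"
proof -
  have fin: "finite \<T>" using assms(1) finite_prime_sets_upto finite_subset by blast
  have T: "prime_set T" "\<Prod>T \<le> R" if "T \<in> \<T>" for T using assms(1) that by (auto simp: prime_sets_upto_def)
  define I where "I = (SIGMA T:\<T>. {h. h < \<Prod>T \<and> coprime h (\<Prod>T)})"
  define f where "f = (\<lambda>(T, h). real h / real (\<Prod>T))"
  have finI: "finite I" using fin by (auto simp: I_def)
  have sp: "1 / real R ^ 2 \<le> \<bar>f x - f y\<bar> \<and> \<bar>f x - f y\<bar> \<le> 1 - 1 / real R ^ 2" if "x \<in> I" "y \<in> I" "x \<noteq> y" for x y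
  proof -
    obtain T h T' h' where xy: "x = (T, h)" "y = (T', h')" by fastforce
    have "(h, \<Prod>T) \<noteq> (h', \<Prod>T')"
      using that xy inj_onD[OF inj_on_prod_prime_sets, of T T'] T by (auto simp: I_def)
    then show ?thesis
      using that xy T reduced_fractions_spaced[of h "\<Prod>T" h' "\<Prod>T'" R] by (simp add: I_def f_def)
  qed
  have inj: "inj_on f I"
  proof (rule inj_onI, rule ccontr)
    fix x y assume "x \<in> I" "y \<in> I" "f x = f y" "x \<noteq> y"
    then show False using sp[of x y] assms(2) by simp
  qed
  have ws: "well_spaced (1 / real R ^ 2) (f ` I)"
    using finI sp by (auto simp: well_spaced_def)
  have "(\<Sum>T\<in>\<T>. real (\<Prod>T) * variance Q T)
      = (\<Sum>T\<in>\<T>. \<Sum>h\<in>{h. h < \<Prod>T \<and> coprime h (\<Prod>T)}. (norm (\<Sum>q\<in>Q. unit_char (real q * (real h / real (\<Prod>T)))))\<^sup>2)"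
    by (rule sum.cong[OF refl], rule variance_eq_exponential_sums) (use T in auto)
  also have "\<dots> = (\<Sum>x\<in>I. (norm (\<Sum>q\<in>Q. unit_char (real q * f x)))\<^sup>2)"
    unfolding I_def f_def using fin by (subst sum.Sigma) (auto simp: case_prod_beta)
  also have "\<dots> = (\<Sum>\<alpha>\<in>f ` I. (norm (\<Sum>q\<in>Q. unit_char (real q * \<alpha>)))\<^sup>2)"
    by (simp add: sum.reindex[OF inj])
  \<comment> \<open>The window is lengthened to \<open>L + R ^ 2\<close> so that it is at least the
    inverse of the spacing.\<close>
  also have "\<dots> \<le> 20 * real (L + R ^ 2) * real (card Q)"
    using assms(2,3) by (intro large_sieve[OF ws, of _ _ N]) auto
  finally show ?thesis by simp
qed

section \<open>Selberg's sieve\<close>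

text \<open>For a set of primes this is the reciprocal of Euler's function at
  \<open>\<Prod>E\<close>.\<close>

definition sieve_weight :: "nat set \<Rightarrow> real" where
  "sieve_weight E = (\<Prod>p\<in>E. 1 / (real p - 1))"

lemma sieve_weight_nonneg: "prime_set E \<Longrightarrow> sieve_weight E \<ge> 0"
  unfolding sieve_weight_def prime_set_def
  by (intro prod_nonneg) (metis diff_ge_0_iff_ge of_nat_1 of_nat_le_iff prime_ge_1_nat zero_le_divide_1_iff)

lemma sieve_weight_Un:
  "finite E \<Longrightarrow> finite F \<Longrightarrow> E \<inter> F = {} \<Longrightarrow> sieve_weight (E \<union> F) = sieve_weight E * sieve_weight F"
  by (simp add: sieve_weight_def prod.union_disjoint)

lemma sum_powers_le:
  assumes "(x::real) > 1"
  shows "(\<Sum>j\<in>{1..n}. 1 / x ^ j) \<le> 1 / (x - 1)"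
proof -
  have "(\<Sum>j\<in>{1..n}. 1 / x ^ j) = (1 - 1 / x ^ n) / (x - 1)"
  proof (induction n)
    case (Suc n)
    define y where "y = 1 / x ^ Suc n"
    have "1 / x ^ n = x * y" using assms by (simp add: y_def)
    then have "(\<Sum>j\<in>{1..Suc n}. 1 / x ^ j) = (1 - x * y) / (x - 1) + y"
      using Suc by (simp add: y_def)
    also have "\<dots> = (1 - y) / (x - 1)" using assms by (simp add: field_simps)
    finally show ?case by (simp add: y_def)
  qed simp
  also have "\<dots> \<le> 1 / (x - 1)" using assms by (intro divide_right_mono) auto
  finally show ?thesis .
qed

text \<open>A number with prime factors exactly \<open>E\<close> corresponds to its exponents, all
  at least 1. Without the restriction \<open>n \<le> Q\<close> the exponents are independent, and
  each prime contributes a geometric series bounded by \<open>1 / (p - 1)\<close>.\<close>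

lemma sum_fibre_prime_factors_le:
  assumes E: "prime_set E"
  shows "(\<Sum>n | n \<in> {1..Q} \<and> prime_factors n = E. 1 / real n) \<le> sieve_weight E"
proof -
  have fin: "finite E" using E by (rule prime_set_finite)
  let ?N = "{n. n \<in> {1..Q} \<and> prime_factors n = E}"
  define \<phi> where "\<phi> n = (\<lambda>p\<in>E. multiplicity p n)" for n :: nat
  have prod_eq: "(\<Prod>p\<in>E. p ^ \<phi> n p) = n" if "n \<in> ?N" for n
  proof -
    have "(\<Prod>p\<in>E. p ^ \<phi> n p) = (\<Prod>p\<in>prime_factors n. p ^ multiplicity p n)"
      using that by (intro prod.cong) (auto simp: \<phi>_def)
    also have "\<dots> = n" using that prod_prime_factors[of n] by auto
    finally show ?thesis .
  qed
  then have inj: "inj_on \<phi> ?N"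
    by (intro inj_on_inverseI[of ?N "\<lambda>f. \<Prod>p\<in>E. p ^ f p"]) simp
  have img: "\<phi> ` ?N \<subseteq> (\<Pi>\<^sub>E p\<in>E. {1..Q})"
  proof (rule image_subsetI)
    fix n assume n: "n \<in> ?N"
    have "multiplicity p n \<in> {1..Q}" if "p \<in> E" for p
    proof -
      have p: "p \<in> prime_factors n" "prime p" using n that E by (auto simp: prime_set_def)
      then have "multiplicity p n \<ge> 1" by (auto simp: prime_factors_multiplicity)
      moreover have "p ^ multiplicity p n \<le> n" using n by (intro dvd_imp_le multiplicity_dvd) auto
      then have "multiplicity p n < n"
        using power_gt_expt[of p "multiplicity p n"] prime_gt_1_nat[OF p(2)] by simp
      ultimately show ?thesis using n by auto
    qed
    then show "\<phi> n \<in> (\<Pi>\<^sub>E p\<in>E. {1..Q})" by (auto simp: \<phi>_def)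
  qed
  have "(\<Sum>n\<in>?N. 1 / real n) = (\<Sum>n\<in>?N. \<Prod>p\<in>E. 1 / real p ^ \<phi> n p)"
  proof (rule sum.cong[OF refl])
    fix n assume "n \<in> ?N"
    then have "real n = (\<Prod>p\<in>E. real p ^ \<phi> n p)"
      using prod_eq[of n] by (metis (no_types, lifting) of_nat_power of_nat_prod prod.cong)
    then show "1 / real n = (\<Prod>p\<in>E. 1 / real p ^ \<phi> n p)" by (simp add: prod_dividef)
  qed
  also have "\<dots> = (\<Sum>f\<in>\<phi> ` ?N. \<Prod>p\<in>E. 1 / real p ^ f p)"
    by (rule sum.reindex[OF inj, symmetric, unfolded o_def])
  also have "\<dots> \<le> (\<Sum>f\<in>(\<Pi>\<^sub>E p\<in>E. {1..Q}). \<Prod>p\<in>E. 1 / real p ^ f p)"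
    by (rule sum_mono2) (use img fin in \<open>auto intro!: finite_PiE prod_nonneg\<close>)
  also have "\<dots> = (\<Prod>p\<in>E. \<Sum>j\<in>{1..Q}. 1 / real p ^ j)"
    using fin by (intro prod_sum_PiE[symmetric]) auto
  also have "\<dots> \<le> (\<Prod>p\<in>E. 1 / (real p - 1))"
  proof (rule prod_mono)
    fix p assume "p \<in> E"
    then have "real p > 1" using E prime_gt_1_nat by (auto simp: prime_set_def)
    then show "0 \<le> (\<Sum>j\<in>{1..Q}. 1 / real p ^ j) \<and> (\<Sum>j\<in>{1..Q}. 1 / real p ^ j) \<le> 1 / (real p - 1)"
      using sum_powers_le[of "real p" Q] by (auto intro!: sum_nonneg)
  qed
  finally show ?thesis by (simp add: sieve_weight_def)
qed

lemma prod_prime_factors_le: "n > 0 \<Longrightarrow> \<Prod>(prime_factors n) \<le> (n::nat)"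
  using prod_primes_dvd[of "prime_factors n" n]
  by (intro dvd_imp_le) (auto simp: in_prime_factors_iff)

text \<open>The integers up to \<open>Q\<close> are grouped by their sets of prime factors; the
  product of such a set is at most \<open>Q\<close>. This is the source of the logarithm in
  Selberg's bound.\<close>

lemma harmonic_le_sum_sieve_weight:
  "(\<Sum>n\<in>{1..Q}. 1 / real n) \<le> (\<Sum>E\<in>prime_sets_upto Q. sieve_weight E)"
proof -
  have "(\<Sum>n\<in>{1..Q}. 1 / real n)
      = (\<Sum>E\<in>prime_sets_upto Q. \<Sum>n | n \<in> {1..Q} \<and> prime_factors n = E. 1 / real n)"
  proof (rule sum.group[symmetric])
    show "prime_factors ` {1..Q} \<subseteq> prime_sets_upto Q"
    proof (rule image_subsetI)
      fix n assume n: "n \<in> {1..Q}"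
      then have "\<Prod>(prime_factors n) \<le> Q" using prod_prime_factors_le[of n] by auto
      then show "prime_factors n \<in> prime_sets_upto Q"
        by (auto simp: prime_sets_upto_def prime_set_def in_prime_factors_iff)
    qed
  qed (auto simp: finite_prime_sets_upto)
  also have "\<dots> \<le> (\<Sum>E\<in>prime_sets_upto Q. sieve_weight E)"
    by (intro sum_mono sum_fibre_prime_factors_le) (simp add: prime_sets_upto_def)
  finally show ?thesis .
qed

definition sieve_family :: "nat \<Rightarrow> nat set \<Rightarrow> nat set set" where
  "sieve_family Q B = {E \<in> prime_sets_upto Q. E \<inter> B = {}}"

lemma finite_sieve_family: "finite (sieve_family Q B)"
  by (simp add: sieve_family_def finite_prime_sets_upto)

lemma sieve_family_prime_set: "E \<in> sieve_family Q B \<Longrightarrow> prime_set E"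
  by (simp add: sieve_family_def prime_sets_upto_def)

lemma prime_sets_upto_mono:
  assumes "E \<in> prime_sets_upto Q" "F \<subseteq> E"
  shows "F \<in> prime_sets_upto Q"
proof -
  have E: "prime_set E" "\<Prod>E \<le> Q" using assms(1) by (auto simp: prime_sets_upto_def)
  have "\<Prod>F dvd \<Prod>E" using E assms(2) by (intro prod_dvd_prod_subset) (auto simp: prime_set_def)
  then have "\<Prod>F \<le> \<Prod>E" using prod_prime_set_pos[OF E(1)] by (rule dvd_imp_le)
  then show ?thesis using E prime_set_subset[OF E(1) assms(2)] by (auto simp: prime_sets_upto_def)
qed

lemma sieve_family_subset: "E \<in> sieve_family Q B \<Longrightarrow> F \<subseteq> E \<Longrightarrow> F \<in> sieve_family Q B"
  using prime_sets_upto_mono by (auto simp: sieve_family_def)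

text \<open>Selberg's main sum; its reciprocal is the minimum of the quadratic form and so the
  density in the upper bound.\<close>

definition sieve_sum :: "nat \<Rightarrow> nat set \<Rightarrow> real" where
  "sieve_sum Q B = (\<Sum>E\<in>sieve_family Q B. sieve_weight E)"

text \<open>Splitting each set into its parts inside and outside \<open>B\<close> bounds the full
  sum by a product. The factor for \<open>B\<close> later cancels the density of the integers that
  avoid \<open>B\<close>.\<close>

lemma sieve_sum_lower_bound:
  assumes B: "prime_set B"
  shows "(\<Sum>n\<in>{1..Q}. 1 / real n) \<le> (\<Prod>p\<in>B. real p / (real p - 1)) * sieve_sum Q B"
proof -
  have finB: "finite B" using B by (rule prime_set_finite)
  let ?f = "\<lambda>E. (E \<inter> B, E - B)"
  have E: "prime_set E" if "E \<in> prime_sets_upto Q" for E using that by (simp add: prime_sets_upto_def)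
  have inj: "inj_on ?f (prime_sets_upto Q)" by (rule inj_onI) blast
  have "(\<Sum>E\<in>prime_sets_upto Q. sieve_weight E)
      = (\<Sum>E\<in>prime_sets_upto Q. sieve_weight (E \<inter> B) * sieve_weight (E - B))"
  proof (rule sum.cong[OF refl])
    fix X assume "X \<in> prime_sets_upto Q"
    then have "finite X" using E prime_set_finite by blast
    then have "sieve_weight ((X \<inter> B) \<union> (X - B)) = sieve_weight (X \<inter> B) * sieve_weight (X - B)"
      by (intro sieve_weight_Un) auto
    then show "sieve_weight X = sieve_weight (X \<inter> B) * sieve_weight (X - B)"
      by (simp add: Int_Diff_Un)
  qed
  also have "\<dots> = (\<Sum>(F, K)\<in>?f ` prime_sets_upto Q. sieve_weight F * sieve_weight K)"
    by (simp add: sum.reindex[OF inj])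
  also have "\<dots> \<le> (\<Sum>(F, K)\<in>Pow B \<times> sieve_family Q B. sieve_weight F * sieve_weight K)"
  proof (rule sum_mono2)
    show "?f ` prime_sets_upto Q \<subseteq> Pow B \<times> sieve_family Q B"
      using prime_sets_upto_mono by (auto simp: sieve_family_def)
    fix x assume "x \<in> Pow B \<times> sieve_family Q B - ?f ` prime_sets_upto Q"
    then show "0 \<le> (case x of (F, K) \<Rightarrow> sieve_weight F * sieve_weight K)"
      using B prime_set_subset sieve_family_prime_set by (auto intro!: mult_nonneg_nonneg sieve_weight_nonneg)
  qed (use finB finite_sieve_family in auto)
  also have "\<dots> = (\<Sum>F\<in>Pow B. sieve_weight F) * sieve_sum Q B"
    by (simp add: sieve_sum_def sum_product sum.cartesian_product)
  also have "(\<Sum>F\<in>Pow B. sieve_weight F) = (\<Prod>p\<in>B. 1 / (real p - 1) + 1)"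
    using prod_add[OF finB, of "\<lambda>p. 1 / (real p - 1)" "\<lambda>_. 1"] by (simp add: sieve_weight_def)
  also have "\<dots> = (\<Prod>p\<in>B. real p / (real p - 1))"
  proof (rule prod.cong[OF refl])
    fix p assume "p \<in> B"
    then have "real p > 1" using B prime_gt_1_nat by (auto simp: prime_set_def)
    then show "1 / (real p - 1) + 1 = real p / (real p - 1)" by (simp add: field_simps)
  qed
  finally show ?thesis using harmonic_le_sum_sieve_weight[of Q] by linarith
qed

section \<open>Selberg's optimal weights\<close>

lemma empty_in_sieve_family: "Q \<ge> 1 \<Longrightarrow> {} \<in> sieve_family Q B"
  by (simp add: sieve_family_def prime_sets_upto_def prime_set_empty)

lemma sieve_sum_pos: "Q \<ge> 1 \<Longrightarrow> sieve_sum Q B \<ge> 1"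
proof -
  assume "Q \<ge> 1"
  then have "(\<Sum>E\<in>{{}}. sieve_weight E) \<le> sieve_sum Q B"
    unfolding sieve_sum_def using empty_in_sieve_family[of Q B] finite_sieve_family
    by (intro sum_mono2) (auto intro: sieve_weight_nonneg sieve_family_prime_set)
  then show ?thesis by (simp add: sieve_weight_def)
qed

text \<open>The extremal coefficients of Selberg's sieve, with \<open>(-1) ^ card E\<close> as
  Moebius function. They are obtained by inverting the substitution \<open>y\<close> in
  \<open>selberg_quadratic_form\<close>, and the division by \<open>sieve_sum\<close> normalises the
  coefficient of the empty set to 1.\<close>

definition selberg_weight :: "nat \<Rightarrow> nat set \<Rightarrow> nat set \<Rightarrow> real" where
  "selberg_weight Q B E = (-1) ^ card E * real (\<Prod>E)
     * (\<Sum>K | K \<in> sieve_family Q B \<and> E \<subseteq> K. sieve_weight K) / sieve_sum Q B"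

lemma selberg_weight_empty: "Q \<ge> 1 \<Longrightarrow> selberg_weight Q B {} = 1"
  using sieve_sum_pos[of Q B] by (simp add: selberg_weight_def sieve_sum_def)

text \<open>Removing \<open>E\<close> maps the sets that contain \<open>E\<close> injectively into
  the family, so the inner sum is at most \<open>sieve_weight E * sieve_sum Q B\<close>; what
  remains is a product of factors \<open>p / (p - 1) \<le> 2\<close>. A divisor function of this
  size is absorbed by small powers of \<open>x\<close>.\<close>

lemma abs_selberg_weight_le:
  assumes E: "E \<in> sieve_family Q B" and Q: "Q \<ge> 1"
  shows "\<bar>selberg_weight Q B E\<bar> \<le> 2 ^ card E"
proof -
  let ?K = "{K. K \<in> sieve_family Q B \<and> E \<subseteq> K}"
  let ?w = "\<Sum>K\<in>?K. sieve_weight K"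
  have ps: "prime_set E" using E by (rule sieve_family_prime_set)
  have fin: "finite K" if "K \<in> sieve_family Q B" for K
    using sieve_family_prime_set[OF that] prime_set_finite by blast
  have w0: "?w \<ge> 0" by (intro sum_nonneg sieve_weight_nonneg) (auto intro: sieve_family_prime_set)
  have "?w = (\<Sum>K\<in>?K. sieve_weight E * sieve_weight (K - E))"
  proof (rule sum.cong[OF refl])
    fix K assume K: "K \<in> ?K"
    then have "E \<union> (K - E) = K" by auto
    then show "sieve_weight K = sieve_weight E * sieve_weight (K - E)"
      using sieve_weight_Un[of E "K - E"] fin K E by auto
  qed
  also have "\<dots> = sieve_weight E * (\<Sum>L\<in>(\<lambda>K. K - E) ` ?K. sieve_weight L)"
    by (subst sum.reindex) (auto simp: inj_on_def sum_distrib_left)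
  also have "\<dots> \<le> sieve_weight E * sieve_sum Q B"
    unfolding sieve_sum_def
    by (intro mult_left_mono sum_mono2)
       (auto intro: sieve_weight_nonneg ps sieve_family_prime_set sieve_family_subset finite_sieve_family)
  finally have w: "?w \<le> sieve_weight E * sieve_sum Q B" .
  have "\<bar>selberg_weight Q B E\<bar> = real (\<Prod>E) * ?w / sieve_sum Q B"
    using w0 sieve_sum_pos[OF Q, of B] by (simp add: selberg_weight_def abs_mult power_abs del: of_nat_prod)
  also have "\<dots> \<le> real (\<Prod>E) * (sieve_weight E * sieve_sum Q B) / sieve_sum Q B"
    using sieve_sum_pos[OF Q, of B] w by (intro divide_right_mono mult_left_mono) (auto simp del: of_nat_prod)
  also have "\<dots> = real (\<Prod>E) * sieve_weight E" using sieve_sum_pos[OF Q, of B] by simp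
  also have "\<dots> = (\<Prod>p\<in>E. real p / (real p - 1))" by (simp add: sieve_weight_def prod_dividef)
  also have "\<dots> \<le> (\<Prod>p\<in>E. 2)"
  proof (rule prod_mono)
    fix p assume "p \<in> E"
    then have "real p \<ge> 2" using ps prime_ge_2_nat by (auto simp: prime_set_def)
    then show "0 \<le> real p / (real p - 1) \<and> real p / (real p - 1) \<le> 2" by (simp add: field_simps)
  qed
  finally show ?thesis by simp
qed

text \<open>Moebius inversion on the lattice of subsets: once \<open>K\<close> is factored out, the
  sum is the expansion of a product of zeros over \<open>L - K\<close>.\<close>

lemma sum_alternating_interval:
  assumes "finite L"
  shows "(\<Sum>E | K \<subseteq> E \<and> E \<subseteq> L. (-1::real) ^ card E) = (if K = L then (-1) ^ card K else 0)"
proof (cases "K \<subseteq> L")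
  case False
  then have empty: "{E. K \<subseteq> E \<and> E \<subseteq> L} = {}" by auto
  show ?thesis unfolding empty using False by auto
next
  case True
  note assms = assms True
  have "(\<Sum>E | K \<subseteq> E \<and> E \<subseteq> L. (-1::real) ^ card E) = (\<Sum>X\<in>Pow (L - K). (-1) ^ card (K \<union> X))"
    by (rule sum.reindex_bij_witness[of _ "\<lambda>X. K \<union> X" "\<lambda>E. E - K"]) (use assms in \<open>auto simp: Un_absorb1\<close>)
  also have "\<dots> = (\<Sum>X\<in>Pow (L - K). (-1) ^ card K * (-1) ^ card X)"
  proof (rule sum.cong[OF refl])
    fix X assume X: "X \<in> Pow (L - K)"
    have "card (K \<union> X) = card K + card X"
      by (rule card_Un_disjoint) (use X assms in \<open>auto intro: finite_subset\<close>)
    then show "(-1::real) ^ card (K \<union> X) = (-1) ^ card K * (-1) ^ card X" by (simp add: power_add)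
  qed
  also have "\<dots> = (-1) ^ card K * (\<Sum>X\<in>Pow (L - K). (-1) ^ card X)"
    by (simp only: sum_distrib_left)
  also have "(\<Sum>X\<in>Pow (L - K). (-1::real) ^ card X) = (\<Prod>p\<in>L - K. -1 + 1)"
    using prod_add[of "L - K" "\<lambda>_. -1::real" "\<lambda>_. 1"] assms by simp
  also have "\<dots> = (if K = L then 1 else 0)"
    using assms by (auto simp: prod_zero_iff)
  finally show ?thesis by simp
qed

text \<open>The product over \<open>E \<union> F\<close> is a least common multiple, and its
  reciprocal contains the greatest common divisor, which is the sum of Euler's function
  \<open>v\<close> over the common divisors \<open>K\<close>. This diagonalises the form into
  squares of \<open>y\<close>, and the weights are designed so that \<open>y K\<close> is
  \<open>sieve_weight K / sieve_sum Q B\<close> up to sign.\<close>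

lemma selberg_quadratic_form:
  assumes Q: "Q \<ge> 1"
  shows "(\<Sum>E\<in>sieve_family Q B. \<Sum>F\<in>sieve_family Q B.
      selberg_weight Q B E * selberg_weight Q B F / real (\<Prod>(E \<union> F))) = 1 / sieve_sum Q B"
proof -
  let ?\<E> = "sieve_family Q B" and ?\<rho> = "selberg_weight Q B" and ?G = "sieve_sum Q B"
  define v where "v K = (\<Prod>p\<in>K. real p - 1)" for K :: "nat set"
  define y where "y K = (\<Sum>E | E \<in> ?\<E> \<and> K \<subseteq> E. ?\<rho> E / real (\<Prod>E))" for K
  have ps: "prime_set E" "finite E" if "E \<in> ?\<E>" for E
    using sieve_family_prime_set[OF that] prime_set_finite by blast+
  have pos: "real (\<Prod>E) > 0" if "E \<in> ?\<E>" for E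
    using prod_prime_set_pos[OF ps(1)[OF that]] by (simp only: of_nat_0_less_iff)
  have G: "?G > 0" using sieve_sum_pos[OF Q, of B] by simp
  have y_eq: "y K = (-1) ^ card K * sieve_weight K / ?G" if K: "K \<in> ?\<E>" for K
  proof -
    have "y K = (\<Sum>E | E \<in> ?\<E> \<and> K \<subseteq> E. \<Sum>L | L \<in> ?\<E> \<and> E \<subseteq> L. (-1) ^ card E * sieve_weight L / ?G)"
      unfolding y_def
    proof (rule sum.cong[OF refl])
      fix E assume "E \<in> {E. E \<in> ?\<E> \<and> K \<subseteq> E}"
      then have "real (\<Prod>E) \<noteq> 0" using pos[of E] by auto
      then have "?\<rho> E / real (\<Prod>E) = (-1) ^ card E * (\<Sum>L | L \<in> ?\<E> \<and> E \<subseteq> L. sieve_weight L) / ?G"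
        by (simp add: selberg_weight_def del: of_nat_prod)
      then show "?\<rho> E / real (\<Prod>E) = (\<Sum>L | L \<in> ?\<E> \<and> E \<subseteq> L. (-1) ^ card E * sieve_weight L / ?G)"
        by (simp only: sum_distrib_left sum_divide_distrib)
    qed
    also have "\<dots> = (\<Sum>L\<in>?\<E>. \<Sum>E | E \<in> {E. E \<in> ?\<E> \<and> K \<subseteq> E} \<and> E \<subseteq> L. (-1) ^ card E * sieve_weight L / ?G)"
      by (rule sum.swap_restrict) (auto simp: finite_sieve_family)
    also have "\<dots> = (\<Sum>L\<in>?\<E>. (if K = L then (-1) ^ card K else 0) * sieve_weight L / ?G)"
    proof (rule sum.cong[OF refl])
      fix L assume L: "L \<in> ?\<E>"
      then have set_eq: "{E. E \<in> {E. E \<in> ?\<E> \<and> K \<subseteq> E} \<and> E \<subseteq> L} = {E. K \<subseteq> E \<and> E \<subseteq> L}"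
        using sieve_family_subset by auto
      show "(\<Sum>E | E \<in> {E. E \<in> ?\<E> \<and> K \<subseteq> E} \<and> E \<subseteq> L. (-1) ^ card E * sieve_weight L / ?G)
          = (if K = L then (-1) ^ card K else 0) * sieve_weight L / ?G"
        unfolding set_eq sum_alternating_interval[OF ps(2)[OF L], symmetric]
        by (simp only: sum_distrib_right sum_divide_distrib)
    qed
    also have "\<dots> = (\<Sum>L\<in>{K}. (-1) ^ card K * sieve_weight L / ?G)"
      by (rule sum.mono_neutral_cong_right) (use K finite_sieve_family in auto)
    finally show ?thesis by simp
  qed
  have term_eq: "?\<rho> E * ?\<rho> F / real (\<Prod>(E \<union> F))
      = (\<Sum>K\<in>?\<E>. v K * (of_bool (K \<subseteq> E) * (?\<rho> E / real (\<Prod>E))) * (of_bool (K \<subseteq> F) * (?\<rho> F / real (\<Prod>F))))"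
    if EF: "E \<in> ?\<E>" "F \<in> ?\<E>" for E F
  proof -
    have fin: "finite E" "finite F" using EF ps by auto
    have "(\<Sum>K\<in>?\<E>. v K * (of_bool (K \<subseteq> E) * (?\<rho> E / real (\<Prod>E))) * (of_bool (K \<subseteq> F) * (?\<rho> F / real (\<Prod>F))))
        = (\<Sum>K\<in>Pow (E \<inter> F). v K * (?\<rho> E / real (\<Prod>E)) * (?\<rho> F / real (\<Prod>F)))"
      by (rule sum.mono_neutral_cong_right)
         (use EF finite_sieve_family sieve_family_subset in auto)
    also have "\<dots> = (\<Sum>K\<in>Pow (E \<inter> F). v K) * (?\<rho> E / real (\<Prod>E)) * (?\<rho> F / real (\<Prod>F))"
      by (simp only: sum_distrib_right)
    also have "(\<Sum>K\<in>Pow (E \<inter> F). v K) = real (\<Prod>(E \<inter> F))"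
      using prod_add[of "E \<inter> F" "\<lambda>p. real p - 1" "\<lambda>_. 1"] fin by (simp add: v_def)
    also have "real (\<Prod>(E \<inter> F)) * (?\<rho> E / real (\<Prod>E)) * (?\<rho> F / real (\<Prod>F)) = ?\<rho> E * ?\<rho> F / real (\<Prod>(E \<union> F))"
    proof -
      have "\<Prod>(E \<union> F) * \<Prod>(E \<inter> F) = \<Prod>E * \<Prod>F" using fin by (rule prod.union_inter)
      then have "real (\<Prod>(E \<union> F)) * real (\<Prod>(E \<inter> F)) = real (\<Prod>E) * real (\<Prod>F)"
        by (simp only: of_nat_mult[symmetric])
      moreover have "prime_set (E \<union> F)" using EF ps by (simp add: prime_set_Un)
      then have "real (\<Prod>(E \<union> F)) > 0" using prod_prime_set_pos by (simp only: of_nat_0_less_iff)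
      ultimately show ?thesis using pos[OF EF(1)] pos[OF EF(2)]
        by (simp add: frac_eq_eq mult_ac del: of_nat_prod)
    qed
    finally show ?thesis by simp
  qed
  have "(\<Sum>E\<in>?\<E>. \<Sum>F\<in>?\<E>. ?\<rho> E * ?\<rho> F / real (\<Prod>(E \<union> F)))
      = (\<Sum>E\<in>?\<E>. \<Sum>F\<in>?\<E>. \<Sum>K\<in>?\<E>. v K * (of_bool (K \<subseteq> E) * (?\<rho> E / real (\<Prod>E))) * (of_bool (K \<subseteq> F) * (?\<rho> F / real (\<Prod>F))))"
    by (intro sum.cong refl term_eq)
  also have "\<dots> = (\<Sum>K\<in>?\<E>. \<Sum>E\<in>?\<E>. \<Sum>F\<in>?\<E>. v K * (of_bool (K \<subseteq> E) * (?\<rho> E / real (\<Prod>E))) * (of_bool (K \<subseteq> F) * (?\<rho> F / real (\<Prod>F))))"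
  proof -
    have "(\<Sum>E\<in>?\<E>. \<Sum>F\<in>?\<E>. \<Sum>K\<in>?\<E>. g E F K) = (\<Sum>K\<in>?\<E>. \<Sum>E\<in>?\<E>. \<Sum>F\<in>?\<E>. g E F K)" for g :: "_ \<Rightarrow> _ \<Rightarrow> _ \<Rightarrow> real"
      by (subst (2) sum.swap, subst sum.swap) (rule refl)
    then show ?thesis .
  qed
  also have "\<dots> = (\<Sum>K\<in>?\<E>. v K * (\<Sum>E\<in>?\<E>. of_bool (K \<subseteq> E) * (?\<rho> E / real (\<Prod>E))) * (\<Sum>F\<in>?\<E>. of_bool (K \<subseteq> F) * (?\<rho> F / real (\<Prod>F))))"
    by (simp only: sum_distrib_left[symmetric] sum_distrib_right[symmetric])
  also have "\<dots> = (\<Sum>K\<in>?\<E>. v K * y K * y K)"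
  proof -
    have "(\<Sum>E\<in>?\<E>. of_bool (K \<subseteq> E) * (?\<rho> E / real (\<Prod>E))) = y K" for K
      unfolding y_def by (rule sum.mono_neutral_cong_right) (auto simp: finite_sieve_family)
    then show ?thesis by simp
  qed
  also have "\<dots> = (\<Sum>K\<in>?\<E>. sieve_weight K / ?G ^ 2)"
  proof (rule sum.cong[OF refl])
    fix K assume K: "K \<in> ?\<E>"
    have "v K * sieve_weight K = (\<Prod>p\<in>K. 1)"
      unfolding v_def sieve_weight_def prod.distrib[symmetric]
    proof (rule prod.cong[OF refl])
      fix p assume "p \<in> K"
      then have "real p > 1" using ps(1)[OF K] prime_gt_1_nat by (auto simp: prime_set_def)
      then show "(real p - 1) * (1 / (real p - 1)) = 1" by simp
    qed
    then have "v K * sieve_weight K = 1" by simp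
    then have "v K * (sieve_weight K * (sieve_weight K * ((-1) ^ card K * (-1) ^ card K))) = sieve_weight K"
      by (simp add: power_mult_distrib[symmetric] flip: mult.assoc)
    then show "v K * y K * y K = sieve_weight K / ?G ^ 2"
      unfolding y_eq[OF K] by (simp add: power2_eq_square mult_ac)
  qed
  also have "\<dots> = 1 / ?G"
    using G by (simp add: sieve_sum_def power2_eq_square flip: sum_divide_distrib)
  finally show ?thesis .
qed

section \<open>Bilinear counting to squarefree moduli\<close>

lemma sum_periodic_window:
  fixes g :: "nat \<Rightarrow> real"
  assumes per: "\<And>m. g (m + P) = g m"
  shows "(\<Sum>m\<in>{lo..<lo + P}. g m) = (\<Sum>b<P. g b)"
proof (induction lo)
  case (Suc lo)
  show ?case
  proof (cases "P = 0")
    case False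
    have "{Suc lo..<Suc lo + P} = insert (lo + P) {Suc lo..<lo + P}" using False by auto
    then have "(\<Sum>m\<in>{Suc lo..<Suc lo + P}. g m) = g lo + (\<Sum>m\<in>{Suc lo..<lo + P}. g m)"
      by (simp add: per)
    also have "\<dots> = (\<Sum>m\<in>{lo..<lo + P}. g m)"
      using False by (simp add: sum.atLeast_Suc_lessThan)
    finally show ?thesis using Suc by simp
  qed simp
qed (simp add: atLeast0LessThan)

text \<open>For nonnegative \<open>g\<close> the sum lies between those over \<open>k\<close> and
  \<open>k + 1\<close> full periods, and \<open>n / P\<close> lies between \<open>k\<close> and
  \<open>k + 1\<close> as well.\<close>

lemma sum_periodic_bound:
  fixes g :: "nat \<Rightarrow> real"
  assumes per: "\<And>m. g (m + P) = g m" and "P > 0" and nonneg: "\<And>m. g m \<ge> 0"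
  shows "\<bar>(\<Sum>m\<in>{lo..<lo + n}. g m) - real n / real P * (\<Sum>b<P. g b)\<bar> \<le> (\<Sum>b<P. g b)"
proof -
  let ?G = "\<Sum>b<P. g b"
  have full: "(\<Sum>m\<in>{lo..<lo + k * P}. g m) = real k * ?G" for k lo
  proof (induction k)
    case (Suc k)
    have "{lo..<lo + Suc k * P} = {lo..<lo + k * P} \<union> {lo + k * P..<lo + k * P + P}" by auto
    then have "(\<Sum>m\<in>{lo..<lo + Suc k * P}. g m)
        = (\<Sum>m\<in>{lo..<lo + k * P}. g m) + (\<Sum>m\<in>{lo + k * P..<lo + k * P + P}. g m)"
      by (simp add: sum.union_disjoint)
    also have "\<dots> = real (Suc k) * ?G"
      using Suc sum_periodic_window[of g P "lo + k * P"] per by (simp add: algebra_simps)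
    finally show ?case .
  qed simp
  have G0: "?G \<ge> 0" using nonneg by (rule sum_nonneg)
  define k where "k = n div P"
  have k: "k * P \<le> n" "n \<le> Suc k * P"
    using div_times_less_eq_dividend[of n P] dividend_less_div_times[OF \<open>P > 0\<close>, of n] by (simp_all add: k_def)
  have "(\<Sum>m\<in>{lo..<lo + k * P}. g m) \<le> (\<Sum>m\<in>{lo..<lo + n}. g m)"
    using k nonneg by (intro sum_mono2) auto
  then have lower: "real k * ?G \<le> (\<Sum>m\<in>{lo..<lo + n}. g m)" by (simp only: full)
  have "(\<Sum>m\<in>{lo..<lo + n}. g m) \<le> (\<Sum>m\<in>{lo..<lo + Suc k * P}. g m)"
    using k nonneg by (intro sum_mono2) auto
  then have upper: "(\<Sum>m\<in>{lo..<lo + n}. g m) \<le> (real k + 1) * ?G" by (simp only: full of_nat_Suc add.commute)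
  have "real k * real P \<le> real n" "real n \<le> (real k + 1) * real P"
  proof -
    have "real (k * P) \<le> real n" "real n \<le> real (Suc k * P)" using k by (simp_all only: of_nat_le_iff)
    then show "real k * real P \<le> real n" "real n \<le> (real k + 1) * real P"
      by (simp_all only: of_nat_mult of_nat_Suc add.commute)
  qed
  then have "real k \<le> real n / real P" "real n / real P \<le> real k + 1"
    using assms(2) by (simp_all add: field_simps)
  then have "real k * ?G \<le> real n / real P * ?G" "real n / real P * ?G \<le> (real k + 1) * ?G"
    using G0 by (simp_all only: mult_right_mono)
  then show ?thesis using lower upper unfolding abs_le_iff by (simp add: algebra_simps)
qed

text \<open>The divisor bound. A prime with \<open>p powr \<epsilon> \<ge> c\<close> pays for its
  own factor \<open>c\<close>; the finitely many smaller primes are collected in the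
  constant.\<close>

lemma power_card_le_powr:
  assumes "c \<ge> (1::real)" "\<epsilon> > 0"
  shows "\<exists>C\<ge>1. \<forall>U. prime_set U \<longrightarrow> c ^ card U \<le> C * real (\<Prod>U) powr \<epsilon>"
proof -
  \<comment> \<open>A prime with \<open>p powr \<epsilon> < c\<close> is less than
    \<open>c powr (1 / \<epsilon>)\<close>, so fewer than \<open>k + 1\<close> primes are
    exceptional.\<close>
  define k where "k = nat \<lceil>c powr (1 / \<epsilon>)\<rceil>"
  show ?thesis
  proof (intro exI conjI allI impI)
    show "c ^ k \<ge> 1" using assms(1) by (rule one_le_power)
    fix U assume U: "prime_set U"
    have fin: "finite U" using U by (rule prime_set_finite)
    have p1: "real p \<ge> 1" if "p \<in> U" for p
      using U that prime_ge_1_nat by (auto simp: prime_set_def)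
    let ?S = "{p \<in> U. real p powr \<epsilon> < c}"
    have "?S \<subseteq> {..<k}"
    proof
      fix p assume p: "p \<in> ?S"
      have "real p = (real p powr \<epsilon>) powr (1 / \<epsilon>)" using assms(2) by (simp add: powr_powr)
      also have "\<dots> < c powr (1 / \<epsilon>)" using p assms(2) by (intro powr_less_mono2) auto
      finally show "p \<in> {..<k}" unfolding k_def by simp linarith
    qed
    then have card_S: "card ?S \<le> k" using card_mono[of "{..<k}" ?S] by simp
    have "c ^ card U = (\<Prod>p\<in>U. c)" by simp
    also have "\<dots> \<le> (\<Prod>p\<in>U. (if real p powr \<epsilon> < c then c else 1) * real p powr \<epsilon>)"
    proof (rule prod_mono)
      fix p assume "p \<in> U"
      then have "real p powr \<epsilon> \<ge> 1" using p1[of p] assms(2) by (intro ge_one_powr_ge_zero) auto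
      then show "0 \<le> c \<and> c \<le> (if real p powr \<epsilon> < c then c else 1) * real p powr \<epsilon>"
        using assms(1) by (auto simp: mult_le_cancel_left1)
    qed
    also have "\<dots> = c ^ card ?S * (\<Prod>p\<in>U. real p powr \<epsilon>)"
      using fin by (simp add: prod.distrib prod.If_cases Int_def)
    also have "(\<Prod>p\<in>U. real p powr \<epsilon>) = real (\<Prod>U) powr \<epsilon>"
      using p1 by (simp add: prod_powr_distrib)
    also have "c ^ card ?S * real (\<Prod>U) powr \<epsilon> \<le> c ^ k * real (\<Prod>U) powr \<epsilon>"
      using card_S assms(1) by (intro mult_right_mono power_increasing) auto
    finally show "c ^ card U \<le> c ^ k * real (\<Prod>U) powr \<epsilon>" .
  qed
qed

section \<open>Centred congruence indicators\<close>

definition avoids :: "nat set \<Rightarrow> nat \<Rightarrow> bool" where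
  "avoids B m \<longleftrightarrow> (\<forall>p\<in>B. \<not> p dvd m)"

text \<open>The part of the indicator of \<open>q * m \<equiv> a\<close> modulo
  \<open>\<Prod>S\<close> that has mean zero in \<open>m\<close> modulo every prime of
  \<open>S\<close>, for \<open>q\<close> coprime to the modulus.\<close>

definition centred :: "int \<Rightarrow> nat set \<Rightarrow> nat \<Rightarrow> nat \<Rightarrow> real" where
  "centred a S q m = (\<Prod>p\<in>S. of_bool (int p dvd int q * int m - a) - 1 / real p)"

lemma dvd_linear_mod:
  "int p dvd int q * int (m mod p) - a \<longleftrightarrow> int p dvd int q * int m - a"
proof -
  have "[int q * int (m mod p) = int q * int m] (mod int p)"
    by (intro cong_scalar_left) (simp add: Cong.cong_def zmod_int)
  then show ?thesis by (metis cong_iff_dvd_diff cong_sym cong_trans)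
qed

lemma dvd_linear_add:
  assumes "p dvd P"
  shows "int p dvd int q * int (m + P) - a \<longleftrightarrow> int p dvd int q * int m - a"
proof -
  have "(m + P) mod p = m mod p" using assms by (metis dvd_imp_mod_0 mod_add_right_eq add_0_right)
  then show ?thesis using dvd_linear_mod[of p q "m + P" a] dvd_linear_mod[of p q m a] by simp
qed

text \<open>The conditions at the primes of \<open>B\<close> and \<open>V\<close> are independent,
  and those at \<open>V\<close> select a single class. A full period thus holds at most
  \<open>\<Prod>B\<close> solutions, which bounds the error uniformly in \<open>V\<close>.\<close>

lemma count_linear_congruence:
  fixes a :: int
  assumes B: "prime_set B" and V: "prime_set V" and disj: "B \<inter> V = {}"
    and q: "\<And>p. p \<in> V \<Longrightarrow> \<not> p dvd q"
  shows "\<bar>(\<Sum>m\<in>{lo..<lo + n}. of_bool (avoids B m) * (\<Prod>p\<in>V. of_bool (int p dvd int q * int m - a)))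
      - real n * (\<Prod>p\<in>B. 1 - 1 / real p) * (\<Prod>p\<in>V. 1 / real p)\<bar> \<le> real (\<Prod>B)"
proof -
  define F where "F p c = (if p \<in> B then 1 - of_bool (p dvd c) else of_bool (int p dvd int q * int c - a) :: real)" for p c
  define g where "g m = (\<Prod>p\<in>B \<union> V. F p (m mod p))" for m
  have fin: "finite B" "finite V" using B V by (auto dest: prime_set_finite)
  have BV: "prime_set (B \<union> V)" using B V by (simp add: prime_set_Un)
  have g_eq: "g m = of_bool (avoids B m) * (\<Prod>p\<in>V. of_bool (int p dvd int q * int m - a))" for m
  proof -
    have "g m = (\<Prod>p\<in>B. F p (m mod p)) * (\<Prod>p\<in>V. F p (m mod p))"
      unfolding g_def using fin disj by (rule prod.union_disjoint)
    also have "(\<Prod>p\<in>B. F p (m mod p)) = (\<Prod>p\<in>B. of_bool (\<not> p dvd m))"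
      by (rule prod.cong) (auto simp: F_def dvd_mod_iff)
    also have "\<dots> = of_bool (avoids B m)"
      unfolding avoids_def by (simp only: of_bool_Ball_eq_prod[OF fin(1)])
    also have "(\<Prod>p\<in>V. F p (m mod p)) = (\<Prod>p\<in>V. of_bool (int p dvd int q * int m - a))"
      by (rule prod.cong) (use disj in \<open>auto simp: F_def dvd_linear_mod\<close>)
    finally show ?thesis .
  qed
  have per: "g (m + \<Prod>(B \<union> V)) = g m" for m
    unfolding g_def
  proof (rule prod.cong[OF refl])
    fix p assume "p \<in> B \<union> V"
    then have "p dvd \<Prod>(B \<union> V)" using dvd_prodI[of "B \<union> V" p "\<lambda>x. x"] fin by simp
    then have "(m + \<Prod>(B \<union> V)) mod p = m mod p" by (metis dvd_imp_mod_0 mod_add_right_eq add_0_right)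
    then show "F p ((m + \<Prod>(B \<union> V)) mod p) = F p (m mod p)" by simp
  qed
  have g0: "g m \<ge> 0" for m unfolding g_eq by (intro mult_nonneg_nonneg prod_nonneg) auto
  have sumB: "(\<Sum>c<p. F p c) = real p - 1" if "p \<in> B" for p
  proof -
    have "p > 0" using that B by (auto simp: prime_set_def dest: prime_gt_0_nat)
    then have "{c. c < p \<and> p dvd c} = {0}" by (auto dest: dvd_imp_le)
    then have "(\<Sum>c<p. of_bool (p dvd c)) = (1::real)"
      using sum.inter_filter[of "{..<p}" "\<lambda>_. 1::real" "\<lambda>c. p dvd c"] by (simp add: of_bool_def)
    then show ?thesis using that by (simp add: F_def sum_subtractf)
  qed
  have sumV: "(\<Sum>c<p. F p c) = 1" if "p \<in> V" for p
  proof -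
    have p: "prime p" using that V by (auto simp: prime_set_def)
    then have "coprime q p" using q[OF that] by (simp add: prime_imp_coprime coprime_commute)
    then obtain c where c: "c < p" "\<And>b. int p dvd int q * int b - a \<longleftrightarrow> b mod p = c"
      using linear_congruence_unique_solution prime_gt_0_nat[OF p] by metis
    have "(\<Sum>b<p. F p b) = (\<Sum>b<p. of_bool (b = c))"
      using that disj by (intro sum.cong) (auto simp: F_def c(2))
    then show ?thesis using c(1) by (simp add: of_bool_def)
  qed
  have G: "(\<Sum>b<\<Prod>(B \<union> V). g b) = (\<Prod>p\<in>B. real p - 1)"
  proof -
    have "(\<Sum>b<\<Prod>(B \<union> V). g b) = (\<Prod>p\<in>B \<union> V. \<Sum>c<p. F p c)"
      unfolding g_def by (rule sum_mod_prime_set[OF BV])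
    also have "\<dots> = (\<Prod>p\<in>B. \<Sum>c<p. F p c) * (\<Prod>p\<in>V. \<Sum>c<p. F p c)"
      using fin disj by (rule prod.union_disjoint)
    finally show ?thesis by (simp add: sumB sumV)
  qed
  have ratio: "real n / real (\<Prod>(B \<union> V)) * (\<Prod>p\<in>B. real p - 1)
      = real n * (\<Prod>p\<in>B. 1 - 1 / real p) * (\<Prod>p\<in>V. 1 / real p)"
  proof -
    have "(\<Prod>p\<in>B. 1 - 1 / real p) = (\<Prod>p\<in>B. (real p - 1) / real p)"
      using B by (intro prod.cong) (auto simp: prime_set_def diff_divide_distrib dest: prime_gt_0_nat)
    then show ?thesis using fin disj by (simp add: prod.union_disjoint prod_dividef)
  qed
  have "\<bar>(\<Sum>m\<in>{lo..<lo + n}. g m) - real n / real (\<Prod>(B \<union> V)) * (\<Sum>b<\<Prod>(B \<union> V). g b)\<bar> \<le> (\<Sum>b<\<Prod>(B \<union> V). g b)"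
    by (rule sum_periodic_bound[of g "\<Prod>(B \<union> V)", OF per _ g0]) (use prod_prime_set_pos[OF BV] in simp)
  also have "(\<Sum>b<\<Prod>(B \<union> V). g b) \<le> real (\<Prod>B)"
    unfolding G of_nat_prod using B prime_ge_1_nat by (intro prod_mono) (auto simp: prime_set_def)
  finally show ?thesis unfolding G ratio unfolding g_eq .
qed

text \<open>The product expands into \<open>2 ^ card S\<close> counts over subsets \<open>V\<close>.
  Their main terms cancel unless \<open>S\<close> is empty, as every prime of \<open>S\<close>
  contributes \<open>1 / p - 1 / p\<close>.\<close>

lemma sum_centred_small:
  fixes a :: int
  assumes B: "prime_set B" and S: "prime_set S" and disj: "B \<inter> S = {}"
    and q: "\<And>p. p \<in> S \<Longrightarrow> \<not> p dvd q"
  shows "\<bar>(\<Sum>m\<in>{lo..<lo + n}. of_bool (avoids B m) * centred a S q m)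
      - of_bool (S = {}) * (real n * (\<Prod>p\<in>B. 1 - 1 / real p))\<bar> \<le> real (\<Prod>B) * 2 ^ card S"
proof -
  have fin: "finite S" using S by (rule prime_set_finite)
  let ?\<kappa> = "\<Prod>p\<in>B. 1 - 1 / real p"
  let ?o = "\<lambda>p m. of_bool (int p dvd int q * int m - a) :: real"
  define c where "c V = (\<Prod>p\<in>S - V. - (1 / real p))" for V
  define N where "N V = (\<Sum>m\<in>{lo..<lo + n}. of_bool (avoids B m) * (\<Prod>p\<in>V. ?o p m))" for V
  have c1: "\<bar>c V\<bar> \<le> 1" for V
    unfolding c_def abs_prod
    using S by (intro prod_le_1) (auto simp: prime_set_def divide_le_eq dest: prime_gt_0_nat)
  have "(\<Sum>m\<in>{lo..<lo + n}. of_bool (avoids B m) * centred a S q m)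
      = (\<Sum>m\<in>{lo..<lo + n}. \<Sum>V\<in>Pow S. c V * (of_bool (avoids B m) * (\<Prod>p\<in>V. ?o p m)))"
  proof (rule sum.cong[OF refl])
    fix m
    have "centred a S q m = (\<Prod>p\<in>S. ?o p m + - (1 / real p))" by (simp add: centred_def)
    also have "\<dots> = (\<Sum>V\<in>Pow S. (\<Prod>p\<in>V. ?o p m) * c V)" unfolding c_def by (rule prod_add[OF fin])
    finally show "of_bool (avoids B m) * centred a S q m
      = (\<Sum>V\<in>Pow S. c V * (of_bool (avoids B m) * (\<Prod>p\<in>V. ?o p m)))"
      by (simp add: sum_distrib_left mult_ac)
  qed
  also have "\<dots> = (\<Sum>V\<in>Pow S. c V * N V)"
    unfolding N_def sum_distrib_left by (rule sum.swap)
  finally have lhs: "(\<Sum>m\<in>{lo..<lo + n}. of_bool (avoids B m) * centred a S q m) = (\<Sum>V\<in>Pow S. c V * N V)" .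
  have "(\<Sum>V\<in>Pow S. c V * (real n * ?\<kappa> * (\<Prod>p\<in>V. 1 / real p)))
      = real n * ?\<kappa> * (\<Sum>V\<in>Pow S. (\<Prod>p\<in>V. 1 / real p) * c V)"
    by (simp add: sum_distrib_left mult_ac)
  also have "(\<Sum>V\<in>Pow S. (\<Prod>p\<in>V. 1 / real p) * c V) = (\<Prod>p\<in>S. 1 / real p + - (1 / real p))"
    unfolding c_def by (rule prod_add[OF fin, symmetric])
  also have "\<dots> = of_bool (S = {})" using fin by (auto simp: prod_zero_iff)
  finally have main: "(\<Sum>V\<in>Pow S. c V * (real n * ?\<kappa> * (\<Prod>p\<in>V. 1 / real p))) = of_bool (S = {}) * (real n * ?\<kappa>)"
    by simp
  have "\<bar>(\<Sum>V\<in>Pow S. c V * N V) - (\<Sum>V\<in>Pow S. c V * (real n * ?\<kappa> * (\<Prod>p\<in>V. 1 / real p)))\<bar>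
      = \<bar>\<Sum>V\<in>Pow S. c V * (N V - real n * ?\<kappa> * (\<Prod>p\<in>V. 1 / real p))\<bar>"
    by (simp add: sum_subtractf right_diff_distrib)
  also have "\<dots> \<le> (\<Sum>V\<in>Pow S. \<bar>c V * (N V - real n * ?\<kappa> * (\<Prod>p\<in>V. 1 / real p))\<bar>)"
    by (rule sum_abs)
  also have "\<dots> \<le> (\<Sum>V\<in>Pow S. 1 * real (\<Prod>B))"
  proof (rule sum_mono)
    fix V assume V: "V \<in> Pow S"
    have "\<bar>N V - real n * ?\<kappa> * (\<Prod>p\<in>V. 1 / real p)\<bar> \<le> real (\<Prod>B)"
      unfolding N_def using V S disj q by (intro count_linear_congruence B) (auto intro: prime_set_subset)
    then show "\<bar>c V * (N V - real n * ?\<kappa> * (\<Prod>p\<in>V. 1 / real p))\<bar> \<le> 1 * real (\<Prod>B)"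
      unfolding abs_mult using c1[of V] by (intro mult_mono) auto
  qed
  also have "\<dots> = real (\<Prod>B) * 2 ^ card S" using fin by (simp add: card_Pow)
  finally show ?thesis unfolding lhs main .
qed

text \<open>With the sum over \<open>q\<close> innermost, absolute values discard the factor
  \<open>avoids\<close>, and Cauchy-Schwarz leaves the squares of a function of period
  \<open>\<Prod>S\<close>, whose sum over one period is the variance of \<open>Q\<close>.\<close>

lemma sum_centred_large:
  fixes a :: int
  assumes S: "prime_set S" and a: "\<And>p. p \<in> S \<Longrightarrow> \<not> int p dvd a"
    and q: "\<And>p q. p \<in> S \<Longrightarrow> q \<in> Q \<Longrightarrow> \<not> p dvd q"
  shows "\<bar>\<Sum>q\<in>Q. \<Sum>m\<in>{lo..<lo + n}. of_bool (avoids B m) * centred a S q m\<bar>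
      \<le> sqrt (real n * (real n / real (\<Prod>S) + 1) * variance Q S)"
proof -
  define \<Delta> where "\<Delta> m = (\<Sum>q\<in>Q. centred a S q m)" for m
  have fin: "finite S" using S by (rule prime_set_finite)
  have per: "(\<Delta> (m + \<Prod>S))\<^sup>2 = (\<Delta> m)\<^sup>2" for m
  proof -
    have "centred a S q (m + \<Prod>S) = centred a S q m" for q
      unfolding centred_def
    proof (rule prod.cong[OF refl])
      fix p assume "p \<in> S"
      then have "p dvd \<Prod>S" using dvd_prodI[of S p "\<lambda>x. x"] fin by simp
      then show "of_bool (int p dvd int q * int (m + \<Prod>S) - a) - 1 / real p
        = of_bool (int p dvd int q * int m - a) - 1 / real p" by (simp only: dvd_linear_add)
    qed
    then show ?thesis by (simp add: \<Delta>_def)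
  qed
  have var: "(\<Sum>b<\<Prod>S. (\<Delta> b)\<^sup>2) = variance Q S"
    unfolding \<Delta>_def centred_def by (rule sum_square_eq_variance[OF S]) (use a q in auto)
  have "\<bar>\<Sum>q\<in>Q. \<Sum>m\<in>{lo..<lo + n}. of_bool (avoids B m) * centred a S q m\<bar>
      = \<bar>\<Sum>m\<in>{lo..<lo + n}. of_bool (avoids B m) * \<Delta> m\<bar>"
    unfolding \<Delta>_def sum_distrib_left by (subst sum.swap) (rule refl)
  also have "\<dots> \<le> (\<Sum>m\<in>{lo..<lo + n}. \<bar>of_bool (avoids B m) * \<Delta> m\<bar>)" by (rule sum_abs)
  also have "\<dots> \<le> (\<Sum>m\<in>{lo..<lo + n}. 1 * \<bar>\<Delta> m\<bar>)"
    by (rule sum_mono) (simp add: abs_mult)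
  finally have "\<bar>\<Sum>q\<in>Q. \<Sum>m\<in>{lo..<lo + n}. of_bool (avoids B m) * centred a S q m\<bar>\<^sup>2
      \<le> (\<Sum>m\<in>{lo..<lo + n}. 1 * \<bar>\<Delta> m\<bar>)\<^sup>2" by (intro power_mono) auto
  also have "\<dots> \<le> (\<Sum>m\<in>{lo..<lo + n}. 1\<^sup>2) * (\<Sum>m\<in>{lo..<lo + n}. \<bar>\<Delta> m\<bar>\<^sup>2)"
    by (rule Cauchy_Schwarz_ineq_sum)
  also have "\<dots> = real n * (\<Sum>m\<in>{lo..<lo + n}. (\<Delta> m)\<^sup>2)" by simp
  also have "\<dots> \<le> real n * ((real n / real (\<Prod>S) + 1) * variance Q S)"
  proof (rule mult_left_mono)
    show "(\<Sum>m\<in>{lo..<lo + n}. (\<Delta> m)\<^sup>2) \<le> (real n / real (\<Prod>S) + 1) * variance Q S"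
      using sum_periodic_bound[of "\<lambda>m. (\<Delta> m)\<^sup>2" "\<Prod>S" lo n, OF per] prod_prime_set_pos[OF S]
      unfolding var by (simp add: algebra_simps abs_le_iff)
  qed simp
  finally have "\<bar>\<Sum>q\<in>Q. \<Sum>m\<in>{lo..<lo + n}. of_bool (avoids B m) * centred a S q m\<bar>\<^sup>2
      \<le> real n * (real n / real (\<Prod>S) + 1) * variance Q S" by (simp only: mult.assoc)
  then show ?thesis by (intro real_le_rsqrt) simp
qed

lemma count_expand_centred:
  assumes U: "prime_set U"
  shows "(\<Prod>p\<in>U. of_bool (int p dvd int q * int m - a)) = (\<Sum>S\<in>Pow U. centred a S q m * (\<Prod>p\<in>U - S. 1 / real p))"
proof -
  have "(\<Prod>p\<in>U. of_bool (int p dvd int q * int m - a))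
      = (\<Prod>p\<in>U. (of_bool (int p dvd int q * int m - a) - 1 / real p) + 1 / real p)" by simp
  also have "\<dots> = (\<Sum>S\<in>Pow U. centred a S q m * (\<Prod>p\<in>U - S. 1 / real p))"
    unfolding centred_def by (rule prod_add[OF prime_set_finite[OF U]])
  finally show ?thesis .
qed

text \<open>Each divisibility indicator is its centred part plus the mean \<open>1 / p\<close>.
  Among the resulting subsets \<open>S\<close> of \<open>U\<close> only the empty one carries the
  main term \<open>X\<close>.\<close>

lemma bilinear_count:
  fixes a :: int and \<beta> :: "nat set \<Rightarrow> real"
  assumes U: "prime_set U"
    and \<beta>: "\<And>S. S \<subseteq> U \<Longrightarrow> \<bar>(\<Sum>q\<in>Q. \<Sum>m\<in>J. of_bool (avoids B m) * centred a S q m) - of_bool (S = {}) * X\<bar> \<le> \<beta> S"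
  shows "\<bar>(\<Sum>q\<in>Q. \<Sum>m\<in>J. of_bool (avoids B m) * (\<Prod>p\<in>U. of_bool (int p dvd int q * int m - a)))
      - X / real (\<Prod>U)\<bar> \<le> (\<Sum>S\<in>Pow U. \<beta> S * (\<Prod>p\<in>U - S. 1 / real p))"
proof -
  let ?w = "\<lambda>S. \<Sum>q\<in>Q. \<Sum>m\<in>J. of_bool (avoids B m) * centred a S q m"
  let ?c = "\<lambda>S. \<Prod>p\<in>U - S. 1 / real p"
  have "(\<Sum>q\<in>Q. \<Sum>m\<in>J. of_bool (avoids B m) * (\<Prod>p\<in>U. of_bool (int p dvd int q * int m - a)))
      = (\<Sum>q\<in>Q. \<Sum>m\<in>J. \<Sum>S\<in>Pow U. of_bool (avoids B m) * centred a S q m * ?c S)"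
    by (simp add: count_expand_centred[OF U] sum_distrib_left mult.assoc)
  also have "\<dots> = (\<Sum>q\<in>Q. \<Sum>S\<in>Pow U. \<Sum>m\<in>J. of_bool (avoids B m) * centred a S q m * ?c S)"
    by (intro sum.cong refl sum.swap)
  also have "\<dots> = (\<Sum>S\<in>Pow U. \<Sum>q\<in>Q. \<Sum>m\<in>J. of_bool (avoids B m) * centred a S q m * ?c S)"
    by (rule sum.swap)
  also have "\<dots> = (\<Sum>S\<in>Pow U. ?w S * ?c S)" by (simp only: sum_distrib_right)
  finally have lhs: "(\<Sum>q\<in>Q. \<Sum>m\<in>J. of_bool (avoids B m) * (\<Prod>p\<in>U. of_bool (int p dvd int q * int m - a)))
      = (\<Sum>S\<in>Pow U. ?w S * ?c S)" .
  have "(\<Sum>S\<in>Pow U. of_bool (S = {}) * X * ?c S) = (\<Sum>S\<in>{{}}. X * ?c S)"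
    by (rule sum.mono_neutral_cong_right) (use prime_set_finite[OF U] in auto)
  also have "\<dots> = X / real (\<Prod>U)" by (simp add: prod_dividef)
  finally have "\<bar>(\<Sum>S\<in>Pow U. ?w S * ?c S) - X / real (\<Prod>U)\<bar> = \<bar>\<Sum>S\<in>Pow U. (?w S - of_bool (S = {}) * X) * ?c S\<bar>"
    by (simp only: left_diff_distrib sum_subtractf)
  also have "\<dots> \<le> (\<Sum>S\<in>Pow U. \<bar>(?w S - of_bool (S = {}) * X) * ?c S\<bar>)" by (rule sum_abs)
  also have "\<dots> \<le> (\<Sum>S\<in>Pow U. \<beta> S * ?c S)"
  proof (rule sum_mono)
    fix S assume "S \<in> Pow U"
    moreover have "?c S \<ge> 0" by (intro prod_nonneg) auto
    ultimately show "\<bar>(?w S - of_bool (S = {}) * X) * ?c S\<bar> \<le> \<beta> S * ?c S"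
      unfolding abs_mult using \<beta>[of S] by (intro mult_mono) auto
  qed
  finally show ?thesis unfolding lhs .
qed

lemma sum_inverse_prime_sets_le: "(\<Sum>T\<in>prime_sets_upto R. 1 / real (\<Prod>T)) \<le> (\<Sum>n\<in>{1..R}. 1 / real n)"
proof -
  have inj: "inj_on (\<lambda>T. \<Prod>T) (prime_sets_upto R)"
    by (rule inj_on_subset[OF inj_on_prod_prime_sets]) (auto simp: prime_sets_upto_def)
  have "(\<Sum>T\<in>prime_sets_upto R. 1 / real (\<Prod>T)) = (\<Sum>n\<in>(\<lambda>T. \<Prod>T) ` prime_sets_upto R. 1 / real n)"
    by (rule sum.reindex[OF inj, symmetric, unfolded o_def])
  also have "\<dots> \<le> (\<Sum>n\<in>{1..R}. 1 / real n)"
  proof (rule sum_mono2)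
    show "(\<lambda>T. \<Prod>T) ` prime_sets_upto R \<subseteq> {1..R}"
    proof (rule image_subsetI)
      fix T assume "T \<in> prime_sets_upto R"
      then show "\<Prod>T \<in> {1..R}" using prod_prime_set_pos[of T] by (simp add: prime_sets_upto_def Suc_le_eq)
    qed
  qed auto
  finally show ?thesis .
qed

lemma card_prime_sets_upto_le: "card (prime_sets_upto R) \<le> R"
proof -
  have "card (prime_sets_upto R) = card ((\<lambda>T. \<Prod>T) ` prime_sets_upto R)"
    by (rule card_image[symmetric], rule inj_on_subset[OF inj_on_prod_prime_sets])
       (auto simp: prime_sets_upto_def)
  also have "\<dots> \<le> card {1..R}"
  proof (rule card_mono, simp, rule image_subsetI)
    fix T assume "T \<in> prime_sets_upto R"
    then show "\<Prod>T \<in> {1..R}" using prod_prime_set_pos[of T] by (simp add: prime_sets_upto_def Suc_le_eq)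
  qed
  finally show ?thesis by simp
qed

text \<open>The substitution \<open>W = U - S\<close> embeds the pairs of nested sets into pairs of
  independent sets with products at most \<open>R\<close>, and the sums decouple.\<close>

lemma sum_over_subsets_le:
  fixes \<beta> :: "nat set \<Rightarrow> real"
  assumes "\<And>S. \<beta> S \<ge> 0"
  shows "(\<Sum>U\<in>prime_sets_upto R. \<Sum>S\<in>Pow U. \<beta> S * (\<Prod>p\<in>U - S. 1 / real p))
    \<le> (\<Sum>n\<in>{1..R}. 1 / real n) * (\<Sum>S\<in>prime_sets_upto R. \<beta> S)"
proof -
  let ?P = "prime_sets_upto R"
  define I where "I = (SIGMA U:?P. Pow U)"
  have fin: "finite U" if "U \<in> ?P" for U using that prime_set_finite by (auto simp: prime_sets_upto_def)
  have "(\<Sum>U\<in>?P. \<Sum>S\<in>Pow U. \<beta> S * (\<Prod>p\<in>U - S. 1 / real p))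
      = (\<Sum>(U, S)\<in>I. \<beta> S * (\<Prod>p\<in>U - S. 1 / real p))"
    unfolding I_def by (rule sum.Sigma) (use fin finite_prime_sets_upto in auto)
  also have "\<dots> = (\<Sum>(W, S)\<in>(\<lambda>(U, S). (U - S, S)) ` I. \<beta> S * (\<Prod>p\<in>W. 1 / real p))"
    by (subst sum.reindex) (auto simp: I_def inj_on_def case_prod_beta)
  also have "\<dots> \<le> (\<Sum>(W, S)\<in>?P \<times> ?P. \<beta> S * (\<Prod>p\<in>W. 1 / real p))"
    by (rule sum_mono2)
       (auto simp: I_def finite_prime_sets_upto intro: prime_sets_upto_mono
             intro!: mult_nonneg_nonneg prod_nonneg assms)
  also have "\<dots> = (\<Sum>W\<in>?P. 1 / real (\<Prod>W)) * (\<Sum>S\<in>?P. \<beta> S)"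
  proof -
    have "(\<Sum>(W, S)\<in>?P \<times> ?P. \<beta> S * (\<Prod>p\<in>W. 1 / real p)) = (\<Sum>(W, S)\<in>?P \<times> ?P. 1 / real (\<Prod>W) * \<beta> S)"
      by (rule sum.cong) (auto simp: prod_dividef)
    then show ?thesis by (simp only: sum_product sum.cartesian_product)
  qed
  also have "\<dots> \<le> (\<Sum>n\<in>{1..R}. 1 / real n) * (\<Sum>S\<in>?P. \<beta> S)"
    by (intro mult_right_mono sum_inverse_prime_sets_le sum_nonneg assms)
  finally show ?thesis .
qed

text \<open>Group \<open>x\<close> by its class \<open>b\<close>, with \<open>\<alpha> b\<close>
  elements. The discrepancy \<open>\<Delta>\<close> of \<open>Y\<close> sums to zero over the
  classes, so \<alpha> may be replaced by its deviation from the mean; Cauchy-Schwarz then produces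
  both variances.\<close>

lemma bilinear_prime_modulus:
  fixes a :: int
  assumes q: "prime q" "\<not> int q dvd a" and Y: "\<And>y. y \<in> Y \<Longrightarrow> \<not> q dvd y" and fin: "finite X" "finite Y"
  shows "\<bar>(\<Sum>x\<in>X. \<Sum>y\<in>Y. of_bool (int q dvd int y * int x - a)) - real (card X) * real (card Y) / real q\<bar>
    \<le> sqrt (variance X {q} * variance Y {q})"
proof -
  have q0: "q > 0" using q(1) by (rule prime_gt_0_nat)
  have T: "prime_set {q}" using q by (simp add: prime_set_def)
  define \<Delta> where "\<Delta> b = (\<Sum>y\<in>Y. of_bool (int q dvd int y * int b - a) - 1 / real q)" for b
  define \<alpha> where "\<alpha> b = (\<Sum>x\<in>X. of_bool (x mod q = b) :: real)" for b
  let ?m = "real (card X) / real q"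
  have \<Delta>_mod: "\<Delta> (x mod q) = \<Delta> x" for x unfolding \<Delta>_def by (simp add: dvd_linear_mod)
  have delta: "(\<Sum>b<q. of_bool (x mod q = b) * f b) = f (x mod q)" for x and f :: "nat \<Rightarrow> real"
  proof -
    have "(\<Sum>b<q. of_bool (x mod q = b) * f b) = (\<Sum>b<q. if b = x mod q then f b else 0)"
      by (rule sum.cong) auto
    then show ?thesis using q0 by simp
  qed
  have sum0: "(\<Sum>b<q. \<Delta> b) = 0"
  proof -
    have "(\<Sum>b<q. \<Delta> b) = (\<Sum>y\<in>Y. \<Sum>b<q. of_bool (int q dvd int y * int b - a) - 1 / real q)"
      unfolding \<Delta>_def by (rule sum.swap)
    also have "\<dots> = (\<Sum>y\<in>Y. 0)"
    proof (rule sum.cong[OF refl])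
      fix y assume "y \<in> Y"
      then have "coprime y q" using Y q by (simp add: prime_imp_coprime coprime_commute)
      then obtain c where c: "c < q" "\<And>b. int q dvd int y * int b - a \<longleftrightarrow> b mod q = c"
        using linear_congruence_unique_solution q0 by metis
      have "(\<Sum>b<q. of_bool (int q dvd int y * int b - a)) = (\<Sum>b<q. of_bool (b = c) :: real)"
        by (rule sum.cong) (auto simp: c(2))
      then show "(\<Sum>b<q. of_bool (int q dvd int y * int b - a) - 1 / real q) = 0"
        using c(1) q0 by (simp add: sum_subtractf of_bool_def)
    qed
    finally show ?thesis by simp
  qed
  have "(\<Sum>x\<in>X. \<Sum>y\<in>Y. of_bool (int q dvd int y * int x - a)) - real (card X) * real (card Y) / real q
      = (\<Sum>x\<in>X. \<Delta> x)" by (simp add: \<Delta>_def sum_subtractf)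
  also have "\<dots> = (\<Sum>x\<in>X. \<Sum>b<q. of_bool (x mod q = b) * \<Delta> b)" by (simp only: delta \<Delta>_mod)
  also have "\<dots> = (\<Sum>b<q. \<alpha> b * \<Delta> b)"
    unfolding \<alpha>_def sum_distrib_right by (rule sum.swap)
  also have "\<dots> = (\<Sum>b<q. (\<alpha> b - ?m) * \<Delta> b)"
    by (simp only: left_diff_distrib sum_subtractf sum_distrib_left[symmetric] sum0 mult_zero_right diff_zero)
  finally have eq: "(\<Sum>x\<in>X. \<Sum>y\<in>Y. of_bool (int q dvd int y * int x - a)) - real (card X) * real (card Y) / real q
      = (\<Sum>b<q. (\<alpha> b - ?m) * \<Delta> b)" .
  have varY: "(\<Sum>b<q. (\<Delta> b)\<^sup>2) = variance Y {q}"
    using sum_square_eq_variance[OF T, of a Y] q Y by (simp add: \<Delta>_def)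
  have varX: "(\<Sum>b<q. (\<alpha> b - ?m)\<^sup>2) = variance X {q}"
  proof -
    have "(\<Sum>b<q. (\<alpha> b)\<^sup>2) = (\<Sum>b<q. \<Sum>x\<in>X. \<Sum>x'\<in>X. of_bool (x mod q = b) * of_bool (x' mod q = b))"
      by (simp add: \<alpha>_def power2_eq_square sum_product)
    also have "\<dots> = (\<Sum>x\<in>X. \<Sum>x'\<in>X. \<Sum>b<q. of_bool (x mod q = b) * of_bool (x' mod q = b))"
      by (simp only: sum.swap[where A = "{..<q}"])
    also have "\<dots> = (\<Sum>x\<in>X. \<Sum>x'\<in>X. of_bool ([x = x'] (mod q)))"
      by (intro sum.cong refl) (auto simp: delta Cong.cong_def)
    finally have s2: "(\<Sum>b<q. (\<alpha> b)\<^sup>2) = (\<Sum>x\<in>X. \<Sum>x'\<in>X. of_bool ([x = x'] (mod q)))" .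
    have "(\<Sum>b<q. \<alpha> b) = (\<Sum>x\<in>X. \<Sum>b<q. of_bool (x mod q = b) * 1)"
      unfolding \<alpha>_def by (subst sum.swap) simp
    also have "\<dots> = real (card X)" by (subst delta) simp
    finally have s1: "(\<Sum>b<q. \<alpha> b) = real (card X)" .
    have "(\<Sum>b<q. (\<alpha> b - ?m)\<^sup>2) = (\<Sum>b<q. (\<alpha> b)\<^sup>2 - 2 * ?m * \<alpha> b + ?m\<^sup>2)"
      by (rule sum.cong) (simp_all add: power2_diff)
    also have "\<dots> = (\<Sum>b<q. (\<alpha> b)\<^sup>2) - 2 * ?m * (\<Sum>b<q. \<alpha> b) + real q * ?m\<^sup>2"
      by (simp add: sum.distrib sum_subtractf sum_distrib_left)
    also have "\<dots> = (\<Sum>x\<in>X. \<Sum>x'\<in>X. of_bool ([x = x'] (mod q))) - real (card X) * real (card X) / real q"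
      unfolding s1 s2 using q0 by (simp add: power2_eq_square)
    also have "\<dots> = variance X {q}"
      by (simp add: variance_def sum_subtractf)
    finally show ?thesis .
  qed
  have "\<bar>\<Sum>b<q. (\<alpha> b - ?m) * \<Delta> b\<bar>\<^sup>2 \<le> (\<Sum>b<q. (\<alpha> b - ?m)\<^sup>2) * (\<Sum>b<q. (\<Delta> b)\<^sup>2)"
    unfolding power2_abs by (rule Cauchy_Schwarz_ineq_sum)
  then have "\<bar>\<Sum>b<q. (\<alpha> b - ?m) * \<Delta> b\<bar>\<^sup>2 \<le> variance X {q} * variance Y {q}" by (simp only: varX varY)
  then show ?thesis unfolding eq by (intro real_le_rsqrt) simp
qed

section \<open>Selberg's majorant inside a bilinear sum\<close>

definition sifted :: "nat \<Rightarrow> nat set \<Rightarrow> int \<Rightarrow> bool" where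
  "sifted z X n \<longleftrightarrow> (\<forall>p. prime p \<and> p \<le> z \<and> p \<notin> X \<longrightarrow> \<not> int p dvd n)"

definition divisor_indicator :: "nat set \<Rightarrow> int \<Rightarrow> real" where
  "divisor_indicator E n = (\<Prod>p\<in>E. of_bool (int p dvd n))"

lemma divisor_indicator_eq: "finite E \<Longrightarrow> divisor_indicator E n = of_bool (\<forall>p\<in>E. int p dvd n)"
  by (simp add: divisor_indicator_def of_bool_Ball_eq_prod)

text \<open>For a sifted \<open>n\<close> only the empty set survives in the sum, and its weight is
  1; for any other \<open>n\<close> a square is nonnegative.\<close>

lemma selberg_upper_bound:
  assumes z: "z \<ge> 1"
  shows "of_bool (sifted z X n) \<le> (\<Sum>E\<in>sieve_family z X. selberg_weight z X E * divisor_indicator E n)\<^sup>2"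
proof (cases "sifted z X n")
  case True
  have "(\<Sum>E\<in>sieve_family z X. selberg_weight z X E * divisor_indicator E n)
      = (\<Sum>E\<in>{{}}. selberg_weight z X E * divisor_indicator E n)"
  proof (rule sum.mono_neutral_right)
    show "{{}} \<subseteq> sieve_family z X" using empty_in_sieve_family[OF z] by simp
    show "\<forall>E\<in>sieve_family z X - {{}}. selberg_weight z X E * divisor_indicator E n = 0"
    proof
      fix E assume E: "E \<in> sieve_family z X - {{}}"
      then obtain p where p: "p \<in> E" by auto
      have "prime p" "p \<notin> X" "p \<le> z"
        using E p sieve_family_prime_set[of E z X] prime_sets_upto_subset[of E z]
        by (auto simp: prime_set_def sieve_family_def)
      then have "\<not> int p dvd n" using True by (auto simp: sifted_def)
      moreover have "finite E" using E sieve_family_prime_set[of E z X] prime_set_finite by blast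
      ultimately have "divisor_indicator E n = 0" using p by (auto simp: divisor_indicator_eq)
      then show "selberg_weight z X E * divisor_indicator E n = 0" by simp
    qed
  qed (rule finite_sieve_family)
  then show ?thesis using selberg_weight_empty[OF z, of X] by (simp add: divisor_indicator_def)
qed simp

lemma divisor_indicator_mult:
  assumes "finite E" "finite F"
  shows "divisor_indicator {p} n * (divisor_indicator E n * divisor_indicator F n)
    = divisor_indicator (insert p (E \<union> F)) n"
  using assms by (auto simp: divisor_indicator_eq)

text \<open>The least common multiple of two sieve divisors is at most \<open>z ^ 2\<close>, and it
  does not contain \<open>p\<close> because \<open>p\<close> is exempt from sieving; hence the
  modulus is squarefree and at most \<open>p * z ^ 2\<close>.\<close>

lemma insert_Un_in_prime_sets_upto:
  assumes "prime p" "E \<in> sieve_family z X" "F \<in> sieve_family z X" "p \<in> X" "p * z ^ 2 \<le> R"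
  shows "insert p (E \<union> F) \<in> prime_sets_upto R"
    "\<Prod>(insert p (E \<union> F)) = p * \<Prod>(E \<union> F)" "insert p (E \<union> F) \<inter> (X - {p}) = {}"
proof -
  have ps: "prime_set E" "prime_set F" using assms sieve_family_prime_set by blast+
  then have fin: "finite E" "finite F" by (auto dest: prime_set_finite)
  have le: "\<Prod>E \<le> z" "\<Prod>F \<le> z" "E \<inter> X = {}" "F \<inter> X = {}"
    using assms by (auto simp: sieve_family_def prime_sets_upto_def)
  have "\<Prod>(E \<union> F) * \<Prod>(E \<inter> F) = \<Prod>E * \<Prod>F" using fin by (rule prod.union_inter)
  moreover have "\<Prod>(E \<inter> F) \<ge> 1"
    using prod_prime_set_pos[OF prime_set_subset[OF ps(1), of "E \<inter> F"]] by simp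
  ultimately have "\<Prod>(E \<union> F) \<le> \<Prod>E * \<Prod>F"
    by (metis mult.right_neutral mult_le_mono2)
  also have "\<dots> \<le> z ^ 2" using le mult_le_mono by (simp add: power2_eq_square)
  finally have *: "p * \<Prod>(E \<union> F) \<le> R" using assms(5) by (meson le_trans mult_le_mono2)
  show eq: "\<Prod>(insert p (E \<union> F)) = p * \<Prod>(E \<union> F)"
    using fin le assms(4) by (subst prod.insert) auto
  show "insert p (E \<union> F) \<in> prime_sets_upto R"
    using * ps assms(1) unfolding prime_sets_upto_def eq[symmetric]
    by (simp add: prime_set_insert prime_set_Un)
  show "insert p (E \<union> F) \<inter> (X - {p}) = {}" using le by auto
qed

text \<open>Errors are collected by modulus. A modulus \<open>U\<close> arises from at most
  \<open>card U * 4 ^ card U \<le> 8 ^ card U\<close> triples \<open>(p, E, F)\<close>; together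
  with the factor \<open>4 ^ card U\<close> from the sieve weights this gives 32.\<close>

lemma sum_sieve_pairs_le:
  fixes g :: "nat set \<Rightarrow> real"
  assumes P: "finite P" "\<And>p. p \<in> P \<Longrightarrow> prime p" "\<And>p. p \<in> P \<Longrightarrow> p * z ^ 2 \<le> R"
    and g: "\<And>U. g U \<ge> 0"
  shows "(\<Sum>p\<in>P. \<Sum>E\<in>sieve_family z (insert p B). \<Sum>F\<in>sieve_family z (insert p B).
      4 ^ card (insert p (E \<union> F)) * g (insert p (E \<union> F)))
    \<le> (\<Sum>U\<in>prime_sets_upto R. 32 ^ card U * g U)"
proof -
  let ?\<E> = "\<lambda>p. sieve_family z (insert p B)"
  define I where "I = (SIGMA p:P. ?\<E> p \<times> ?\<E> p)"
  define h where "h = (\<lambda>(p, E, F). insert p (E \<union> F) :: nat set)"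
  have finI: "finite I" unfolding I_def using P(1) finite_sieve_family by auto
  have img: "h ` I \<subseteq> prime_sets_upto R"
  proof (rule image_subsetI)
    fix i assume "i \<in> I"
    then obtain p E F where i: "i = (p, E, F)" "p \<in> P" "E \<in> ?\<E> p" "F \<in> ?\<E> p" by (auto simp: I_def)
    then show "h i \<in> prime_sets_upto R"
      using insert_Un_in_prime_sets_upto(1)[of p E z "insert p B" F R] P by (simp add: h_def)
  qed
  have "(\<Sum>p\<in>P. \<Sum>E\<in>?\<E> p. \<Sum>F\<in>?\<E> p. 4 ^ card (insert p (E \<union> F)) * g (insert p (E \<union> F)))
      = (\<Sum>p\<in>P. \<Sum>x\<in>?\<E> p \<times> ?\<E> p. 4 ^ card (h (p, x)) * g (h (p, x)))"
    by (simp add: sum.cartesian_product h_def case_prod_beta)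
  also have "\<dots> = (\<Sum>i\<in>I. 4 ^ card (h i) * g (h i))"
    unfolding I_def using P(1) finite_sieve_family by (subst sum.Sigma) auto
  also have "\<dots> = (\<Sum>U\<in>prime_sets_upto R. \<Sum>i | i \<in> I \<and> h i = U. 4 ^ card (h i) * g (h i))"
    by (rule sum.group[OF finI finite_prime_sets_upto img, symmetric])
  also have "\<dots> \<le> (\<Sum>U\<in>prime_sets_upto R. 32 ^ card U * g U)"
  proof (rule sum_mono)
    fix U assume U: "U \<in> prime_sets_upto R"
    have finU: "finite U" using U prime_set_finite by (auto simp: prime_sets_upto_def)
    have "card {i. i \<in> I \<and> h i = U} \<le> card (U \<times> Pow U \<times> Pow U)"
      by (rule card_mono) (use finU in \<open>auto simp: I_def h_def\<close>)
    also have "\<dots> = card U * (2 ^ card U * 2 ^ card U)"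
      using finU by (simp add: card_cartesian_product card_Pow)
    also have "\<dots> \<le> 2 ^ card U * (2 ^ card U * 2 ^ card U)"
      by (intro mult_le_mono1 less_imp_le less_exp)
    also have "\<dots> = 8 ^ card U" by (simp flip: power_mult_distrib)
    finally have "real (card {i. i \<in> I \<and> h i = U}) \<le> real (8 ^ card U)" by (rule of_nat_mono)
    then have c8: "real (card {i. i \<in> I \<and> h i = U}) \<le> 8 ^ card U" by simp
    have "(\<Sum>i | i \<in> I \<and> h i = U. 4 ^ card (h i) * g (h i)) = (\<Sum>i | i \<in> I \<and> h i = U. 4 ^ card U * g U)"
      by (rule sum.cong) auto
    also have "\<dots> = real (card {i. i \<in> I \<and> h i = U}) * (4 ^ card U * g U)" by simp
    also have "\<dots> \<le> 8 ^ card U * (4 ^ card U * g U)"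
      using c8 g by (intro mult_right_mono) auto
    also have "\<dots> = 32 ^ card U * g U" by (simp flip: power_mult_distrib mult.assoc)
    finally show "(\<Sum>i | i \<in> I \<and> h i = U. 4 ^ card (h i) * g (h i)) \<le> 32 ^ card U * g U" .
  qed
  finally show ?thesis .
qed

text \<open>The discrepancy modulo \<open>\<Prod>S\<close>: when this is small, every single \<open>q\<close> sees \<open>m\<close> run through long intervals;
  otherwise Cauchy-Schwarz leads to the variance, which the large sieve bounds on average over \<open>S\<close>.\<close>

definition level_error :: "nat \<Rightarrow> nat \<Rightarrow> nat set \<Rightarrow> nat set \<Rightarrow> nat set \<Rightarrow> real" where
  "level_error S\<^sub>0 M B Q S = (if \<Prod>S \<le> S\<^sub>0 then real (card Q) * (real (\<Prod>B) * 2 ^ card S)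
     else sqrt (real M * (real M / real (\<Prod>S) + 1) * \<bar>variance Q S\<bar>))"

lemma level_error_nonneg: "level_error S\<^sub>0 M B Q S \<ge> 0"
proof -
  have "real (\<Prod>A) \<ge> 0" for A by (rule of_nat_0_le_iff)
  then show ?thesis by (auto simp: level_error_def simp del: of_nat_prod)
qed

lemma level_error_bound:
  fixes a :: int
  assumes B: "prime_set B" and S: "prime_set S" and disj: "B \<inter> S = {}" and n: "n \<le> M"
    and a: "\<And>p. p \<in> S \<Longrightarrow> \<not> int p dvd a" and q: "\<And>p q. p \<in> S \<Longrightarrow> q \<in> Q \<Longrightarrow> \<not> p dvd q"
    and S\<^sub>0: "S\<^sub>0 \<ge> 1"
  shows "\<bar>(\<Sum>q\<in>Q. \<Sum>m\<in>{lo..<lo + n}. of_bool (avoids B m) * centred a S q m)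
     - of_bool (S = {}) * (real (card Q) * (real n * (\<Prod>p\<in>B. 1 - 1 / real p)))\<bar> \<le> level_error S\<^sub>0 M B Q S"
proof (cases "\<Prod>S \<le> S\<^sub>0")
  case True
  let ?K = "of_bool (S = {}) * (real n * (\<Prod>p\<in>B. 1 - 1 / real p))"
  have "\<bar>(\<Sum>q\<in>Q. \<Sum>m\<in>{lo..<lo + n}. of_bool (avoids B m) * centred a S q m)
     - of_bool (S = {}) * (real (card Q) * (real n * (\<Prod>p\<in>B. 1 - 1 / real p)))\<bar>
    = \<bar>\<Sum>q\<in>Q. (\<Sum>m\<in>{lo..<lo + n}. of_bool (avoids B m) * centred a S q m) - ?K\<bar>"
    by (simp add: sum_subtractf)
  also have "\<dots> \<le> (\<Sum>q\<in>Q. \<bar>(\<Sum>m\<in>{lo..<lo + n}. of_bool (avoids B m) * centred a S q m) - ?K\<bar>)"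
    by (rule sum_abs)
  also have "\<dots> \<le> (\<Sum>q\<in>Q. real (\<Prod>B) * 2 ^ card S)"
    using B S disj q by (intro sum_mono sum_centred_small) auto
  also have "\<dots> = level_error S\<^sub>0 M B Q S" using True by (simp add: level_error_def)
  finally show ?thesis .
next
  case False
  \<comment> \<open>Because \<open>S\<^sub>0 \<ge> 1\<close>, the empty set belongs to the first
    case and no main term is left here.\<close>
  then have "S \<noteq> {}" using S\<^sub>0 by auto
  then have "\<bar>(\<Sum>q\<in>Q. \<Sum>m\<in>{lo..<lo + n}. of_bool (avoids B m) * centred a S q m)
     - of_bool (S = {}) * (real (card Q) * (real n * (\<Prod>p\<in>B. 1 - 1 / real p)))\<bar>
     = \<bar>\<Sum>q\<in>Q. \<Sum>m\<in>{lo..<lo + n}. of_bool (avoids B m) * centred a S q m\<bar>" by simp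
  also have "\<dots> \<le> sqrt (real n * (real n / real (\<Prod>S) + 1) * variance Q S)"
    using S a q by (rule sum_centred_large)
  also have "\<dots> \<le> level_error S\<^sub>0 M B Q S"
    unfolding level_error_def using False n
    by (auto intro!: mult_mono divide_right_mono add_mono mult_nonneg_nonneg divide_nonneg_nonneg variance_nonneg S
          simp del: of_nat_prod)
  finally show ?thesis .
qed

text \<open>Selberg's majorant is opened into pairs \<open>E\<close>, \<open>F\<close>, each of
  which asks for divisibility of \<open>q * m - a\<close> by \<open>p\<close> times a least common
  multiple; \<open>bilinear_count\<close> applies. The main terms reassemble into the quadratic
  form. The primes dividing \<open>a\<close> are exempt from the sieve, and the condition
  \<open>avoids B m\<close> is counted exactly in their place.\<close>

lemma sieve_bilinear_upper:
  fixes a :: int and lo len :: "nat \<Rightarrow> nat"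
  assumes B: "prime_set B" and aB: "\<And>p. prime p \<Longrightarrow> int p dvd a \<longleftrightarrow> p \<in> B"
    and P: "finite P" "\<And>p. p \<in> P \<Longrightarrow> prime p" "\<And>p. p \<in> P \<Longrightarrow> p \<notin> B" "\<And>p. p \<in> P \<Longrightarrow> p * z ^ 2 \<le> R"
    and len: "\<And>p. p \<in> P \<Longrightarrow> len p \<le> M" and z: "z \<ge> 1" and S\<^sub>0: "S\<^sub>0 \<ge> 1"
    and Q: "\<And>p q. prime p \<Longrightarrow> p \<le> R \<Longrightarrow> q \<in> Q \<Longrightarrow> \<not> p dvd q"
  shows "(\<Sum>p\<in>P. \<Sum>q\<in>Q. \<Sum>m\<in>{lo p..<lo p + len p}. of_bool (avoids B m \<and>
      int p dvd int q * int m - a \<and> sifted z (insert p B) (int q * int m - a)))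
    \<le> (\<Sum>p\<in>P. real (card Q) * (real (len p) * (\<Prod>r\<in>B. 1 - 1 / real r)) / real p / sieve_sum z (insert p B))
      + (\<Sum>U\<in>prime_sets_upto R. 32 ^ card U * (\<Sum>S\<in>Pow U. level_error S\<^sub>0 M B Q S * (\<Prod>p\<in>U - S. 1 / real p)))"
proof -
  let ?\<beta> = "level_error S\<^sub>0 M B Q"
  let ?\<E> = "\<lambda>p. sieve_family z (insert p B)"
  let ?\<rho> = "\<lambda>p. selberg_weight z (insert p B)"
  let ?X = "\<lambda>p. real (card Q) * (real (len p) * (\<Prod>r\<in>B. 1 - 1 / real r))"
  define err where "err U = (\<Sum>S\<in>Pow U. ?\<beta> S * (\<Prod>p\<in>U - S. 1 / real p))" for U
  have err0: "err U \<ge> 0" for U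
    unfolding err_def by (intro sum_nonneg mult_nonneg_nonneg prod_nonneg level_error_nonneg) auto
  have each: "(\<Sum>q\<in>Q. \<Sum>m\<in>{lo p..<lo p + len p}. of_bool (avoids B m \<and>
      int p dvd int q * int m - a \<and> sifted z (insert p B) (int q * int m - a)))
    \<le> ?X p / real p / sieve_sum z (insert p B)
      + (\<Sum>E\<in>?\<E> p. \<Sum>F\<in>?\<E> p. 4 ^ card (insert p (E \<union> F)) * err (insert p (E \<union> F)))"
    if p: "p \<in> P" for p
  proof -
    let ?J = "{lo p..<lo p + len p}"
    let ?n = "\<lambda>q m. int q * int m - a"
    let ?U = "\<lambda>E F. insert p (E \<union> F)"
    let ?N = "\<lambda>U. \<Sum>q\<in>Q. \<Sum>m\<in>?J. of_bool (avoids B m) * divisor_indicator U (?n q m)"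
    have prime_p: "prime p" using P p by auto
    then have p0: "p > 0" by (rule prime_gt_0_nat)
    have fin: "finite E" if "E \<in> ?\<E> p" for E
      using sieve_family_prime_set[OF that] by (rule prime_set_finite)
    have U: "?U E F \<in> prime_sets_upto R" "\<Prod>(?U E F) = p * \<Prod>(E \<union> F)" "?U E F \<inter> B = {}"
      if "E \<in> ?\<E> p" "F \<in> ?\<E> p" for E F
      using insert_Un_in_prime_sets_upto[OF prime_p that, of R] P p by auto
    have count: "\<bar>?N (?U E F) - ?X p / real (\<Prod>(?U E F))\<bar> \<le> err (?U E F)"
      if EF: "E \<in> ?\<E> p" "F \<in> ?\<E> p" for E F
    proof -
      let ?V = "?U E F"
      have V: "prime_set ?V" "?V \<subseteq> {..R}"
        using U(1)[OF EF] prime_sets_upto_subset by (auto simp: prime_sets_upto_def)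
      have "\<bar>(\<Sum>q\<in>Q. \<Sum>m\<in>?J. of_bool (avoids B m) * centred a S q m) - of_bool (S = {}) * ?X p\<bar> \<le> ?\<beta> S"
        if S: "S \<subseteq> ?V" for S
      proof (rule level_error_bound[OF B _ _ _ _ _ S\<^sub>0])
        show "prime_set S" using V S prime_set_subset by blast
        show "B \<inter> S = {}" using U(3)[OF EF] S by auto
        show "len p \<le> M" using len p by simp
        show "\<not> int r dvd a" if "r \<in> S" for r
        proof -
          have "r \<in> ?V" "r \<notin> B" using that S U(3)[OF EF] by auto
          then show ?thesis using V(1) aB[of r] prime_set_prime by blast
        qed
        show "\<not> r dvd q" if "r \<in> S" "q \<in> Q" for r q
        proof -
          have "r \<in> ?V" using that S by blast
          then have "prime r" "r \<le> R" using V prime_set_prime by blast+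
          then show ?thesis using Q that by blast
        qed
      qed
      then show ?thesis
        unfolding err_def divisor_indicator_def by (rule bilinear_count[OF V(1)])
    qed
    have "(\<Sum>q\<in>Q. \<Sum>m\<in>?J. of_bool (avoids B m \<and> int p dvd ?n q m \<and> sifted z (insert p B) (?n q m)))
        \<le> (\<Sum>q\<in>Q. \<Sum>m\<in>?J. of_bool (avoids B m) * (divisor_indicator {p} (?n q m) *
            (\<Sum>E\<in>?\<E> p. ?\<rho> p E * divisor_indicator E (?n q m))\<^sup>2))"
    proof (intro sum_mono)
      fix q m
      have "of_bool (avoids B m \<and> int p dvd ?n q m \<and> sifted z (insert p B) (?n q m))
          = of_bool (avoids B m) * (divisor_indicator {p} (?n q m) * of_bool (sifted z (insert p B) (?n q m)))"
        by (simp add: divisor_indicator_def)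
      also have "\<dots> \<le> of_bool (avoids B m) * (divisor_indicator {p} (?n q m) *
            (\<Sum>E\<in>?\<E> p. ?\<rho> p E * divisor_indicator E (?n q m))\<^sup>2)"
        by (intro mult_left_mono selberg_upper_bound z) (auto simp: divisor_indicator_def)
      finally show "of_bool (avoids B m \<and> int p dvd ?n q m \<and> sifted z (insert p B) (?n q m))
          \<le> of_bool (avoids B m) * (divisor_indicator {p} (?n q m) *
            (\<Sum>E\<in>?\<E> p. ?\<rho> p E * divisor_indicator E (?n q m))\<^sup>2)" .
    qed
    also have "\<dots> = (\<Sum>q\<in>Q. \<Sum>m\<in>?J. \<Sum>E\<in>?\<E> p. \<Sum>F\<in>?\<E> p. ?\<rho> p E * ?\<rho> p F *
        (of_bool (avoids B m) * divisor_indicator (?U E F) (?n q m)))"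
    proof (intro sum.cong refl)
      fix q m
      have "of_bool (avoids B m) * (divisor_indicator {p} (?n q m) *
            (\<Sum>E\<in>?\<E> p. ?\<rho> p E * divisor_indicator E (?n q m))\<^sup>2)
        = (\<Sum>E\<in>?\<E> p. \<Sum>F\<in>?\<E> p. of_bool (avoids B m) * (divisor_indicator {p} (?n q m) *
            ((?\<rho> p E * divisor_indicator E (?n q m)) * (?\<rho> p F * divisor_indicator F (?n q m)))))"
      proof -
        have "(\<Sum>E\<in>?\<E> p. ?\<rho> p E * divisor_indicator E (?n q m))\<^sup>2
          = (\<Sum>E\<in>?\<E> p. \<Sum>F\<in>?\<E> p. (?\<rho> p E * divisor_indicator E (?n q m)) * (?\<rho> p F * divisor_indicator F (?n q m)))"
          by (simp only: power2_eq_square sum_product)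
        then show ?thesis by (simp only: sum_distrib_left)
      qed
      also have "\<dots> = (\<Sum>E\<in>?\<E> p. \<Sum>F\<in>?\<E> p. ?\<rho> p E * ?\<rho> p F *
        (of_bool (avoids B m) * divisor_indicator (?U E F) (?n q m)))"
        by (intro sum.cong refl) (simp add: fin mult_ac flip: divisor_indicator_mult)
      finally show "of_bool (avoids B m) * (divisor_indicator {p} (?n q m) *
            (\<Sum>E\<in>?\<E> p. ?\<rho> p E * divisor_indicator E (?n q m))\<^sup>2)
        = (\<Sum>E\<in>?\<E> p. \<Sum>F\<in>?\<E> p. ?\<rho> p E * ?\<rho> p F *
        (of_bool (avoids B m) * divisor_indicator (?U E F) (?n q m)))" .
    qed
    also have "\<dots> = (\<Sum>E\<in>?\<E> p. \<Sum>F\<in>?\<E> p. \<Sum>q\<in>Q. \<Sum>m\<in>?J. ?\<rho> p E * ?\<rho> p F *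
        (of_bool (avoids B m) * divisor_indicator (?U E F) (?n q m)))"
      by (simp only: sum.swap[where A = ?J and B = "?\<E> p"] sum.swap[where A = Q and B = "?\<E> p"])
    also have "\<dots> = (\<Sum>E\<in>?\<E> p. \<Sum>F\<in>?\<E> p. ?\<rho> p E * ?\<rho> p F * ?N (?U E F))"
      by (simp only: sum_distrib_left)
    also have "\<dots> \<le> (\<Sum>E\<in>?\<E> p. \<Sum>F\<in>?\<E> p. ?X p / real p * (?\<rho> p E * ?\<rho> p F / real (\<Prod>(E \<union> F)))
        + 4 ^ card (?U E F) * err (?U E F))"
    proof (intro sum_mono)
      fix E F assume EF: "E \<in> ?\<E> p" "F \<in> ?\<E> p"
      have "card E \<le> card (?U E F)" "card F \<le> card (?U E F)"
        using fin EF by (auto intro!: card_mono)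
      then have "(2::real) ^ card E * 2 ^ card F \<le> 2 ^ card (?U E F) * 2 ^ card (?U E F)"
        by (intro mult_mono power_increasing) auto
      also have "\<dots> = 4 ^ card (?U E F)" by (simp flip: power_mult_distrib)
      finally have "\<bar>?\<rho> p E * ?\<rho> p F\<bar> \<le> 4 ^ card (?U E F)"
        using mult_mono[OF abs_selberg_weight_le[OF EF(1) z] abs_selberg_weight_le[OF EF(2) z]]
        by (simp add: abs_mult)
      then have "\<bar>?\<rho> p E * ?\<rho> p F * (?N (?U E F) - ?X p / real (\<Prod>(?U E F)))\<bar> \<le> 4 ^ card (?U E F) * err (?U E F)"
        unfolding abs_mult[of "?\<rho> p E * ?\<rho> p F"] using count[OF EF] by (intro mult_mono) auto
      then have "?\<rho> p E * ?\<rho> p F * ?N (?U E F) - ?\<rho> p E * ?\<rho> p F * (?X p / real (\<Prod>(?U E F))) \<le> 4 ^ card (?U E F) * err (?U E F)"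
        unfolding right_diff_distrib by linarith
      moreover have "?\<rho> p E * ?\<rho> p F * (?X p / real (\<Prod>(?U E F))) = ?X p / real p * (?\<rho> p E * ?\<rho> p F / real (\<Prod>(E \<union> F)))"
        unfolding U(2)[OF EF] of_nat_mult by (simp only: times_divide_times_eq mult_ac times_divide_eq_right divide_divide_eq_left)
      ultimately show "?\<rho> p E * ?\<rho> p F * ?N (?U E F) \<le> ?X p / real p * (?\<rho> p E * ?\<rho> p F / real (\<Prod>(E \<union> F)))
        + 4 ^ card (?U E F) * err (?U E F)" by linarith
    qed
    also have "\<dots> = ?X p / real p * (\<Sum>E\<in>?\<E> p. \<Sum>F\<in>?\<E> p. ?\<rho> p E * ?\<rho> p F / real (\<Prod>(E \<union> F)))
        + (\<Sum>E\<in>?\<E> p. \<Sum>F\<in>?\<E> p. 4 ^ card (?U E F) * err (?U E F))"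
      by (simp only: sum.distrib sum_distrib_left)
    also have "(\<Sum>E\<in>?\<E> p. \<Sum>F\<in>?\<E> p. ?\<rho> p E * ?\<rho> p F / real (\<Prod>(E \<union> F))) = 1 / sieve_sum z (insert p B)"
      by (rule selberg_quadratic_form[OF z])
    finally show ?thesis by (simp only: times_divide_eq_right mult_1_right)
  qed
  have "(\<Sum>p\<in>P. \<Sum>q\<in>Q. \<Sum>m\<in>{lo p..<lo p + len p}. of_bool (avoids B m \<and>
      int p dvd int q * int m - a \<and> sifted z (insert p B) (int q * int m - a)))
    \<le> (\<Sum>p\<in>P. ?X p / real p / sieve_sum z (insert p B)
      + (\<Sum>E\<in>?\<E> p. \<Sum>F\<in>?\<E> p. 4 ^ card (insert p (E \<union> F)) * err (insert p (E \<union> F))))"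
    by (rule sum_mono) (rule each)
  also have "\<dots> = (\<Sum>p\<in>P. ?X p / real p / sieve_sum z (insert p B))
      + (\<Sum>p\<in>P. \<Sum>E\<in>?\<E> p. \<Sum>F\<in>?\<E> p. 4 ^ card (insert p (E \<union> F)) * err (insert p (E \<union> F)))"
    by (rule sum.distrib)
  also have "\<dots> \<le> (\<Sum>p\<in>P. ?X p / real p / sieve_sum z (insert p B)) + (\<Sum>U\<in>prime_sets_upto R. 32 ^ card U * err U)"
    by (intro add_left_mono sum_sieve_pairs_le P err0)
  finally show ?thesis unfolding err_def .
qed

text \<open>At most \<open>S\<^sub>0\<close> moduli use the trivial error. For the others,
  Cauchy-Schwarz over the moduli is arranged to meet the weights \<open>\<Prod>S\<close> of the
  large sieve.\<close>

lemma sum_level_error_le: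
  assumes C: "C \<ge> 1" "\<And>U. prime_set U \<Longrightarrow> 32 ^ card U \<le> C * real (\<Prod>U) powr \<epsilon>" and \<epsilon>: "\<epsilon> > 0"
    and R: "R \<ge> 1" and S\<^sub>0: "S\<^sub>0 \<ge> 1" and Q: "Q \<subseteq> {N..<N + L}"
  shows "(\<Sum>U\<in>prime_sets_upto R. 32 ^ card U * (\<Sum>S\<in>Pow U. level_error S\<^sub>0 M B Q S * (\<Prod>p\<in>U - S. 1 / real p)))
    \<le> C * real R powr \<epsilon> * (\<Sum>n\<in>{1..R}. 1 / real n) *
       (real (card Q) * real (\<Prod>B) * C * real R powr \<epsilon> * real S\<^sub>0
        + sqrt (real M * (real M / real S\<^sub>0 + 1)) * sqrt ((\<Sum>n\<in>{1..R}. 1 / real n) * (20 * (real L + real R ^ 2) * real (card Q))))"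
proof -
  let ?H = "\<Sum>n\<in>{1..R}. 1 / real n"
  let ?\<beta> = "level_error S\<^sub>0 M B Q"
  let ?P = "prime_sets_upto R"
  have H0: "?H \<ge> 0" by (intro sum_nonneg) auto
  have ps: "prime_set S" "\<Prod>S \<le> R" "\<Prod>S > 0" if "S \<in> ?P" for S
    using that prod_prime_set_pos[of S] by (auto simp: prime_sets_upto_def)
  have pow: "32 ^ card U \<le> C * real R powr \<epsilon>" if "U \<in> ?P" for U
  proof -
    have "real (\<Prod>U) \<le> real R" using ps(2)[OF that] by (simp only: of_nat_le_iff)
    then have "real (\<Prod>U) powr \<epsilon> \<le> real R powr \<epsilon>" using \<epsilon> by (intro powr_mono2) (auto intro: prod_nonneg)
    then have "C * real (\<Prod>U) powr \<epsilon> \<le> C * real R powr \<epsilon>" using C(1) by (intro mult_left_mono) auto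
    then show ?thesis using C(2)[OF ps(1)[OF that]] by linarith
  qed
  have "(\<Sum>U\<in>?P. 32 ^ card U * (\<Sum>S\<in>Pow U. ?\<beta> S * (\<Prod>p\<in>U - S. 1 / real p)))
      \<le> (\<Sum>U\<in>?P. C * real R powr \<epsilon> * (\<Sum>S\<in>Pow U. ?\<beta> S * (\<Prod>p\<in>U - S. 1 / real p)))"
    by (intro sum_mono mult_right_mono pow sum_nonneg mult_nonneg_nonneg level_error_nonneg prod_nonneg) auto
  also have "\<dots> = C * real R powr \<epsilon> * (\<Sum>U\<in>?P. \<Sum>S\<in>Pow U. ?\<beta> S * (\<Prod>p\<in>U - S. 1 / real p))"
    by (simp only: sum_distrib_left)
  also have "\<dots> \<le> C * real R powr \<epsilon> * (?H * (\<Sum>S\<in>?P. ?\<beta> S))"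
    using C(1) by (intro mult_left_mono sum_over_subsets_le level_error_nonneg) auto
  also have "(\<Sum>S\<in>?P. ?\<beta> S) \<le> real (card Q) * real (\<Prod>B) * C * real R powr \<epsilon> * real S\<^sub>0
        + sqrt (real M * (real M / real S\<^sub>0 + 1)) * sqrt (?H * (20 * (real L + real R ^ 2) * real (card Q)))"
  proof -
    let ?P1 = "{S \<in> ?P. \<Prod>S \<le> S\<^sub>0}" and ?P2 = "{S \<in> ?P. \<not> \<Prod>S \<le> S\<^sub>0}"
    have fin: "finite ?P1" "finite ?P2" using finite_prime_sets_upto by auto
    have "(\<Sum>S\<in>?P. ?\<beta> S) = (\<Sum>S\<in>?P1. ?\<beta> S) + (\<Sum>S\<in>?P2. ?\<beta> S)"
      using fin by (subst sum.union_disjoint[symmetric]) (auto intro!: sum.cong)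
    moreover have "(\<Sum>S\<in>?P1. ?\<beta> S) \<le> real (card Q) * real (\<Prod>B) * C * real R powr \<epsilon> * real S\<^sub>0"
    proof -
      have "(\<Sum>S\<in>?P1. ?\<beta> S) \<le> (\<Sum>S\<in>?P1. real (card Q) * (real (\<Prod>B) * (C * real R powr \<epsilon>)))"
      proof (rule sum_mono)
        fix S assume S: "S \<in> ?P1"
        have "(2::real) ^ card S \<le> 32 ^ card S" by (intro power_mono) auto
        also have "\<dots> \<le> C * real R powr \<epsilon>" using pow S by auto
        finally have "(2::real) ^ card S \<le> C * real R powr \<epsilon>" .
        then have "real (card Q) * (real (\<Prod>B) * 2 ^ card S) \<le> real (card Q) * (real (\<Prod>B) * (C * real R powr \<epsilon>))"
          by (intro mult_left_mono) (auto intro: prod_nonneg)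
        then show "?\<beta> S \<le> real (card Q) * (real (\<Prod>B) * (C * real R powr \<epsilon>))"
          using S by (simp add: level_error_def)
      qed
      also have "\<dots> = real (card ?P1) * (real (card Q) * (real (\<Prod>B) * (C * real R powr \<epsilon>)))" by simp
      also have "\<dots> \<le> real S\<^sub>0 * (real (card Q) * (real (\<Prod>B) * (C * real R powr \<epsilon>)))"
      proof (rule mult_right_mono)
        have "?P1 \<subseteq> prime_sets_upto S\<^sub>0" by (auto simp: prime_sets_upto_def)
        then have "card ?P1 \<le> card (prime_sets_upto S\<^sub>0)" by (intro card_mono finite_prime_sets_upto)
        also have "\<dots> \<le> S\<^sub>0" by (rule card_prime_sets_upto_le)
        finally show "real (card ?P1) \<le> real S\<^sub>0" by simp
      qed (use C(1) in \<open>auto intro!: mult_nonneg_nonneg prod_nonneg\<close>)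
      finally show ?thesis by (simp only: mult_ac)
    qed
    moreover have "(\<Sum>S\<in>?P2. ?\<beta> S) \<le> sqrt (real M * (real M / real S\<^sub>0 + 1)) * sqrt (?H * (20 * (real L + real R ^ 2) * real (card Q)))"
    proof -
      let ?K = "real M * (real M / real S\<^sub>0 + 1)"
      have "(\<Sum>S\<in>?P2. ?\<beta> S) \<le> (\<Sum>S\<in>?P2. sqrt ?K * sqrt (variance Q S))"
      proof (rule sum_mono)
        fix S assume S: "S \<in> ?P2"
        then have v: "variance Q S \<ge> 0" using ps(1) variance_nonneg by auto
        have "real S\<^sub>0 \<le> real (\<Prod>S)" using S by (simp only: of_nat_le_iff mem_Collect_eq not_le less_imp_le)
        then have "real M / real (\<Prod>S) \<le> real M / real S\<^sub>0" using S\<^sub>0 by (intro divide_left_mono mult_pos_pos) auto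
        then have "real M * (real M / real (\<Prod>S) + 1) * variance Q S \<le> ?K * variance Q S"
          using v by (intro mult_right_mono mult_left_mono add_right_mono) auto
        then have "sqrt (real M * (real M / real (\<Prod>S) + 1) * variance Q S) \<le> sqrt (?K * variance Q S)" by simp
        then show "?\<beta> S \<le> sqrt ?K * sqrt (variance Q S)"
          using S v by (simp add: level_error_def real_sqrt_mult del: of_nat_prod)
      qed
      \<comment> \<open>The split into \<open>1 / \<Prod>S\<close> and
        \<open>\<Prod>S * variance\<close> costs one harmonic sum and makes the second factor the
        quantity bounded by \<open>variance_large_sieve\<close>.\<close>
      also have "\<dots> = sqrt ?K * (\<Sum>S\<in>?P2. sqrt (1 / real (\<Prod>S)) * sqrt (real (\<Prod>S) * variance Q S))"
      proof -
        have "sqrt (variance Q S) = sqrt (1 / real (\<Prod>S)) * sqrt (real (\<Prod>S) * variance Q S)" if "S \<in> ?P2" for S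
        proof -
          have "real (\<Prod>S) \<noteq> 0" using ps(3)[of S] that by (simp del: of_nat_prod)
          then show ?thesis by (simp add: real_sqrt_mult[symmetric] del: of_nat_prod)
        qed
        then have "(\<Sum>S\<in>?P2. sqrt (variance Q S)) = (\<Sum>S\<in>?P2. sqrt (1 / real (\<Prod>S)) * sqrt (real (\<Prod>S) * variance Q S))"
          by (intro sum.cong refl)
        then show ?thesis by (simp only: sum_distrib_left[symmetric])
      qed
      also have "\<dots> \<le> sqrt ?K * sqrt (?H * (20 * (real L + real R ^ 2) * real (card Q)))"
      proof (rule mult_left_mono)
        have "(\<Sum>S\<in>?P2. sqrt (1 / real (\<Prod>S)) * sqrt (real (\<Prod>S) * variance Q S))\<^sup>2
            \<le> (\<Sum>S\<in>?P2. (sqrt (1 / real (\<Prod>S)))\<^sup>2) * (\<Sum>S\<in>?P2. (sqrt (real (\<Prod>S) * variance Q S))\<^sup>2)"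
          by (rule Cauchy_Schwarz_ineq_sum)
        also have "(\<Sum>S\<in>?P2. (sqrt (1 / real (\<Prod>S)))\<^sup>2) = (\<Sum>S\<in>?P2. 1 / real (\<Prod>S))"
          by (intro sum.cong refl real_sqrt_pow2) (simp add: prod_nonneg)
        also have "(\<Sum>S\<in>?P2. (sqrt (real (\<Prod>S) * variance Q S))\<^sup>2) = (\<Sum>S\<in>?P2. real (\<Prod>S) * variance Q S)"
          by (intro sum.cong refl real_sqrt_pow2 mult_nonneg_nonneg variance_nonneg) (use ps in \<open>auto simp: prod_nonneg\<close>)
        also have "(\<Sum>S\<in>?P2. 1 / real (\<Prod>S)) * (\<Sum>S\<in>?P2. real (\<Prod>S) * variance Q S)
            \<le> ?H * (20 * (real L + real R ^ 2) * real (card Q))"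
        proof (rule mult_mono)
          have "(\<Sum>S\<in>?P2. 1 / real (\<Prod>S)) \<le> (\<Sum>S\<in>?P. 1 / real (\<Prod>S))"
            by (rule sum_mono2) (auto simp: finite_prime_sets_upto prod_nonneg)
          then show "(\<Sum>S\<in>?P2. 1 / real (\<Prod>S)) \<le> ?H" using sum_inverse_prime_sets_le[of R] by linarith
          show "(\<Sum>S\<in>?P2. real (\<Prod>S) * variance Q S) \<le> 20 * (real L + real R ^ 2) * real (card Q)"
            using R Q by (intro variance_large_sieve) auto
          show "0 \<le> (\<Sum>S\<in>?P2. real (\<Prod>S) * variance Q S)"
            by (intro sum_nonneg mult_nonneg_nonneg variance_nonneg) (use ps in \<open>auto simp: prod_nonneg\<close>)
        qed (rule H0)
        finally show "(\<Sum>S\<in>?P2. sqrt (1 / real (\<Prod>S)) * sqrt (real (\<Prod>S) * variance Q S))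
            \<le> sqrt (?H * (20 * (real L + real R ^ 2) * real (card Q)))"
          by (rule real_le_rsqrt)
      qed simp
      finally show ?thesis .
    qed
    ultimately show ?thesis by linarith
  qed
  finally show ?thesis
    using C(1) H0 by (simp add: mult_left_mono mult.assoc)
qed

section \<open>Short blocks of primes\<close>

definition primes_ln_sum :: "real \<Rightarrow> real \<Rightarrow> real" where
  "primes_ln_sum u v = (\<Sum>p | prime p \<and> u < real p \<and> real p \<le> v. ln (real p) / real p)"

lemma finite_primes_between: "finite {p::nat. prime p \<and> u < real p \<and> real p \<le> v}"
  by (rule finite_subset[of _ "{..nat \<lfloor>v\<rfloor>}"]) (auto simp: le_nat_floor)

text \<open>Mertens' estimate is taken at the integer parts of the end points; passing from
  \<open>t\<close> to its integer part changes the logarithm by at most \<open>ln 2\<close>.\<close>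

lemma primes_ln_sum_bounds:
  "\<exists>C>0. \<forall>u\<ge>1. \<forall>v\<ge>u. \<bar>primes_ln_sum u v - ln (v / u)\<bar> \<le> C"
proof -
  obtain C where C: "C > 0" "\<And>n. n \<ge> 1 \<Longrightarrow> \<bar>(\<Sum>p | prime p \<and> p \<le> n. ln (real p) / real p) - ln (real n)\<bar> \<le> C"
    using mertens by blast
  define M where "M t = (\<Sum>p | prime p \<and> real p \<le> t. ln (real p) / real p)" for t
  have M: "\<bar>M t - ln t\<bar> \<le> C + ln 2" if "t \<ge> 1" for t
  proof -
    define n where "n = nat \<lfloor>t\<rfloor>"
    have n: "n \<ge> 1" "real n \<le> t" "t \<le> 2 * real n"
    proof -
      have "\<lfloor>t\<rfloor> \<ge> 1" using that by simp
      then have "real n = of_int \<lfloor>t\<rfloor>" by (simp add: n_def)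
      then show "n \<ge> 1" "real n \<le> t" "t \<le> 2 * real n" using \<open>\<lfloor>t\<rfloor> \<ge> 1\<close> by linarith+
    qed
    have "real p \<le> t \<longleftrightarrow> p \<le> n" for p using that unfolding n_def by (simp add: le_nat_floor le_nat_iff le_floor_iff)
    then have "M t = (\<Sum>p | prime p \<and> p \<le> n. ln (real p) / real p)" by (simp add: M_def)
    then have "\<bar>M t - ln (real n)\<bar> \<le> C" using C(2)[OF n(1)] by simp
    moreover have "ln (real n) \<le> ln t" using n by simp
    moreover have "ln t \<le> ln 2 + ln (real n)"
    proof -
      have "ln t \<le> ln (2 * real n)" using n that by (subst ln_le_cancel_iff) auto
      then show ?thesis using n(1) by (simp add: ln_mult)
    qed
    ultimately show ?thesis by linarith
  qed
  have diff: "primes_ln_sum u v = M v - M u" if "u \<le> v" for u v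
  proof -
    have fin: "finite {p::nat. prime p \<and> real p \<le> t}" for t
      by (rule finite_subset[of _ "{..nat \<lfloor>t\<rfloor>}"]) (auto simp: le_nat_floor)
    have eq: "{p::nat. prime p \<and> real p \<le> v} = {p. prime p \<and> real p \<le> u} \<union> {p. prime p \<and> u < real p \<and> real p \<le> v}"
      using that by auto
    have "M v = M u + primes_ln_sum u v"
      unfolding M_def primes_ln_sum_def eq
      by (rule sum.union_disjoint) (use fin[of u] finite_primes_between[of u v] in auto)
    then show ?thesis by simp
  qed
  show ?thesis
  proof (intro exI conjI allI impI)
    show "2 * (C + ln 2) > 0" using C(1) by (simp add: add_pos_pos)
    fix u v :: real assume "1 \<le> u" "u \<le> v"
    then have "\<bar>M u - ln u\<bar> \<le> C + ln 2" "\<bar>M v - ln v\<bar> \<le> C + ln 2" using M by auto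
    moreover have "ln (v / u) = ln v - ln u" using \<open>1 \<le> u\<close> \<open>u \<le> v\<close> by (simp add: ln_div)
    ultimately show "\<bar>primes_ln_sum u v - ln (v / u)\<bar> \<le> 2 * (C + ln 2)"
      unfolding diff[OF \<open>u \<le> v\<close>] abs_le_iff distrib_left by (elim conjE) (intro conjI; linarith)
  qed
qed

lemma primes_ln_sum_add:
  assumes "u \<le> v" "v \<le> w"
  shows "primes_ln_sum u w = primes_ln_sum u v + primes_ln_sum v w"
proof -
  have eq: "{p::nat. prime p \<and> u < real p \<and> real p \<le> w}
      = {p. prime p \<and> u < real p \<and> real p \<le> v} \<union> {p. prime p \<and> v < real p \<and> real p \<le> w}"
    using assms by auto
  show ?thesis unfolding primes_ln_sum_def eq
    by (rule sum.union_disjoint) (use finite_primes_between in auto)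
qed

definition prime_block :: "real \<Rightarrow> real \<Rightarrow> nat set" where
  "prime_block \<delta> z = {p. prime p \<and> z < real p \<and> real p \<le> (1 + \<delta>) * z}"

lemma finite_prime_block: "finite (prime_block \<delta> z)"
  unfolding prime_block_def by (rule finite_primes_between)

text \<open>The second-order term matters: sparse and expected block sums agree to first order in
  \<delta>.\<close>

lemma ln_one_plus_ge:
  assumes "0 \<le> (\<delta>::real)"
  shows "\<delta> - \<delta>\<^sup>2 / 2 \<le> ln (1 + \<delta>)"
proof -
  let ?f = "\<lambda>t::real. ln (1 + t) - t + t\<^sup>2 / 2"
  have "?f 0 \<le> ?f \<delta>"
  proof (rule DERIV_nonneg_imp_nondecreasing[OF assms])
    fix t :: real assume t: "0 \<le> t" "t \<le> \<delta>"
    have "(?f has_real_derivative (1 / (1 + t) - 1 + t)) (at t)"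
      using t by (auto intro!: derivative_eq_intros)
    moreover have "1 / (1 + t) - 1 + t = t\<^sup>2 / (1 + t)" using t by (simp add: field_simps power2_eq_square)
    then have "1 / (1 + t) - 1 + t \<ge> 0" using t by simp
    ultimately show "\<exists>y. (?f has_real_derivative y) (at t) \<and> y \<ge> 0" by blast
  qed
  then show ?thesis by simp
qed

text \<open>Mertens' estimate over a long enough interval leaves no room for all short blocks to be sparse;
  one dense block is enough, so the prime number theorem is not needed.\<close>

lemma dense_prime_block_exists:
  assumes \<delta>: "0 < \<delta>" "\<delta> < 1 / 2"
  shows "\<exists>K\<ge>1. \<forall>u\<ge>exp 1. \<exists>z. u \<le> z \<and> z \<le> K * u
    \<and> (1 - 2 * \<delta>) * \<delta> * z \<le> real (card (prime_block \<delta> z)) * ln z"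
proof -
  obtain C where C: "C > 0" "\<And>u v. u \<ge> 1 \<Longrightarrow> v \<ge> u \<Longrightarrow> \<bar>primes_ln_sum u v - ln (v / u)\<bar> \<le> C"
    using primes_ln_sum_bounds by blast
  \<comment> \<open>Over \<open>J\<close> consecutive blocks a deficit of
    \<open>\<delta>\<^sup>2 / 2\<close> each exceeds the error \<open>C\<close> of Mertens'
    estimate.\<close>
  define J where "J = nat \<lceil>2 * C / \<delta>\<^sup>2\<rceil> + 1"
  have J: "real J > 2 * C / \<delta>\<^sup>2" unfolding J_def by linarith
  define K where "K = (1 + \<delta>) ^ J"
  have "K \<ge> 1" using \<delta> by (simp add: K_def one_le_power)
  moreover have "\<exists>z. u \<le> z \<and> z \<le> K * u \<and> (1 - 2 * \<delta>) * \<delta> * z \<le> real (card (prime_block \<delta> z)) * ln z"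
    if u: "u \<ge> exp 1" for u
  proof (rule ccontr)
    assume contra: "\<not> ?thesis"
    have u1: "u \<ge> 1" using u one_le_exp_iff[of 1] by linarith
    have lnu: "ln u \<ge> 1" using u u1 ln_ge_iff[of u 1] by simp
    \<comment> \<open>A sparse block yields at most
      \<open>(1 + \<delta>) * (1 - 2 * \<delta>) * \<delta>\<close>, short of the expected
      \<open>ln (1 + \<delta>)\<close>. The assumption \<open>u \<ge> exp 1\<close> gives
      \<open>ln z \<ge> 1\<close>, which turns the additive change of \<open>ln p\<close> over the
      block into a factor.\<close>
    have step: "primes_ln_sum z ((1 + \<delta>) * z) \<le> \<delta> - \<delta>\<^sup>2" if z: "u \<le> z" "z \<le> K * u" for z
    proof -
      have z1: "z \<ge> 1" using z u1 by linarith
      have lnz: "ln z \<ge> 1" using z lnu u1 ln_le_cancel_iff[of u z] by linarith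
      have card: "real (card (prime_block \<delta> z)) * ln z < (1 - 2 * \<delta>) * \<delta> * z"
        using contra z by force
      have "primes_ln_sum z ((1 + \<delta>) * z) \<le> (\<Sum>p\<in>prime_block \<delta> z. (1 + \<delta>) * ln z / z)"
        unfolding primes_ln_sum_def prime_block_def
      proof (rule sum_mono)
        fix p assume p: "p \<in> {p. prime p \<and> z < real p \<and> real p \<le> (1 + \<delta>) * z}"
        have "ln (real p) \<le> ln ((1 + \<delta>) * z)" using p z1 by simp
        also have "\<dots> = ln (1 + \<delta>) + ln z" using \<delta> z1 by (simp add: ln_mult)
        also have "\<dots> \<le> \<delta> * ln z + ln z"
        proof -
          have "\<delta> * 1 \<le> \<delta> * ln z" using \<delta> lnz by (intro mult_left_mono) auto
          moreover have "ln (1 + \<delta>) \<le> \<delta>" using \<delta> by (intro ln_add_one_self_le_self) simp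
          ultimately show ?thesis by linarith
        qed
        finally have "ln (real p) \<le> (1 + \<delta>) * ln z" by (simp add: distrib_right)
        moreover have "z \<le> real p" using p by simp
        ultimately show "ln (real p) / real p \<le> (1 + \<delta>) * ln z / z"
          using z1 \<delta> lnz by (intro frac_le) auto
      qed
      also have "\<dots> = (1 + \<delta>) / z * (real (card (prime_block \<delta> z)) * ln z)" by simp
      also have "\<dots> \<le> (1 + \<delta>) / z * ((1 - 2 * \<delta>) * \<delta> * z)"
        using card \<delta> z1 by (intro mult_left_mono) auto
      also have "\<dots> = (1 + \<delta>) * (1 - 2 * \<delta>) * \<delta>" using z1 by simp
      also have "\<dots> \<le> \<delta> - \<delta>\<^sup>2" using \<delta> by (simp add: algebra_simps power2_eq_square)
      finally show ?thesis .
    qed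
    have "primes_ln_sum u ((1 + \<delta>) ^ j * u) \<le> real j * (\<delta> - \<delta>\<^sup>2)" if "j \<le> J" for j
      using that
    proof (induction j)
      case 0
      have empty: "{p::nat. prime p \<and> u < real p \<and> real p \<le> u} = {}" by auto
      show ?case by (simp add: primes_ln_sum_def empty)
    next
      case (Suc j)
      let ?z = "(1 + \<delta>) ^ j * u"
      have z: "u \<le> ?z" using \<delta> u1 by (simp add: one_le_power)
      have zK: "?z \<le> K * u"
        unfolding K_def using \<delta> u1 Suc.prems by (intro mult_right_mono power_increasing) auto
      have z': "?z \<le> (1 + \<delta>) * ?z" using \<delta> z u1 by (simp add: distrib_right)
      have "primes_ln_sum u ((1 + \<delta>) * ?z) = primes_ln_sum u ?z + primes_ln_sum ?z ((1 + \<delta>) * ?z)"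
        by (rule primes_ln_sum_add[OF z z'])
      also have "\<dots> \<le> real j * (\<delta> - \<delta>\<^sup>2) + (\<delta> - \<delta>\<^sup>2)"
        using Suc step[OF z zK] by (intro add_mono) auto
      also have "\<dots> = real (Suc j) * (\<delta> - \<delta>\<^sup>2)" by (simp add: distrib_right)
      finally show ?case by (simp add: mult.assoc)
    qed
    from this[of J] have "primes_ln_sum u (K * u) \<le> real J * (\<delta> - \<delta>\<^sup>2)" by (simp add: K_def)
    moreover have "\<bar>primes_ln_sum u (K * u) - ln (K * u / u)\<bar> \<le> C"
      using C(2)[of u "K * u"] u1 \<open>K \<ge> 1\<close> by simp
    moreover have "ln (K * u / u) = real J * ln (1 + \<delta>)"
      using u1 by (simp add: K_def ln_realpow)
    moreover have "real J * (\<delta> - \<delta>\<^sup>2 / 2) \<le> real J * ln (1 + \<delta>)"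
      using \<delta> by (intro mult_left_mono ln_one_plus_ge) auto
    ultimately have "real J * (\<delta> - \<delta>\<^sup>2 / 2) - C \<le> real J * (\<delta> - \<delta>\<^sup>2)" by linarith
    then have "real J * (\<delta>\<^sup>2 / 2) \<le> C" by (simp add: algebra_simps)
    then have "real J \<le> 2 * C / \<delta>\<^sup>2" using \<delta> by (simp add: field_simps)
    then show False using J by simp
  qed
  ultimately show ?thesis by blast
qed

section \<open>Eventual inequalities between powers and logarithms\<close>

lemma ln_power_le_powr:
  assumes "c > 0" "\<epsilon> > 0"
  shows "eventually (\<lambda>x::real. C * ln x ^ k \<le> \<epsilon> * x powr c) at_top"
proof -
  have "((\<lambda>x::real. ln x ^ k / x powr c) \<longlongrightarrow> 0) at_top"
    using assms by real_asymp
  then have "((\<lambda>x::real. C * (ln x ^ k / x powr c)) \<longlongrightarrow> 0) at_top"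
    by (rule tendsto_mult_right_zero)
  then have "eventually (\<lambda>x::real. C * (ln x ^ k / x powr c) < \<epsilon>) at_top"
    using assms(2) by (rule order_tendstoD)
  then show ?thesis using eventually_gt_at_top[of 0]
    by eventually_elim (simp add: field_simps)
qed

lemma ln_power_le_powr_diff:
  assumes "c > 0"
  shows "eventually (\<lambda>x::real. C * ln x ^ k \<le> x powr c) at_top"
  using ln_power_le_powr[OF assms, of 1 C k] by simp

lemma const_powr_le:
  assumes "a < b"
  shows "eventually (\<lambda>x::real. C * x powr a \<le> x powr b) at_top"
proof -
  have pos: "b - a > 0" using assms by simp
  show ?thesis using ln_power_le_powr_diff[OF pos, of C 0] eventually_gt_at_top[of 0]
  proof eventually_elim
    case (elim x)
    then have "C * x powr a \<le> x powr (b - a) * x powr a" by (intro mult_right_mono) auto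
    then show ?case by (simp flip: powr_add)
  qed
qed

section \<open>Small moduli\<close>

text \<open>This is \<open>T d\<close> for the pairs from \<open>X\<close> and
  \<open>Y\<close>.\<close>

definition shifted_count :: "nat set \<Rightarrow> nat set \<Rightarrow> int \<Rightarrow> nat \<Rightarrow> real" where
  "shifted_count X Y a d = (\<Sum>x\<in>X. \<Sum>y\<in>Y. of_bool (int d dvd int x * int y + a))"

lemma shifted_count_nonneg: "shifted_count X Y a d \<ge> 0"
  by (simp add: shifted_count_def sum_nonneg)

lemma shifted_count_le: "shifted_count X Y a d \<le> real (card X) * real (card Y)"
proof -
  have "shifted_count X Y a d \<le> (\<Sum>x\<in>X. \<Sum>y\<in>Y. 1)"
    unfolding shifted_count_def by (intro sum_mono) simp
  then show ?thesis by simp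
qed

lemma prime_block_window:
  assumes "z \<ge> 0" "\<delta> \<ge> 0"
  shows "\<exists>N L. prime_block \<delta> z \<subseteq> {N..<N + L} \<and> real L \<le> \<delta> * z + 1"
proof (intro exI conjI)
  let ?N = "nat \<lfloor>z\<rfloor> + 1" and ?L = "nat \<lfloor>(1 + \<delta>) * z\<rfloor> - nat \<lfloor>z\<rfloor>"
  have le: "z \<le> (1 + \<delta>) * z" using assms by (simp add: distrib_right)
  then have fl: "nat \<lfloor>z\<rfloor> \<le> nat \<lfloor>(1 + \<delta>) * z\<rfloor>" by (intro nat_mono floor_mono)
  show "prime_block \<delta> z \<subseteq> {?N..<?N + ?L}"
  proof
    fix p assume p: "p \<in> prime_block \<delta> z"
    then have "nat \<lfloor>z\<rfloor> < p" "p \<le> nat \<lfloor>(1 + \<delta>) * z\<rfloor>"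
      using assms by (auto simp: prime_block_def le_nat_floor nat_less_iff floor_less_iff)
    then show "p \<in> {?N..<?N + ?L}" using fl by auto
  qed
  have "real ?L = of_int \<lfloor>(1 + \<delta>) * z\<rfloor> - of_int \<lfloor>z\<rfloor>"
    using fl assms by (simp add: of_nat_diff)
  also have "\<dots> \<le> (1 + \<delta>) * z - z + 1" by linarith
  finally show "real ?L \<le> \<delta> * z + 1" by (simp add: distrib_right)
qed

text \<open>In a dyadic range the weight \<open>q\<close> of the large sieve can be traded for
  \<open>y\<close>. Cauchy-Schwarz over \<open>q\<close> then leaves two large sieve sums over the
  one-element sets \<open>{q}\<close>, with level \<open>2 * y\<close>.\<close>

lemma sum_variance_dyadic:
  assumes X: "X \<subseteq> {N\<^sub>1..<N\<^sub>1 + L\<^sub>1}" and Y: "Y \<subseteq> {N\<^sub>2..<N\<^sub>2 + L\<^sub>2}" and y: "y \<ge> 1"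
  shows "(\<Sum>q | prime q \<and> y < q \<and> q \<le> 2 * y. sqrt (variance X {q} * variance Y {q}))
    \<le> 20 * sqrt (real (card X) * real (card Y)) *
        (sqrt (real L\<^sub>1 * real L\<^sub>2) / real y + 2 * (sqrt (real L\<^sub>1) + sqrt (real L\<^sub>2)) + 4 * real y)"
proof -
  let ?S = "{q. prime q \<and> y < q \<and> q \<le> 2 * y}"
  have fin: "finite ?S" by (rule finite_subset[of _ "{..2 * y}"]) auto
  have v: "variance Z {q} \<ge> 0" if "q \<in> ?S" for Z q using that by (intro variance_nonneg) (simp add: prime_set_def)
  have large: "(\<Sum>q\<in>?S. real q * variance Z {q}) \<le> 20 * (real L + real (2 * y) ^ 2) * real (card Z)"
    if "Z \<subseteq> {N..<N + L}" for Z N L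
  proof -
    have inj: "inj_on (\<lambda>q. {q}) ?S" by (rule inj_onI) simp
    have "(\<Sum>q\<in>?S. real q * variance Z {q}) = (\<Sum>T\<in>(\<lambda>q. {q}) ` ?S. real (\<Prod>T) * variance Z T)"
      by (subst sum.reindex[OF inj]) simp
    also have "\<dots> \<le> 20 * (real L + real (2 * y) ^ 2) * real (card Z)"
      using that y by (intro variance_large_sieve) (auto simp: prime_sets_upto_def prime_set_def)
    finally show ?thesis .
  qed
  have "(\<Sum>q\<in>?S. sqrt (variance X {q} * variance Y {q}))
      \<le> (\<Sum>q\<in>?S. 1 / real y * (sqrt (real q * variance X {q}) * sqrt (real q * variance Y {q})))"
  proof (rule sum_mono)
    fix q assume q: "q \<in> ?S"
    have "sqrt (real q * variance X {q}) * sqrt (real q * variance Y {q}) = real q * sqrt (variance X {q} * variance Y {q})"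
      using v[OF q] by (simp add: real_sqrt_mult)
    moreover have "real y * sqrt (variance X {q} * variance Y {q}) \<le> real q * sqrt (variance X {q} * variance Y {q})"
      using q v[OF q] by (intro mult_right_mono) auto
    ultimately show "sqrt (variance X {q} * variance Y {q})
        \<le> 1 / real y * (sqrt (real q * variance X {q}) * sqrt (real q * variance Y {q}))"
      using y by (simp add: field_simps)
  qed
  also have "\<dots> = 1 / real y * (\<Sum>q\<in>?S. sqrt (real q * variance X {q}) * sqrt (real q * variance Y {q}))"
    by (simp only: sum_distrib_left)
  also have "\<dots> \<le> 1 / real y * sqrt ((20 * (real L\<^sub>1 + real (2 * y) ^ 2) * real (card X)) * (20 * (real L\<^sub>2 + real (2 * y) ^ 2) * real (card Y)))"
  proof (rule mult_left_mono)
    have "(\<Sum>q\<in>?S. sqrt (real q * variance X {q}) * sqrt (real q * variance Y {q}))\<^sup>2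
        \<le> (\<Sum>q\<in>?S. (sqrt (real q * variance X {q}))\<^sup>2) * (\<Sum>q\<in>?S. (sqrt (real q * variance Y {q}))\<^sup>2)"
      by (rule Cauchy_Schwarz_ineq_sum)
    also have "\<dots> = (\<Sum>q\<in>?S. real q * variance X {q}) * (\<Sum>q\<in>?S. real q * variance Y {q})"
      using v by (intro arg_cong2[of _ _ _ _ "(*)"] sum.cong refl real_sqrt_pow2 mult_nonneg_nonneg) auto
    also have "\<dots> \<le> (20 * (real L\<^sub>1 + real (2 * y) ^ 2) * real (card X)) * (20 * (real L\<^sub>2 + real (2 * y) ^ 2) * real (card Y))"
      using large[OF X] large[OF Y] v by (intro mult_mono sum_nonneg mult_nonneg_nonneg) auto
    finally show "(\<Sum>q\<in>?S. sqrt (real q * variance X {q}) * sqrt (real q * variance Y {q}))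
        \<le> sqrt ((20 * (real L\<^sub>1 + real (2 * y) ^ 2) * real (card X)) * (20 * (real L\<^sub>2 + real (2 * y) ^ 2) * real (card Y)))"
      by (rule real_le_rsqrt)
  qed simp
  also have "\<dots> = 20 * sqrt (real (card X) * real (card Y)) * (sqrt (real L\<^sub>1 + (2 * real y) ^ 2) * sqrt (real L\<^sub>2 + (2 * real y) ^ 2) / real y)"
  proof -
    have "(20 * u * c) * (20 * w * d) = 20\<^sup>2 * ((c * d) * (u * w))" for u w c d :: real
      by (simp add: power2_eq_square)
    then show ?thesis by (simp only: real_sqrt_mult of_nat_mult of_nat_numeral) simp
  qed
  also have "\<dots> \<le> 20 * sqrt (real (card X) * real (card Y)) * ((sqrt (real L\<^sub>1) + 2 * real y) * (sqrt (real L\<^sub>2) + 2 * real y) / real y)"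
  proof -
    have "sqrt (l + (2 * real y) ^ 2) \<le> sqrt l + 2 * real y" if "l \<ge> 0" for l
    proof -
      have "sqrt ((2 * real y) ^ 2) = 2 * real y" by (rule real_sqrt_unique) auto
      then show ?thesis using sqrt_add_le_add_sqrt[OF that, of "(2 * real y) ^ 2"] by simp
    qed
    then show ?thesis by (intro mult_left_mono divide_right_mono mult_mono) auto
  qed
  also have "(sqrt (real L\<^sub>1) + 2 * real y) * (sqrt (real L\<^sub>2) + 2 * real y) / real y
      = sqrt (real L\<^sub>1 * real L\<^sub>2) / real y + 2 * (sqrt (real L\<^sub>1) + sqrt (real L\<^sub>2)) + 4 * real y"
    using y by (simp add: field_simps real_sqrt_mult)
  finally show ?thesis .
qed

lemma ln_le_two_sqrt: "x > 0 \<Longrightarrow> ln x \<le> 2 * sqrt x"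
  using ln_bound[of "sqrt x"] by (simp add: ln_sqrt)

text \<open>The term with \<open>1 / y\<close> is largest at the start of the range: by
  \<open>ln (2 * y) \<le> 2 * sqrt (2 * y)\<close> it is dominated by a geometric series of ratio
  \<open>1 / sqrt 2\<close>, which keeps the saving \<open>1 / sqrt l\<close>. The other terms grow
  with \<open>y\<close> and are bounded by their size at the end, times the number of steps.\<close>

lemma sum_variance_dyadic_range:
  assumes X: "X \<subseteq> {N\<^sub>1..<N\<^sub>1 + L\<^sub>1}" and Y: "Y \<subseteq> {N\<^sub>2..<N\<^sub>2 + L\<^sub>2}" and l: "l \<ge> 1"
  shows "(\<Sum>q | prime q \<and> l < q \<and> q \<le> l * 2 ^ i. ln (real q) * sqrt (variance X {q} * variance Y {q}))
    \<le> 20 * sqrt (real (card X) * real (card Y)) *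
        (sqrt (real L\<^sub>1 * real L\<^sub>2) * (3 / sqrt (real l) * (\<Sum>j<i. (1 / sqrt 2) ^ j))
         + real i * ln (real (l * 2 ^ i)) * (2 * (sqrt (real L\<^sub>1) + sqrt (real L\<^sub>2)) + 4 * real (l * 2 ^ i)))"
proof (induction i)
  case 0
  have empty: "{q. prime q \<and> l < q \<and> q \<le> l * 2 ^ 0} = {}" by auto
  show ?case unfolding empty by simp
next
  case (Suc i)
  let ?y = "l * 2 ^ i"
  let ?s = "\<lambda>q. sqrt (variance X {q} * variance Y {q})"
  let ?R = "20 * sqrt (real (card X) * real (card Y))"
  let ?A = "sqrt (real L\<^sub>1 * real L\<^sub>2)" and ?B = "2 * (sqrt (real L\<^sub>1) + sqrt (real L\<^sub>2))"
  let ?f = "\<lambda>j. 3 / sqrt (real l) * (\<Sum>j<j. (1 / sqrt 2) ^ j)"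
  have y: "?y \<ge> 1" using l by simp
  have y': "real (l * 2 ^ Suc i) = 2 * real ?y" by simp
  have "real ?y \<ge> 1" using y by linarith
  then have lny: "0 \<le> ln (2 * real ?y)" by (intro ln_ge_zero) linarith
  have split: "{q. prime q \<and> l < q \<and> q \<le> l * 2 ^ Suc i}
      = {q. prime q \<and> l < q \<and> q \<le> ?y} \<union> {q. prime q \<and> ?y < q \<and> q \<le> 2 * ?y}"
  proof -
    have "l \<le> ?y" "l * 2 ^ Suc i = 2 * ?y" by simp_all
    then have "l < q \<and> q \<le> l * 2 ^ Suc i \<longleftrightarrow> (l < q \<and> q \<le> ?y) \<or> (?y < q \<and> q \<le> 2 * ?y)" for q
      by linarith
    then show ?thesis by blast
  qed
  have fin: "finite {q. prime q \<and> u < q \<and> q \<le> v}" for u v :: nat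
    by (rule finite_subset[of _ "{..v}"]) auto
  have total: "(\<Sum>q | prime q \<and> l < q \<and> q \<le> l * 2 ^ Suc i. ln (real q) * ?s q)
      = (\<Sum>q | prime q \<and> l < q \<and> q \<le> ?y. ln (real q) * ?s q) + (\<Sum>q | prime q \<and> ?y < q \<and> q \<le> 2 * ?y. ln (real q) * ?s q)"
    unfolding split by (rule sum.union_disjoint) (use fin in auto)
  have "(\<Sum>q | prime q \<and> ?y < q \<and> q \<le> 2 * ?y. ln (real q) * ?s q)
      \<le> (\<Sum>q | prime q \<and> ?y < q \<and> q \<le> 2 * ?y. ln (2 * real ?y) * ?s q)"
  proof (rule sum_mono)
    fix q assume q: "q \<in> {q. prime q \<and> ?y < q \<and> q \<le> 2 * ?y}"
    then have "real q \<le> real (2 * ?y)" by (simp only: mem_Collect_eq of_nat_le_iff)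
    then have "ln (real q) \<le> ln (2 * real ?y)" using q prime_gt_0_nat by (subst ln_le_cancel_iff) auto
    moreover have "?s q \<ge> 0" using q by (auto intro!: variance_nonneg mult_nonneg_nonneg simp: prime_set_def)
    ultimately show "ln (real q) * ?s q \<le> ln (2 * real ?y) * ?s q" by (rule mult_right_mono)
  qed
  also have "\<dots> = ln (2 * real ?y) * (\<Sum>q | prime q \<and> ?y < q \<and> q \<le> 2 * ?y. ?s q)"
    by (simp only: sum_distrib_left)
  also have "\<dots> \<le> ln (2 * real ?y) * (?R * (?A / real ?y + ?B + 4 * real ?y))"
    by (rule mult_left_mono[OF sum_variance_dyadic[OF X Y y] lny])
  also have "\<dots> = ?R * (?A * (ln (2 * real ?y) / real ?y) + ln (2 * real ?y) * (?B + 4 * real ?y))"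
    by (simp add: algebra_simps)
  also have "\<dots> \<le> ?R * (?A * (3 / sqrt (real l) * (1 / sqrt 2) ^ i) + ln (2 * real ?y) * (?B + 4 * (2 * real ?y)))"
  proof (intro mult_left_mono add_mono)
    have yr: "real ?y > 0" using y by linarith
    have "ln (2 * real ?y) \<le> 2 * sqrt (2 * real ?y)" using yr by (intro ln_le_two_sqrt) simp
    also have "\<dots> = 2 * sqrt 2 * sqrt (real ?y)" by (simp add: real_sqrt_mult)
    also have "\<dots> \<le> 3 * sqrt (real ?y)"
    proof (rule mult_right_mono)
      have "sqrt 2 \<le> 3 / 2" by (rule real_le_lsqrt) (auto simp: power2_eq_square)
      then show "2 * sqrt 2 \<le> 3" by simp
    qed simp
    finally have "ln (2 * real ?y) / real ?y \<le> 3 * sqrt (real ?y) / real ?y" using yr by (intro divide_right_mono) auto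
    also have "\<dots> = 3 / sqrt (real ?y)"
    proof -
      have "3 * sqrt t / t = 3 / sqrt t" if "t > 0" for t :: real
        using that by (simp add: frac_eq_eq mult.assoc)
      then show ?thesis using yr by blast
    qed
    also have "\<dots> = 3 / sqrt (real l) * (1 / sqrt 2) ^ i"
      by (simp add: real_sqrt_mult real_sqrt_power power_divide)
    finally show "ln (2 * real ?y) / real ?y \<le> 3 / sqrt (real l) * (1 / sqrt 2) ^ i" .
    show "0 \<le> ln (2 * real ?y)" using y by (intro ln_ge_zero) linarith
  qed (use y in auto)
  finally have step: "(\<Sum>q | prime q \<and> ?y < q \<and> q \<le> 2 * ?y. ln (real q) * ?s q)
      \<le> ?R * (?A * (3 / sqrt (real l) * (1 / sqrt 2) ^ i) + ln (2 * real ?y) * (?B + 4 * (2 * real ?y)))" .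
  have "(\<Sum>q | prime q \<and> l < q \<and> q \<le> l * 2 ^ Suc i. ln (real q) * ?s q) \<le> ?R * (?A * ?f i + real i * ln (real ?y) * (?B + 4 * real ?y))
      + ?R * (?A * (3 / sqrt (real l) * (1 / sqrt 2) ^ i) + ln (2 * real ?y) * (?B + 4 * (2 * real ?y)))"
    unfolding total using Suc.IH step by (rule add_mono)
  also have "\<dots> \<le> ?R * (?A * ?f i + real i * ln (2 * real ?y) * (?B + 4 * (2 * real ?y)))
      + ?R * (?A * (3 / sqrt (real l) * (1 / sqrt 2) ^ i) + ln (2 * real ?y) * (?B + 4 * (2 * real ?y)))"
  proof -
    have "ln (real ?y) \<le> ln (2 * real ?y)" using \<open>real ?y \<ge> 1\<close> by (subst ln_le_cancel_iff) linarith+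
    then have "real i * ln (real ?y) \<le> real i * ln (2 * real ?y)" by (rule mult_left_mono) simp
    moreover have "?B + 4 * real ?y \<le> ?B + 4 * (2 * real ?y)" by simp
    ultimately have "real i * ln (real ?y) * (?B + 4 * real ?y) \<le> real i * ln (2 * real ?y) * (?B + 4 * (2 * real ?y))"
      by (rule mult_mono) (use lny in auto)
    then show ?thesis by (intro add_right_mono mult_left_mono add_left_mono) auto
  qed
  also have "\<dots> = ?R * (?A * ?f (Suc i) + real (Suc i) * ln (2 * real ?y) * (?B + 4 * (2 * real ?y)))"
    by (simp add: algebra_simps)
  finally show ?case unfolding y' .
qed

text \<open>The least number of doublings of \<open>l\<close> that reaches \<open>v\<close>
  overshoots by at most a factor 2 and is \<open>O(ln v)\<close>; the geometric series is at most 4,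
  whence the constant 12.\<close>

lemma sum_variance_range:
  assumes X: "X \<subseteq> {N\<^sub>1..<N\<^sub>1 + L\<^sub>1}" and Y: "Y \<subseteq> {N\<^sub>2..<N\<^sub>2 + L\<^sub>2}" and l: "l \<ge> 1" "real l \<le> v"
  shows "(\<Sum>q | prime q \<and> l < q \<and> real q \<le> v. ln (real q) * sqrt (variance X {q} * variance Y {q}))
    \<le> 20 * sqrt (real (card X) * real (card Y)) *
        (12 * sqrt (real L\<^sub>1 * real L\<^sub>2) / sqrt (real l)
         + 2 * (ln (2 * v))\<^sup>2 * (2 * (sqrt (real L\<^sub>1) + sqrt (real L\<^sub>2)) + 8 * v))"
proof -
  let ?s = "\<lambda>q. sqrt (variance X {q} * variance Y {q})"
  have v: "v \<ge> 1" using l by linarith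
  define i where "i = (LEAST i. v \<le> real (l * 2 ^ i))"
  have ex: "\<exists>i. v \<le> real (l * 2 ^ i)"
  proof -
    obtain n where n: "v < real n" using reals_Archimedean2 by blast
    have "n \<le> 2 ^ n" by (simp add: less_imp_le)
    also have "\<dots> \<le> l * 2 ^ n" using l by simp
    finally have "real n \<le> real (l * 2 ^ n)" by (simp only: of_nat_le_iff)
    then show ?thesis using n by (intro exI[of _ n]) linarith
  qed
  have i1: "v \<le> real (l * 2 ^ i)" unfolding i_def by (rule LeastI_ex[OF ex])
  have i2: "real (l * 2 ^ i) \<le> 2 * v"
  proof (cases i)
    case 0
    then show ?thesis using l v by simp
  next
    case (Suc k)
    then have "\<not> v \<le> real (l * 2 ^ k)" using not_less_Least[of k "\<lambda>i. v \<le> real (l * 2 ^ i)"] by (simp add: i_def)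
    then show ?thesis using Suc by simp
  qed
  have i3: "real i \<le> 2 * ln (2 * v)"
  proof -
    have "2 ^ i \<le> real (l * 2 ^ i)" using l by simp
    then have "2 ^ i \<le> 2 * v" using i2 by linarith
    then have "ln (2 ^ i) \<le> ln (2 * v)" using v by (subst ln_le_cancel_iff) auto
    then have "real i * ln 2 \<le> ln (2 * v)" by (simp add: ln_realpow)
    moreover have "real i * (1 / 2) \<le> real i * ln 2"
      using ln2_ge_two_thirds by (intro mult_left_mono) auto
    ultimately show ?thesis by linarith
  qed
  have lv: "0 \<le> ln (2 * v)" using v by (intro ln_ge_zero) linarith
  have geo: "(\<Sum>j<i. (1 / sqrt 2) ^ j) \<le> (4::real)"
  proof -
    have "(4 / 3)\<^sup>2 \<le> (2::real)" by (simp add: power2_eq_square)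
    then have s: "sqrt 2 \<ge> 4 / 3" "sqrt 2 > 0" by (simp_all only: real_le_rsqrt) simp
    then have r: "1 / sqrt 2 \<le> 3 / 4" by (simp add: field_simps)
    have "(\<Sum>j<i. (1 / sqrt 2) ^ j) \<le> (\<Sum>j<i. (3 / 4 :: real) ^ j)"
      using r by (intro sum_mono power_mono) auto
    also have "\<dots> \<le> 4" by (subst geometric_sum) auto
    finally show ?thesis .
  qed
  have fin: "finite {q. prime q \<and> l < q \<and> q \<le> l * 2 ^ i}" by (rule finite_subset[of _ "{..l * 2 ^ i}"]) auto
  have "(\<Sum>q | prime q \<and> l < q \<and> real q \<le> v. ln (real q) * ?s q)
      \<le> (\<Sum>q | prime q \<and> l < q \<and> q \<le> l * 2 ^ i. ln (real q) * ?s q)"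
  proof (rule sum_mono2[OF fin])
    show "{q. prime q \<and> l < q \<and> real q \<le> v} \<subseteq> {q. prime q \<and> l < q \<and> q \<le> l * 2 ^ i}"
    proof
      fix q assume q: "q \<in> {q. prime q \<and> l < q \<and> real q \<le> v}"
      then have "real q \<le> real (l * 2 ^ i)" using i1 by simp
      then show "q \<in> {q. prime q \<and> l < q \<and> q \<le> l * 2 ^ i}" using q by (simp only: of_nat_le_iff mem_Collect_eq)
    qed
    fix q assume "q \<in> {q. prime q \<and> l < q \<and> q \<le> l * 2 ^ i} - {q. prime q \<and> l < q \<and> real q \<le> v}"
    then have "prime q" by simp
    then show "0 \<le> ln (real q) * ?s q"
      by (auto intro!: mult_nonneg_nonneg ln_prime_nonneg variance_nonneg simp: prime_set_def)
  qed
  also have "\<dots> \<le> 20 * sqrt (real (card X) * real (card Y)) *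
        (sqrt (real L\<^sub>1 * real L\<^sub>2) * (3 / sqrt (real l) * (\<Sum>j<i. (1 / sqrt 2) ^ j))
         + real i * ln (real (l * 2 ^ i)) * (2 * (sqrt (real L\<^sub>1) + sqrt (real L\<^sub>2)) + 4 * real (l * 2 ^ i)))"
    by (rule sum_variance_dyadic_range[OF X Y l(1)])
  also have "\<dots> \<le> 20 * sqrt (real (card X) * real (card Y)) *
        (sqrt (real L\<^sub>1 * real L\<^sub>2) * (3 / sqrt (real l) * 4)
         + 2 * ln (2 * v) * ln (2 * v) * (2 * (sqrt (real L\<^sub>1) + sqrt (real L\<^sub>2)) + 4 * (2 * v)))"
  proof (intro mult_left_mono add_mono mult_mono)
    show "ln (real (l * 2 ^ i)) \<le> ln (2 * v)" using i1 i2 v by (subst ln_le_cancel_iff) linarith+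
    show "0 \<le> ln (real (l * 2 ^ i))" using i1 v by (intro ln_ge_zero) linarith
    then show "0 \<le> 2 * (sqrt (real L\<^sub>1) + sqrt (real L\<^sub>2)) + 4 * real (l * 2 ^ i)" by simp
  qed (use i2 i3 geo lv in \<open>auto simp del: of_nat_mult of_nat_power\<close>)
  finally show ?thesis by (simp add: power2_eq_square mult_ac)
qed

text \<open>Since \<open>q\<close> exceeds \<open>l\<close> and hence the absolute value of
  \<open>a\<close>, it does not divide \<open>a\<close>; since the primes in \<open>Y\<close> exceed
  \<open>v\<close>, it divides none of them. So \<open>bilinear_prime_modulus\<close> applies to
  each \<open>q\<close>.\<close>

lemma sum_ln_shifted_count_le:
  fixes a :: int
  assumes X: "X \<subseteq> {N\<^sub>1..<N\<^sub>1 + L\<^sub>1}" and Y: "Y \<subseteq> {N\<^sub>2..<N\<^sub>2 + L\<^sub>2}" and l: "l \<ge> 1" "real l \<le> v"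
    and a: "a \<noteq> 0" "nat \<bar>a\<bar> \<le> l" and Yp: "\<And>y. y \<in> Y \<Longrightarrow> prime y \<and> v < real y"
  shows "(\<Sum>q | prime q \<and> l < q \<and> real q \<le> v. ln (real q) * shifted_count X Y a q)
    \<le> real (card X) * real (card Y) * primes_ln_sum (real l) v
      + 20 * sqrt (real (card X) * real (card Y)) *
        (12 * sqrt (real L\<^sub>1 * real L\<^sub>2) / sqrt (real l)
         + 2 * (ln (2 * v))\<^sup>2 * (2 * (sqrt (real L\<^sub>1) + sqrt (real L\<^sub>2)) + 8 * v))"
proof -
  let ?S = "{q. prime q \<and> l < q \<and> real q \<le> v}"
  have fin: "finite X" "finite Y" using X Y finite_subset by auto
  have "(\<Sum>q\<in>?S. ln (real q) * shifted_count X Y a q)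
      \<le> (\<Sum>q\<in>?S. real (card X) * real (card Y) * (ln (real q) / real q) + ln (real q) * sqrt (variance X {q} * variance Y {q}))"
  proof (rule sum_mono)
    fix q assume q: "q \<in> ?S"
    have "\<not> int q dvd - a"
    proof
      assume "int q dvd - a"
      then have "int q \<le> \<bar>a\<bar>" using a(1) dvd_imp_le_int[of a "int q"] by simp
      moreover have "\<bar>a\<bar> \<le> int l" using a(2) by simp
      moreover have "l < q" using q by simp
      ultimately show False by linarith
    qed
    moreover have "\<not> q dvd y" if "y \<in> Y" for y
    proof
      assume "q dvd y"
      then have "q = y" using Yp[OF that] q primes_dvd_imp_eq by blast
      then show False using Yp[OF that] q by simp
    qed
    ultimately have "\<bar>(\<Sum>x\<in>X. \<Sum>y\<in>Y. of_bool (int q dvd int y * int x - (- a))) - real (card X) * real (card Y) / real q\<bar>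
        \<le> sqrt (variance X {q} * variance Y {q})"
      using q fin by (intro bilinear_prime_modulus) auto
    then have "shifted_count X Y a q \<le> real (card X) * real (card Y) / real q + sqrt (variance X {q} * variance Y {q})"
      by (simp add: shifted_count_def mult.commute abs_le_iff)
    then have "ln (real q) * shifted_count X Y a q
        \<le> ln (real q) * (real (card X) * real (card Y) / real q + sqrt (variance X {q} * variance Y {q}))"
      using q ln_prime_nonneg by (intro mult_left_mono) auto
    then show "ln (real q) * shifted_count X Y a q
        \<le> real (card X) * real (card Y) * (ln (real q) / real q) + ln (real q) * sqrt (variance X {q} * variance Y {q})"
      by (simp add: distrib_left mult_ac)
  qed
  also have "\<dots> = real (card X) * real (card Y) * primes_ln_sum (real l) v
      + (\<Sum>q\<in>?S. ln (real q) * sqrt (variance X {q} * variance Y {q}))"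
    by (simp add: sum.distrib sum_distrib_left primes_ln_sum_def)
  also have "\<dots> \<le> real (card X) * real (card Y) * primes_ln_sum (real l) v
      + 20 * sqrt (real (card X) * real (card Y)) *
        (12 * sqrt (real L\<^sub>1 * real L\<^sub>2) / sqrt (real l)
         + 2 * (ln (2 * v))\<^sup>2 * (2 * (sqrt (real L\<^sub>1) + sqrt (real L\<^sub>2)) + 8 * v))"
    by (rule add_left_mono[OF sum_variance_range[OF X Y l]])
  finally show ?thesis .
qed

text \<open>The first prime is kept tiny because it divides every modulus used in the sieve for large \<open>q\<close>.\<close>

definition admissible :: "real \<Rightarrow> real \<Rightarrow> real \<Rightarrow> real \<Rightarrow> real \<Rightarrow> bool" where
  "admissible \<delta> K x z\<^sub>1 z\<^sub>2 \<longleftrightarrow>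
     x powr \<delta> \<le> z\<^sub>1 \<and> z\<^sub>1 \<le> K * x powr \<delta> \<and> x powr (1 - 3 * \<delta>) \<le> z\<^sub>2 \<and> z\<^sub>2 \<le> K * x powr (1 - 3 * \<delta>) \<and>
     (1 - 2 * \<delta>) * \<delta> * z\<^sub>1 \<le> real (card (prime_block \<delta> z\<^sub>1)) * ln z\<^sub>1 \<and>
     (1 - 2 * \<delta>) * \<delta> * z\<^sub>2 \<le> real (card (prime_block \<delta> z\<^sub>2)) * ln z\<^sub>2"

lemma admissible_exists:
  assumes "0 < \<delta>" "\<delta> < 1 / 3"
  shows "\<exists>K\<ge>1. eventually (\<lambda>x. \<exists>z\<^sub>1 z\<^sub>2. admissible \<delta> K x z\<^sub>1 z\<^sub>2) at_top"
proof -
  obtain K where K: "K \<ge> 1" "\<And>u. u \<ge> exp 1 \<Longrightarrow> \<exists>z. u \<le> z \<and> z \<le> K * u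
    \<and> (1 - 2 * \<delta>) * \<delta> * z \<le> real (card (prime_block \<delta> z)) * ln z"
    using dense_prime_block_exists[of \<delta>] assms by auto
  have "eventually (\<lambda>x::real. exp 1 * x powr 0 \<le> x powr \<delta>) at_top"
    "eventually (\<lambda>x::real. exp 1 * x powr 0 \<le> x powr (1 - 3 * \<delta>)) at_top"
    using assms by (intro const_powr_le; simp)+
  then have "eventually (\<lambda>x. \<exists>z\<^sub>1 z\<^sub>2. admissible \<delta> K x z\<^sub>1 z\<^sub>2) at_top"
    using eventually_gt_at_top[of 0]
  proof eventually_elim
    case (elim x)
    then have "exp 1 \<le> x powr \<delta>" "exp 1 \<le> x powr (1 - 3 * \<delta>)" by auto
    then show ?case using K(2) unfolding admissible_def by meson
  qed
  then show ?thesis using K(1) by blast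
qed

text \<open>The gaps between the exponents of \<open>x\<close> absorb the unspecified constant
  \<open>K\<close>: \<open>z\<^sub>1 * z\<^sub>2\<close> is at most
  \<open>K\<^sup>2 * x powr (1 - 2 * \<delta>)\<close>, and \<open>ln x\<close> may replace the
  logarithms in the density bounds. The factor 2 in front of the product leaves room for the shift
  by \<open>a\<close>.\<close>

lemma admissible_facts:
  assumes \<delta>: "0 < \<delta>" "\<delta> \<le> 1 / 100" and K: "K \<ge> 1"
  shows "eventually (\<lambda>x. \<forall>z\<^sub>1 z\<^sub>2. admissible \<delta> K x z\<^sub>1 z\<^sub>2 \<longrightarrow>
      1 \<le> z\<^sub>1 \<and> (1 + \<delta>) * z\<^sub>1 < z\<^sub>2 \<and> x powr (1 - 2 * \<delta>) \<le> z\<^sub>1 * z\<^sub>2 \<and> 2 * ((1 + \<delta>) * z\<^sub>1) * ((1 + \<delta>) * z\<^sub>2) \<le> x \<and>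
      (1 - 2 * \<delta>) * (\<delta> * z\<^sub>2) \<le> real (card (prime_block \<delta> z\<^sub>2)) * ln x \<and>
      \<delta> * z\<^sub>1 \<le> 2 * (real (card (prime_block \<delta> z\<^sub>1)) * ln x) \<and>
      \<delta> * z\<^sub>2 \<le> 2 * (real (card (prime_block \<delta> z\<^sub>2)) * ln x) \<and>
      1 \<le> card (prime_block \<delta> z\<^sub>1) \<and> 1 \<le> card (prime_block \<delta> z\<^sub>2)) at_top"
proof -
  have e: "eventually (\<lambda>x::real. 2 * K * x powr \<delta> \<le> x powr (1 - 3 * \<delta>)) at_top"
    "eventually (\<lambda>x::real. 3 * K\<^sup>2 * x powr (1 - 2 * \<delta>) \<le> x powr 1) at_top"
    "eventually (\<lambda>x::real. K * x powr (1 - 3 * \<delta>) \<le> x powr 1) at_top"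
    using \<delta> by (intro const_powr_le; simp)+
  show ?thesis using e eventually_ge_at_top[of "exp 1"]
  proof eventually_elim
    case (elim x)
    have x1: "x \<ge> 1" using elim(4) one_le_exp_iff[of 1] by linarith
    have x0: "x > 0" using x1 by simp
    show ?case
    proof (intro allI impI)
      fix z\<^sub>1 z\<^sub>2 assume adm: "admissible \<delta> K x z\<^sub>1 z\<^sub>2"
      let ?X = "real (card (prime_block \<delta> z\<^sub>1))" and ?Y = "real (card (prime_block \<delta> z\<^sub>2))"
      have z: "x powr \<delta> \<le> z\<^sub>1" "z\<^sub>1 \<le> K * x powr \<delta>" "x powr (1 - 3 * \<delta>) \<le> z\<^sub>2" "z\<^sub>2 \<le> K * x powr (1 - 3 * \<delta>)"
        and dense: "(1 - 2 * \<delta>) * \<delta> * z\<^sub>1 \<le> ?X * ln z\<^sub>1" "(1 - 2 * \<delta>) * \<delta> * z\<^sub>2 \<le> ?Y * ln z\<^sub>2"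
        using adm by (auto simp: admissible_def)
      have "1 \<le> x powr \<delta>" using x1 \<delta> by (intro ge_one_powr_ge_zero) auto
      then have z1: "1 \<le> z\<^sub>1" using z(1) by linarith
      have "(1 + \<delta>) * z\<^sub>1 < 2 * z\<^sub>1" using \<delta> z1 by (intro mult_strict_right_mono) auto
      also have "2 * z\<^sub>1 \<le> 2 * K * x powr \<delta>" using z(2) by simp
      also have "\<dots> \<le> z\<^sub>2" using elim(1) z(3) by linarith
      finally have lt: "(1 + \<delta>) * z\<^sub>1 < z\<^sub>2" .
      have "1 * z\<^sub>1 \<le> (1 + \<delta>) * z\<^sub>1" using \<delta> z1 by (intro mult_right_mono) auto
      then have z12: "z\<^sub>1 < z\<^sub>2" "1 \<le> z\<^sub>2" using lt z1 by linarith+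
      have z2x: "z\<^sub>2 \<le> x" using z(4) elim(3) x0 by simp
      have "x powr \<delta> * x powr (1 - 3 * \<delta>) \<le> z\<^sub>1 * z\<^sub>2" using z z1 by (intro mult_mono) auto
      then have prod_ge: "x powr (1 - 2 * \<delta>) \<le> z\<^sub>1 * z\<^sub>2" by (simp flip: powr_add)
      have "z\<^sub>1 * z\<^sub>2 \<le> (K * x powr \<delta>) * (K * x powr (1 - 3 * \<delta>))" using z z1 z12 K by (intro mult_mono) auto
      also have "\<dots> = K\<^sup>2 * (x powr \<delta> * x powr (1 - 3 * \<delta>))" by (simp add: power2_eq_square)
      also have "x powr \<delta> * x powr (1 - 3 * \<delta>) = x powr (1 - 2 * \<delta>)" by (simp flip: powr_add)
      finally have "3 * (z\<^sub>1 * z\<^sub>2) \<le> x" using elim(2) x0 by simp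
      moreover have "2 * (1 + \<delta>) * (1 + \<delta>) * (z\<^sub>1 * z\<^sub>2) \<le> 3 * (z\<^sub>1 * z\<^sub>2)"
      proof (rule mult_right_mono)
        have "(1 + \<delta>) * (1 + \<delta>) \<le> (101 / 100) * (101 / 100)" using \<delta> by (intro mult_mono) auto
        then have "2 * ((1 + \<delta>) * (1 + \<delta>)) \<le> 3" by linarith
        then show "2 * (1 + \<delta>) * (1 + \<delta>) \<le> 3" by (simp only: mult.assoc)
      qed (use z1 z12 in simp)
      ultimately have prod_le: "2 * ((1 + \<delta>) * z\<^sub>1) * ((1 + \<delta>) * z\<^sub>2) \<le> x" by (simp add: mult_ac)
      have lnz: "ln z\<^sub>1 \<le> ln x" "ln z\<^sub>2 \<le> ln x" using z1 z12 z2x by auto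
      have d1: "(1 - 2 * \<delta>) * (\<delta> * z\<^sub>1) \<le> ?X * ln x" "(1 - 2 * \<delta>) * (\<delta> * z\<^sub>2) \<le> ?Y * ln x"
        using dense mult_left_mono[OF lnz(1), of ?X] mult_left_mono[OF lnz(2), of ?Y] by (simp_all add: mult.assoc)
      have half: "1 / 2 * (\<delta> * w) \<le> (1 - 2 * \<delta>) * (\<delta> * w)" if "w \<ge> 1" for w
        using \<delta> that by (intro mult_right_mono) auto
      have d2: "\<delta> * z\<^sub>1 \<le> 2 * (?X * ln x)" "\<delta> * z\<^sub>2 \<le> 2 * (?Y * ln x)"
        using d1 half[OF z1] half[OF z12(2)] by linarith+
      have "?X \<noteq> 0"
      proof
        assume "?X = 0"
        then have "\<delta> * z\<^sub>1 \<le> 0" using d2(1) by (simp del: of_nat_eq_0_iff)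
        then show False using \<delta> z1 by (simp add: mult_le_0_iff)
      qed
      moreover have "?Y \<noteq> 0"
      proof
        assume "?Y = 0"
        then have "\<delta> * z\<^sub>2 \<le> 0" using d2(2) by (simp del: of_nat_eq_0_iff)
        then show False using \<delta> z12 by (simp add: mult_le_0_iff)
      qed
      ultimately have "1 \<le> card (prime_block \<delta> z\<^sub>1)" "1 \<le> card (prime_block \<delta> z\<^sub>2)" by linarith+
      then show "1 \<le> z\<^sub>1 \<and> (1 + \<delta>) * z\<^sub>1 < z\<^sub>2 \<and> x powr (1 - 2 * \<delta>) \<le> z\<^sub>1 * z\<^sub>2 \<and> 2 * ((1 + \<delta>) * z\<^sub>1) * ((1 + \<delta>) * z\<^sub>2) \<le> x \<and>
          (1 - 2 * \<delta>) * (\<delta> * z\<^sub>2) \<le> ?Y * ln x \<and> \<delta> * z\<^sub>1 \<le> 2 * (?X * ln x) \<and> \<delta> * z\<^sub>2 \<le> 2 * (?Y * ln x) \<and>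
          1 \<le> card (prime_block \<delta> z\<^sub>1) \<and> 1 \<le> card (prime_block \<delta> z\<^sub>2)"
        using z1 lt prod_ge prod_le d1 d2 by blast
    qed
  qed
qed

text \<open>Mertens' estimate supplies half of \<open>ln x\<close>. One error term of the large
  sieve saves only \<open>1 / sqrt l\<close> and no power of \<open>x\<close>, so a large constant
  \<open>l\<close> is cut off; the primes up to \<open>l\<close> are left to
  \<open>prime_power_contribution\<close>.\<close>

lemma small_moduli_contribution:
  fixes a :: int
  assumes \<delta>: "0 < \<delta>" "\<delta> \<le> 1 / 100" and K: "K \<ge> 1" and a: "a \<noteq> 0"
  shows "\<exists>l\<ge>1. eventually (\<lambda>x. \<forall>z\<^sub>1 z\<^sub>2. admissible \<delta> K x z\<^sub>1 z\<^sub>2 \<longrightarrow>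
      (\<Sum>q | prime q \<and> l < q \<and> real q \<le> x powr (1 / 2 - 3 * \<delta> / 2).
          ln (real q) * shifted_count (prime_block \<delta> z\<^sub>1) (prime_block \<delta> z\<^sub>2) a q)
      \<le> (1 / 2 + \<delta>) * (real (card (prime_block \<delta> z\<^sub>1)) * real (card (prime_block \<delta> z\<^sub>2)) * ln x)) at_top"
proof -
  obtain C where C: "C > 0" "\<And>u v. u \<ge> 1 \<Longrightarrow> v \<ge> u \<Longrightarrow> \<bar>primes_ln_sum u v - ln (v / u)\<bar> \<le> C"
    using primes_ln_sum_bounds by blast
  \<comment> \<open>The first error is bounded by \<open>48 / \<delta>\<close> relative to
    \<open>sqrt l\<close>; the choice of 1920 makes this at most \<open>\<delta> / 40\<close>.
    Adding the absolute value of \<open>a\<close> keeps the moduli coprime to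
    \<open>a\<close>.\<close>
  define l where "l = nat \<lceil>(1920 / \<delta>\<^sup>2)\<^sup>2\<rceil> + nat \<bar>a\<bar> + 2"
  have l: "l \<ge> 1" "l \<ge> 2" "nat \<bar>a\<bar> \<le> l" by (simp_all add: l_def)
  have "(1920 / \<delta>\<^sup>2)\<^sup>2 \<le> real l" unfolding l_def by linarith
  then have sqrt_l: "1920 / \<delta>\<^sup>2 \<le> sqrt (real l)" by (rule real_le_rsqrt)
  \<comment> \<open>The square of this end point is \<open>x powr (1 - 3 * \<delta>)\<close>, the
    lower bound for \<open>z\<^sub>2\<close>. The error of size \<open>x powr ?e\<close> is then
    smaller than \<open>sqrt (z\<^sub>1 * z\<^sub>2)\<close> by the factor
    \<open>x powr (\<delta> / 2)\<close>, which beats all logarithms.\<close>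
  let ?e = "1 / 2 - 3 * \<delta> / 2"
  let ?c = "80 * (4 * sqrt (2 * K) + 8)"
  have e: "eventually (\<lambda>x::real. ?c * ln x ^ 2 \<le> \<delta>\<^sup>2 / 2 * x powr (\<delta> / 2)) at_top"
    "eventually (\<lambda>x::real. C / (3 * \<delta> / 2) \<le> ln x) at_top"
    "eventually (\<lambda>x::real. real l * x powr 0 \<le> x powr ?e) at_top"
    "eventually (\<lambda>x::real. 2 * x powr ?e \<le> x powr 1) at_top"
    subgoal by (rule ln_power_le_powr) (use \<delta> in auto)
    subgoal by real_asymp
    subgoal using \<delta> by (intro const_powr_le) auto
    subgoal using \<delta> by (intro const_powr_le) auto
    done
  have "eventually (\<lambda>x. \<forall>z\<^sub>1 z\<^sub>2. admissible \<delta> K x z\<^sub>1 z\<^sub>2 \<longrightarrow>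
      (\<Sum>q | prime q \<and> l < q \<and> real q \<le> x powr ?e.
          ln (real q) * shifted_count (prime_block \<delta> z\<^sub>1) (prime_block \<delta> z\<^sub>2) a q)
      \<le> (1 / 2 + \<delta>) * (real (card (prime_block \<delta> z\<^sub>1)) * real (card (prime_block \<delta> z\<^sub>2)) * ln x)) at_top"
    using e admissible_facts[OF \<delta> K] eventually_ge_at_top[of "exp 1"]
  proof eventually_elim
    case (elim x)
    have x1: "x \<ge> 1" using elim(6) one_le_exp_iff[of 1] by linarith
    then have x0: "x > 0" by simp
    have lx: "ln x \<ge> 1" using elim(6) x0 ln_ge_iff[of x 1] by simp
    let ?v = "x powr ?e"
    have lv: "real l \<le> ?v" using elim(3) x0 by simp
    have v1: "?v \<ge> 1" using lv l by linarith
    show ?case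
    proof (intro allI impI)
      fix z\<^sub>1 z\<^sub>2 assume adm: "admissible \<delta> K x z\<^sub>1 z\<^sub>2"
      define X where "X = prime_block \<delta> z\<^sub>1"
      define Y where "Y = prime_block \<delta> z\<^sub>2"
      define n where "n = sqrt (real (card X) * real (card Y))"
      have facts: "1 \<le> z\<^sub>1" "(1 + \<delta>) * z\<^sub>1 < z\<^sub>2" "x powr (1 - 2 * \<delta>) \<le> z\<^sub>1 * z\<^sub>2"
        "\<delta> * z\<^sub>1 \<le> 2 * (real (card X) * ln x)" "\<delta> * z\<^sub>2 \<le> 2 * (real (card Y) * ln x)"
        using elim(5) adm unfolding X_def Y_def by blast+
      have z: "z\<^sub>1 \<le> K * x powr \<delta>" "x powr (1 - 3 * \<delta>) \<le> z\<^sub>2" "z\<^sub>2 \<le> K * x powr (1 - 3 * \<delta>)"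
        using adm by (auto simp: admissible_def)
      have "1 * z\<^sub>1 \<le> (1 + \<delta>) * z\<^sub>1" using \<delta> facts(1) by (intro mult_right_mono) auto
      then have z2: "1 \<le> z\<^sub>2" using facts by linarith
      obtain N\<^sub>1 L\<^sub>1 where X: "X \<subseteq> {N\<^sub>1..<N\<^sub>1 + L\<^sub>1}" "real L\<^sub>1 \<le> \<delta> * z\<^sub>1 + 1"
        using prime_block_window[of z\<^sub>1 \<delta>] facts(1) \<delta> unfolding X_def by auto
      obtain N\<^sub>2 L\<^sub>2 where Y: "Y \<subseteq> {N\<^sub>2..<N\<^sub>2 + L\<^sub>2}" "real L\<^sub>2 \<le> \<delta> * z\<^sub>2 + 1"
        using prime_block_window[of z\<^sub>2 \<delta>] z2 \<delta> unfolding Y_def by auto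
      have "\<delta> * z\<^sub>1 \<le> 1 * z\<^sub>1" "\<delta> * z\<^sub>2 \<le> 1 * z\<^sub>2" using \<delta> facts(1) z2 by (intro mult_right_mono; simp)+
      then have L: "real L\<^sub>1 \<le> 2 * z\<^sub>1" "real L\<^sub>2 \<le> 2 * z\<^sub>2" using X(2) Y(2) facts(1) z2 by linarith+
      let ?P = "sqrt (z\<^sub>1 * z\<^sub>2)"
      have n0: "n \<ge> 0" by (simp add: n_def)
      have n2: "n * n = real (card X) * real (card Y)" by (simp add: n_def)
      have P_le: "\<delta> * ?P \<le> 2 * (n * ln x)"
      proof -
        have "\<delta> * ?P = sqrt ((\<delta> * z\<^sub>1) * (\<delta> * z\<^sub>2))" using \<delta> by (simp add: real_sqrt_mult)
        also have "\<dots> \<le> sqrt ((2 * (real (card X) * ln x)) * (2 * (real (card Y) * ln x)))"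
          using facts z2 \<delta> lx by (intro real_sqrt_le_mono mult_mono[of "\<delta> * z\<^sub>1" _ "\<delta> * z\<^sub>2"]) auto
        also have "(2 * (real (card X) * ln x)) * (2 * (real (card Y) * ln x)) = (2 * (n * ln x))\<^sup>2"
          using n2 by (simp add: power2_eq_square mult_ac)
        also have "sqrt \<dots> = 2 * (n * ln x)" using n0 lx by (intro real_sqrt_unique) auto
        finally show ?thesis .
      qed
      have P_ge: "x powr (1 / 2 - \<delta>) \<le> ?P"
      proof -
        have "x powr (1 / 2 - \<delta>) = sqrt (x powr (1 - 2 * \<delta>))"
          by (simp add: powr_half_sqrt[symmetric] powr_powr algebra_simps)
        then show ?thesis using facts(3) by simp
      qed
      have main: "primes_ln_sum (real l) ?v \<le> 1 / 2 * ln x"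
      proof -
        have "primes_ln_sum (real l) ?v \<le> ln (?v / real l) + C" using C(2)[of "real l" ?v] l lv by (simp add: abs_le_iff)
        also have "ln (?v / real l) \<le> ln ?v"
        proof (subst ln_le_cancel_iff)
          show "?v / real l \<le> ?v" using l v1 mult_left_mono[of 1 "real l" ?v] by (simp add: divide_le_eq)
        qed (use l v1 x0 in auto)
        also have "ln ?v = ?e * ln x" using x0 by (simp add: ln_powr)
        also have "?e * ln x + C \<le> 1 / 2 * ln x"
          using elim(2) \<delta> by (simp add: field_simps)
        finally show ?thesis by simp
      qed
      have err1: "12 * sqrt (real L\<^sub>1 * real L\<^sub>2) / sqrt (real l) \<le> \<delta> / 40 * (n * ln x)"
      proof -
        have "real L\<^sub>1 * real L\<^sub>2 \<le> (2 * z\<^sub>1) * (2 * z\<^sub>2)" using L facts(1) by (intro mult_mono) auto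
        then have "sqrt (real L\<^sub>1 * real L\<^sub>2) \<le> sqrt (2\<^sup>2 * (z\<^sub>1 * z\<^sub>2))" by (simp add: mult_ac)
        also have "\<dots> = 2 * ?P" by (simp add: real_sqrt_mult)
        also have "\<dots> \<le> 2 * (2 * (n * ln x) / \<delta>)" using P_le \<delta> by (simp add: field_simps)
        finally have s: "sqrt (real L\<^sub>1 * real L\<^sub>2) \<le> 4 * (n * ln x) / \<delta>" by simp
        have "12 * sqrt (real L\<^sub>1 * real L\<^sub>2) / sqrt (real l) \<le> 12 * (4 * (n * ln x) / \<delta>) / (1920 / \<delta>\<^sup>2)"
          using s sqrt_l \<delta> n0 lx by (intro frac_le mult_left_mono) auto
        also have "\<dots> = \<delta> / 40 * (n * ln x)" using \<delta> by (simp add: power2_eq_square field_simps)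
        finally show ?thesis .
      qed
      have err2: "2 * (ln (2 * ?v))\<^sup>2 * (2 * (sqrt (real L\<^sub>1) + sqrt (real L\<^sub>2)) + 8 * ?v) \<le> \<delta> / 40 * (n * ln x)"
      proof -
        have e1: "x powr (\<delta> / 2) \<le> ?v" using x1 \<delta> by (intro powr_mono) auto
        have "sqrt (real L\<^sub>1) \<le> sqrt (2 * (K * x powr \<delta>))" using L(1) z(1) by simp
        also have "\<dots> = sqrt (2 * K) * x powr (\<delta> / 2)"
          by (simp add: real_sqrt_mult powr_half_sqrt[symmetric] powr_powr)
        also have "\<dots> \<le> sqrt (2 * K) * ?v" using e1 K by (intro mult_left_mono) auto
        finally have s1: "sqrt (real L\<^sub>1) \<le> sqrt (2 * K) * ?v" .
        have "sqrt (real L\<^sub>2) \<le> sqrt (2 * (K * x powr (1 - 3 * \<delta>)))" using L(2) z(3) by simp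
        also have "\<dots> = sqrt (2 * K) * ?v"
          by (simp add: real_sqrt_mult powr_half_sqrt[symmetric] powr_powr algebra_simps)
        finally have s2: "sqrt (real L\<^sub>2) \<le> sqrt (2 * K) * ?v" .
        have "0 \<le> ln (2 * ?v)" using v1 by (intro ln_ge_zero) linarith
        moreover have "ln (2 * ?v) \<le> ln x" using elim(4) x0 v1 by (subst ln_le_cancel_iff) auto
        ultimately have "(ln (2 * ?v))\<^sup>2 \<le> (ln x)\<^sup>2" by (intro power_mono)
        then have "2 * (ln (2 * ?v))\<^sup>2 * (2 * (sqrt (real L\<^sub>1) + sqrt (real L\<^sub>2)) + 8 * ?v)
          \<le> 2 * (ln x)\<^sup>2 * (2 * (sqrt (2 * K) * ?v + sqrt (2 * K) * ?v) + 8 * ?v)"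
          using s1 s2 by (intro mult_mono mult_left_mono add_mono) auto
        also have "\<dots> = 1 / 40 * (?c * ln x ^ 2) * ?v" by (simp add: algebra_simps)
        also have "\<dots> \<le> 1 / 40 * (\<delta>\<^sup>2 / 2 * x powr (\<delta> / 2)) * ?v"
          using elim(1) by (intro mult_right_mono mult_left_mono) auto
        also have "\<dots> = \<delta>\<^sup>2 / 80 * x powr (1 / 2 - \<delta>)"
        proof -
          have "x powr (\<delta> / 2) * ?v = x powr (1 / 2 - \<delta>)" by (simp add: powr_add[symmetric] field_simps)
          then show ?thesis by simp
        qed
        also have "\<dots> \<le> \<delta>\<^sup>2 / 80 * ?P" using P_ge by (intro mult_left_mono) auto
        also have "\<dots> = \<delta> / 80 * (\<delta> * ?P)" by (simp add: power2_eq_square)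
        also have "\<dots> \<le> \<delta> / 80 * (2 * (n * ln x))" using P_le \<delta> by (intro mult_left_mono) auto
        finally show ?thesis by simp
      qed
      have "?v < z\<^sub>2"
      proof -
        have "?v * 1 < ?v * ?v" using v1 lv l by (intro mult_strict_left_mono) linarith+
        also have "?v * ?v = x powr (1 - 3 * \<delta>)" by (simp add: powr_add[symmetric])
        finally show ?thesis using z(2) by linarith
      qed
      then have Yp: "\<And>y. y \<in> Y \<Longrightarrow> prime y \<and> ?v < real y" by (auto simp: Y_def prime_block_def)
      have "(\<Sum>q | prime q \<and> l < q \<and> real q \<le> ?v. ln (real q) * shifted_count X Y a q)
        \<le> real (card X) * real (card Y) * primes_ln_sum (real l) ?v + 20 * n *
        (12 * sqrt (real L\<^sub>1 * real L\<^sub>2) / sqrt (real l)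
         + 2 * (ln (2 * ?v))\<^sup>2 * (2 * (sqrt (real L\<^sub>1) + sqrt (real L\<^sub>2)) + 8 * ?v))"
        unfolding n_def by (rule sum_ln_shifted_count_le[OF X(1) Y(1) l(1) lv a l(3) Yp])
      also have "\<dots> \<le> real (card X) * real (card Y) * (1 / 2 * ln x) + 20 * n * (\<delta> / 40 * (n * ln x) + \<delta> / 40 * (n * ln x))"
        using main err1 err2 n0 by (intro add_mono mult_left_mono) auto
      also have "\<dots> = (1 / 2 + \<delta>) * (real (card X) * real (card Y) * ln x)"
        by (simp add: algebra_simps flip: n2)
      finally show "(\<Sum>q | prime q \<and> l < q \<and> real q \<le> ?v.
          ln (real q) * shifted_count (prime_block \<delta> z\<^sub>1) (prime_block \<delta> z\<^sub>2) a q)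
        \<le> (1 / 2 + \<delta>) * (real (card (prime_block \<delta> z\<^sub>1)) * real (card (prime_block \<delta> z\<^sub>2)) * ln x)"
        unfolding X_def Y_def .
    qed
  qed
  then show ?thesis using l by blast
qed

text \<open>Only primes up to \<open>sqrt B\<close> occur, and the exponents of one prime
  \<open>q\<close> together contribute at most the logarithm of its largest power, hence at most
  \<open>ln B\<close>.\<close>

lemma sum_ln_proper_prime_powers_le:
  assumes "B \<ge> 1"
  shows "(\<Sum>(q, j)\<in>prime_power_pairs B \<inter> proper_prime_powers. ln (real q)) \<le> sqrt (real B) * ln (real B)"
proof -
  let ?I = "prime_power_pairs B \<inter> proper_prime_powers"
  define J where "J q = {j. 2 \<le> j \<and> q ^ j \<le> B}" for q
  let ?S = "{q. prime q \<and> q ^ 2 \<le> B}"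
  have S: "?S \<subseteq> {1..nat \<lfloor>sqrt (real B)\<rfloor>}"
  proof
    fix q assume q: "q \<in> ?S"
    then have "(real q)\<^sup>2 \<le> real B" by (simp flip: of_nat_power)
    then have "real q \<le> sqrt (real B)" by (rule real_le_rsqrt)
    then show "q \<in> {1..nat \<lfloor>sqrt (real B)\<rfloor>}" using q prime_ge_1_nat by (auto simp: le_nat_floor)
  qed
  have finS: "finite ?S" using S finite_subset by blast
  have finJ: "finite (J q)" if "prime q" for q
  proof (rule finite_subset[of _ "{..B}"])
    show "J q \<subseteq> {..B}"
      using power_gt_expt[of q] prime_gt_1_nat[OF that] by (auto simp: J_def intro: order.trans[OF less_imp_le])
  qed simp
  have "?I = (SIGMA q:?S. J q)"
  proof -
    have "q ^ 2 \<le> B" if "prime q" "2 \<le> j" "q ^ j \<le> B" for q j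
      using power_increasing[of 2 j q] that prime_ge_1_nat[OF that(1)] by linarith
    then show ?thesis by (auto simp: prime_power_pairs_def proper_prime_powers_def J_def)
  qed
  then have "(\<Sum>(q, j)\<in>?I. ln (real q)) = (\<Sum>q\<in>?S. \<Sum>j\<in>J q. ln (real q))"
    using finS finJ by (subst sum.Sigma) auto
  also have "\<dots> \<le> (\<Sum>q\<in>?S. ln (real B))"
  proof (rule sum_mono)
    fix q assume q: "q \<in> ?S"
    then have pq: "prime q" and q0: "q > 0" by (auto dest: prime_gt_0_nat)
    have ne: "J q \<noteq> {}" using q by (auto simp: J_def)
    let ?m = "Max (J q)"
    have m: "?m \<in> J q" using finJ[OF pq] ne by (rule Max_in)
    have "J q \<subseteq> {1..?m}" using Max_ge[OF finJ[OF pq]] by (auto simp: J_def)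
    then have "card (J q) \<le> ?m" using card_mono[of "{1..?m}" "J q"] by simp
    then have "real (card (J q)) * ln (real q) \<le> real ?m * ln (real q)"
      using ln_prime_nonneg[OF pq] by (intro mult_right_mono) auto
    also have "\<dots> = ln (real (q ^ ?m))" by (simp add: ln_realpow)
    also have "\<dots> \<le> ln (real B)"
    proof -
      have "real (q ^ ?m) \<le> real B" using m by (simp only: J_def mem_Collect_eq of_nat_le_iff)
      moreover have "real (q ^ ?m) > 0" using q0 by simp
      ultimately show ?thesis by (subst ln_le_cancel_iff) linarith+
    qed
    finally show "(\<Sum>j\<in>J q. ln (real q)) \<le> ln (real B)" by simp
  qed
  also have "\<dots> = real (card ?S) * ln (real B)" by simp
  also have "\<dots> \<le> sqrt (real B) * ln (real B)"
  proof (rule mult_right_mono)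
    have "card ?S \<le> nat \<lfloor>sqrt (real B)\<rfloor>" using card_mono[OF _ S] by simp
    then have "real (card ?S) \<le> real (nat \<lfloor>sqrt (real B)\<rfloor>)" by (simp only: of_nat_le_iff)
    also have "\<dots> \<le> sqrt (real B)" by (rule of_nat_floor) simp
    finally show "real (card ?S) \<le> sqrt (real B)" .
  qed (use assms in simp)
  finally show ?thesis .
qed

lemma count_residue_le:
  fixes a :: int
  assumes "coprime x d" "d > 0" "Y \<subseteq> {N..<N + L}"
  shows "(\<Sum>y\<in>Y. of_bool (int d dvd int x * int y + a)) \<le> real L / real d + 1"
proof -
  obtain c where c: "c < d" "\<And>b. int d dvd int x * int b - (- a) \<longleftrightarrow> b mod d = c"
    using linear_congruence_unique_solution[OF assms(1,2)] by blast
  have "(\<Sum>y\<in>Y. of_bool (int d dvd int x * int y + a)) \<le> (\<Sum>y\<in>{N..<N + L}. of_bool (int d dvd int x * int y + a) :: real)"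
    using assms(3) by (intro sum_mono2) auto
  also have "\<dots> = (\<Sum>y\<in>{N..<N + L}. of_bool (y mod d = c))" using c(2) by simp
  also have "\<dots> \<le> real L / real d + 1"
  proof -
    have "\<bar>(\<Sum>m\<in>{N..<N + L}. of_bool (m mod d = c)) - real L / real d * (\<Sum>b<d. of_bool (b mod d = c))\<bar>
        \<le> (\<Sum>b<d. of_bool (b mod d = c))"
      by (rule sum_periodic_bound[of "\<lambda>m. of_bool (m mod d = c)"]) (use assms in auto)
    moreover have "(\<Sum>b<d. of_bool (b mod d = c)) = (\<Sum>b<d. of_bool (b = c) :: real)"
      by (rule sum.cong) auto
    then have "(\<Sum>b<d. of_bool (b mod d = c)) = (1::real)" using c(1) by (simp add: of_bool_def)
    ultimately show ?thesis by simp
  qed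
  finally show ?thesis .
qed

section \<open>Prime powers\<close>

lemma nat_floor_bounds:
  assumes "x \<ge> 1"
  shows "1 \<le> nat \<lfloor>x\<rfloor>" "real (nat \<lfloor>x\<rfloor>) \<le> x" "x < real (nat \<lfloor>x\<rfloor>) + 1"
proof -
  have "\<lfloor>x\<rfloor> \<ge> 1" using assms by simp
  then show "1 \<le> nat \<lfloor>x\<rfloor>" "real (nat \<lfloor>x\<rfloor>) \<le> x" "x < real (nat \<lfloor>x\<rfloor>) + 1" by linarith+
qed

text \<open>For \<open>q\<close> different from \<open>x\<close> the congruence fixes one class of
  \<open>y\<close> modulo \<open>q ^ j\<close>; for \<open>q = x\<close> it would force
  \<open>x\<close> to divide \<open>a\<close>.\<close>

lemma shifted_count_prime_power_le:
  fixes a :: int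
  assumes q: "prime q" "j \<ge> 1" and X: "\<And>x. x \<in> X \<Longrightarrow> prime x \<and> \<not> int x dvd a" and Y: "Y \<subseteq> {N..<N + L}"
  shows "shifted_count X Y a (q ^ j) \<le> real (card X) * (real L / real q ^ j + 1)"
proof -
  have "shifted_count X Y a (q ^ j) \<le> (\<Sum>x\<in>X. real L / real q ^ j + 1)"
    unfolding shifted_count_def
  proof (rule sum_mono)
    fix x assume x: "x \<in> X"
    show "(\<Sum>y\<in>Y. of_bool (int (q ^ j) dvd int x * int y + a)) \<le> real L / real q ^ j + 1"
    proof (cases "q = x")
      case True
      have "\<not> int (q ^ j) dvd int x * int y + a" for y
      proof
        assume "int (q ^ j) dvd int x * int y + a"
        moreover have "int x dvd int (q ^ j)" using True q(2) by (simp add: dvd_power)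
        ultimately have "int x dvd int x * int y + a" by (rule dvd_trans[rotated])
        then have "int x dvd a" by (simp add: dvd_add_right_iff)
        then show False using X[OF x] by simp
      qed
      then show ?thesis by simp
    next
      case False
      then have "coprime x (q ^ j)" using q X[OF x] primes_coprime[of x q] by simp
      then show ?thesis using count_residue_le[of x "q ^ j" Y N L a] Y q prime_gt_0_nat by simp
    qed
  qed
  then show ?thesis by simp
qed

text \<open>Finitely many pairs are bounded trivially and lose against \<open>ln x\<close>. Outside
  them the convergent series has tail at most \<delta>, and the rounding error 1 for each power
  costs about \<open>sqrt x * ln x\<close>, a power of \<open>x\<close> below the size of the second
  block.\<close>

lemma prime_power_contribution:
  fixes a :: int
  assumes \<delta>: "0 < \<delta>" "\<delta> \<le> 1 / 100" and K: "K \<ge> 1" and a: "a \<noteq> 0"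
  shows "eventually (\<lambda>x. \<forall>z\<^sub>1 z\<^sub>2. admissible \<delta> K x z\<^sub>1 z\<^sub>2 \<longrightarrow>
      (\<Sum>(q, j)\<in>{(q, j) \<in> prime_power_pairs (nat \<lfloor>x\<rfloor>). j \<ge> 2 \<or> q \<le> l}.
          ln (real q) * shifted_count (prime_block \<delta> z\<^sub>1) (prime_block \<delta> z\<^sub>2) a (q ^ j))
      \<le> 5 * \<delta> * (real (card (prime_block \<delta> z\<^sub>1)) * real (card (prime_block \<delta> z\<^sub>2)) * ln x)) at_top"
proof -
  let ?f = "\<lambda>(q, j). ln (real q) / real q ^ j"
  obtain F where F: "finite F" "F \<subseteq> proper_prime_powers"
    "\<And>G. finite G \<Longrightarrow> G \<subseteq> proper_prime_powers - F \<Longrightarrow> sum ?f G \<le> \<delta>"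
    using sum_proper_prime_powers_bounded small_tail[of proper_prime_powers ?f _ \<delta>] \<delta>(1) by blast
  \<comment> \<open>The primes up to \<open>l\<close>, excluded from the range of the small moduli,
    join the finite exceptional set as first powers.\<close>
  define F' where "F' = F \<union> (\<lambda>q. (q, 1)) ` {..l}"
  have finF': "finite F'" using F(1) by (simp add: F'_def)
  define C where "C = (\<Sum>(q, j)\<in>F'. \<bar>ln (real q)\<bar>)"
  have e: "eventually (\<lambda>x::real. (\<bar>of_int a\<bar> + 1) * x powr 0 \<le> x powr \<delta>) at_top"
    "eventually (\<lambda>x::real. C / \<delta> \<le> ln x) at_top"
    "eventually (\<lambda>x::real. 2 * ln x ^ 1 \<le> \<delta>\<^sup>2 * x powr (1 / 2 - 3 * \<delta>)) at_top"
    subgoal using \<delta> by (intro const_powr_le) auto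
    subgoal by real_asymp
    subgoal using \<delta> by (intro ln_power_le_powr) auto
    done
  show ?thesis
    using e admissible_facts[OF \<delta> K] eventually_ge_at_top[of "exp 1"]
  proof eventually_elim
    case (elim x)
    have x1: "x \<ge> 1" using elim(5) one_le_exp_iff[of 1] by linarith
    then have x0: "x > 0" by simp
    have lx: "ln x \<ge> 1" using elim(5) x0 ln_ge_iff[of x 1] by simp
    define I where "I = {(q, j) \<in> prime_power_pairs (nat \<lfloor>x\<rfloor>). j \<ge> 2 \<or> q \<le> l}"
    have finI: "finite I" unfolding I_def using finite_prime_power_pairs[of "nat \<lfloor>x\<rfloor>"]
      by (rule rev_finite_subset) auto
    have I2: "I - F' \<subseteq> prime_power_pairs (nat \<lfloor>x\<rfloor>) \<inter> proper_prime_powers" "I - F' \<subseteq> proper_prime_powers - F"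
      by (auto simp: I_def F'_def prime_power_pairs_def proper_prime_powers_def image_iff not_less_eq_eq Suc_le_eq
          le_less numeral_2_eq_2)
    show ?case unfolding I_def[symmetric]
    proof (intro allI impI)
      fix z\<^sub>1 z\<^sub>2 assume adm: "admissible \<delta> K x z\<^sub>1 z\<^sub>2"
      define X where "X = prime_block \<delta> z\<^sub>1"
      define Y where "Y = prime_block \<delta> z\<^sub>2"
      let ?X = "real (card X)" and ?Y = "real (card Y)"
      let ?T = "\<lambda>(q, j). ln (real q) * shifted_count X Y a (q ^ j)"
      have facts: "1 \<le> z\<^sub>1" "(1 + \<delta>) * z\<^sub>1 < z\<^sub>2"
        "\<delta> * z\<^sub>2 \<le> 2 * (?Y * ln x)" "1 \<le> card Y"
        using elim(4) adm unfolding X_def Y_def by blast+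
      have z: "x powr \<delta> \<le> z\<^sub>1" "x powr (1 - 3 * \<delta>) \<le> z\<^sub>2" using adm by (auto simp: admissible_def)
      have "1 * z\<^sub>1 \<le> (1 + \<delta>) * z\<^sub>1" using \<delta> facts(1) by (intro mult_right_mono) auto
      then have z2: "1 \<le> z\<^sub>2" using facts by linarith
      obtain N L where Y: "Y \<subseteq> {N..<N + L}" "real L \<le> \<delta> * z\<^sub>2 + 1"
        using prime_block_window[of z\<^sub>2 \<delta>] z2 \<delta> unfolding Y_def by auto
      have Xa: "prime p \<and> \<not> int p dvd a" if "p \<in> X" for p
      proof -
        have p: "prime p" "z\<^sub>1 < real p" using that by (auto simp: X_def prime_block_def)
        have "\<not> int p dvd a"
        proof
          assume "int p dvd a"
          then have "int p \<le> \<bar>a\<bar>" using a dvd_imp_le_int[of a "int p"] by simp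
          then have "real p \<le> \<bar>of_int a\<bar>" by linarith
          then show False using p(2) z(1) elim(1) x0 by simp
        qed
        then show ?thesis using p by simp
      qed
      have YL: "1 \<le> ?Y * ln x" using facts(4) lx mult_mono[of 1 ?Y 1 "ln x"] by simp
      have "sum ?T I = sum ?T (I \<inter> F') + sum ?T (I - F')"
        using finI by (rule sum.Int_Diff)
      also have "sum ?T (I \<inter> F') \<le> \<delta> * (?X * ?Y * ln x)"
      proof -
        have "sum ?T (I \<inter> F') \<le> (\<Sum>(q, j)\<in>I \<inter> F'. \<bar>ln (real q)\<bar> * (?X * ?Y))"
        proof (rule sum_mono)
          fix i assume "i \<in> I \<inter> F'"
          then show "?T i \<le> (case i of (q, j) \<Rightarrow> \<bar>ln (real q)\<bar> * (?X * ?Y))"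
            using shifted_count_le[of X Y a] shifted_count_nonneg[of X Y a]
            by (cases i) (auto intro!: mult_mono)
        qed
        also have "\<dots> \<le> (\<Sum>(q, j)\<in>F'. \<bar>ln (real q)\<bar> * (?X * ?Y))"
          using finF' by (intro sum_mono2) auto
        also have "\<dots> = C * (?X * ?Y)" by (simp add: C_def sum_distrib_right case_prod_beta)
        also have "\<dots> \<le> (\<delta> * ln x) * (?X * ?Y)"
          using elim(2) \<delta> by (intro mult_right_mono) (auto simp: field_simps)
        finally show ?thesis by (simp add: mult_ac)
      qed
      moreover have "sum ?T (I - F') \<le> 3 * \<delta> * (?X * ?Y * ln x) + \<delta> * (?X * ?Y * ln x)"
      proof -
        have "sum ?T (I - F') \<le> (\<Sum>(q, j)\<in>I - F'. ?X * real L * (ln (real q) / real q ^ j) + ?X * ln (real q))"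
        proof (rule sum_mono)
          fix i assume i: "i \<in> I - F'"
          obtain q j where qj: "i = (q, j)" by fastforce
          have pq: "prime q" "j \<ge> 1" using i qj by (auto simp: I_def prime_power_pairs_def)
          have "ln (real q) * shifted_count X Y a (q ^ j) \<le> ln (real q) * (?X * (real L / real q ^ j + 1))"
            using ln_prime_nonneg[OF pq(1)] shifted_count_prime_power_le[OF pq Xa Y(1)] by (rule mult_left_mono[rotated])
          then show "?T i \<le> (case i of (q, j) \<Rightarrow> ?X * real L * (ln (real q) / real q ^ j) + ?X * ln (real q))"
            by (simp add: qj algebra_simps)
        qed
        also have "\<dots> = ?X * real L * sum ?f (I - F') + ?X * (\<Sum>(q, j)\<in>I - F'. ln (real q))"
          by (simp add: case_prod_beta sum.distrib sum_distrib_left)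
        also have "\<dots> \<le> ?X * (\<delta> * z\<^sub>2 + 1) * \<delta> + ?X * (sqrt x * ln x)"
        proof (intro add_mono mult_mono mult_left_mono)
          show "sum ?f (I - F') \<le> \<delta>" using finI I2(2) by (intro F(3)) auto
          show "0 \<le> sum ?f (I - F')"
            by (rule sum_nonneg) (auto simp: I_def prime_power_pairs_def intro!: divide_nonneg_nonneg ln_prime_nonneg)
          show "0 \<le> (\<Sum>(q, j)\<in>I - F'. ln (real q))"
            by (rule sum_nonneg) (auto simp: I_def prime_power_pairs_def ln_prime_nonneg)
          have "(\<Sum>(q, j)\<in>I - F'. ln (real q)) \<le> (\<Sum>(q, j)\<in>prime_power_pairs (nat \<lfloor>x\<rfloor>) \<inter> proper_prime_powers. ln (real q))"
            using I2(1) finite_prime_power_pairs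
            by (intro sum_mono2) (auto simp: proper_prime_powers_def ln_prime_nonneg)
          also have "\<dots> \<le> sqrt (real (nat \<lfloor>x\<rfloor>)) * ln (real (nat \<lfloor>x\<rfloor>))"
            by (rule sum_ln_proper_prime_powers_le) (rule nat_floor_bounds(1)[OF x1])
          also have "\<dots> \<le> sqrt x * ln x"
          proof -
            have "1 \<le> real (nat \<lfloor>x\<rfloor>)" "real (nat \<lfloor>x\<rfloor>) \<le> x" using nat_floor_bounds[OF x1] by simp_all
            then show ?thesis by (intro mult_mono) auto
          qed
          finally show "(\<Sum>(q, j)\<in>I - F'. ln (real q)) \<le> sqrt x * ln x" .
        qed (use Y(2) z2 \<delta> in auto)
        also have "?X * (\<delta> * z\<^sub>2 + 1) * \<delta> \<le> 3 * \<delta> * (?X * ?Y * ln x)"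
        proof -
          have "?X * (\<delta> * z\<^sub>2 + 1) * \<delta> \<le> ?X * (3 * (?Y * ln x)) * \<delta>"
            using facts(3) YL \<delta> by (intro mult_right_mono mult_left_mono) auto
          then show ?thesis by (simp add: mult_ac)
        qed
        also have "?X * (sqrt x * ln x) \<le> \<delta> * (?X * ?Y * ln x)"
        proof -
          have "2 * (sqrt x * ln x) = x powr (1 / 2) * (2 * ln x ^ 1)" using x0 by (simp add: powr_half_sqrt)
          also have "\<dots> \<le> x powr (1 / 2) * (\<delta>\<^sup>2 * x powr (1 / 2 - 3 * \<delta>))" using elim(3) by (intro mult_left_mono) auto
          also have "\<dots> = \<delta>\<^sup>2 * x powr (1 - 3 * \<delta>)"
          proof -
            have "x powr (1 / 2) * x powr (1 / 2 - 3 * \<delta>) = x powr (1 - 3 * \<delta>)"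
              unfolding powr_add[symmetric] by simp
            then show ?thesis by (simp only: mult.left_commute)
          qed
          also have "\<dots> \<le> \<delta> * (\<delta> * z\<^sub>2)" using z(2) \<delta> by (simp add: power2_eq_square)
          also have "\<dots> \<le> \<delta> * (2 * (?Y * ln x))" using facts(3) \<delta> by (intro mult_left_mono) auto
          finally have "sqrt x * ln x \<le> \<delta> * (?Y * ln x)" by simp
          then have "?X * (sqrt x * ln x) \<le> ?X * (\<delta> * (?Y * ln x))" by (rule mult_left_mono) simp
          then show ?thesis by (simp add: mult_ac)
        qed
        finally show ?thesis by simp
      qed
      ultimately have "sum ?T I \<le> 5 * \<delta> * (?X * ?Y * ln x)" by (simp add: algebra_simps)
      then show "(\<Sum>(q, j)\<in>I. ln (real q) * shifted_count (prime_block \<delta> z\<^sub>1) (prime_block \<delta> z\<^sub>2) a (q ^ j))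
        \<le> 5 * \<delta> * (real (card (prime_block \<delta> z\<^sub>1)) * real (card (prime_block \<delta> z\<^sub>2)) * ln x)"
        unfolding X_def Y_def .
    qed
  qed
qed

section \<open>Large moduli\<close>

lemma harmonic_sum_le: "n \<ge> 1 \<Longrightarrow> (\<Sum>k\<in>{1..n}. 1 / real k) \<le> 1 + ln (real n)"
proof (induction n rule: nat_induct_at_least)
  case (Suc n)
  have n: "real n > 0" using Suc.hyps by simp
  have "1 / real (Suc n) \<le> ln (real (Suc n)) - ln (real n)"
  proof -
    have "ln (real n / real (Suc n)) \<le> real n / real (Suc n) - 1" using n by (intro ln_le_minus_one) simp
    moreover have "real n / real (Suc n) - 1 = - (1 / real (Suc n))" by (simp add: field_simps)
    ultimately show ?thesis using n by (simp add: ln_div)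
  qed
  then show ?case using Suc.IH by simp
qed simp

lemma harmonic_sum_ge: "ln (real n + 1) \<le> (\<Sum>k\<in>{1..n}. 1 / real k)"
  using ln_le_harm[of n] by (simp add: harm_def inverse_eq_divide)

text \<open>Here \<open>V\<close> stands for \<open>z\<^sub>1 * z\<^sub>2\<close>, \<open>D\<close>
  for the size of \<open>q\<close>, \<open>M\<close> for the longest window of \<open>m\<close>, and
  \<open>b\<close> for the product of the primes dividing \<open>a\<close>. The hypotheses make
  \<open>D\<close> and \<open>R\<^sup>2\<close> smaller than \<open>V\<close> by
  \<open>x powr (2 * \<delta>)\<close>; this saving is shared between the two ranges of moduli, and
  the divisor and logarithmic factors reduce it to \<open>x powr (\<delta> / 4)\<close>.\<close>

lemma level_error_asymptotic:
  fixes b C \<delta> :: real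
  assumes \<delta>: "0 < \<delta>" "\<delta> \<le> 1 / 100" and C: "C \<ge> 1" and b: "b \<ge> 0"
  shows "eventually (\<lambda>x. \<forall>V D M L nQ R.
      x powr (1 - 2 * \<delta>) \<le> V \<and> 1 \<le> D \<and> D \<le> x powr (5 / 8) \<and> real M * D \<le> 4 * V \<and>
      0 \<le> L \<and> L \<le> 2 * D \<and> 0 \<le> nQ \<and> nQ \<le> 2 * D \<and> 1 \<le> R \<and> real R \<le> x powr (1 / 2 - 2 * \<delta>) \<longrightarrow>
      C * real R powr (\<delta> / 8) * (\<Sum>n\<in>{1..R}. 1 / real n) *
       (nQ * b * C * real R powr (\<delta> / 8) * real (nat \<lfloor>real M / x powr \<delta>\<rfloor> + 1)
        + sqrt (real M * (real M / real (nat \<lfloor>real M / x powr \<delta>\<rfloor> + 1) + 1))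
          * sqrt ((\<Sum>n\<in>{1..R}. 1 / real n) * (20 * (L + real R ^ 2) * nQ)))
      \<le> V * x powr (- (\<delta> / 4))) at_top"
proof -
  let ?c = "20 * C\<^sup>2 * b + 88 * C"
  have e: "eventually (\<lambda>x::real. ?c * ln x ^ 2 \<le> x powr (\<delta> / 8)) at_top"
    "eventually (\<lambda>x::real. 2 * x powr (5 / 8) \<le> x powr (1 - 4 * \<delta>)) at_top"
    subgoal using \<delta> by (intro ln_power_le_powr_diff) auto
    subgoal using \<delta> by (intro const_powr_le) auto
    done
  show ?thesis using e eventually_ge_at_top[of "exp 1"]
  proof eventually_elim
    case (elim x)
    have x1: "x \<ge> 1" using elim(3) one_le_exp_iff[of 1] by linarith
    then have x0: "x > 0" by simp
    have lx: "ln x \<ge> 1" using elim(3) x0 ln_ge_iff[of x 1] by simp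
    show ?case
    proof (intro allI impI, elim conjE)
      fix V D L nQ :: real and M R :: nat
      assume V: "x powr (1 - 2 * \<delta>) \<le> V" and D: "1 \<le> D" "D \<le> x powr (5 / 8)" and M: "real M * D \<le> 4 * V"
        and L: "0 \<le> L" "L \<le> 2 * D" and nQ: "0 \<le> nQ" "nQ \<le> 2 * D" and R: "1 \<le> R" "real R \<le> x powr (1 / 2 - 2 * \<delta>)"
      let ?H = "\<Sum>n\<in>{1..R}. 1 / real n"
      \<comment> \<open>The threshold \<open>M / x powr \<delta>\<close> balances the ranges: below
        it the rounding errors total about \<open>M * D * x powr (- \<delta>)\<close>, and above it
        \<open>M / S\<close> is at most \<open>x powr \<delta>\<close>, half of the saving available
        under the root.\<close>
      define S where "S = nat \<lfloor>real M / x powr \<delta>\<rfloor> + 1"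
      have xd: "1 \<le> x powr \<delta>" using x1 \<delta> by (intro ge_one_powr_ge_zero) auto
      have V0: "V \<ge> 0" using V by (rule order_trans[rotated]) simp
      have q0: "0 \<le> real M / x powr \<delta>" by simp
      have S1: "real S \<le> real M / x powr \<delta> + 1" "real M / x powr \<delta> \<le> real S" "S \<ge> 1"
        unfolding S_def using q0 by linarith+
      have MS: "real M / real S \<le> x powr \<delta>"
      proof -
        have "real M \<le> real S * x powr \<delta>" using S1(2) xd x0 by (subst (asm) pos_divide_le_eq) auto
        then show ?thesis using S1(3) by (simp add: pos_divide_le_eq mult.commute)
      qed
      have Rx: "real R \<le> x"
      proof -
        have "x powr (1 / 2 - 2 * \<delta>) \<le> x powr 1" using x1 \<delta> by (intro powr_mono) auto
        then show ?thesis using R(2) x0 by simp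
      qed
      have Re: "real R powr (\<delta> / 8) \<le> x powr (\<delta> / 8)" using Rx \<delta> by (intro powr_mono2) auto
      have H: "0 \<le> ?H" "?H \<le> 2 * ln x"
      proof -
        have "?H \<le> 1 + ln (real R)" by (rule harmonic_sum_le[OF R(1)])
        moreover have "ln (real R) \<le> ln x" using R(1) Rx by simp
        ultimately show "?H \<le> 2 * ln x" using lx by linarith
      qed (simp add: sum_nonneg)
      have V4: "x powr (1 - 4 * \<delta>) \<le> V * x powr (- (2 * \<delta>))"
      proof -
        have "x powr (1 - 4 * \<delta>) = x powr (1 - 2 * \<delta>) * x powr (- (2 * \<delta>))" unfolding powr_add[symmetric] by simp
        then show ?thesis using V by (simp add: mult_right_mono)
      qed
      have D4: "2 * D \<le> V * x powr (- (2 * \<delta>))" using D(2) elim(2) V4 by linarith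
      have DV: "D \<le> V * x powr (- \<delta>)"
      proof -
        have "x powr (- (2 * \<delta>)) \<le> x powr (- \<delta>)" using x1 \<delta> by (intro powr_mono) auto
        then have "V * x powr (- (2 * \<delta>)) \<le> V * x powr (- \<delta>)" using V0 by (rule mult_left_mono)
        then show ?thesis using D4 D(1) by linarith
      qed
      have t1: "nQ * b * C * real R powr (\<delta> / 8) * real S \<le> 10 * b * C * x powr (\<delta> / 8) * (V * x powr (- \<delta>))"
      proof -
        have "nQ * real S \<le> 2 * D * (real M / x powr \<delta> + 1)" using nQ S1 D by (intro mult_mono) auto
        also have "\<dots> = 2 * (real M * D) * x powr (- \<delta>) + 2 * D" by (simp add: powr_minus field_simps)
        also have "\<dots> \<le> 2 * (4 * V) * x powr (- \<delta>) + 2 * (V * x powr (- \<delta>))"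
          using M DV by (intro add_mono mult_right_mono mult_left_mono) auto
        finally have "nQ * real S \<le> 10 * (V * x powr (- \<delta>))" by simp
        then have "(b * C) * real R powr (\<delta> / 8) * (nQ * real S) \<le> (b * C) * x powr (\<delta> / 8) * (10 * (V * x powr (- \<delta>)))"
          using Re b C nQ by (intro mult_mono[of "b * C * real R powr (\<delta> / 8)"] mult_left_mono) auto
        then show ?thesis by (simp add: mult_ac)
      qed
      have t2: "sqrt (real M * (real M / real S + 1)) * sqrt (?H * (20 * (L + real R ^ 2) * nQ)) \<le> 44 * ln x * (V * x powr (- (\<delta> / 2)))"
      proof -
        have R2: "real R ^ 2 \<le> V * x powr (- (2 * \<delta>))"
        proof -
          have "real R ^ 2 \<le> (x powr (1 / 2 - 2 * \<delta>)) ^ 2" using R(2) by (intro power_mono) auto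
          also have "\<dots> = x powr (1 - 4 * \<delta>)" unfolding power2_eq_square powr_add[symmetric] by simp
          finally show ?thesis using V4 by linarith
        qed
        have "real M * (real M / real S + 1) * (?H * (20 * (L + real R ^ 2) * nQ))
            \<le> real M * (2 * x powr \<delta>) * ((2 * ln x) * (20 * (2 * (V * x powr (- (2 * \<delta>)))) * (2 * D)))"
        proof (rule mult_mono)
          show "real M * (real M / real S + 1) \<le> real M * (2 * x powr \<delta>)"
            using MS xd by (intro mult_left_mono) auto
          have "20 * (L + real R ^ 2) * nQ \<le> 20 * (2 * (V * x powr (- (2 * \<delta>)))) * (2 * D)"
            using L D4 R2 nQ V0 by (intro mult_mono) auto
          then show "?H * (20 * (L + real R ^ 2) * nQ) \<le> (2 * ln x) * (20 * (2 * (V * x powr (- (2 * \<delta>)))) * (2 * D))"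
            using H L nQ lx by (intro mult_mono[of ?H "2 * ln x"]) auto
          show "0 \<le> ?H * (20 * (L + real R ^ 2) * nQ)" using H L nQ by (intro mult_nonneg_nonneg) auto
        qed simp
        also have "\<dots> = 320 * ln x * (real M * D) * V * (x powr \<delta> * x powr (- (2 * \<delta>)))" by simp
        also have "x powr \<delta> * x powr (- (2 * \<delta>)) = x powr (- \<delta>)" unfolding powr_add[symmetric] by simp
        also have "320 * ln x * (real M * D) * V * x powr (- \<delta>) \<le> 320 * ln x * (4 * V) * V * x powr (- \<delta>)"
          using M V0 lx by (intro mult_right_mono mult_left_mono) auto
        \<comment> \<open>The constant 44 is chosen because \<open>320 * 4 = 1280\<close> is below
          \<open>44\<^sup>2 = 1936\<close>.\<close>
        also have "\<dots> \<le> (44 * ln x * (V * x powr (- (\<delta> / 2))))\<^sup>2"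
        proof -
          have "x powr (- \<delta>) = (x powr (- (\<delta> / 2)))\<^sup>2" unfolding power2_eq_square powr_add[symmetric] by simp
          moreover have "1280 * ln x \<le> 1936 * (ln x)\<^sup>2"
            using lx mult_mono[of 1 "ln x" "ln x" "ln x"] by (simp add: power2_eq_square)
          then have "1280 * ln x * (V\<^sup>2 * (x powr (- (\<delta> / 2)))\<^sup>2) \<le> 1936 * (ln x)\<^sup>2 * (V\<^sup>2 * (x powr (- (\<delta> / 2)))\<^sup>2)"
            by (rule mult_right_mono) simp
          ultimately show ?thesis by (simp add: power_mult_distrib power2_eq_square mult_ac)
        qed
        finally have "sqrt (real M * (real M / real S + 1) * (?H * (20 * (L + real R ^ 2) * nQ)))
            \<le> 44 * ln x * (V * x powr (- (\<delta> / 2)))"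
          using lx V0 by (intro real_le_lsqrt mult_nonneg_nonneg) auto
        then show ?thesis by (simp only: real_sqrt_mult)
      qed
      have "C * real R powr (\<delta> / 8) * ?H *
         (nQ * b * C * real R powr (\<delta> / 8) * real S
          + sqrt (real M * (real M / real S + 1)) * sqrt (?H * (20 * (L + real R ^ 2) * nQ)))
        \<le> C * x powr (\<delta> / 8) * (2 * ln x) * (10 * b * C * x powr (\<delta> / 8) * (V * x powr (- \<delta>)) + 44 * ln x * (V * x powr (- (\<delta> / 2))))"
      proof (rule mult_mono)
        show "C * real R powr (\<delta> / 8) * ?H \<le> C * x powr (\<delta> / 8) * (2 * ln x)"
          using C Re H by (intro mult_mono) auto
        show "0 \<le> nQ * b * C * real R powr (\<delta> / 8) * real S
          + sqrt (real M * (real M / real S + 1)) * sqrt (?H * (20 * (L + real R ^ 2) * nQ))"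
          using nQ b C H L by (intro add_nonneg_nonneg mult_nonneg_nonneg) auto
      qed (use t1 t2 C lx in \<open>auto intro: add_mono\<close>)
      also have "\<dots> = (20 * C\<^sup>2 * b) * ln x * (x powr (\<delta> / 8) * x powr (\<delta> / 8) * x powr (- \<delta>)) * V
          + (88 * C) * (ln x)\<^sup>2 * (x powr (\<delta> / 8) * x powr (- (\<delta> / 2))) * V"
        by (simp add: power2_eq_square algebra_simps)
      also have "x powr (\<delta> / 8) * x powr (\<delta> / 8) * x powr (- \<delta>) = x powr (- (3 * \<delta> / 4))"
        unfolding powr_add[symmetric] by simp
      also have "x powr (\<delta> / 8) * x powr (- (\<delta> / 2)) = x powr (- (3 * \<delta> / 8))"
        unfolding powr_add[symmetric] by simp
      also have "(20 * C\<^sup>2 * b) * ln x * x powr (- (3 * \<delta> / 4)) * V + (88 * C) * (ln x)\<^sup>2 * x powr (- (3 * \<delta> / 8)) * V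
        \<le> (20 * C\<^sup>2 * b) * (ln x)\<^sup>2 * x powr (- (3 * \<delta> / 8)) * V + (88 * C) * (ln x)\<^sup>2 * x powr (- (3 * \<delta> / 8)) * V"
      proof (intro add_right_mono mult_right_mono)
        have "ln x \<le> (ln x)\<^sup>2" using lx by (simp add: power2_eq_square)
        moreover have "x powr (- (3 * \<delta> / 4)) \<le> x powr (- (3 * \<delta> / 8))" using x1 \<delta> by (intro powr_mono) auto
        ultimately show "(20 * C\<^sup>2 * b) * ln x * x powr (- (3 * \<delta> / 4)) \<le> (20 * C\<^sup>2 * b) * (ln x)\<^sup>2 * x powr (- (3 * \<delta> / 8))"
          using b C lx by (intro mult_mono mult_left_mono) auto
      qed (rule V0)
      also have "\<dots> = (?c * ln x ^ 2) * (x powr (- (3 * \<delta> / 8)) * V)" by (simp add: algebra_simps)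
      also have "\<dots> \<le> x powr (\<delta> / 8) * (x powr (- (3 * \<delta> / 8)) * V)"
        using elim(1) V0 by (intro mult_right_mono) auto
      also have "\<dots> = V * x powr (- (\<delta> / 4))"
        by (simp add: mult.commute mult.left_commute flip: powr_add)
      finally show "C * real R powr (\<delta> / 8) * ?H *
       (nQ * b * C * real R powr (\<delta> / 8) * real (nat \<lfloor>real M / x powr \<delta>\<rfloor> + 1)
        + sqrt (real M * (real M / real (nat \<lfloor>real M / x powr \<delta>\<rfloor> + 1) + 1))
          * sqrt (?H * (20 * (L + real R ^ 2) * nQ)))
      \<le> V * x powr (- (\<delta> / 4))" unfolding S_def .
    qed
  qed
qed

lemma sum_of_bool_eq_card: "finite A \<Longrightarrow> (\<Sum>x\<in>A. of_bool (P x) :: real) = real (card {x \<in> A. P x})"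
  by (simp add: Int_def)

text \<open>The switch to the cofactor \<open>m = (p * y + a) / q\<close>. As
  \<open>q * m - a = p * y\<close> with \<open>y\<close> a prime beyond \<open>z\<close>, no prime
  up to \<open>z\<close> except \<open>p\<close> divides it. A prime of \<open>B\<close> dividing
  \<open>m\<close> would, since it divides \<open>a\<close>, also divide \<open>p * y\<close>, so
  \<open>m\<close> avoids \<open>B\<close>.\<close>

lemma shifted_count_le_sifted_count:
  fixes a :: int
  assumes Y: "finite Y" "\<And>y. y \<in> Y \<Longrightarrow> prime y" "\<And>y. y \<in> Y \<Longrightarrow> z < y" "\<And>y. y \<in> Y \<Longrightarrow> y \<notin> B"
    and p: "prime p" "p \<notin> B" and B: "\<And>r. r \<in> B \<Longrightarrow> prime r" "\<And>r. r \<in> B \<Longrightarrow> int r dvd a" and q: "q > 0"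
    and pos: "\<And>y. y \<in> Y \<Longrightarrow> 0 \<le> int p * int y + a"
    and win: "\<And>y m. y \<in> Y \<Longrightarrow> int q * int m = int p * int y + a \<Longrightarrow> lo \<le> m \<and> m < hi"
  shows "(\<Sum>y\<in>Y. of_bool (int q dvd int p * int y + a) :: real)
    \<le> (\<Sum>m\<in>{lo..<lo + (hi - lo)}. of_bool (avoids B m \<and> int p dvd int q * int m - a
        \<and> sifted z (insert p B) (int q * int m - a)))"
proof -
  let ?Y = "{y \<in> Y. int q dvd int p * int y + a}"
  let ?M = "{m \<in> {lo..<lo + (hi - lo)}. avoids B m \<and> int p dvd int q * int m - a
        \<and> sifted z (insert p B) (int q * int m - a)}"
  define f where "f y = nat ((int p * int y + a) div int q)" for y
  have f: "int q * int (f y) = int p * int y + a" if "y \<in> ?Y" for y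
  proof -
    have "0 \<le> (int p * int y + a) div int q" using that pos[of y] q by (simp add: pos_imp_zdiv_nonneg_iff)
    then show ?thesis using that unfolding f_def by simp
  qed
  have div_cases: "r = p \<or> r = y" if "prime r" "y \<in> Y" "int r dvd int p * int y" for r y
  proof -
    have "r dvd p * y" using that(3) by (metis int_dvd_int_iff of_nat_mult)
    then have "r dvd p \<or> r dvd y" using that(1) by (simp add: prime_dvd_mult_iff)
    then show ?thesis using that(1) p(1) Y(2)[OF that(2)] by (auto dest: primes_dvd_imp_eq)
  qed
  have "card ?Y \<le> card ?M"
  proof (rule card_inj_on_le[of f])
    show "inj_on f ?Y"
    proof (rule inj_onI)
      fix y y' assume "y \<in> ?Y" "y' \<in> ?Y" "f y = f y'"
      then have "int p * int y = int p * int y'" using f[of y] f[of y'] by presburger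
      then show "y = y'" using p(1) by (auto dest: prime_gt_0_nat)
    qed
    show "f ` ?Y \<subseteq> ?M"
    proof (rule image_subsetI)
      fix y assume y: "y \<in> ?Y"
      then have yY: "y \<in> Y" by simp
      have e: "int q * int (f y) - a = int p * int y" using f[OF y] by simp
      have av: "avoids B (f y)" unfolding avoids_def
      proof (intro ballI notI)
        fix r assume r: "r \<in> B" "r dvd f y"
        have "int r dvd int q * int (f y)" using r(2) by simp
        then have "int r dvd int p * int y" unfolding e[symmetric] using B(2)[OF r(1)] by (rule dvd_diff)
        then have "r = p \<or> r = y" using div_cases[OF B(1)[OF r(1)] yY] by simp
        then show False using r(1) p(2) Y(4)[OF yY] by auto
      qed
      have si: "sifted z (insert p B) (int p * int y)" unfolding sifted_def
      proof (intro allI impI notI)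
        fix r assume r: "prime r \<and> r \<le> z \<and> r \<notin> insert p B" "int r dvd int p * int y"
        then have "r = p \<or> r = y" using div_cases[of r y] yY by simp
        then show False using r(1) Y(3)[OF yY] by auto
      qed
      have "f y \<in> {lo..<lo + (hi - lo)}" using win[OF yY f[OF y]] by simp
      then show "f y \<in> ?M" using av si unfolding mem_Collect_eq e by (intro conjI) simp_all
    qed
  qed simp
  then have "real (card ?Y) \<le> real (card ?M)" by (rule of_nat_mono)
  then show ?thesis unfolding sum_of_bool_eq_card[OF Y(1)] sum_of_bool_eq_card[OF finite_atLeastLessThan] .
qed

text \<open>The window is the hull of the possible \<open>m\<close> over both blocks, so that it
  depends on \<open>p\<close> only. Relative to \<open>p * z / D\<close> its length is the sum of
  the two block widths, up to bounded rounding.\<close>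

lemma quotient_window:
  fixes D z A \<delta> \<eta> :: real and a :: int and p :: nat
  assumes "1 \<le> D" "0 \<le> \<eta>" "0 \<le> \<delta>" "0 \<le> z" "\<bar>real_of_int a\<bar> \<le> A"
  defines "lo \<equiv> nat \<lfloor>(real p * z - A) / ((1 + \<eta>) * D)\<rfloor>" and "hi \<equiv> nat \<lfloor>(real p * ((1 + \<delta>) * z) + A) / D\<rfloor> + 1"
  shows "\<lbrakk>z \<le> real y; real y \<le> (1 + \<delta>) * z; D < real q; real q \<le> (1 + \<eta>) * D; int q * int m = int p * int y + a\<rbrakk>
      \<Longrightarrow> lo \<le> m \<and> m < hi"
    and "real (hi - lo) \<le> real p * z / D * (\<delta> + \<eta>) + 2 * A + 2"
proof -
  have A: "A \<ge> 0" using assms(5) by linarith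
  have D1: "(1 + \<eta>) * D \<ge> 1" using mult_mono[of 1 "1 + \<eta>" 1 D] assms by simp
  {
    assume y: "z \<le> real y" "real y \<le> (1 + \<delta>) * z" and q: "D < real q" "real q \<le> (1 + \<eta>) * D"
      and m: "int q * int m = int p * int y + a"
    have m': "real q * real m = real p * real y + real_of_int a" using m by (metis of_int_add of_int_mult of_int_of_nat_eq)
    have "real p * z - A \<le> real m * ((1 + \<eta>) * D)"
    proof -
      have "real p * z \<le> real p * real y" using y by (intro mult_left_mono) auto
      moreover have "real q * real m \<le> ((1 + \<eta>) * D) * real m" using q by (intro mult_right_mono) auto
      ultimately show ?thesis using m' assms(5) by (simp add: mult.commute)
    qed
    then have "(real p * z - A) / ((1 + \<eta>) * D) \<le> real m" using D1 by (subst pos_divide_le_eq) auto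
    then have "lo \<le> m" unfolding lo_def by linarith
    moreover have "real m * D \<le> real p * ((1 + \<delta>) * z) + A"
    proof -
      have "real p * real y \<le> real p * ((1 + \<delta>) * z)" using y by (intro mult_left_mono) auto
      moreover have "D * real m \<le> real q * real m" using q by (intro mult_right_mono) auto
      ultimately show ?thesis using m' assms(5) by (simp add: mult.commute)
    qed
    then have "real m \<le> (real p * ((1 + \<delta>) * z) + A) / D" using assms(1) by (subst pos_le_divide_eq) auto
    then have "m < hi" unfolding hi_def by linarith
    ultimately show "lo \<le> m \<and> m < hi" ..
  }
  have lo: "real lo \<ge> (real p * z - A) / ((1 + \<eta>) * D) - 1" unfolding lo_def by linarith
  have "0 \<le> (real p * ((1 + \<delta>) * z) + A) / D" using assms A by (intro divide_nonneg_nonneg add_nonneg_nonneg mult_nonneg_nonneg) auto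
  then have hi: "real hi \<le> (real p * ((1 + \<delta>) * z) + A) / D + 1" unfolding hi_def by linarith
  have l2: "(real p * z - A) / ((1 + \<eta>) * D) \<ge> real p * z / D * (1 - \<eta>) - A"
  proof -
    have "(1 - \<eta>) * (1 + \<eta>) \<le> 1" by (simp add: algebra_simps)
    then have "1 - \<eta> \<le> 1 / (1 + \<eta>)" using assms by (subst pos_le_divide_eq) auto
    then have "real p * z / D * (1 - \<eta>) \<le> real p * z / D * (1 / (1 + \<eta>))" using assms by (intro mult_left_mono) auto
    moreover have "A / ((1 + \<eta>) * D) \<le> A / 1" using D1 A by (intro divide_left_mono) auto
    moreover have "(real p * z - A) / ((1 + \<eta>) * D) = real p * z / D * (1 / (1 + \<eta>)) - A / ((1 + \<eta>) * D)"
      by (simp add: diff_divide_distrib)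
    ultimately show ?thesis by linarith
  qed
  have h2: "(real p * ((1 + \<delta>) * z) + A) / D \<le> real p * z / D * (1 + \<delta>) + A"
  proof -
    have "A / D \<le> A / 1" using assms A by (intro divide_left_mono) auto
    then show ?thesis by (simp add: add_divide_distrib mult.commute mult.left_commute)
  qed
  have "real p * z / D * (1 + \<delta>) - real p * z / D * (1 - \<eta>) = real p * z / D * (\<delta> + \<eta>)"
    unfolding right_diff_distrib[symmetric] by (rule arg_cong[where f = "(*) _"]) simp
  moreover have "h - l \<le> u + 2 * A + 2"
    if "u1 - u2 = u" "v2 - 1 \<le> l" "h \<le> v1 + 1" "u2 - A \<le> v2" "v1 \<le> u1 + A" for u1 u2 u v1 v2 l h :: real
    using that by linarith
  ultimately have "real hi - real lo \<le> real p * z / D * (\<delta> + \<eta>) + 2 * A + 2" using lo hi l2 h2 by blast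
  moreover have "0 \<le> real p * z / D * (\<delta> + \<eta>) + 2 * A + 2" using assms A by (intro add_nonneg_nonneg mult_nonneg_nonneg) auto
  ultimately show "real (hi - lo) \<le> real p * z / D * (\<delta> + \<eta>) + 2 * A + 2" by (cases "lo \<le> hi") (auto simp: of_nat_diff)
qed

text \<open>The density of the integers avoiding \<open>B\<close> cancels exactly against the loss
  in the sieve sum from exempting \<open>B\<close>. Exempting \<open>p\<close> costs
  \<open>p / (p - 1)\<close>, which is at most \<open>1 + \<delta>\<close> for large
  \<open>p\<close>.\<close>

lemma sieve_density_le:
  assumes B: "prime_set B" and p: "prime p" "p \<notin> B" "1 + 1 / \<delta> \<le> real p" and \<delta>: "\<delta> > 0" and z: "z \<ge> 1"
  shows "(\<Prod>r\<in>B. 1 - 1 / real r) / sieve_sum z (insert p B) \<le> (1 + \<delta>) / ln (real z + 1)"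
proof -
  let ?S = "sieve_sum z (insert p B)"
  define E where "E = (\<Prod>r\<in>B. 1 - 1 / real r)"
  define G where "G = (\<Prod>r\<in>B. real r / (real r - 1))"
  have r2: "real r \<ge> 2" if "r \<in> B" for r using that B prime_ge_2_nat[of r] by (simp add: prime_set_def)
  have E0: "E \<ge> 0" unfolding E_def by (intro prod_nonneg) (use r2 in \<open>force simp: field_simps\<close>)
  have "E * G = (\<Prod>r\<in>B. (1 - 1 / real r) * (real r / (real r - 1)))" unfolding E_def G_def by (rule prod.distrib[symmetric])
  also have "\<dots> = (\<Prod>r\<in>B. 1)"
  proof (rule prod.cong)
    fix r assume "r \<in> B"
    then have "real r - 1 \<noteq> 0" "real r \<noteq> 0" using r2[of r] by auto
    then show "(1 - 1 / real r) * (real r / (real r - 1)) = 1" by (simp add: field_simps)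
  qed simp
  finally have EG: "E * G = 1" by simp
  have Bp: "prime_set (insert p B)" "finite B" using B p by (auto simp: prime_set_def)
  have S0: "?S > 0" using sieve_sum_pos[OF z, of "insert p B"] by linarith
  have pp: "real p / (real p - 1) \<le> 1 + \<delta>"
  proof -
    have p1: "1 / \<delta> \<le> real p - 1" using p(3) by simp
    then have "1 \<le> \<delta> * (real p - 1)" using \<delta> by (simp add: pos_divide_le_eq mult.commute)
    moreover have "1 / \<delta> > 0" using \<delta> by simp
    then have "real p - 1 > 0" using p1 by linarith
    ultimately show ?thesis by (simp add: pos_divide_le_eq algebra_simps)
  qed
  have "ln (real z + 1) \<le> (\<Prod>r\<in>insert p B. real r / (real r - 1)) * ?S"
    using harmonic_sum_ge[of z] sieve_sum_lower_bound[OF Bp(1), of z] by linarith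
  also have "\<dots> = real p / (real p - 1) * (G * ?S)" using p(2) Bp(2) by (simp add: G_def)
  finally have "ln (real z + 1) \<le> real p / (real p - 1) * (G * ?S)" .
  then have "E * ln (real z + 1) \<le> E * (real p / (real p - 1) * (G * ?S))" using E0 by (rule mult_left_mono)
  also have "\<dots> = real p / (real p - 1) * ?S * (E * G)" by (simp only: mult_ac)
  also have "\<dots> \<le> (1 + \<delta>) * ?S" unfolding EG mult_1_right using pp S0 by (intro mult_right_mono) auto
  finally have "E * ln (real z + 1) \<le> (1 + \<delta>) * ?S" .
  moreover have "ln (real z + 1) > 0" using z by simp
  ultimately show ?thesis unfolding E_def[symmetric] using S0 by (simp add: field_simps)
qed

text \<open>The prime \<open>p\<^sub>1\<close> is fixed, and \<open>p\<^sub>2 = (q * m - a) / p\<^sub>1\<close> is detected by the sieve while \<open>q\<close> and \<open>m\<close> vary.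
  The constant is the main term \<open>1 / ln z\<close> of the sieve with sifting level \<open>z = x powr (1 / 4 - 2 * \<delta>)\<close>.\<close>

lemma large_moduli_block:
  fixes a :: int
  assumes \<delta>: "0 < \<delta>" "\<delta> \<le> 1 / 100" and K: "K \<ge> 1" and a: "a \<noteq> 0"
  shows "eventually (\<lambda>x. \<forall>z\<^sub>1 z\<^sub>2 D. admissible \<delta> K x z\<^sub>1 z\<^sub>2 \<and> x powr (1 / 2 - 3 * \<delta> / 2) \<le> D \<and> D \<le> x powr (5 / 8) \<longrightarrow>
      (\<Sum>q\<in>prime_block (\<delta>\<^sup>2) D. shifted_count (prime_block \<delta> z\<^sub>1) (prime_block \<delta> z\<^sub>2) a q)
      \<le> real (card (prime_block \<delta> z\<^sub>1)) * (real (card (prime_block (\<delta>\<^sup>2) D))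
          * (z\<^sub>2 / D * (\<delta> * (1 + 2 * \<delta>)) * ((1 + \<delta>) / ((1 / 4 - 2 * \<delta>) * ln x))))
        + z\<^sub>1 * z\<^sub>2 * x powr (- (\<delta> / 4))) at_top"
proof -
  \<comment> \<open>Modulo a prime that divides \<open>a\<close> the covariance identity breaks
    down, so these primes are kept out of the sieve.\<close>
  define B where "B = prime_factors (nat \<bar>a\<bar>)"
  define A where "A = \<bar>real_of_int a\<bar>"
  have A0: "A \<ge> 0" "\<bar>real_of_int a\<bar> \<le> A" by (auto simp: A_def)
  have B: "prime_set B" by (auto simp: prime_set_def B_def)
  have aB: "int p dvd a \<longleftrightarrow> p \<in> B" if "prime p" for p
    using that a by (auto simp: B_def in_prime_factors_iff nat_abs_dvd_iff)
  have BA: "real r \<le> A" if "r \<in> B" for r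
  proof -
    have "r \<le> nat \<bar>a\<bar>" using that a by (intro dvd_imp_le) (auto simp: B_def)
    then show ?thesis unfolding A_def by linarith
  qed
  obtain C where C: "C \<ge> 1" "\<And>U. prime_set U \<Longrightarrow> 32 ^ card U \<le> C * real (\<Prod>U) powr (\<delta> / 8)"
    using power_card_le_powr[of 32 "\<delta> / 8"] \<delta> by auto
  have b: "real (\<Prod>B) \<ge> 0" by (rule of_nat_0_le_iff)
  have e: "eventually (\<lambda>x::real. 2 * K * x powr (1 / 2 - 3 * \<delta>) \<le> x powr (1 / 2 - 2 * \<delta>)) at_top"
    "eventually (\<lambda>x::real. (A + 1) * x powr 0 \<le> x powr \<delta>) at_top"
    "eventually (\<lambda>x::real. (2 * A + 2) / \<delta>\<^sup>2 * x powr (5 / 8) \<le> x powr (1 - 2 * \<delta>)) at_top"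
    "eventually (\<lambda>x::real. (1 + 1 / \<delta>) * x powr 0 \<le> x powr \<delta>) at_top"
    using \<delta> by (intro const_powr_le; simp)+
  show ?thesis using e admissible_facts[OF \<delta> K] level_error_asymptotic[OF \<delta> C(1) b] eventually_ge_at_top[of "exp 1"]
  proof eventually_elim
    case (elim x)
    have x1: "x > 1" using elim(7) one_less_exp_iff[of 1] by linarith
    then have x0: "x > 0" by simp
    show ?case
    proof (intro allI impI, elim conjE)
      fix z\<^sub>1 z\<^sub>2 D assume adm: "admissible \<delta> K x z\<^sub>1 z\<^sub>2" and D: "x powr (1 / 2 - 3 * \<delta> / 2) \<le> D" "D \<le> x powr (5 / 8)"
      let ?X = "prime_block \<delta> z\<^sub>1" and ?Y = "prime_block \<delta> z\<^sub>2" and ?Q = "prime_block (\<delta>\<^sup>2) D"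
      \<comment> \<open>With \<open>p\<close> of size \<open>x powr \<delta>\<close> this makes
        \<open>p * z ^ 2\<close> about \<open>x powr (1 / 2 - 3 * \<delta>)\<close>, below the level
        \<open>R\<close> even after the constant \<open>2 * K\<close>.\<close>
      define z where "z = nat \<lfloor>x powr (1 / 4 - 2 * \<delta>)\<rfloor>"
      define R where "R = nat \<lfloor>x powr (1 / 2 - 2 * \<delta>)\<rfloor>"
      \<comment> \<open>A common bound for all windows, from \<open>p \<le> 2 * z\<^sub>1\<close>
        and \<open>\<delta> * (1 + 2 * \<delta>) \<le> 2\<close>.\<close>
      define M where "M = nat \<lfloor>4 * (z\<^sub>1 * z\<^sub>2) / D\<rfloor>"
      define lo where "lo p = nat \<lfloor>(real p * z\<^sub>2 - A) / ((1 + \<delta>\<^sup>2) * D)\<rfloor>" for p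
      define hi where "hi p = nat \<lfloor>(real p * ((1 + \<delta>) * z\<^sub>2) + A) / D\<rfloor> + 1" for p
      have f: "1 \<le> z\<^sub>1" "(1 + \<delta>) * z\<^sub>1 < z\<^sub>2" "x powr (1 - 2 * \<delta>) \<le> z\<^sub>1 * z\<^sub>2" using elim(5) adm by blast+
      have z1: "x powr \<delta> \<le> z\<^sub>1" "z\<^sub>1 \<le> K * x powr \<delta>" and z2: "x powr (1 - 3 * \<delta>) \<le> z\<^sub>2"
        using adm unfolding admissible_def by blast+
      have z12: "z\<^sub>1 \<le> z\<^sub>2"
      proof -
        have "1 * z\<^sub>1 \<le> (1 + \<delta>) * z\<^sub>1" using f(1) \<delta> by (intro mult_right_mono) auto
        then show ?thesis using f(2) by linarith
      qed
      have z0: "z\<^sub>1 > 0" "z\<^sub>2 > 0" using f z12 by auto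
      have D1: "D \<ge> 1"
      proof -
        have "1 \<le> x powr (1 / 2 - 3 * \<delta> / 2)" using x1 \<delta> by (intro ge_one_powr_ge_zero) auto
        then show ?thesis using D by linarith
      qed
      have lnx: "ln x > 0" using x1 by simp
      have Az: "A < z\<^sub>1" using elim(2) z1 x0 by simp
      have zb: "1 \<le> z" "real z \<le> x powr (1 / 4 - 2 * \<delta>)" "x powr (1 / 4 - 2 * \<delta>) \<le> real z + 1"
      proof -
        have "1 \<le> x powr (1 / 4 - 2 * \<delta>)" using x1 \<delta> by (intro ge_one_powr_ge_zero) auto
        then show "1 \<le> z" "real z \<le> x powr (1 / 4 - 2 * \<delta>)" "x powr (1 / 4 - 2 * \<delta>) \<le> real z + 1"
          unfolding z_def by linarith+
      qed
      have Rb: "1 \<le> R" "real R \<le> x powr (1 / 2 - 2 * \<delta>)"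
      proof -
        have "1 \<le> x powr (1 / 2 - 2 * \<delta>)" using x1 \<delta> by (intro ge_one_powr_ge_zero) auto
        then show "1 \<le> R" "real R \<le> x powr (1 / 2 - 2 * \<delta>)" unfolding R_def by linarith+
      qed
      have MD: "real M * D \<le> 4 * (z\<^sub>1 * z\<^sub>2)"
      proof -
        have "0 \<le> 4 * (z\<^sub>1 * z\<^sub>2) / D" using z0 D1 by simp
        then have "real M \<le> 4 * (z\<^sub>1 * z\<^sub>2) / D" unfolding M_def by linarith
        then show ?thesis using D1 by (simp add: pos_le_divide_eq)
      qed
      have Xp: "prime p" "z\<^sub>1 < real p" "real p \<le> (1 + \<delta>) * z\<^sub>1" "p \<notin> B" if "p \<in> ?X" for p
        using that BA[of p] Az unfolding prime_block_def by auto
      have Yp: "prime y" "z\<^sub>2 < real y" "real y \<le> (1 + \<delta>) * z\<^sub>2" "y \<notin> B" "z < y" if "y \<in> ?Y" for y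
      proof -
        show y: "prime y" "z\<^sub>2 < real y" "real y \<le> (1 + \<delta>) * z\<^sub>2" using that unfolding prime_block_def by auto
        then show "y \<notin> B" using BA[of y] Az z12 by auto
        have "x powr (1 / 4 - 2 * \<delta>) \<le> x powr (1 - 3 * \<delta>)" using x1 \<delta> by (intro powr_mono) auto
        then show "z < y" using y zb z2 by linarith
      qed
      have Qp: "prime q" "D < real q" "real q \<le> (1 + \<delta>\<^sup>2) * D" "0 < q" if "q \<in> ?Q" for q
        using that D1 unfolding prime_block_def by auto
      \<comment> \<open>The block of \<open>q\<close> has relative width
        \<open>\<delta>\<^sup>2\<close>, of lower order than the width \<delta> of the block of
        \<open>p\<^sub>2\<close>. The widening of the window and the rounding then cost
        \<open>\<delta>\<^sup>2\<close> each, that is, a factor \<open>1 + 2 * \<delta>\<close> in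
        all.\<close>
      have len: "real (hi p - lo p) \<le> real p * (z\<^sub>2 / D * (\<delta> * (1 + 2 * \<delta>)))" if "p \<in> ?X" for p
      proof -
        have "(2 * A + 2) / \<delta>\<^sup>2 * D \<le> (2 * A + 2) / \<delta>\<^sup>2 * x powr (5 / 8)" using D A0 by (intro mult_left_mono) auto
        then have "(2 * A + 2) / \<delta>\<^sup>2 * D \<le> z\<^sub>1 * z\<^sub>2" using elim(3) f(3) by linarith
        also have "\<dots> \<le> real p * z\<^sub>2" using Xp[OF that] z0 by (intro mult_right_mono) auto
        finally have "2 * A + 2 \<le> real p * z\<^sub>2 / D * \<delta>\<^sup>2" using D1 \<delta> by (simp add: field_simps)
        moreover have "real (hi p - lo p) \<le> real p * z\<^sub>2 / D * (\<delta> + \<delta>\<^sup>2) + 2 * A + 2"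
          unfolding lo_def hi_def using \<delta> z0 by (intro quotient_window(2)[OF D1 _ _ _ A0(2)]) auto
        ultimately have "real (hi p - lo p) \<le> real p * z\<^sub>2 / D * (\<delta> + \<delta>\<^sup>2) + real p * z\<^sub>2 / D * \<delta>\<^sup>2" by linarith
        also have "\<dots> = real p * z\<^sub>2 / D * ((\<delta> + \<delta>\<^sup>2) + \<delta>\<^sup>2)" by (rule distrib_left[symmetric])
        also have "(\<delta> + \<delta>\<^sup>2) + \<delta>\<^sup>2 = \<delta> * (1 + 2 * \<delta>)" by (simp add: power2_eq_square algebra_simps)
        finally show ?thesis by simp
      qed
      have lenM: "hi p - lo p \<le> M" if "p \<in> ?X" for p
      proof -
        have d1: "\<delta> * (1 + 2 * \<delta>) \<le> 1 * 2" using \<delta> by (intro mult_mono) auto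
        have "(1 + \<delta>) * z\<^sub>1 \<le> 2 * z\<^sub>1" using \<delta> z0 by (intro mult_right_mono) auto
        then have p2: "real p \<le> 2 * z\<^sub>1" using Xp(3)[OF that] by linarith
        have "real p * (z\<^sub>2 / D * (\<delta> * (1 + 2 * \<delta>))) \<le> (2 * z\<^sub>1) * (z\<^sub>2 / D * 2)"
          using z0 D1 d1 p2 \<delta> by (intro mult_mono mult_left_mono) auto
        then have "real (hi p - lo p) \<le> 4 * (z\<^sub>1 * z\<^sub>2) / D" using len[OF that] by simp
        then show ?thesis unfolding M_def by linarith
      qed
      have pz: "p * z ^ 2 \<le> R" if "p \<in> ?X" for p
      proof -
        have "real (p * z ^ 2) \<le> 2 * (K * x powr \<delta>) * (x powr (1 / 4 - 2 * \<delta>)) ^ 2"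
          unfolding of_nat_mult of_nat_power
        proof (intro mult_mono power_mono)
          have "(1 + \<delta>) * z\<^sub>1 \<le> 2 * (K * x powr \<delta>)" using z1 \<delta> z0 by (intro mult_mono) auto
          then show "real p \<le> 2 * (K * x powr \<delta>)" using Xp(3)[OF that] by linarith
        qed (use zb K in auto)
        also have "\<dots> = 2 * K * x powr (1 / 2 - 3 * \<delta>)"
        proof -
          have "x powr \<delta> * (x powr (1 / 4 - 2 * \<delta>)) ^ 2 = x powr (1 / 2 - 3 * \<delta>)"
            unfolding power2_eq_square powr_add[symmetric] by simp
          then show ?thesis by (simp add: mult.assoc)
        qed
        finally have "real (p * z ^ 2) \<le> x powr (1 / 2 - 2 * \<delta>)" using elim(1) by linarith
        then show ?thesis unfolding R_def by (rule le_nat_floor)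
      qed
      have Qnd: "\<not> p dvd q" if "prime p" "p \<le> R" "q \<in> ?Q" for p q
      proof
        assume "p dvd q"
        then have "p = q" using primes_dvd_imp_eq[OF that(1) Qp(1)[OF that(3)]] by simp
        moreover have "x powr (1 / 2 - 2 * \<delta>) \<le> x powr (1 / 2 - 3 * \<delta> / 2)" using x1 \<delta> by (intro powr_mono) auto
        ultimately show False using that(2) Rb(2) D(1) Qp(2)[OF that(3)] by linarith
      qed
      obtain N L where W: "?Q \<subseteq> {N..<N + L}" "real L \<le> \<delta>\<^sup>2 * D + 1"
        using prime_block_window[of D "\<delta>\<^sup>2"] D1 by auto
      have L2: "real L \<le> 2 * D"
      proof -
        have "\<delta>\<^sup>2 * D \<le> 1 * D" using \<delta> D1 by (intro mult_right_mono) (auto simp: power_le_one)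
        then show ?thesis using W(2) D1 by linarith
      qed
      have cQ: "real (card ?Q) \<le> 2 * D"
        using card_mono[OF _ W(1)] L2 by simp
      let ?S = "nat \<lfloor>real M / x powr \<delta>\<rfloor> + 1"
      have main: "real (card ?Q) * (real (hi p - lo p) * (\<Prod>r\<in>B. 1 - 1 / real r)) / real p / sieve_sum z (insert p B)
          \<le> real (card ?Q) * (z\<^sub>2 / D * (\<delta> * (1 + 2 * \<delta>)) * ((1 + \<delta>) / ((1 / 4 - 2 * \<delta>) * ln x)))" if "p \<in> ?X" for p
      proof -
        have p0: "real p > 0" using Xp(2)[OF that] z0 by linarith
        have p1: "1 + 1 / \<delta> \<le> real p" using elim(4) x0 z1 Xp(2)[OF that] by simp
        have S0: "sieve_sum z (insert p B) > 0" using sieve_sum_pos[OF zb(1), of "insert p B"] by linarith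
        have "(\<Prod>r\<in>B. 1 - 1 / real r) / sieve_sum z (insert p B) \<le> (1 + \<delta>) / ln (real z + 1)"
          by (rule sieve_density_le[OF B Xp(1)[OF that] Xp(4)[OF that] p1 \<delta>(1) zb(1)])
        also have "\<dots> \<le> (1 + \<delta>) / ((1 / 4 - 2 * \<delta>) * ln x)"
        proof (rule divide_left_mono)
          have "(1 / 4 - 2 * \<delta>) * ln x = ln (x powr (1 / 4 - 2 * \<delta>))" using x0 by (simp add: ln_powr)
          also have "\<dots> \<le> ln (real z + 1)" using zb(3) x0 by (subst ln_le_cancel_iff) auto
          finally show "(1 / 4 - 2 * \<delta>) * ln x \<le> ln (real z + 1)" .
          have "(1 / 4 - 2 * \<delta>) * ln x > 0" using \<delta> lnx by (intro mult_pos_pos) auto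
          moreover have "ln (real z + 1) > 0" using zb(1) by simp
          ultimately show "0 < ln (real z + 1) * ((1 / 4 - 2 * \<delta>) * ln x)" by (rule mult_pos_pos[rotated])
        qed (use \<delta> in simp)
        finally have d: "(\<Prod>r\<in>B. 1 - 1 / real r) / sieve_sum z (insert p B) \<le> (1 + \<delta>) / ((1 / 4 - 2 * \<delta>) * ln x)" .
        have E0: "0 \<le> (\<Prod>r\<in>B. 1 - 1 / real r) / sieve_sum z (insert p B)"
          using S0 by (intro divide_nonneg_nonneg prod_nonneg) (auto simp: divide_le_eq_1)
        have l: "real (hi p - lo p) / real p \<le> z\<^sub>2 / D * (\<delta> * (1 + 2 * \<delta>))"
          using len[OF that] p0 by (simp add: pos_divide_le_eq mult.commute)
        have "(real (hi p - lo p) / real p) * ((\<Prod>r\<in>B. 1 - 1 / real r) / sieve_sum z (insert p B))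
          \<le> z\<^sub>2 / D * (\<delta> * (1 + 2 * \<delta>)) * ((1 + \<delta>) / ((1 / 4 - 2 * \<delta>) * ln x))"
        proof (rule mult_mono[OF l d _ E0])
          show "0 \<le> z\<^sub>2 / D * (\<delta> * (1 + 2 * \<delta>))" using z0 D1 \<delta> by simp
        qed
        then have "real (card ?Q) * ((real (hi p - lo p) / real p) * ((\<Prod>r\<in>B. 1 - 1 / real r) / sieve_sum z (insert p B)))
          \<le> real (card ?Q) * (z\<^sub>2 / D * (\<delta> * (1 + 2 * \<delta>)) * ((1 + \<delta>) / ((1 / 4 - 2 * \<delta>) * ln x)))"
          by (rule mult_left_mono) simp
        then show ?thesis by (simp add: mult.assoc)
      qed
      have "(\<Sum>q\<in>?Q. shifted_count ?X ?Y a q) = (\<Sum>p\<in>?X. \<Sum>q\<in>?Q. \<Sum>y\<in>?Y. of_bool (int q dvd int p * int y + a))"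
        unfolding shifted_count_def by (rule sum.swap)
      also have "\<dots> \<le> (\<Sum>p\<in>?X. \<Sum>q\<in>?Q. \<Sum>m\<in>{lo p..<lo p + (hi p - lo p)}. of_bool (avoids B m \<and> int p dvd int q * int m - a
        \<and> sifted z (insert p B) (int q * int m - a)))"
      proof (intro sum_mono shifted_count_le_sifted_count)
        fix p q y assume p: "p \<in> ?X" and q: "q \<in> ?Q" and y: "y \<in> ?Y"
        have "z\<^sub>1 * 1 \<le> real p * real y" using Xp(2)[OF p] Yp(2)[OF y] z0 z12 f(1) by (intro mult_mono) auto
        then have "A < real p * real y" using Az by simp
        then have "0 \<le> real p * real y + real_of_int a" unfolding A_def by linarith
        then have "0 \<le> real_of_int (int p * int y + a)" by simp
        then show "0 \<le> int p * int y + a" by (simp only: of_int_0_le_iff)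
      next
        fix p q y m assume p: "p \<in> ?X" and q: "q \<in> ?Q" and y: "y \<in> ?Y" and m: "int q * int m = int p * int y + a"
        show "lo p \<le> m \<and> m < hi p" unfolding lo_def hi_def
          using \<delta> z0 Yp(2,3)[OF y] Qp(2,3)[OF q] by (intro quotient_window(1)[OF D1 _ _ _ A0(2) _ _ _ _ m]) auto
      next
        fix r assume "r \<in> B"
        then show "prime r" "int r dvd a" using aB[of r] B by (auto simp: prime_set_def)
      qed (use finite_prime_block Xp Yp Qp in auto)
      also have "\<dots> \<le> (\<Sum>p\<in>?X. real (card ?Q) * (real (hi p - lo p) * (\<Prod>r\<in>B. 1 - 1 / real r)) / real p / sieve_sum z (insert p B))
        + (\<Sum>U\<in>prime_sets_upto R. 32 ^ card U * (\<Sum>S\<in>Pow U. level_error ?S M B ?Q S * (\<Prod>p\<in>U - S. 1 / real p)))"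
        by (rule sieve_bilinear_upper[OF B aB finite_prime_block Xp(1) Xp(4) pz lenM zb(1)]) (use Qnd in auto)
      also have "\<dots> \<le> (\<Sum>p\<in>?X. real (card ?Q) * (z\<^sub>2 / D * (\<delta> * (1 + 2 * \<delta>)) * ((1 + \<delta>) / ((1 / 4 - 2 * \<delta>) * ln x))))
        + z\<^sub>1 * z\<^sub>2 * x powr (- (\<delta> / 4))"
      proof (rule add_mono)
        show "(\<Sum>p\<in>?X. real (card ?Q) * (real (hi p - lo p) * (\<Prod>r\<in>B. 1 - 1 / real r)) / real p / sieve_sum z (insert p B))
          \<le> (\<Sum>p\<in>?X. real (card ?Q) * (z\<^sub>2 / D * (\<delta> * (1 + 2 * \<delta>)) * ((1 + \<delta>) / ((1 / 4 - 2 * \<delta>) * ln x))))"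
          by (rule sum_mono) (rule main)
        have "(\<Sum>U\<in>prime_sets_upto R. 32 ^ card U * (\<Sum>S\<in>Pow U. level_error ?S M B ?Q S * (\<Prod>p\<in>U - S. 1 / real p)))
          \<le> C * real R powr (\<delta> / 8) * (\<Sum>n\<in>{1..R}. 1 / real n) *
             (real (card ?Q) * real (\<Prod>B) * C * real R powr (\<delta> / 8) * real ?S
              + sqrt (real M * (real M / real ?S + 1)) * sqrt ((\<Sum>n\<in>{1..R}. 1 / real n) * (20 * (real L + real R ^ 2) * real (card ?Q))))"
          by (rule sum_level_error_le[OF C _ Rb(1) _ W(1)]) (use \<delta> in auto)
        also have "\<dots> \<le> z\<^sub>1 * z\<^sub>2 * x powr (- (\<delta> / 4))"
          by (rule elim(6)[rule_format]) (use f(3) D1 D(2) MD L2 cQ Rb in auto)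
        finally show "(\<Sum>U\<in>prime_sets_upto R. 32 ^ card U * (\<Sum>S\<in>Pow U. level_error ?S M B ?Q S * (\<Prod>p\<in>U - S. 1 / real p)))
          \<le> z\<^sub>1 * z\<^sub>2 * x powr (- (\<delta> / 4))" .
      qed
      also have "(\<Sum>p\<in>?X. real (card ?Q) * (z\<^sub>2 / D * (\<delta> * (1 + 2 * \<delta>)) * ((1 + \<delta>) / ((1 / 4 - 2 * \<delta>) * ln x))))
        = real (card ?X) * (real (card ?Q) * (z\<^sub>2 / D * (\<delta> * (1 + 2 * \<delta>)) * ((1 + \<delta>) / ((1 / 4 - 2 * \<delta>) * ln x))))"
        by (rule sum_constant)
      finally show "(\<Sum>q\<in>?Q. shifted_count ?X ?Y a q) \<le> real (card ?X) * (real (card ?Q)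
          * (z\<^sub>2 / D * (\<delta> * (1 + 2 * \<delta>)) * ((1 + \<delta>) / ((1 / 4 - 2 * \<delta>) * ln x)))) + z\<^sub>1 * z\<^sub>2 * x powr (- (\<delta> / 4))" .
    qed
  qed
qed

section \<open>Summation over the blocks of large moduli\<close>

lemma sum_geometric_prime_blocks_le:
  fixes F :: "nat \<Rightarrow> real"
  assumes "0 < \<eta>" "0 < u"
    and block: "\<And>i. i < J \<Longrightarrow> (\<Sum>q\<in>prime_block \<eta> (u * (1 + \<eta>) ^ i). F q)
      \<le> W * primes_ln_sum (u * (1 + \<eta>) ^ i) ((1 + \<eta>) * (u * (1 + \<eta>) ^ i)) + E"
  shows "(\<Sum>q | prime q \<and> u < real q \<and> real q \<le> u * (1 + \<eta>) ^ J. F q) \<le> W * primes_ln_sum u (u * (1 + \<eta>) ^ J) + real J * E"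
  using block
proof (induction J)
  case 0
  have "{q. prime q \<and> u < real q \<and> real q \<le> u} = {}" by auto
  then show ?case by (simp only: primes_ln_sum_def power_0 mult_1_right) simp
next
  case (Suc J)
  let ?v = "u * (1 + \<eta>) ^ J"
  have uv: "u \<le> ?v" "?v \<le> (1 + \<eta>) * ?v"
  proof -
    have "1 \<le> (1 + \<eta>) ^ J" using assms by (intro one_le_power) simp
    then have "u * 1 \<le> ?v" using assms by (intro mult_left_mono) auto
    then show "u \<le> ?v" by simp
    then have "1 * ?v \<le> (1 + \<eta>) * ?v" using assms by (intro mult_right_mono) auto
    then show "?v \<le> (1 + \<eta>) * ?v" by simp
  qed
  have e: "u * (1 + \<eta>) ^ Suc J = (1 + \<eta>) * ?v" by simp
  have "{q. prime q \<and> u < real q \<and> real q \<le> (1 + \<eta>) * ?v}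
      = {q. prime q \<and> u < real q \<and> real q \<le> ?v} \<union> prime_block \<eta> ?v"
    unfolding prime_block_def using uv by auto
  then have "(\<Sum>q | prime q \<and> u < real q \<and> real q \<le> (1 + \<eta>) * ?v. F q)
      = (\<Sum>q | prime q \<and> u < real q \<and> real q \<le> ?v. F q) + (\<Sum>q\<in>prime_block \<eta> ?v. F q)"
    by (simp add: sum.union_disjoint finite_primes_between finite_prime_block)
      (subst sum.union_disjoint; auto simp: finite_primes_between finite_prime_block prime_block_def)
  moreover have "(\<Sum>q | prime q \<and> u < real q \<and> real q \<le> ?v. F q) \<le> W * primes_ln_sum u ?v + real J * E"
    by (rule Suc.IH) (rule Suc.prems, simp)
  moreover have "(\<Sum>q\<in>prime_block \<eta> ?v. F q) \<le> W * primes_ln_sum ?v ((1 + \<eta>) * ?v) + E"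
    by (rule Suc.prems) simp
  moreover have "primes_ln_sum u ((1 + \<eta>) * ?v) = primes_ln_sum u ?v + primes_ln_sum ?v ((1 + \<eta>) * ?v)"
    by (rule primes_ln_sum_add[OF uv])
  ultimately show ?case unfolding e by (simp add: algebra_simps)
qed

lemma geometric_steps:
  fixes u v r :: real
  assumes "1 < r" "0 < u" "u \<le> v"
  shows "\<exists>J. v \<le> u * r ^ J \<and> (\<forall>i<J. u * r ^ i \<le> v) \<and> u * r ^ J \<le> r * v \<and> real J \<le> ln (v / u) / ln r + 1"
proof -
  define J where "J = (LEAST J. v \<le> u * r ^ J)"
  obtain n where "v / u < r ^ n" using real_arch_pow[OF assms(1)] by blast
  then have "v \<le> u * r ^ n" using assms by (simp add: pos_divide_less_eq mult.commute)
  then have J: "v \<le> u * r ^ J" unfolding J_def by (rule LeastI)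
  have lt: "u * r ^ i < v" if "i < J" for i using not_less_Least[of i "\<lambda>J. v \<le> u * r ^ J"] that unfolding J_def by simp
  have "u * r ^ J \<le> r * v \<and> real J \<le> ln (v / u) / ln r + 1"
  proof (cases J)
    case 0
    have "1 * v \<le> r * v" using assms by (intro mult_right_mono) auto
    then have "u \<le> r * v" using assms by linarith
    then show ?thesis using 0 assms by simp
  next
    case (Suc i)
    then have i: "u * r ^ i < v" using lt by simp
    have "r * (u * r ^ i) \<le> r * v" using i assms by (intro mult_left_mono) auto
    moreover have "r ^ i \<le> v / u" using i assms by (simp add: pos_le_divide_eq mult.commute)
    then have "ln (r ^ i) \<le> ln (v / u)" using assms by (subst ln_le_cancel_iff) auto
    then have "real i * ln r \<le> ln (v / u)" using assms by (simp add: ln_realpow)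
    then have "real i \<le> ln (v / u) / ln r" using assms by (simp add: pos_le_divide_eq)
    ultimately show ?thesis using Suc by (simp add: mult.left_commute)
  qed
  then show ?thesis using J lt by (intro exI[of _ J]) (auto intro: less_imp_le)
qed

text \<open>On a short block \<open>ln q\<close> and \<open>1 / q\<close> are nearly constant, so the number of primes can be traded for Mertens' weights.\<close>
lemma card_prime_block_le_primes_ln_sum:
  assumes "0 < \<eta>" "exp 1 \<le> D"
  shows "ln ((1 + \<eta>) * D) * (real (card (prime_block \<eta> D)) / D) \<le> (1 + \<eta>)\<^sup>2 * primes_ln_sum D ((1 + \<eta>) * D)"
proof -
  have D0: "D > 0" using assms(2) by (rule order_less_le_trans[rotated]) simp
  have lD: "ln D \<ge> 1" using assms(2) D0 ln_ge_iff[of D 1] by simp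
  have "real (card (prime_block \<eta> D)) * (ln D / ((1 + \<eta>) * D)) = (\<Sum>q\<in>prime_block \<eta> D. ln D / ((1 + \<eta>) * D))" by simp
  also have "\<dots> \<le> (\<Sum>q\<in>prime_block \<eta> D. ln (real q) / real q)"
    using D0 lD by (intro sum_mono frac_le) (auto simp: prime_block_def)
  also have "\<dots> = primes_ln_sum D ((1 + \<eta>) * D)" unfolding primes_ln_sum_def prime_block_def ..
  finally have s: "real (card (prime_block \<eta> D)) * (ln D / ((1 + \<eta>) * D)) \<le> primes_ln_sum D ((1 + \<eta>) * D)" .
  have "ln ((1 + \<eta>) * D) \<le> (1 + \<eta>) * ln D"
  proof -
    have "\<eta> * 1 \<le> \<eta> * ln D" using lD assms by (intro mult_left_mono) auto
    moreover have "ln (1 + \<eta>) \<le> \<eta>" using assms by (intro ln_add_one_self_le_self) auto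
    moreover have "ln ((1 + \<eta>) * D) = ln (1 + \<eta>) + ln D" using assms D0 by (subst ln_mult) auto
    ultimately show ?thesis unfolding distrib_right by linarith
  qed
  then have "ln ((1 + \<eta>) * D) * (real (card (prime_block \<eta> D)) / D) \<le> ((1 + \<eta>) * ln D) * (real (card (prime_block \<eta> D)) / D)"
    using D0 by (intro mult_right_mono) auto
  also have "\<dots> = (1 + \<eta>)\<^sup>2 * (real (card (prime_block \<eta> D)) * (ln D / ((1 + \<eta>) * D)))"
    using assms D0 by (simp add: power2_eq_square)
  also have "\<dots> \<le> (1 + \<eta>)\<^sup>2 * primes_ln_sum D ((1 + \<eta>) * D)" by (rule mult_left_mono[OF s]) simp
  finally show ?thesis .
qed

text \<open>The numerator collects the losses from the window length, from exempting
  \<open>p\<^sub>1\<close>, and from trading the cardinality of a block of \<open>q\<close> for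
  Mertens' weights. The denominator holds the density of the block of \<open>p\<^sub>2\<close> and
  the exponent of the sifting level.\<close>

definition sieve_constant :: "real \<Rightarrow> real" where
  "sieve_constant \<delta> = (1 + 2 * \<delta>) * (1 + \<delta>) * (1 + \<delta>\<^sup>2)\<^sup>2 / ((1 - 2 * \<delta>) * (1 / 4 - 2 * \<delta>))"

text \<open>The main terms of the blocks add up to one Mertens sum over the whole range, of
  logarithmic length \<open>\<theta> - 1 / 2 + 3 * \<delta> / 2\<close>; the remaining
  \<open>\<delta> / 2\<close> covers its bounded error and the overshoot of the last block. There
  are only \<open>O(ln x)\<close> blocks, so the error of each, smaller by
  \<open>x powr (\<delta> / 4)\<close>, stays negligible in total.\<close>

lemma large_moduli_contribution:
  fixes a :: int
  assumes \<delta>: "0 < \<delta>" "\<delta> \<le> 1 / 100" and K: "K \<ge> 1" and a: "a \<noteq> 0" and \<theta>: "1 / 2 < \<theta>" "\<theta> < 5 / 8"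
  shows "eventually (\<lambda>x. \<forall>z\<^sub>1 z\<^sub>2. admissible \<delta> K x z\<^sub>1 z\<^sub>2 \<longrightarrow>
      (\<Sum>q | prime q \<and> x powr (1 / 2 - 3 * \<delta> / 2) < real q \<and> real q \<le> x powr \<theta>.
          ln (real q) * shifted_count (prime_block \<delta> z\<^sub>1) (prime_block \<delta> z\<^sub>2) a q)
      \<le> (sieve_constant \<delta> * (\<theta> - 1 / 2 + 2 * \<delta>) + \<delta>)
          * (real (card (prime_block \<delta> z\<^sub>1)) * real (card (prime_block \<delta> z\<^sub>2)) * ln x)) at_top"
proof -
  obtain C where C: "C > 0" "\<And>u v. u \<ge> 1 \<Longrightarrow> v \<ge> u \<Longrightarrow> \<bar>primes_ln_sum u v - ln (v / u)\<bar> \<le> C"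
    using primes_ln_sum_bounds by blast
  define \<eta> where "\<eta> = \<delta>\<^sup>2"
  have \<eta>: "0 < \<eta>" "\<eta> \<le> 1" using \<delta> by (auto simp: \<eta>_def power_le_one)
  have l\<eta>: "ln (1 + \<eta>) > 0" using \<eta> by simp
  \<comment> \<open>The number of blocks of ratio \<open>1 + \<eta>\<close> is at most
    \<open>c * ln x\<close>.\<close>
  define c where "c = 1 / ln (1 + \<eta>) + 1"
  have c0: "c > 0" using l\<eta> by (simp add: c_def add_pos_pos)
  have e: "eventually (\<lambda>x::real. exp 1 * x powr 0 \<le> x powr (1 / 2 - 3 * \<delta> / 2)) at_top"
    "eventually (\<lambda>x::real. 2 * x powr \<theta> \<le> x powr 1) at_top"
    "eventually (\<lambda>x::real. 4 * c / \<delta>\<^sup>2 * ln x ^ 3 \<le> \<delta> * x powr (\<delta> / 4)) at_top"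
    using \<delta> \<theta> by (intro const_powr_le ln_power_le_powr; simp)+
  have e2: "eventually (\<lambda>x::real. C + ln 2 \<le> \<delta> / 2 * ln x) at_top" using \<delta> by real_asymp
  show ?thesis using e e2 large_moduli_block[OF \<delta> K a] admissible_facts[OF \<delta> K] eventually_ge_at_top[of "exp 1"]
  proof eventually_elim
    case (elim x)
    have x1: "x > 1" using elim(7) one_less_exp_iff[of 1] by linarith
    then have x0: "x > 0" by simp
    have lx: "ln x \<ge> 1" using elim(7) x0 ln_ge_iff[of x 1] by simp
    show ?case
    proof (intro allI impI)
      fix z\<^sub>1 z\<^sub>2 assume adm: "admissible \<delta> K x z\<^sub>1 z\<^sub>2"
      let ?X = "prime_block \<delta> z\<^sub>1" and ?Y = "prime_block \<delta> z\<^sub>2"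
      let ?F = "\<lambda>q. ln (real q) * shifted_count ?X ?Y a q"
      define N where "N = real (card ?X) * real (card ?Y)"
      define u where "u = x powr (1 / 2 - 3 * \<delta> / 2)"
      define v where "v = x powr \<theta>"
      define E where "E = ln x * (z\<^sub>1 * z\<^sub>2 * x powr (- (\<delta> / 4)))"
      \<comment> \<open>The main term of a block per unit of Mertens weight; the factor
        \<open>(1 + \<eta>)\<^sup>2\<close> comes from
        \<open>card_prime_block_le_primes_ln_sum\<close>.\<close>
      define W where "W = real (card ?X) * (z\<^sub>2 * (\<delta> * (1 + 2 * \<delta>)) * ((1 + \<delta>) / ((1 / 4 - 2 * \<delta>) * ln x))) * (1 + \<eta>)\<^sup>2"
      have f: "1 \<le> z\<^sub>1" "(1 + \<delta>) * z\<^sub>1 < z\<^sub>2" "(1 - 2 * \<delta>) * (\<delta> * z\<^sub>2) \<le> real (card ?Y) * ln x"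
          "\<delta> * z\<^sub>1 \<le> 2 * (real (card ?X) * ln x)" "\<delta> * z\<^sub>2 \<le> 2 * (real (card ?Y) * ln x)"
        using elim(6) adm by blast+
      have "1 * z\<^sub>1 \<le> (1 + \<delta>) * z\<^sub>1" using f(1) \<delta> by (intro mult_right_mono) auto
      then have z2: "z\<^sub>2 > 0" using f(1,2) by linarith
      have N0: "N \<ge> 0" by (simp add: N_def)
      have u0: "u \<ge> exp 1" "u > 0" using elim(1) x0 by (auto simp: u_def)
      have uv: "u \<le> v" unfolding u_def v_def using x1 \<delta> \<theta> by (intro powr_mono) auto
      have W0: "W \<ge> 0" unfolding W_def using z2 \<delta> lx by (intro mult_nonneg_nonneg divide_nonneg_nonneg) auto
      obtain J where J: "v \<le> u * (1 + \<eta>) ^ J" "\<And>i. i < J \<Longrightarrow> u * (1 + \<eta>) ^ i \<le> v"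
          "u * (1 + \<eta>) ^ J \<le> (1 + \<eta>) * v" "real J \<le> ln (v / u) / ln (1 + \<eta>) + 1"
        using geometric_steps[of "1 + \<eta>" u v] \<eta> u0 uv by auto
      have lvu: "ln (v / u) = (\<theta> - 1 / 2 + 3 * \<delta> / 2) * ln x"
        unfolding u_def v_def powr_diff[symmetric] using x0 by (simp add: ln_powr)
      have block: "(\<Sum>q\<in>prime_block \<eta> D. ?F q) \<le> W * primes_ln_sum D ((1 + \<eta>) * D) + E" if D: "u \<le> D" "D \<le> v" for D
      proof -
        let ?Q = "prime_block \<eta> D"
        have De: "exp 1 \<le> D" using u0 D by linarith
        have D0: "D > 0" using u0 D by linarith
        have D1: "(1 + \<eta>) * D > 1"
        proof -
          have "exp 1 > (1 :: real)" by simp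
          moreover have "1 * D \<le> (1 + \<eta>) * D" using D0 \<eta> by (intro mult_right_mono) auto
          ultimately show ?thesis using De by linarith
        qed
        define lm where "lm = ln ((1 + \<eta>) * D)"
        have l0: "lm \<ge> 0" unfolding lm_def using D1 by simp
        have lmx: "lm \<le> ln x"
        proof -
          have "(1 + \<eta>) * D \<le> 2 * v" using \<eta> D D0 by (intro mult_mono) auto
          then have "(1 + \<eta>) * D \<le> x" using elim(2) x0 by (simp add: v_def)
          then show ?thesis unfolding lm_def using D1 x0 by (subst ln_le_cancel_iff) auto
        qed
        have "D \<le> x powr (5 / 8)"
        proof -
          have "v \<le> x powr (5 / 8)" unfolding v_def using x1 \<theta> by (intro powr_mono) auto
          then show ?thesis using D by linarith
        qed
        then have b: "(\<Sum>q\<in>?Q. shifted_count ?X ?Y a q) \<le> real (card ?X) * (real (card ?Q)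
          * (z\<^sub>2 / D * (\<delta> * (1 + 2 * \<delta>)) * ((1 + \<delta>) / ((1 / 4 - 2 * \<delta>) * ln x)))) + z\<^sub>1 * z\<^sub>2 * x powr (- (\<delta> / 4))"
          using elim(5) adm D(1) unfolding u_def \<eta>_def by blast
        have "(\<Sum>q\<in>?Q. ?F q) \<le> (\<Sum>q\<in>?Q. lm * shifted_count ?X ?Y a q)"
        proof (intro sum_mono mult_right_mono shifted_count_nonneg)
          fix q assume "q \<in> ?Q"
          then have "D < real q" "real q \<le> (1 + \<eta>) * D" by (auto simp: prime_block_def)
          then show "ln (real q) \<le> lm" unfolding lm_def using D0 by (subst ln_le_cancel_iff) auto
        qed
        also have "\<dots> = lm * (\<Sum>q\<in>?Q. shifted_count ?X ?Y a q)" by (rule sum_distrib_left[symmetric])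
        also have "\<dots> \<le> lm * (real (card ?X) * (real (card ?Q)
          * (z\<^sub>2 / D * (\<delta> * (1 + 2 * \<delta>)) * ((1 + \<delta>) / ((1 / 4 - 2 * \<delta>) * ln x)))) + z\<^sub>1 * z\<^sub>2 * x powr (- (\<delta> / 4)))"
          by (rule mult_left_mono[OF b l0])
        also have "\<dots> = real (card ?X) * (z\<^sub>2 * (\<delta> * (1 + 2 * \<delta>)) * ((1 + \<delta>) / ((1 / 4 - 2 * \<delta>) * ln x)))
            * (lm * (real (card ?Q) / D)) + lm * (z\<^sub>1 * z\<^sub>2 * x powr (- (\<delta> / 4)))"
        proof -
          have "l * (X * (Q * (z / D * s * t)) + e) = X * (z * s * t) * (l * (Q / D)) + l * e" for l X Q z s t e :: real
            by (simp add: distrib_left)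
          then show ?thesis .
        qed
        also have "\<dots> \<le> W * primes_ln_sum D ((1 + \<eta>) * D) + E"
        proof (rule add_mono)
          have "real (card ?X) * (z\<^sub>2 * (\<delta> * (1 + 2 * \<delta>)) * ((1 + \<delta>) / ((1 / 4 - 2 * \<delta>) * ln x))) * (lm * (real (card ?Q) / D))
            \<le> real (card ?X) * (z\<^sub>2 * (\<delta> * (1 + 2 * \<delta>)) * ((1 + \<delta>) / ((1 / 4 - 2 * \<delta>) * ln x)))
              * ((1 + \<eta>)\<^sup>2 * primes_ln_sum D ((1 + \<eta>) * D))"
          proof (rule mult_left_mono)
            show "lm * (real (card ?Q) / D) \<le> (1 + \<eta>)\<^sup>2 * primes_ln_sum D ((1 + \<eta>) * D)"
              unfolding lm_def by (rule card_prime_block_le_primes_ln_sum[OF \<eta>(1) De])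
            show "0 \<le> real (card ?X) * (z\<^sub>2 * (\<delta> * (1 + 2 * \<delta>)) * ((1 + \<delta>) / ((1 / 4 - 2 * \<delta>) * ln x)))"
              using z2 \<delta> lx by (intro mult_nonneg_nonneg divide_nonneg_nonneg) auto
          qed
          then show "real (card ?X) * (z\<^sub>2 * (\<delta> * (1 + 2 * \<delta>)) * ((1 + \<delta>) / ((1 / 4 - 2 * \<delta>) * ln x))) * (lm * (real (card ?Q) / D))
            \<le> W * primes_ln_sum D ((1 + \<eta>) * D)" unfolding W_def by (simp only: mult.assoc)
          show "lm * (z\<^sub>1 * z\<^sub>2 * x powr (- (\<delta> / 4))) \<le> E"
            unfolding E_def using lmx f(1) z2 by (intro mult_right_mono) auto
        qed
        finally show ?thesis .
      qed
      have "(\<Sum>q | prime q \<and> u < real q \<and> real q \<le> v. ?F q) \<le> (\<Sum>q | prime q \<and> u < real q \<and> real q \<le> u * (1 + \<eta>) ^ J. ?F q)"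
        using J(1) by (intro sum_mono2 finite_primes_between) (auto intro!: mult_nonneg_nonneg shifted_count_nonneg ln_prime_nonneg)
      also have "\<dots> \<le> W * primes_ln_sum u (u * (1 + \<eta>) ^ J) + real J * E"
      proof (rule sum_geometric_prime_blocks_le[OF \<eta>(1) u0(2)])
        fix i assume "i < J"
        have "u * 1 \<le> u * (1 + \<eta>) ^ i" using u0 \<eta> by (intro mult_left_mono one_le_power) auto
        then show "(\<Sum>q\<in>prime_block \<eta> (u * (1 + \<eta>) ^ i). ?F q)
          \<le> W * primes_ln_sum (u * (1 + \<eta>) ^ i) ((1 + \<eta>) * (u * (1 + \<eta>) ^ i)) + E"
          using J(2)[OF \<open>i < J\<close>] by (intro block) auto
      qed
      also have "\<dots> \<le> sieve_constant \<delta> * (\<theta> - 1 / 2 + 2 * \<delta>) * (N * ln x) + \<delta> * (N * ln x)"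
      proof (rule add_mono)
        have "primes_ln_sum u (u * (1 + \<eta>) ^ J) \<le> (\<theta> - 1 / 2 + 2 * \<delta>) * ln x"
        proof -
          let ?w = "u * (1 + \<eta>) ^ J"
          have "u \<ge> 1" using u0(1) one_le_exp_iff[of 1] by linarith
          moreover have uw: "u \<le> ?w" using uv J(1) by linarith
          ultimately have "primes_ln_sum u ?w \<le> ln (?w / u) + C" using C(2)[of u ?w] by linarith
          moreover have "ln (?w / u) \<le> ln (2 * (v / u))"
          proof -
            have "?w \<le> 2 * v" using J(3) \<eta> uv u0 mult_right_mono[of "1 + \<eta>" 2 v] by linarith
            then have "?w / u \<le> 2 * v / u" using u0 by (intro divide_right_mono) auto
            moreover have "?w / u > 0" using u0 uw by simp
            ultimately show ?thesis by (subst ln_le_cancel_iff) auto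
          qed
          moreover have "ln (2 * (v / u)) = ln 2 + ln (v / u)" using u0 uv by (subst ln_mult) auto
          moreover have "(\<theta> - 1 / 2 + 2 * \<delta>) * ln x = (\<theta> - 1 / 2 + 3 * \<delta> / 2) * ln x + \<delta> / 2 * ln x"
            by (simp add: algebra_simps)
          ultimately show ?thesis using lvu elim(4) by linarith
        qed
        then have "W * primes_ln_sum u (u * (1 + \<eta>) ^ J) \<le> W * ((\<theta> - 1 / 2 + 2 * \<delta>) * ln x)" by (rule mult_left_mono[OF _ W0])
        also have "\<dots> \<le> (sieve_constant \<delta> * N) * ((\<theta> - 1 / 2 + 2 * \<delta>) * ln x)"
        proof (rule mult_right_mono)
          define k where "k = (1 + 2 * \<delta>) * (1 + \<delta>) * (1 + \<eta>)\<^sup>2 / (1 / 4 - 2 * \<delta>)"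
          have k0: "k \<ge> 0" unfolding k_def using \<delta> by (intro divide_nonneg_nonneg mult_nonneg_nonneg) auto
          have "\<delta> * z\<^sub>2 / ln x \<le> real (card ?Y) / (1 - 2 * \<delta>)"
            using f(3) \<delta> lx by (simp add: field_simps)
          then have "real (card ?X) * k * (\<delta> * z\<^sub>2 / ln x) \<le> real (card ?X) * k * (real (card ?Y) / (1 - 2 * \<delta>))"
            using k0 by (intro mult_left_mono) auto
          moreover have "W = real (card ?X) * k * (\<delta> * z\<^sub>2 / ln x)" unfolding W_def k_def by simp
          moreover have "sieve_constant \<delta> * N = real (card ?X) * k * (real (card ?Y) / (1 - 2 * \<delta>))"
            unfolding sieve_constant_def k_def N_def \<eta>_def by (simp add: mult_ac)
          ultimately show "W \<le> sieve_constant \<delta> * N" by linarith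
          show "0 \<le> (\<theta> - 1 / 2 + 2 * \<delta>) * ln x" using \<theta> \<delta> lx by (intro mult_nonneg_nonneg) auto
        qed
        finally show "W * primes_ln_sum u (u * (1 + \<eta>) ^ J) \<le> sieve_constant \<delta> * (\<theta> - 1 / 2 + 2 * \<delta>) * (N * ln x)"
          by (simp only: mult_ac)
      next
        have Jc: "real J \<le> c * ln x"
        proof -
          have "(\<theta> - 1 / 2 + 3 * \<delta> / 2) * ln x \<le> 1 * ln x" using \<theta> \<delta> lx by (intro mult_right_mono) auto
          then have "ln (v / u) / ln (1 + \<eta>) \<le> ln x / ln (1 + \<eta>)" unfolding lvu using l\<eta> by (intro divide_right_mono) auto
          then show ?thesis using J(4) lx unfolding c_def by (simp add: distrib_right)
        qed
        have zN: "z\<^sub>1 * z\<^sub>2 \<le> 4 / \<delta>\<^sup>2 * (ln x)\<^sup>2 * N"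
        proof -
          have "(\<delta> * z\<^sub>1) * (\<delta> * z\<^sub>2) \<le> (2 * (real (card ?X) * ln x)) * (2 * (real (card ?Y) * ln x))"
            by (rule mult_mono[OF f(4,5)]) (use lx z2 \<delta> in auto)
          then have "\<delta>\<^sup>2 * (z\<^sub>1 * z\<^sub>2) \<le> 4 * (ln x)\<^sup>2 * N" by (simp add: N_def power2_eq_square mult_ac)
          then show ?thesis using \<delta> by (simp add: field_simps)
        qed
        have "real J * E \<le> (c * ln x) * (ln x * (4 / \<delta>\<^sup>2 * (ln x)\<^sup>2 * N * x powr (- (\<delta> / 4))))"
          unfolding E_def
        proof (rule mult_mono[OF Jc])
          show "ln x * (z\<^sub>1 * z\<^sub>2 * x powr (- (\<delta> / 4))) \<le> ln x * (4 / \<delta>\<^sup>2 * (ln x)\<^sup>2 * N * x powr (- (\<delta> / 4)))"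
            using lx by (intro mult_left_mono mult_right_mono zN) auto
        qed (use lx c0 f(1) z2 in auto)
        also have "\<dots> = (4 * c / \<delta>\<^sup>2 * ln x ^ 3) * (ln x * N * x powr (- (\<delta> / 4)))"
          by (simp add: power2_eq_square power3_eq_cube)
        also have "\<dots> \<le> (\<delta> * x powr (\<delta> / 4)) * (ln x * N * x powr (- (\<delta> / 4)))"
          using lx N0 by (intro mult_right_mono elim(3)) auto
        also have "\<dots> = \<delta> * (N * ln x) * (x powr (\<delta> / 4) * x powr (- (\<delta> / 4)))" by (simp only: mult_ac)
        also have "\<dots> = \<delta> * (N * ln x)" unfolding powr_add[symmetric] using x0 by simp
        finally show "real J * E \<le> \<delta> * (N * ln x)" .
      qed
      also have "\<dots> = (sieve_constant \<delta> * (\<theta> - 1 / 2 + 2 * \<delta>) + \<delta>) * (N * ln x)" by (rule distrib_right[symmetric])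
      finally show "(\<Sum>q | prime q \<and> x powr (1 / 2 - 3 * \<delta> / 2) < real q \<and> real q \<le> x powr \<theta>. ?F q)
        \<le> (sieve_constant \<delta> * (\<theta> - 1 / 2 + 2 * \<delta>) + \<delta>) * (real (card ?X) * real (card ?Y) * ln x)"
        unfolding u_def v_def N_def .
    qed
  qed
qed

section \<open>The contradiction\<close>

lemma sieve_constant_tendsto: "(sieve_constant \<longlongrightarrow> 4) (at_right 0)"
  unfolding sieve_constant_def by (auto intro!: tendsto_eq_intros)

text \<open>Chebyshev's starting point: the logarithm of the whole product, distributed over the
  prime powers that divide its factors.\<close>

lemma sum_shifted_logs:
  fixes a :: int
  assumes "finite X" "finite Y"
    and bound: "\<And>x y. x \<in> X \<Longrightarrow> y \<in> Y \<Longrightarrow> 0 < int x * int y + a \<and> int x * int y + a \<le> int B"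
  shows "(\<Sum>x\<in>X. \<Sum>y\<in>Y. ln (real_of_int (int x * int y + a)))
    = (\<Sum>(q, j)\<in>prime_power_pairs B. ln (real q) * shifted_count X Y a (q ^ j))"
proof -
  have "ln (real_of_int (int x * int y + a))
      = (\<Sum>(q, j)\<in>prime_power_pairs B. ln (real q) * of_bool (int (q ^ j) dvd int x * int y + a))"
    if xy: "x \<in> X" "y \<in> Y" for x y
  proof -
    define m where "m = nat (int x * int y + a)"
    have m: "int m = int x * int y + a" "0 < m" "m \<le> B" using bound[OF xy] unfolding m_def by auto
    have "ln (real_of_int (int x * int y + a)) = ln (real m)" unfolding m(1)[symmetric] by simp
    also have "\<dots> = (\<Sum>(q, j)\<in>prime_power_pairs B. if q ^ j dvd m then ln (real q) else 0)"
      by (rule ln_eq_sum_prime_powers[OF m(2,3)])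
    also have "\<dots> = (\<Sum>(q, j)\<in>prime_power_pairs B. ln (real q) * of_bool (int (q ^ j) dvd int x * int y + a))"
    proof (intro sum.cong refl, clarify)
      fix q j
      have "int (q ^ j) dvd int m \<longleftrightarrow> q ^ j dvd m" by (rule int_dvd_int_iff)
      then show "(if q ^ j dvd m then ln (real q) else 0) = ln (real q) * of_bool (int (q ^ j) dvd int x * int y + a)"
        unfolding m(1)[symmetric] by simp
    qed
    finally show ?thesis .
  qed
  then have "(\<Sum>x\<in>X. \<Sum>y\<in>Y. ln (real_of_int (int x * int y + a)))
      = (\<Sum>x\<in>X. \<Sum>y\<in>Y. \<Sum>(q, j)\<in>prime_power_pairs B. ln (real q) * of_bool (int (q ^ j) dvd int x * int y + a))"
    by (intro sum.cong) auto
  also have "\<dots> = (\<Sum>x\<in>X. \<Sum>(q, j)\<in>prime_power_pairs B. \<Sum>y\<in>Y. ln (real q) * of_bool (int (q ^ j) dvd int x * int y + a))"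
    unfolding case_prod_unfold by (intro sum.cong refl sum.swap)
  also have "\<dots> = (\<Sum>(q, j)\<in>prime_power_pairs B. \<Sum>x\<in>X. \<Sum>y\<in>Y. ln (real q) * of_bool (int (q ^ j) dvd int x * int y + a))"
    unfolding case_prod_unfold by (rule sum.swap)
  also have "\<dots> = (\<Sum>(q, j)\<in>prime_power_pairs B. ln (real q) * shifted_count X Y a (q ^ j))"
    unfolding shifted_count_def by (simp only: sum_distrib_left)
  finally show ?thesis .
qed

text \<open>First powers of primes beyond \<open>l\<close> are divided at \<open>u\<close>, and
  everything else forms the exceptional part. It is an inequality because the ranges on the right
  may extend beyond \<open>B\<close>.\<close>

lemma sum_prime_power_pairs_split_le:
  fixes F :: "nat \<Rightarrow> real" and B :: nat
  assumes F: "\<And>q. prime q \<Longrightarrow> F q \<ge> 0" and F0: "\<And>q. prime q \<Longrightarrow> v < real q \<Longrightarrow> F q = 0"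
    and G: "\<And>q. prime q \<Longrightarrow> G q 1 = F q" and u: "u \<le> v"
  shows "(\<Sum>(q, j)\<in>prime_power_pairs B. G q j) \<le> (\<Sum>(q, j)\<in>{(q, j) \<in> prime_power_pairs B. j \<ge> 2 \<or> q \<le> l}. G q j)
    + (\<Sum>q | prime q \<and> l < q \<and> real q \<le> u. F q) + (\<Sum>q | prime q \<and> u < real q \<and> real q \<le> v. F q)"
proof -
  let ?P1 = "{(q, j) \<in> prime_power_pairs B. j \<ge> 2 \<or> q \<le> l}"
  let ?S = "{q. prime q \<and> l < q \<and> q \<le> B}"
  let ?S1 = "{q. prime q \<and> l < q \<and> real q \<le> u}" and ?S2 = "{q. prime q \<and> u < real q \<and> real q \<le> v}"
  have fin: "finite ?P1" "finite ?S" "finite ?S1" "finite ?S2"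
  proof -
    show "finite ?P1" by (rule finite_subset[OF _ finite_prime_power_pairs[of B]]) auto
    show "finite ?S" by (rule finite_subset[of _ "{..B}"]) auto
    show "finite ?S1" by (rule finite_subset[OF _ finite_primes_between[of "real l" u]]) auto
    show "finite ?S2" by (rule finite_primes_between)
  qed
  have eq: "prime_power_pairs B = ?P1 \<union> (\<lambda>q. (q, 1)) ` ?S"
  proof (rule subset_antisym; rule subsetI)
    fix w assume w: "w \<in> prime_power_pairs B"
    obtain q j where qj: "w = (q, j)" by (cases w)
    show "w \<in> ?P1 \<union> (\<lambda>q. (q, 1)) ` ?S"
    proof (cases "j \<ge> 2 \<or> q \<le> l")
      case True
      then show ?thesis using w qj by auto
    next
      case False
      then have "j = 1" "l < q" using w qj by (auto simp: prime_power_pairs_def)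
      then show ?thesis using w qj by (auto simp: prime_power_pairs_def)
    qed
  next
    fix w assume "w \<in> ?P1 \<union> (\<lambda>q. (q, 1)) ` ?S"
    then show "w \<in> prime_power_pairs B" by (auto simp: prime_power_pairs_def)
  qed
  have "(\<Sum>(q, j)\<in>prime_power_pairs B. G q j) = (\<Sum>(q, j)\<in>?P1. G q j) + (\<Sum>(q, j)\<in>(\<lambda>q. (q, 1)) ` ?S. G q j)"
    unfolding eq[symmetric] by (subst eq, rule sum.union_disjoint) (use fin in auto)
  also have "(\<Sum>(q, j)\<in>(\<lambda>q. (q, 1)) ` ?S. G q j) = (\<Sum>q\<in>?S. F q)"
    by (subst sum.reindex) (auto simp: inj_on_def G[simplified] intro!: sum.cong)
  also have "(\<Sum>q\<in>?S. F q) = (\<Sum>q\<in>{q \<in> ?S. real q \<le> v}. F q)"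
    by (rule sum.mono_neutral_right[OF fin(2)]) (use F0 not_le in auto)
  also have "\<dots> \<le> (\<Sum>q\<in>?S1 \<union> ?S2. F q)"
    by (rule sum_mono2) (use fin F in auto)
  also have "\<dots> = (\<Sum>q\<in>?S1. F q) + (\<Sum>q\<in>?S2. F q)"
    by (rule sum.union_disjoint[OF fin(3,4)]) auto
  finally show ?thesis by linarith
qed

lemma large_prime_factor_nonzero_shift:
  fixes a :: int
  assumes a: "a \<noteq> 0" and \<theta>: "1 / 2 < \<theta>" "\<theta> < 5 / 8"
  shows "eventually (\<lambda>x. \<exists>p\<^sub>1 p\<^sub>2 q. prime p\<^sub>1 \<and> prime p\<^sub>2 \<and> p\<^sub>1 \<le> p\<^sub>2 \<and> real (p\<^sub>1 * p\<^sub>2) \<le> x \<and>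
    int p\<^sub>1 * int p\<^sub>2 + a \<noteq> 0 \<and> prime q \<and> int q dvd int p\<^sub>1 * int p\<^sub>2 + a \<and> x powr \<theta> < real q) at_top"
proof -
  \<comment> \<open>The total of all contributions relative to \<open>N\<close>. The summand
    \<open>10 * \<delta>\<close> consists of \<open>3 * \<delta>\<close> from the lower bound for
    the logarithms, \<open>5 * \<delta>\<close> from the prime powers, and \<delta> from each of the
    two ranges of primes.\<close>
  let ?g = "\<lambda>\<delta>. 1 / 2 + 10 * \<delta> + sieve_constant \<delta> * (\<theta> - 1 / 2 + 2 * \<delta>)"
  have "(?g \<longlongrightarrow> 1 / 2 + 4 * (\<theta> - 1 / 2)) (at_right 0)"
    by (auto intro!: tendsto_eq_intros sieve_constant_tendsto)
  then have "eventually (\<lambda>\<delta>. ?g \<delta> < 1) (at_right 0)" using \<theta> by (intro order_tendstoD(2)) auto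
  moreover have "eventually (\<lambda>\<delta>::real. \<delta> < 1 / 100) (at_right 0)" by (intro order_tendstoD(2)[OF tendsto_ident_at]) simp
  moreover have "eventually (\<lambda>\<delta>::real. 0 < \<delta>) (at_right 0)" by (simp add: eventually_at_right_less)
  ultimately have "eventually (\<lambda>\<delta>. ?g \<delta> < 1 \<and> \<delta> < 1 / 100 \<and> 0 < \<delta>) (at_right 0)" by eventually_elim auto
  from eventually_happens'[OF trivial_limit_at_right_real this]
  obtain \<delta> where g: "?g \<delta> < 1" and "\<delta> < 1 / 100" and "0 < \<delta>" by (elim exE conjE)
  then have \<delta>: "0 < \<delta>" "\<delta> \<le> 1 / 100" by simp_all
  obtain K where K: "K \<ge> 1" "eventually (\<lambda>x. \<exists>z\<^sub>1 z\<^sub>2. admissible \<delta> K x z\<^sub>1 z\<^sub>2) at_top"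
    using admissible_exists[of \<delta>] \<delta> by auto
  obtain l where small: "eventually (\<lambda>x. \<forall>z\<^sub>1 z\<^sub>2. admissible \<delta> K x z\<^sub>1 z\<^sub>2 \<longrightarrow>
      (\<Sum>q | prime q \<and> l < q \<and> real q \<le> x powr (1 / 2 - 3 * \<delta> / 2).
          ln (real q) * shifted_count (prime_block \<delta> z\<^sub>1) (prime_block \<delta> z\<^sub>2) a q)
      \<le> (1 / 2 + \<delta>) * (real (card (prime_block \<delta> z\<^sub>1)) * real (card (prime_block \<delta> z\<^sub>2)) * ln x)) at_top"
    using small_moduli_contribution[OF \<delta> K(1) a] by blast
  have e: "eventually (\<lambda>x::real. 2 * x powr (1 - 3 * \<delta>) \<le> x powr (1 - 2 * \<delta>)) at_top"
    "eventually (\<lambda>x::real. (2 * \<bar>real_of_int a\<bar>) * x powr 0 \<le> x powr (1 - 2 * \<delta>)) at_top"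
    using \<delta> by (intro const_powr_le; simp)+
  show ?thesis using e K(2) small prime_power_contribution[OF \<delta> K(1) a, of l] large_moduli_contribution[OF \<delta> K(1) a \<theta>]
      admissible_facts[OF \<delta> K(1)] eventually_gt_at_top[of 1]
  proof eventually_elim
    case (elim x)
    have x0: "x > 0" "ln x > 0" using elim(8) by auto
    obtain z\<^sub>1 z\<^sub>2 where adm: "admissible \<delta> K x z\<^sub>1 z\<^sub>2" using elim(3) by blast
    let ?X = "prime_block \<delta> z\<^sub>1" and ?Y = "prime_block \<delta> z\<^sub>2"
    let ?T = "shifted_count ?X ?Y a"
    define N where "N = real (card ?X) * real (card ?Y) * ln x"
    have f: "1 \<le> z\<^sub>1" "(1 + \<delta>) * z\<^sub>1 < z\<^sub>2" "x powr (1 - 2 * \<delta>) \<le> z\<^sub>1 * z\<^sub>2"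
        "2 * ((1 + \<delta>) * z\<^sub>1) * ((1 + \<delta>) * z\<^sub>2) \<le> x" "1 \<le> card ?X" "1 \<le> card ?Y"
      using elim(7) adm by blast+
    have "real (card ?X) > 0" "real (card ?Y) > 0" using f(5,6) by linarith+
    then have N0: "N > 0" unfolding N_def using x0 by simp
    have z0: "z\<^sub>1 > 0" "z\<^sub>2 > 0"
    proof -
      have "1 * z\<^sub>1 \<le> (1 + \<delta>) * z\<^sub>1" using f(1) \<delta> by (intro mult_right_mono) auto
      then show "z\<^sub>1 > 0" "z\<^sub>2 > 0" using f(1,2) by linarith+
    qed
    have pr: "prime p \<and> prime y \<and> p \<le> y \<and> z\<^sub>1 * z\<^sub>2 \<le> real p * real y \<and> 2 * (real p * real y) \<le> x"
      if "p \<in> ?X" "y \<in> ?Y" for p y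
    proof -
      have p: "prime p" "z\<^sub>1 < real p" "real p \<le> (1 + \<delta>) * z\<^sub>1" and y: "prime y" "z\<^sub>2 < real y" "real y \<le> (1 + \<delta>) * z\<^sub>2"
        using that by (auto simp: prime_block_def)
      have "p \<le> y" using p y f(2) by linarith
      moreover have "z\<^sub>1 * z\<^sub>2 \<le> real p * real y" using p y z0 by (intro mult_mono) auto
      moreover have "real p * real y \<le> ((1 + \<delta>) * z\<^sub>1) * ((1 + \<delta>) * z\<^sub>2)"
        by (rule mult_mono[OF p(3) y(3)]) (use z0 \<delta> in auto)
      ultimately show ?thesis using p y f(4) by linarith
    qed
    have a2: "2 * \<bar>real_of_int a\<bar> \<le> x powr (1 - 2 * \<delta>)" using elim(2) x0 by simp
    have xd: "x powr (1 - 2 * \<delta>) \<le> x"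
    proof -
      have "x powr (1 - 2 * \<delta>) \<le> x powr 1" using elim(8) \<delta> by (intro powr_mono) auto
      then show ?thesis using x0 by simp
    qed
    have bd: "x powr (1 - 3 * \<delta>) \<le> real_of_int (int p * int y + a)" "real_of_int (int p * int y + a) \<le> x"
      if "p \<in> ?X" "y \<in> ?Y" for p y
    proof -
      have "real_of_int (int p * int y + a) = real p * real y + real_of_int a" by simp
      then show "x powr (1 - 3 * \<delta>) \<le> real_of_int (int p * int y + a)" "real_of_int (int p * int y + a) \<le> x"
        using pr[OF that] a2 xd elim(1) f(3) by linarith+
    qed
    have pos: "0 < int p * int y + a" if "p \<in> ?X" "y \<in> ?Y" for p y
    proof -
      have "0 < x powr (1 - 3 * \<delta>)" using x0 by simp
      then have "0 < real_of_int (int p * int y + a)" using bd(1)[OF that] by linarith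
      then show ?thesis by (simp only: of_int_0_less_iff)
    qed
    show ?case
    proof (rule ccontr)
      assume H: "\<not> ?case"
      have no: "\<not> int q dvd int p * int y + a" if "p \<in> ?X" "y \<in> ?Y" "prime q" "x powr \<theta> < real q" for p y q
      proof
        assume d: "int q dvd int p * int y + a"
        have "0 \<le> real p * real y" by simp
        then have "real (p * y) \<le> x" using pr[OF that(1,2)] by (simp only: of_nat_mult) linarith
        moreover have "int p * int y + a \<noteq> 0" using pos[OF that(1,2)] by simp
        ultimately show False using H pr[OF that(1,2)] that(3,4) d by blast
      qed
      \<comment> \<open>The assumption that no prime beyond \<open>x powr \<theta>\<close> occurs
        enters here: it cuts off the range of the large moduli.\<close>
      then have T0: "?T q = 0" if "prime q" "x powr \<theta> < real q" for q
        using that unfolding shifted_count_def by (intro sum.neutral ballI) simp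
      have uv: "x powr (1 / 2 - 3 * \<delta> / 2) \<le> x powr \<theta>" using elim(8) \<theta> \<delta> by (intro powr_mono) auto
      have "(1 - 3 * \<delta>) * N = (\<Sum>p\<in>?X. \<Sum>y\<in>?Y. (1 - 3 * \<delta>) * ln x)" unfolding N_def by simp
      also have "\<dots> \<le> (\<Sum>p\<in>?X. \<Sum>y\<in>?Y. ln (real_of_int (int p * int y + a)))"
      proof (intro sum_mono)
        fix p y assume py: "p \<in> ?X" "y \<in> ?Y"
        have "(1 - 3 * \<delta>) * ln x = ln (x powr (1 - 3 * \<delta>))" using x0 by (simp add: ln_powr)
        also have "\<dots> \<le> ln (real_of_int (int p * int y + a))"
          using bd(1)[OF py] pos[OF py] x0 by (subst ln_le_cancel_iff) (simp_all only: of_int_0_less_iff, simp)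
        finally show "(1 - 3 * \<delta>) * ln x \<le> ln (real_of_int (int p * int y + a))" .
      qed
      also have "\<dots> = (\<Sum>(q, j)\<in>prime_power_pairs (nat \<lfloor>x\<rfloor>). ln (real q) * ?T (q ^ j))"
      proof (rule sum_shifted_logs[OF finite_prime_block finite_prime_block])
        fix p y assume py: "p \<in> ?X" "y \<in> ?Y"
        then have "int p * int y + a \<le> \<lfloor>x\<rfloor>" using bd(2)[OF py] by (simp only: le_floor_iff)
        then show "0 < int p * int y + a \<and> int p * int y + a \<le> int (nat \<lfloor>x\<rfloor>)" using pos[OF py] by linarith
      qed
      also have "\<dots> \<le> (\<Sum>(q, j)\<in>{(q, j) \<in> prime_power_pairs (nat \<lfloor>x\<rfloor>). j \<ge> 2 \<or> q \<le> l}. ln (real q) * ?T (q ^ j))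
        + (\<Sum>q | prime q \<and> l < q \<and> real q \<le> x powr (1 / 2 - 3 * \<delta> / 2). ln (real q) * ?T q)
        + (\<Sum>q | prime q \<and> x powr (1 / 2 - 3 * \<delta> / 2) < real q \<and> real q \<le> x powr \<theta>. ln (real q) * ?T q)"
        by (rule sum_prime_power_pairs_split_le[OF _ _ _ uv]) (auto simp: T0 shifted_count_nonneg ln_prime_nonneg)
      also have "\<dots> \<le> 5 * \<delta> * N + (1 / 2 + \<delta>) * N + (sieve_constant \<delta> * (\<theta> - 1 / 2 + 2 * \<delta>) + \<delta>) * N"
        unfolding N_def using elim(4,5,6) adm by (intro add_mono) blast+
      finally have "(1 - 3 * \<delta>) * N \<le> 5 * \<delta> * N + (1 / 2 + \<delta>) * N + (sieve_constant \<delta> * (\<theta> - 1 / 2 + 2 * \<delta>) + \<delta>) * N" .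
      then have "1 * N \<le> ?g \<delta> * N" by (simp add: algebra_simps)
      then have "1 \<le> ?g \<delta>" using N0 by (rule mult_right_le_imp_le)
      then show False using g by linarith
    qed
  qed
qed

lemma large_prime_factor:
  fixes a :: int
  assumes \<theta>: "1 / 2 < \<theta>" "\<theta> < 5 / 8"
  shows "eventually (\<lambda>x. \<exists>p\<^sub>1 p\<^sub>2 q. prime p\<^sub>1 \<and> prime p\<^sub>2 \<and> p\<^sub>1 \<le> p\<^sub>2 \<and> real (p\<^sub>1 * p\<^sub>2) \<le> x \<and>
    int p\<^sub>1 * int p\<^sub>2 + a \<noteq> 0 \<and> prime q \<and> int q dvd int p\<^sub>1 * int p\<^sub>2 + a \<and> x powr \<theta> < real q) at_top"
proof (cases "a = 0")
  case True
  \<comment> \<open>The density statement serves as a Bertrand-type existence result: a block with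
    positive count starts between \<open>x powr \<theta>\<close> and
    \<open>K * x powr \<theta>\<close>, and twice any of its primes is still below
    \<open>x\<close>.\<close>
  obtain K where K: "K \<ge> 1" "\<And>u. u \<ge> exp 1 \<Longrightarrow> \<exists>z. u \<le> z \<and> z \<le> K * u
    \<and> (1 - 2 * (1 / 4)) * (1 / 4) * z \<le> real (card (prime_block (1 / 4) z)) * ln z"
    using dense_prime_block_exists[of "1 / 4"] by auto
  have "eventually (\<lambda>x::real. exp 1 * x powr 0 \<le> x powr \<theta>) at_top"
    "eventually (\<lambda>x::real. (4 * K) * x powr \<theta> \<le> x powr 1) at_top"
    using \<theta> by (intro const_powr_le; simp)+
  then show ?thesis using eventually_gt_at_top[of 0]
  proof eventually_elim
    case (elim x)
    have u: "exp 1 \<le> x powr \<theta>" using elim by simp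
    obtain z where z: "x powr \<theta> \<le> z" "z \<le> K * x powr \<theta>"
      "(1 - 2 * (1 / 4)) * (1 / 4) * z \<le> real (card (prime_block (1 / 4) z)) * ln z" using K(2)[OF u] by blast
    have "exp 1 > (0 :: real)" by simp
    then have z0: "z > 0" using u z(1) by linarith
    have "prime_block (1 / 4) z \<noteq> {}" using z(3) z0 by auto
    then obtain p where p: "prime p" "z < real p" "real p \<le> (1 + 1 / 4) * z" by (auto simp: prime_block_def)
    have "real (2 * p) \<le> x"
    proof -
      have "real (2 * p) \<le> 4 * z" using p(3) z0 by simp
      also have "\<dots> \<le> (4 * K) * x powr \<theta>" using z(2) by simp
      also have "\<dots> \<le> x" using elim(2,3) by simp
      finally show ?thesis .
    qed
    moreover have "x powr \<theta> < real p" using p z by linarith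
    moreover have "2 \<le> p" using p(1) by (rule prime_ge_2_nat)
    ultimately have "prime (2::nat) \<and> prime p \<and> 2 \<le> p \<and> real (2 * p) \<le> x \<and>
      int 2 * int p + a \<noteq> 0 \<and> prime p \<and> int p dvd int 2 * int p + a \<and> x powr \<theta> < real p"
      using p(1) True by auto
    then show ?case by blast
  qed
qed (rule large_prime_factor_nonzero_shift[OF _ \<theta>])

theorem theorem1:
  fixes a :: int and \<theta> :: real
  assumes "0.6 < \<theta>" and "\<theta> < 0.625"
  shows "\<exists>x\<^sub>0::real. \<forall>x>x\<^sub>0.
           real_of_int (greatest_prime_factor (shifted_semiprimes_prod a x)) > x powr \<theta>"
proof -
  obtain x\<^sub>0 where x\<^sub>0: "\<And>x. x > x\<^sub>0 \<Longrightarrow> \<exists>p\<^sub>1 p\<^sub>2 q. prime p\<^sub>1 \<and> prime p\<^sub>2 \<and> p\<^sub>1 \<le> p\<^sub>2 \<and> real (p\<^sub>1 * p\<^sub>2) \<le> x \<and>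
      int p\<^sub>1 * int p\<^sub>2 + a \<noteq> 0 \<and> prime q \<and> int q dvd int p\<^sub>1 * int p\<^sub>2 + a \<and> x powr \<theta> < real q"
    using large_prime_factor[of \<theta> a] assms unfolding eventually_at_top_dense by auto
  show ?thesis
  proof (intro exI allI impI)
    fix x :: real assume "x > x\<^sub>0"
    then obtain p\<^sub>1 p\<^sub>2 q where p: "prime p\<^sub>1" "prime p\<^sub>2" "p\<^sub>1 \<le> p\<^sub>2" "real (p\<^sub>1 * p\<^sub>2) \<le> x" "int p\<^sub>1 * int p\<^sub>2 + a \<noteq> 0"
      and q: "prime q" "int q dvd int p\<^sub>1 * int p\<^sub>2 + a" "x powr \<theta> < real q"
      using x\<^sub>0 by blast
    let ?m = "shifted_semiprimes_prod a x"
    have "p\<^sub>1 * p\<^sub>2 \<in> {n. real n \<le> x \<and> semiprime n \<and> int n + a \<noteq> 0}" using p unfolding semiprime_def by auto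
    then have "int (p\<^sub>1 * p\<^sub>2) + a dvd ?m"
      unfolding shifted_semiprimes_prod_def by (rule dvd_prodI[OF finite_shifted_semiprimes])
    with q(2) have "int q dvd ?m" by (simp add: dvd_trans)
    then have "int q \<in> prime_factors ?m"
      using q(1) shifted_semiprimes_prod_nonzero[of a x] by (simp add: in_prime_factors_iff)
    then have "int q \<le> greatest_prime_factor ?m" unfolding greatest_prime_factor_def by (intro Max_ge) auto
    then show "real_of_int (greatest_prime_factor ?m) > x powr \<theta>" using q(3) by linarith
  qed
qed

end
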